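(* In the finite-dimensional setting described in the context, let $A,B$ be the constants associated with $g$ as in the context, and assume $$C:=\sup_{x\in\partial O}h(x)<\infty,\qquad h(x)=-2\frac{\mathcal Lg(x)}{|Q^{1/2}Dg(x)|^2}+\frac{\langle D^2g(x)QDg(x),QDg(x)\rangle}{|Q^{1/2}Dg(x)|^4}.$$ Then for every $\lambda>0$ and $f\in L^2(O,\mu)$ the weak solution $u$ of $\lambda u-\mathcal Lu=f$ in $O$, $u=0$ on $\partial O$, belongs to $W^{2,2}(O,\mu)$ and $$\int_O\mathrm{Tr}[(QD^2u)^2]\,d\mu\le\Big[8+4\max\{C,0\}\Big(2+\frac{2\sqrt2}{\sqrt\lambda}A+\frac{1}{\lambda}|C|A^2+\frac{B}{\lambda}\Big)\Big]\|f\|^2_{L^2(O,\mu)}.$$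
   Context: Finite-dimensional setting: $n\in\mathbb N$, $\lambda_1\ge\dots\ge\lambda_n>0$, $Q=\mathrm{diag}(\lambda_1,\dots,\lambda_n)$, $\mu$ the centered Gaussian measure on $\mathbb R^n$ with covariance $Q$, $\mathcal L\varphi=\frac12\sum_k\lambda_kD_{kk}\varphi-\frac12\sum_kx_kD_k\varphi$. $g\in C^{2+\alpha}_{loc}(\mathbb R^n)$ for some $\alpha\in(0,1)$, $O=\{g<0\}$, $Dg\neq0$ on $\partial O=g^{-1}(0)$, and there is $\delta>0$ with $a:=\sup_{|g|\le\delta}|Q^{1/2}Dg|<\infty$, $b:=\sup_{|g|\le\delta}\|Q^{1/2}D^2gQ^{1/2}\|<\infty$ ($\|\cdot\|$ Hilbert–Schmidt norm). $A:=\sup_{O}|Q^{1/2}D\widetilde g|$ and $B:=\sup_O\|Q^{1/2}D^2\widetilde gQ^{1/2}\|$, where $\widetilde g\in C^{2+\alpha}_{loc}$ satisfies $O=\{\widetilde g<0\}$, $\widetilde g=g$ near $\partial O$, $A\le a$, $B\le b+3a^2/\delta$. Sobolev spaces: $W^{1,2}(O,\mu)$ ($u,D_ku\in L^2(O,\mu)$, norm$^2$ $\int u^2+\int|Q^{1/2}Du|^2$), $W^{2,2}(O,\mu)$ (also $\int\mathrm{Tr}[(QD^2u)^2]d\mu=\int\sum_{h,k}\lambda_h\lambda_k(D_{hk}u)^2d\mu<\infty$), $\mathring W^{1,2}(O,\mu)$ (functions whose null extension lies in $W^{1,2}(\mathbb R^n,\mu)$). The weak solution is the $u\in\mathring W^{1,2}(O,\mu)$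 with $\lambda\int_Ou\psi d\mu+\frac12\int_O\langle Q^{1/2}Du,Q^{1/2}D\psi\rangle d\mu=\int_Of\psi d\mu$ for all $\psi\in\mathring W^{1,2}(O,\mu)$. *)

theory Defs
  imports "HOL-Analysis.Analysis" "HOL-Probability.Probability"
begin

text \<open>Finite-dimensional setting. The dimension n is the cardinality of the finite index
  type 'n; points of R^n are elements of real^'n. The covariance Q = diag(lam) is given by
  the vector lam of (positive) eigenvalues.\<close>

definition gauss :: "real^'n \<Rightarrow> (real^'n) measure" where
  "gauss lam = density lborel
     (\<lambda>x. ennreal (\<Prod>k\<in>UNIV. normal_density 0 (sqrt (lam$k)) (x$k)))"

definition qnorm :: "real^'n \<Rightarrow> real^'n \<Rightarrow> real" where
  "qnorm lam v = sqrt (\<Sum>k\<in>UNIV. lam$k * (v$k)^2)"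

text \<open>Hilbert-Schmidt norm of Q^(1/2) M Q^(1/2)\<close>
definition hsnorm :: "real^'n \<Rightarrow> real^'n^'n \<Rightarrow> real" where
  "hsnorm lam M = sqrt (\<Sum>h\<in>UNIV. \<Sum>k\<in>UNIV. lam$h * lam$k * (M$h$k)^2)"

definition qmul :: "real^'n \<Rightarrow> real^'n \<Rightarrow> real^'n" where
  "qmul lam v = (\<chi> k. lam$k * v$k)"

definition OU_op :: "real^'n \<Rightarrow> (real^'n \<Rightarrow> real^'n) \<Rightarrow> (real^'n \<Rightarrow> real^'n^'n)
     \<Rightarrow> real^'n \<Rightarrow> real" where
  "OU_op lam Dg D2g x =
     (1/2) * (\<Sum>k\<in>UNIV. lam$k * D2g x $ k $ k) - (1/2) * (\<Sum>k\<in>UNIV. x$k * Dg x $ k)"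

definition hfun :: "real^'n \<Rightarrow> (real^'n \<Rightarrow> real^'n) \<Rightarrow> (real^'n \<Rightarrow> real^'n^'n)
     \<Rightarrow> real^'n \<Rightarrow> real" where
  "hfun lam Dg D2g x =
     - 2 * OU_op lam Dg D2g x / (qnorm lam (Dg x))^2
     + ((D2g x *v qmul lam (Dg x)) \<bullet> qmul lam (Dg x)) / (qnorm lam (Dg x))^4"

text \<open>g \<in> C^{2+alpha}_loc(R^n), with gradient Dg and Hessian D2g (D2g x $ i $ j = D_j D_i g x),
  the Hessian being locally alpha-Hoelder continuous.\<close>
definition C2alpha_loc :: "real \<Rightarrow> (real^'n \<Rightarrow> real) \<Rightarrow> (real^'n \<Rightarrow> real^'n)
     \<Rightarrow> (real^'n \<Rightarrow> real^'n^'n) \<Rightarrow> bool" where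
  "C2alpha_loc \<alpha> g Dg D2g \<longleftrightarrow>
     (\<forall>x. (g has_derivative (\<lambda>v. Dg x \<bullet> v)) (at x)) \<and>
     (\<forall>x. (Dg has_derivative (\<lambda>v. D2g x *v v)) (at x)) \<and>
     (\<forall>K. compact K \<longrightarrow>
        (\<exists>M. \<forall>x\<in>K. \<forall>y\<in>K. norm (D2g x - D2g y) \<le> M * dist x y powr \<alpha>))"

text \<open>Supremum of a nonnegative quantity over a set (0 for the empty set).\<close>
definition supnn :: "'a set \<Rightarrow> ('a \<Rightarrow> real) \<Rightarrow> real" where
  "supnn S F = Sup (insert 0 (F ` S))"

definition test_fn :: "(real^'n) set \<Rightarrow> (real^'n \<Rightarrow> real) \<Rightarrow> (real^'n \<Rightarrow> real^'n) \<Rightarrow> bool" where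
  "test_fn Om \<phi> D\<phi> \<longleftrightarrow>
     (\<forall>x. (\<phi> has_derivative (\<lambda>v. D\<phi> x \<bullet> v)) (at x)) \<and> continuous_on UNIV D\<phi> \<and>
     compact (closure {x. \<phi> x \<noteq> 0}) \<and> closure {x. \<phi> x \<noteq> 0} \<subseteq> Om"

definition weak_pderiv :: "(real^'n) set \<Rightarrow> (real^'n \<Rightarrow> real) \<Rightarrow> 'n \<Rightarrow> (real^'n \<Rightarrow> real) \<Rightarrow> bool" where
  "weak_pderiv Om u k v \<longleftrightarrow>
     (\<forall>\<phi> D\<phi>. test_fn Om \<phi> D\<phi> \<longrightarrow>
        set_integrable lborel Om (\<lambda>x. u x * D\<phi> x $ k) \<and>
        set_integrable lborel Om (\<lambda>x. v x * \<phi> x) \<and>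
        (\<integral>x\<in>Om. u x * D\<phi> x $ k \<partial>lborel) = - (\<integral>x\<in>Om. v x * \<phi> x \<partial>lborel))"

definition L2on :: "'a measure \<Rightarrow> 'a set \<Rightarrow> ('a \<Rightarrow> real) \<Rightarrow> bool" where
  "L2on M Om u \<longleftrightarrow> set_borel_measurable M Om u \<and> set_integrable M Om (\<lambda>x. (u x)^2)"

definition W12 :: "real^'n \<Rightarrow> (real^'n) set \<Rightarrow> (real^'n \<Rightarrow> real) \<Rightarrow> bool" where
  "W12 lam Om u \<longleftrightarrow> L2on (gauss lam) Om u \<and>
     (\<exists>Du. \<forall>k. weak_pderiv Om u k (Du k) \<and> L2on (gauss lam) Om (Du k))"

definition W22_derivs :: "real^'n \<Rightarrow> (real^'n) set \<Rightarrow> (real^'n \<Rightarrow> real)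
     \<Rightarrow> ('n \<Rightarrow> real^'n \<Rightarrow> real) \<Rightarrow> ('n \<Rightarrow> 'n \<Rightarrow> real^'n \<Rightarrow> real) \<Rightarrow> bool" where
  "W22_derivs lam Om u Du D2u \<longleftrightarrow> L2on (gauss lam) Om u \<and>
     (\<forall>k. weak_pderiv Om u k (Du k) \<and> L2on (gauss lam) Om (Du k)) \<and>
     (\<forall>h k. weak_pderiv Om (Du k) h (D2u h k) \<and> L2on (gauss lam) Om (D2u h k))"

definition W22 :: "real^'n \<Rightarrow> (real^'n) set \<Rightarrow> (real^'n \<Rightarrow> real) \<Rightarrow> bool" where
  "W22 lam Om u \<longleftrightarrow> (\<exists>Du D2u. W22_derivs lam Om u Du D2u)"

definition W12_0 :: "real^'n \<Rightarrow> (real^'n) set \<Rightarrow> (real^'n \<Rightarrow> real) \<Rightarrow> bool" where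
  "W12_0 lam Om u \<longleftrightarrow> W12 lam UNIV (\<lambda>x. if x \<in> Om then u x else 0)"

definition weak_solution :: "real^'n \<Rightarrow> (real^'n) set \<Rightarrow> real \<Rightarrow> (real^'n \<Rightarrow> real)
     \<Rightarrow> (real^'n \<Rightarrow> real) \<Rightarrow> bool" where
  "weak_solution lam Om lmb f u \<longleftrightarrow> W12_0 lam Om u \<and>
     (\<exists>Du. (\<forall>k. weak_pderiv Om u k (Du k)) \<and>
       (\<forall>\<psi> D\<psi>. W12_0 lam Om \<psi> \<and> (\<forall>k. weak_pderiv Om \<psi> k (D\<psi> k)) \<longrightarrow>
          lmb * (\<integral>x\<in>Om. u x * \<psi> x \<partial>gauss lam)
          + (1/2) * (\<integral>x\<in>Om. (\<Sum>k\<in>UNIV. lam$k * Du k x * D\<psi> k x) \<partial>gauss lam)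
          = (\<integral>x\<in>Om. f x * \<psi> x \<partial>gauss lam)))"

end

theory Submission
 imports Defs
begin

text \<open>
 Let \<open>U\<close> be the solution extended by zero, \<open>w\<close> the Gaussian density, \<open>s = \<langle>Q DU, Dg\<rangle>\<close> and \<open>\<chi>(g)\<close> a cutoff vanishing near the boundary. Interior
 regularity and commuting weak derivatives give a Bochner identity for \<open>U\<close> tested with \<open>\<chi>(g) \<theta>\<^sup>2 w\<close>, where \<open>\<theta>\<close> is a cutoff at infinity.
 It expresses the integral of \<open>Tr[(Q D\<^sup>2U)\<^sup>2]\<close> by \<open>(2 L U)\<^sup>2\<close> and a term supported in the shell where \<open>\<chi>'(g) \<noteq> 0\<close>.

 No regularity up to the boundary is presupposed. \<open>U\<close> is the limit of penalised problems on the whole space; the tangential derivatives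
 \<open>t\<^sub>i\<^sub>j = D\<^sub>ig D\<^sub>jU - D\<^sub>jg D\<^sub>iU\<close> annihilate the penalisation, which is a function of \<open>g\<close>, so that \<open>D t\<^sub>i\<^sub>j\<close> is locally square integrable
 up to the boundary, and by Hardy's inequality so is \<open>t\<^sub>i\<^sub>j / g\<close>. Modulo terms \<open>t (Dt + DU)\<close>, which are negligible on the shell by these
 two facts, the shell term equals \<open>\<chi>'(g) s\<^sup>2 h\<close>, and \<open>h\<close> is at most \<open>C\<close> up to a small error.

 The remaining shell integral of \<open>s\<^sup>2\<close> is a Rellich identity: it is obtained by testing with \<open>\<langle>Q DU, Dgt\<rangle>\<close>, and costs \<open>A\<close> and \<open>B\<close>. Young's inequality absorbs
 the second derivatives. The energy identity bounds \<open>\<integral>(2 L U)\<^sup>2\<close> by \<open>4 \<parallel>f\<parallel>\<^sup>2\<close> and \<open>\<integral>|Q\<^sup>1\<^sup>/\<^sup>2 DU|\<^sup>2\<close> by \<open>\<parallel>f\<parallel>\<^sup>2 / (2 \<lambda>)\<close>.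
\<close>

text \<open>The obstacle is the boundary. Second derivatives of \<open>U\<close> are at first known
  only inside compact parts of the domain and no trace of \<open>DU\<close> is available, so the
  boundary integral of the classical argument is replaced throughout by an integral over the shell
  -2e < g < -e, with e tending to 0. Split \<open>DU\<close> into a multiple of \<open>Dg\<close>
  and a tangential remainder: up to terms with a tangential factor, the Bochner flux through a level
  set is then -s^2 h (\<open>normal_tangential_algebra\<close>), and the antisymmetry of t_ij
  removes exactly the terms in which the cutoff is differentiated twice. The penalised problems live
  on the whole space, so interior regularity applies to them across the boundary, without flattening
  it. The Rellich field comes from \<open>gt\<close>, which is controlled on the whole domain and
  agrees with \<open>g\<close> where the shell lies. Young's inequality leaves a factor 3/4 in front
  of the Hessian term; the 8 in the claim is generous enough to pay for this loss, for the margin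
  added to C and for the cutoff error at infinity, so that the latter two parameters stay fixed and
  need not tend to 0.\<close>

abbreviation (input) sum_UNIV :: "('a => 'b) => 'b::comm_monoid_add" (binder "\<Oplus>" 10) where "sum_UNIV F \<equiv> sum F UNIV"
abbreviation (input) null_integral :: "(real^'n => real) => bool" where "null_integral F \<equiv> has_bochner_integral lborel F 0"

section \<open>Square integrable functions\<close>

definition L2 :: "'a measure => ('a => real) => bool" where
 "L2 M f \<longleftrightarrow> f \<in> borel_measurable M \<and> integrable M (\<lambda>x. (f x)\<^sup>2)"

lemma L2_measurable [measurable_dest]: "L2 M f ==> f \<in> borel_measurable M"
 by (simp add: L2_def)

lemma L2_integrable_square: "L2 M f ==> integrable M (\<lambda>x. (f x)\<^sup>2)"
 by (simp add: L2_def)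

lemma L2_integrable_mult:
 assumes f: "L2 M f" and g: "L2 M g"
 shows "integrable M (\<lambda>x. f x * g x)"
proof (rule Bochner_Integration.integrable_bound)
 show "integrable M (\<lambda>x. (f x)\<^sup>2 + (g x)\<^sup>2)"
  using f g by (auto simp: L2_def)
 show "(\<lambda>x. f x * g x) \<in> borel_measurable M"
  using f g by (auto simp: L2_def)
 have "\<bar>a * b\<bar> \<le> a\<^sup>2 + b\<^sup>2" for a b :: real
  using sum_squares_bound[of "\<bar>a\<bar>" "\<bar>b\<bar>"] mult_nonneg_nonneg[of "\<bar>a\<bar>" "\<bar>b\<bar>"]
  unfolding abs_mult power2_abs by linarith
 then show "AE x in M. norm (f x * g x) \<le> norm ((f x)\<^sup>2 + (g x)\<^sup>2)"
  by (auto simp: abs_of_nonneg)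
qed

lemma L2_bound:
 assumes g: "L2 M g" and f: "f \<in> borel_measurable M" and b: "\<And>x. x \<in> space M ==> \<bar>f x\<bar> \<le> C * \<bar>g x\<bar>"
 shows "L2 M f"
 unfolding L2_def
proof (intro conjI f)
 show "integrable M (\<lambda>x. (f x)\<^sup>2)"
 proof (rule Bochner_Integration.integrable_bound)
  show "integrable M (\<lambda>x. C\<^sup>2 * (g x)\<^sup>2)"
   using g by (simp add: L2_def)
  show "(\<lambda>x. (f x)\<^sup>2) \<in> borel_measurable M" using f by simp
  show "AE x in M. norm ((f x)\<^sup>2) \<le> norm (C\<^sup>2 * (g x)\<^sup>2)"
  proof (rule AE_I2)
   fix x assume "x \<in> space M"
   then have "\<bar>f x\<bar>\<^sup>2 \<le> (C * \<bar>g x\<bar>)\<^sup>2"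
    using b by (intro power_mono) auto
   then show "norm ((f x)\<^sup>2) \<le> norm (C\<^sup>2 * (g x)\<^sup>2)"
    by (simp add: power_mult_distrib)
  qed
 qed
qed

lemma L2_add: assumes f: "L2 M f" and g: "L2 M g" shows "L2 M (\<lambda>x. f x + g x)"
proof -
 have "integrable M (\<lambda>x. (f x)\<^sup>2 + (g x)\<^sup>2 + 2 * (f x * g x))"
  using f g L2_integrable_mult[OF f g] by (auto simp: L2_def)
 moreover have "(\<lambda>x. (f x)\<^sup>2 + (g x)\<^sup>2 + 2 * (f x * g x)) = (\<lambda>x. (f x + g x)\<^sup>2)"
  by (auto simp: power2_eq_square algebra_simps)
 ultimately show ?thesis
  using f g by (auto simp: L2_def)
qed

lemma L2_cmult: "L2 M f ==> L2 M (\<lambda>x. c * f x)"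
 by (auto simp: L2_def power_mult_distrib)

lemma L2_cong: "L2 M f ==> (\<And>x. f x = g x) ==> L2 M g"
 using ext[of f g] by simp

lemma L2_uminus: "L2 M f ==> L2 M (\<lambda>x. - f x)"
 by (auto simp: L2_def)

lemma L2_diff: "L2 M f ==> L2 M g ==> L2 M (\<lambda>x. f x - g x)"
 using L2_add[of M f "\<lambda>x. - g x"] L2_uminus[of M g] by simp

lemma L2_zero [simp]: "L2 M (\<lambda>x. 0)"
 by (simp add: L2_def)

lemma L2_sum: "(\<And>i. i \<in> I ==> L2 M (f i)) ==> L2 M (\<lambda>x. \<Sum>i\<in>I. f i x)"
 by (induction I rule: infinite_finite_induct) (auto intro: L2_add)

lemma L2_bounded_mult:
 assumes f: "L2 M f" and c: "c \<in> borel_measurable M" "\<And>x. \<bar>c x\<bar> \<le> C"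
 shows "L2 M (\<lambda>x. c x * f x)"
 by (rule L2_bound[OF f, of _ C]) (use f c in \<open>auto simp: L2_def abs_mult intro!: mult_right_mono\<close>)

text \<open>The quadratic form \<open>(s, t) \<mapsto> \<integral> (s f + t g)\<^sup>2\<close> is
  nonnegative, and evaluating it at one well-chosen point suffices. The case where \<open>f\<close>
  has norm zero is separate, since the form is then affine in \<open>s\<close>.\<close>

lemma Cauchy_Schwarz_L2:
 assumes f: "L2 M f" and g: "L2 M g"
 shows "(LINT x|M. f x * g x)\<^sup>2 \<le> (LINT x|M. (f x)\<^sup>2) * (LINT x|M. (g x)\<^sup>2)"
proof -
 let ?a = "\<integral>x. (f x)\<^sup>2 \<partial>M" and ?b = "\<integral>x. f x * g x \<partial>M" and ?c = "\<integral>x. (g x)\<^sup>2 \<partial>M"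
 have pos: "0 \<le> s\<^sup>2 * ?a + 2 * (s * t) * ?b + t\<^sup>2 * ?c" for s t
 proof -
  have "0 \<le> (LINT x|M. (s * f x + t * g x)\<^sup>2)" by simp
  also have "(\<lambda>x. (s * f x + t * g x)\<^sup>2) = (\<lambda>x. s\<^sup>2 * (f x)\<^sup>2 + (2 * (s * t)) * (f x * g x) + t\<^sup>2 * (g x)\<^sup>2)"
   by (auto simp: power2_eq_square algebra_simps)
  also have "(LINT x|M. s\<^sup>2 * (f x)\<^sup>2 + (2 * (s * t)) * (f x * g x) + t\<^sup>2 * (g x)\<^sup>2)
    = s\<^sup>2 * ?a + 2 * (s * t) * ?b + t\<^sup>2 * ?c"
   using f g L2_integrable_mult[OF f g] by (subst Bochner_Integration.integral_add) (auto simp: L2_def)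
  finally show ?thesis .
 qed
 have a0: "?a \<ge> 0" by simp
 show ?thesis
 proof (cases "?a = 0")
  case True
  have b0: "?b = 0"
  proof (rule ccontr)
   assume "?b \<noteq> 0"
   \<comment> \<open>With \<open>?a = 0\<close> this choice of \<open>s\<close>, together with
     \<open>t = 1\<close>, gives the form the value \<open>- ?c - 2\<close>, which is
     negative.\<close>
   have "(- (?c + 1) / ?b * 1) * ?b = - (?c + 1)" using \<open>?b \<noteq> 0\<close> by simp
   then have "0 \<le> - 2 * (?c + 1) + ?c"
    using pos[of "- (?c + 1) / ?b" 1] True by (simp only: mult.assoc) simp
   moreover have "?c \<ge> 0" by simp
   ultimately show False by (simp add: algebra_simps)
  qed
  show ?thesis unfolding True b0 by simp
 next
  case False
  then have "?a > 0" using a0 by linarith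
  \<comment> \<open>At \<open>s = - ?b\<close>, \<open>t = ?a\<close> the form is \<open>?a\<close>
    times its determinant.\<close>
  have "0 \<le> ?a * (?a * ?c - ?b\<^sup>2)"
   using pos[of "- ?b" ?a] by (simp add: power2_eq_square algebra_simps)
  then have "0 \<le> ?a * ?c - ?b\<^sup>2"
   using \<open>?a > 0\<close> by (simp add: zero_le_mult_iff)
  then show ?thesis by simp
 qed
qed

lemma L2_tendsto_integral_mult:
 assumes fn: "\<And>n. L2 M (f n)" and f: "L2 M f0" and g: "L2 M g"
  and lim: "(\<lambda>n. \<integral>x. (f n x - f0 x)\<^sup>2 \<partial>M) \<longlonglongrightarrow> 0"
 shows "(\<lambda>n. \<integral>x. f n x * g x \<partial>M) \<longlonglongrightarrow> (LINT x|M. f0 x * g x)"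
proof -
 have "(\<lambda>n. sqrt ((LINT x|M. (f n x - f0 x)\<^sup>2) * (LINT x|M. (g x)\<^sup>2))) \<longlonglongrightarrow> sqrt (0 * (LINT x|M. (g x)\<^sup>2))"
  by (intro tendsto_intros lim)
 then have *: "(\<lambda>n. sqrt ((LINT x|M. (f n x - f0 x)\<^sup>2) * (LINT x|M. (g x)\<^sup>2))) \<longlonglongrightarrow> 0" by simp
 have "(\<lambda>n. (LINT x|M. f n x * g x) - (LINT x|M. f0 x * g x)) \<longlonglongrightarrow> 0"
 proof (rule Lim_null_comparison[OF _ *])
  have "(LINT x|M. f n x * g x) - (LINT x|M. f0 x * g x) = (LINT x|M. (f n x - f0 x) * g x)" for n
   using L2_integrable_mult[OF fn g] L2_integrable_mult[OF f g] by (simp add: left_diff_distrib)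
  moreover have "\<bar>\<integral>x. (f n x - f0 x) * g x \<partial>M\<bar> \<le> sqrt ((LINT x|M. (f n x - f0 x)\<^sup>2) * (LINT x|M. (g x)\<^sup>2))" for n
   using Cauchy_Schwarz_L2[OF L2_diff[OF fn f] g] by (rule real_le_rsqrt[of "\<bar>_\<bar>", simplified])
  ultimately show "\<forall>\<^sub>F n in sequentially. norm ((LINT x|M. f n x * g x) - (LINT x|M. f0 x * g x))
    \<le> sqrt ((LINT x|M. (f n x - f0 x)\<^sup>2) * (LINT x|M. (g x)\<^sup>2))"
   by simp
 qed
 then show ?thesis
  by (rule LIM_zero_cancel)
qed

lemma L2_tendsto_square:
 assumes fn: "\<And>n. L2 M (f n)" and f: "L2 M f0"
  and lim: "(\<lambda>n. \<integral>x. (f n x - f0 x)\<^sup>2 \<partial>M) \<longlonglongrightarrow> 0"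
 shows "(\<lambda>n. \<integral>x. (f n x)\<^sup>2 \<partial>M) \<longlonglongrightarrow> (LINT x|M. (f0 x)\<^sup>2)"
proof -
 have eq: "(LINT x|M. (f n x)\<^sup>2) = (LINT x|M. (f n x - f0 x)\<^sup>2) + 2 * (LINT x|M. f n x * f0 x) - (LINT x|M. (f0 x)\<^sup>2)" for n
 proof -
  have "(\<lambda>x. (f n x - f0 x)\<^sup>2) = (\<lambda>x. (f n x)\<^sup>2 - 2 * (f n x * f0 x) + (f0 x)\<^sup>2)"
   by (auto simp: power2_eq_square algebra_simps)
  then have "(LINT x|M. (f n x - f0 x)\<^sup>2) = (LINT x|M. (f n x)\<^sup>2 - 2 * (f n x * f0 x) + (f0 x)\<^sup>2)" by simp
  also have "\<dots> = (LINT x|M. (f n x)\<^sup>2) - 2 * (LINT x|M. f n x * f0 x) + (LINT x|M. (f0 x)\<^sup>2)"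
   using L2_integrable_mult[OF fn f] L2_integrable_square[OF fn] L2_integrable_square[OF f]
   by (subst Bochner_Integration.integral_add) auto
  finally show ?thesis by simp
 qed
 have "(\<lambda>n. (LINT x|M. (f n x - f0 x)\<^sup>2) + 2 * (LINT x|M. f n x * f0 x) - (LINT x|M. (f0 x)\<^sup>2))
   \<longlonglongrightarrow> 0 + 2 * (LINT x|M. f0 x * f0 x) - (LINT x|M. (f0 x)\<^sup>2)"
  by (intro tendsto_intros lim L2_tendsto_integral_mult[OF fn f f])
 then show ?thesis unfolding eq by (simp add: power2_eq_square)
qed

text \<open>The weight turns the problem into one about \<open>L\<^sup>1\<close>-Cauchy sequences, for which almost everywhere
 convergent subsequences are available.\<close>
lemma L2_complete:
 assumes w: "L2 M w" "\<And>x. w x > 0"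
  and fn: "\<And>n. L2 M (f n)"
  and C: "\<And>e. e > 0 ==> \<exists>N. \<forall>m\<ge>N. \<forall>n\<ge>N. (LINT x|M. (f m x - f n x)\<^sup>2) < e"
 obtains f0 where "L2 M f0" "(\<lambda>n. \<integral>x. (f n x - f0 x)\<^sup>2 \<partial>M) \<longlonglongrightarrow> 0"
proof -
 define W where "W = (LINT x|M. (w x)\<^sup>2)"
 have W0: "W \<ge> 0" by (simp add: W_def)
 note [measurable] = L2_measurable[OF fn] L2_measurable[OF w(1)]
 have L1: "\<exists>N. \<forall>i\<ge>N. \<forall>j\<ge>N. LINT x|M. norm (f i x * w x - f j x * w x) < e" if e: "e > 0" for e
 proof -
  obtain N where N: "\<And>m n. m \<ge> N ==> n \<ge> N ==> (LINT x|M. (f m x - f n x)\<^sup>2) < e\<^sup>2 / (W + 1)"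
   using C[of "e\<^sup>2 / (W + 1)"] e W0 by auto
  have "LINT x|M. norm (f i x * w x - f j x * w x) < e" if ij: "i \<ge> N" "j \<ge> N" for i j
  proof -
   have d: "L2 M (\<lambda>x. \<bar>f i x - f j x\<bar>)"
    by (rule L2_bound[OF L2_diff[OF fn[of i] fn[of j]], of _ 1]) auto
   have "(LINT x|M. norm (f i x * w x - f j x * w x)) = (LINT x|M. \<bar>f i x - f j x\<bar> * w x)"
    by (intro Bochner_Integration.integral_cong)
      (auto simp: abs_mult left_diff_distrib[symmetric] less_imp_le[OF w(2)])
   moreover have "(LINT x|M. \<bar>f i x - f j x\<bar> * w x)\<^sup>2 \<le> (LINT x|M. (f i x - f j x)\<^sup>2) * W"
    using Cauchy_Schwarz_L2[OF d w(1)] by (simp add: W_def)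
   moreover have "\<dots> \<le> e\<^sup>2 / (W + 1) * W"
    using N[OF ij] W0 by (intro mult_right_mono) auto
   moreover have "\<dots> < e\<^sup>2"
    using W0 e by (simp add: field_simps)
   ultimately have "(LINT x|M. norm (f i x * w x - f j x * w x))\<^sup>2 < e\<^sup>2" by simp
   then show ?thesis using e power2_less_imp_less by fastforce
  qed
  then show ?thesis by blast
 qed
 obtain r where r: "strict_mono r" and AE: "AE x in M. Cauchy (\<lambda>i. f (r i) x * w x)"
  by (rule cauchy_L1_AE_cauchy_subseq[OF L2_integrable_mult[OF fn w(1)] L1])
 define f0 where "f0 x = lim (\<lambda>i. f (r i) x)" for x
 have [measurable]: "f0 \<in> borel_measurable M"
  unfolding f0_def by measurable
 have conv: "AE x in M. (\<lambda>i. f (r i) x) \<longlonglongrightarrow> f0 x"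
  using AE
 proof eventually_elim
  case (elim x)
  have "w x \<noteq> 0" using w(2)[of x] by simp
  obtain l where "(\<lambda>i. f (r i) x * w x) \<longlonglongrightarrow> l" using elim Cauchy_convergent_iff convergent_def by blast
  then have "(\<lambda>i. f (r i) x * w x / w x) \<longlonglongrightarrow> l / w x" using \<open>w x \<noteq> 0\<close> by (intro tendsto_intros)
  then have "(\<lambda>i. f (r i) x) \<longlonglongrightarrow> l / w x" using \<open>w x \<noteq> 0\<close> by simp
  then show ?case unfolding f0_def using limI by metis
 qed
 \<comment> \<open>Fatou along the almost everywhere convergent subsequence turns the Cauchy bound
   for the full sequence into a bound for the distance to the limit.\<close>
 have Fatou: "(\<integral>\<^sup>+x. ennreal ((f n x - f0 x)\<^sup>2) \<partial>M) \<le> ennreal e"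
  if N: "\<forall>m\<ge>N. \<forall>n\<ge>N. (LINT x|M. (f m x - f n x)\<^sup>2) < e" and n: "n \<ge> N" for n N e
 proof -
  have "(\<integral>\<^sup>+x. ennreal ((f n x - f0 x)\<^sup>2) \<partial>M) = (\<integral>\<^sup>+x. liminf (\<lambda>i. ennreal ((f n x - f (r i) x)\<^sup>2)) \<partial>M)"
  proof (rule nn_integral_cong_AE)
   show "AE x in M. ennreal ((f n x - f0 x)\<^sup>2) = liminf (\<lambda>i. ennreal ((f n x - f (r i) x)\<^sup>2))"
    using conv
   proof eventually_elim
    case (elim x)
    have "(\<lambda>i. ennreal ((f n x - f (r i) x)\<^sup>2)) \<longlonglongrightarrow> ennreal ((f n x - f0 x)\<^sup>2)"
     by (intro tendsto_ennrealI tendsto_intros elim)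
    then show ?case using lim_imp_Liminf trivial_limit_sequentially by metis
   qed
  qed
  also have "\<dots> \<le> liminf (\<lambda>i. \<integral>\<^sup>+x. ennreal ((f n x - f (r i) x)\<^sup>2) \<partial>M)"
   by (rule nn_integral_liminf) measurable
  also have "\<dots> \<le> ennreal e"
  proof -
   have "(\<integral>\<^sup>+x. ennreal ((f n x - f (r i) x)\<^sup>2) \<partial>M) \<le> ennreal e" if "i \<ge> N" for i
   proof -
    have "r i \<ge> N" using seq_suble[OF r, of i] that by simp
    then show ?thesis
     using L2_integrable_square[OF L2_diff[OF fn[of n] fn[of "r i"]]] N n
     by (subst nn_integral_eq_integral) (simp_all add: ennreal_leI less_imp_le)
   qed
   then have "eventually (\<lambda>i. (\<integral>\<^sup>+x. ennreal ((f n x - f (r i) x)\<^sup>2) \<partial>M) \<le> ennreal e) sequentially"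
    using eventually_sequentially by blast
   then show ?thesis
    by (rule Liminf_le[rotated]) simp
  qed
  finally show ?thesis .
 qed
 have L2d: "L2 M (\<lambda>x. f n x - f0 x)" if N: "\<forall>m\<ge>N. \<forall>n\<ge>N. (LINT x|M. (f m x - f n x)\<^sup>2) < e" and n: "n \<ge> N" for n N e
  unfolding L2_def
 proof
  show "integrable M (\<lambda>x. (f n x - f0 x)\<^sup>2)"
   by (rule integrableI_bounded) (use Fatou[OF N n] in \<open>auto intro: le_less_trans\<close>)
 qed measurable
 obtain N1 where N1: "\<forall>m\<ge>N1. \<forall>n\<ge>N1. (LINT x|M. (f m x - f n x)\<^sup>2) < 1"
  using C[of 1] by auto
 have "L2 M (\<lambda>x. f N1 x - (f N1 x - f0 x))"
  by (rule L2_diff[OF fn L2d[OF N1]]) auto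
 then have L2f0: "L2 M f0" by simp
 moreover have "(\<lambda>n. \<integral>x. (f n x - f0 x)\<^sup>2 \<partial>M) \<longlonglongrightarrow> 0"
 proof (rule LIMSEQ_I)
  fix e :: real assume e: "e > 0"
  then obtain N where N: "\<forall>m\<ge>N. \<forall>n\<ge>N. (LINT x|M. (f m x - f n x)\<^sup>2) < e/2"
   using C[of "e/2"] by auto
  have "norm ((LINT x|M. (f n x - f0 x)\<^sup>2) - 0) < e" if n: "n \<ge> N" for n
  proof -
   have "ennreal (LINT x|M. (f n x - f0 x)\<^sup>2) \<le> ennreal (e/2)"
    using Fatou[OF N n] L2_integrable_square[OF L2_diff[OF fn L2f0]]
    by (subst (asm) nn_integral_eq_integral) auto
   then have "(LINT x|M. (f n x - f0 x)\<^sup>2) \<le> e/2" using e by (simp add: ennreal_le_iff)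
   then show ?thesis using e by simp
  qed
  then show "\<exists>no. \<forall>n\<ge>no. norm ((LINT x|M. (f n x - f0 x)\<^sup>2) - 0) < e" by blast
 qed
 ultimately show thesis by (rule that)
qed

text \<open>Riesz representation without completeness: a sequence of almost minimisers of the energy
 \<open>B s s - 2 * l s\<close> is Cauchy by the parallelogram identity and represents \<open>l\<close> in the limit.\<close>
lemma riesz_sequence:
 fixes B :: "('c => real) => ('c => real) => real"
 assumes lin: "\<And>s t a b. s \<in> S ==> t \<in> S ==> (\<lambda>x. a * s x + b * t x) \<in> S"
  and ne: "S \<noteq> {}"
  and sym: "\<And>s t. s \<in> S ==> t \<in> S ==> B s t = B t s"
  and Blin: "\<And>s t r a b. s \<in> S ==> t \<in> S ==> r \<in> S ==> B (\<lambda>x. a * s x + b * t x) r = a * B s r + b * B t r"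
  and llin: "\<And>s t a b. s \<in> S ==> t \<in> S ==> l (\<lambda>x. a * s x + b * t x) = a * l s + b * l t"
  and bd: "\<And>s. s \<in> S ==> (l s)\<^sup>2 \<le> K * B s s"
  and pos: "\<And>s. s \<in> S ==> B s s \<ge> 0"
 obtains s where "\<And>n. s n \<in> S"
  "\<And>e. e > 0 ==> \<exists>N::nat. \<forall>m\<ge>N. \<forall>n\<ge>N. B (\<lambda>x. s m x - s n x) (\<lambda>x. s m x - s n x) < e"
  "\<And>t. t \<in> S ==> (\<lambda>n. B (s n) t) \<longlonglongrightarrow> l t"
proof -
 define E where "E s = B s s - 2 * l s" for s
 have K: "E s \<ge> - \<bar>K\<bar>" if s: "s \<in> S" for s
 proof -
  have "(l s)\<^sup>2 \<le> \<bar>K\<bar> * B s s"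
   using bd[OF s] mult_right_mono[OF abs_ge_self[of K] pos[OF s]] by linarith
  moreover have "0 \<le> (B s s - \<bar>K\<bar>)\<^sup>2" by simp
  ultimately have "(2 * l s)\<^sup>2 \<le> (B s s + \<bar>K\<bar>)\<^sup>2"
   by (simp add: power2_eq_square algebra_simps)
  then have "2 * l s \<le> B s s + \<bar>K\<bar>"
   by (rule power2_le_imp_le) (use pos[OF s] in simp)
  then show ?thesis by (simp add: E_def)
 qed
 define m where "m = Inf (E ` S)"
 have bdd: "bdd_below (E ` S)" using K by (auto intro!: bdd_belowI[of _ "- \<bar>K\<bar>"])
 have mE: "m \<le> E s" if "s \<in> S" for s
  unfolding m_def using bdd that by (simp add: cINF_lower)
 have "\<exists>s\<in>S. E s < m + 1 / real (Suc n)" for n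
 proof -
  have "Inf (E ` S) < m + 1 / real (Suc n)" by (simp add: m_def)
  then show ?thesis using ne bdd by (subst (asm) cInf_less_iff) auto
 qed
 then obtain s where s: "\<And>n. s n \<in> S" and sE: "\<And>n. E (s n) < m + 1 / real (Suc n)" by metis
 have Blin2: "B r (\<lambda>x. a * s x + b * t x) = a * B r s + b * B r t" if "s \<in> S" "t \<in> S" "r \<in> S" for s t r a b
  using sym[OF that(3) lin[OF that(1,2)]] Blin[OF that] sym[OF that(3,1)] sym[OF that(3,2)] by simp
 have quad: "B (\<lambda>x. a * s x + b * t x) (\<lambda>x. a * s x + b * t x) = a\<^sup>2 * B s s + 2 * a * b * B s t + b\<^sup>2 * B t t"
  if "s \<in> S" "t \<in> S" for s t a b
  using that by (simp add: Blin Blin2 lin sym[of t s] power2_eq_square algebra_simps)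
 \<comment> \<open>The midpoint of two almost minimisers has energy at least \<open>m\<close>, so by
   the parallelogram identity their distance is controlled by their excess energies.\<close>
 have diff: "B (\<lambda>x. s i x - s j x) (\<lambda>x. s i x - s j x) \<le> 2 * (1 / real (Suc i) + 1 / real (Suc j))" for i j
 proof -
  have "E (\<lambda>x. 1/2 * s i x + 1/2 * s j x) \<ge> m" by (intro mE lin s)
  then have "B (s i) (s i) / 4 + B (s i) (s j) / 2 + B (s j) (s j) / 4 - l (s i) - l (s j) \<ge> m"
   unfolding E_def using quad[OF s s, of "1/2" i "1/2" j] llin[OF s s, of "1/2" i "1/2" j]
   by (simp add: power2_eq_square field_simps)
  moreover have "B (\<lambda>x. s i x - s j x) (\<lambda>x. s i x - s j x) = B (s i) (s i) - 2 * B (s i) (s j) + B (s j) (s j)"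
   using quad[OF s s, of 1 i "-1" j] by simp
  ultimately show ?thesis using sE[of i] sE[of j] unfolding E_def distrib_left by linarith
 qed
 show thesis
 proof (rule that[of s])
  show "s n \<in> S" for n by (rule s)
  fix e :: real assume e: "e > 0"
  obtain N where N: "1 / real (Suc N) < e/4" using e by (meson nat_approx_posE divide_pos_pos zero_less_numeral)
  have small: "1 / real (Suc i) < e/4" if "i \<ge> N" for i
  proof -
   have "1 / real (Suc i) \<le> 1 / real (Suc N)" using that by (intro divide_left_mono) auto
   then show ?thesis using N by simp
  qed
  have "B (\<lambda>x. s i x - s j x) (\<lambda>x. s i x - s j x) < e" if "i \<ge> N" "j \<ge> N" for i j
   using diff[of i j] small[OF that(1)] small[OF that(2)] unfolding distrib_left by linarith
  then show "\<exists>N::nat. \<forall>m\<ge>N. \<forall>n\<ge>N. B (\<lambda>x. s m x - s n x) (\<lambda>x. s m x - s n x) < e" by blast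
 next
  fix t assume t: "t \<in> S"
  have bound: "\<bar>B (s n) t - l t\<bar> \<le> (1 + B t t) / sqrt (real (Suc n))" for n
  proof -
   define d where "d = B (s n) t - l t"
   define q where "q = 1 / sqrt (real (Suc n))"
   have q: "q > 0" "q\<^sup>2 = 1 / real (Suc n)" by (auto simp: q_def power_divide)
   \<comment> \<open>The energy of \<open>s n\<close> exceeds the infimum by less than
     \<open>q\<^sup>2\<close>. Moving by a multiple of \<open>t\<close> of the same order
     \<open>q\<close>, in the direction that lowers the energy, therefore bounds the residual
     \<open>d\<close> by a multiple of \<open>q\<close>.\<close>
   define c where "c = - sgn d * q"
   have "m \<le> E (\<lambda>x. 1 * s n x + c * t x)" by (intro mE lin s t)
   also have "\<dots> = E (s n) + 2 * c * d + c\<^sup>2 * B t t"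
    unfolding E_def quad[OF s t] llin[OF s t] d_def by (simp add: algebra_simps)
   finally have "0 \<le> q\<^sup>2 + 2 * c * d + c\<^sup>2 * B t t" using sE[of n] q(2) by simp
   moreover have "c * d = - (q * \<bar>d\<bar>)" by (simp add: c_def abs_sgn mult.commute)
   moreover have "c\<^sup>2 * B t t \<le> q\<^sup>2 * B t t"
    using pos[OF t] by (intro mult_right_mono) (auto simp: c_def power_mult_distrib sgn_real_def)
   ultimately have "2 * (q * \<bar>d\<bar>) \<le> q\<^sup>2 * (1 + B t t)" by (simp add: algebra_simps)
   then have "q * (2 * \<bar>d\<bar>) \<le> q * (q * (1 + B t t))" by (simp add: power2_eq_square algebra_simps)
   then have "2 * \<bar>d\<bar> \<le> q * (1 + B t t)" using q(1) by simp
   then have "\<bar>d\<bar> \<le> q * (1 + B t t)" by simp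
   then show ?thesis by (simp add: d_def q_def)
  qed
  have "filterlim (\<lambda>n. sqrt (real (Suc n))) at_top sequentially"
   by (intro filterlim_compose[OF sqrt_at_top] filterlim_compose[OF filterlim_real_sequentially] filterlim_Suc)
  then have "(\<lambda>n. (1 + B t t) / sqrt (real (Suc n))) \<longlonglongrightarrow> 0"
   by (intro tendsto_divide_0[OF tendsto_const] filterlim_at_top_imp_at_infinity)
  then have "(\<lambda>n. B (s n) t - l t) \<longlonglongrightarrow> 0"
   by (rule Lim_null_comparison[rotated]) (use bound in simp)
  then show "(\<lambda>n. B (s n) t) \<longlonglongrightarrow> l t" by (rule LIM_zero_cancel)
 qed
qed

section \<open>Test functions\<close>

definition C1 :: "(real^'n => real) => (real^'n => real^'n) => bool" where
 "C1 f Df \<longleftrightarrow> (\<forall>x. (f has_derivative (\<lambda>v. Df x \<bullet> v)) (at x)) \<and> continuous_on UNIV Df"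

text \<open>This is what a test function and every component of its gradient have in common, so that
  both sides of an integration by parts are covered by the same integrability lemmas.\<close>

definition cc :: "(real^'n) set => (real^'n => real) => bool" where
 "cc Om f \<longleftrightarrow> continuous_on UNIV f \<and> (\<exists>K. compact K \<and> K \<subseteq> Om \<and> (\<forall>x. x \<notin> K \<longrightarrow> f x = 0))"

lemma C1_derivD: "C1 f Df ==> (f has_derivative (\<lambda>v. Df x \<bullet> v)) (at x)"
 by (simp add: C1_def)

lemma C1_continuous: "C1 f Df ==> continuous_on UNIV f"
 unfolding C1_def by (meson continuous_at_imp_continuous_on has_derivative_continuous)

lemma C1_continuous_D: "C1 f Df ==> continuous_on UNIV (\<lambda>x. Df x $ k)"
 unfolding C1_def by (intro continuous_intros) auto

lemma test_fn_C1: "test_fn Om f Df ==> C1 f Df"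
 by (simp add: test_fn_def C1_def)

lemma C1_const: "C1 (\<lambda>x. c) (\<lambda>x. 0)"
 by (simp add: C1_def)

lemma C1_coord: "C1 (\<lambda>x. (x::real^'n) $ i) (\<lambda>x. axis i 1)"
proof -
 have "((\<lambda>x. x $ i) has_derivative (\<lambda>v. v $ i)) (at x)" for x :: "real^'n"
  by (intro bounded_linear_imp_has_derivative bounded_linear_vec_nth)
 then show ?thesis by (simp add: C1_def inner_axis')
qed

lemma C1_add: "C1 f Df ==> C1 g Dg ==> C1 (\<lambda>x. f x + g x) (\<lambda>x. Df x + Dg x)"
 unfolding C1_def
 using has_derivative_add[of f "\<lambda>v. Df x \<bullet> v" "at x" g "\<lambda>v. Dg x \<bullet> v" for x]
 by (auto simp: inner_add_left[abs_def] intro!: continuous_intros)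

lemma C1_mult: "C1 f Df ==> C1 g Dg ==> C1 (\<lambda>x. f x * g x) (\<lambda>x. f x *\<^sub>R Dg x + g x *\<^sub>R Df x)"
 unfolding C1_def
proof (intro conjI allI)
 fix x assume f: "(\<forall>x. (f has_derivative (\<lambda>v. Df x \<bullet> v)) (at x)) \<and> continuous_on UNIV Df"
  and g: "(\<forall>x. (g has_derivative (\<lambda>v. Dg x \<bullet> v)) (at x)) \<and> continuous_on UNIV Dg"
 show "((\<lambda>x. f x * g x) has_derivative (\<lambda>v. (f x *\<^sub>R Dg x + g x *\<^sub>R Df x) \<bullet> v)) (at x)"
  using f g by (auto intro!: derivative_eq_intros simp: inner_add_left)
next
 assume f: "(\<forall>x. (f has_derivative (\<lambda>v. Df x \<bullet> v)) (at x)) \<and> continuous_on UNIV Df"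
  and g: "(\<forall>x. (g has_derivative (\<lambda>v. Dg x \<bullet> v)) (at x)) \<and> continuous_on UNIV Dg"
 have "continuous_on UNIV f" "continuous_on UNIV g"
  using f g C1_continuous unfolding C1_def by blast+
 then show "continuous_on UNIV (\<lambda>x. f x *\<^sub>R Dg x + g x *\<^sub>R Df x)"
  using f g by (intro continuous_intros) auto
qed

lemma C1_cmult: "C1 f Df ==> C1 (\<lambda>x. c * f x) (\<lambda>x. c *\<^sub>R Df x)"
 using C1_mult[OF C1_const[of c]] by fastforce

lemma C1_compose:
 assumes f: "C1 f Df" and h: "\<And>t. (h has_real_derivative h' t) (at t)" and c: "continuous_on UNIV h'"
 shows "C1 (\<lambda>x. h (f x)) (\<lambda>x. h' (f x) *\<^sub>R Df x)"
 unfolding C1_def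
proof (intro conjI allI)
 fix x
 have "((\<lambda>x. h (f x)) has_derivative (\<lambda>v. h' (f x) * (Df x \<bullet> v))) (at x)"
  using has_derivative_compose[OF C1_derivD[OF f, of x], of h "\<lambda>v. h' (f x) * v"] h[of "f x"]
  by (simp add: has_field_derivative_def)
 then show "((\<lambda>x. h (f x)) has_derivative (\<lambda>v. (h' (f x) *\<^sub>R Df x) \<bullet> v)) (at x)" by simp
next
 have "continuous_on UNIV (\<lambda>x. h' (f x))"
  by (rule continuous_on_compose2[OF c C1_continuous[OF f]]) auto
 then show "continuous_on UNIV (\<lambda>x. h' (f x) *\<^sub>R Df x)"
  using f by (intro continuous_intros) (auto simp: C1_def)
qed

lemma C1_prod_ex:
 assumes "\<And>i. i \<in> I ==> \<exists>D. C1 (f i) D"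
 shows "\<exists>D. C1 (\<lambda>x. \<Prod>i\<in>I. f i x) D"
 using assms
proof (induction I rule: infinite_finite_induct)
 case (insert j I)
 then obtain D1 D2 where "C1 (f j) D1" "C1 (\<lambda>x. \<Prod>i\<in>I. f i x) D2" by (metis insertCI)
 from C1_mult[OF this] show ?case using insert by auto
qed (use C1_const in auto)

lemma C1_sum:
 assumes "\<And>i. i \<in> I ==> C1 (f i) (Df i)"
 shows "C1 (\<lambda>x. \<Sum>i\<in>I. f i x) (\<lambda>x. \<Sum>i\<in>I. Df i x)"
 using assms by (induction I rule: infinite_finite_induct) (auto intro: C1_add simp: C1_const)

lemma test_fnI:
 assumes f: "C1 f Df" and K: "compact K" "K \<subseteq> Om" "\<And>x. x \<notin> K ==> f x = 0"
 shows "test_fn Om f Df"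
proof -
 have "{x. f x \<noteq> 0} \<subseteq> K" using K by auto
 then have "closure {x. f x \<noteq> 0} \<subseteq> K"
  using K(1) by (simp add: closure_minimal compact_imp_closed)
 then show ?thesis
  unfolding test_fn_def using f K
  by (auto simp: C1_def intro: compact_closure[THEN iffD2] bounded_subset[OF compact_imp_bounded])
qed

text \<open>The complement of the support is open and the function is constant there, so its
  gradient vanishes on the same set.\<close>

lemma test_fn_zero_outside:
 assumes "test_fn Om f Df"
 obtains K where "compact K" "K \<subseteq> Om" "\<And>x. x \<notin> K ==> f x = 0" "\<And>x. x \<notin> K ==> Df x = 0"
proof (rule that)
 let ?K = "closure {x. f x \<noteq> 0}"
 show "compact ?K" "?K \<subseteq> Om" using assms by (auto simp: test_fn_def)
 show f0: "f x = 0" if "x \<notin> ?K" for x using that closure_subset[of "{x. f x \<noteq> 0}"] by auto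
 show "Df x = 0" if "x \<notin> ?K" for x
 proof -
  have "(f has_derivative (\<lambda>v. Df x \<bullet> v)) (at x)" using assms by (simp add: test_fn_def)
  moreover have "(f has_derivative (\<lambda>v. 0)) (at x)"
  proof (rule has_derivative_transform_within_open[of "\<lambda>x. 0" _ _ _ "- ?K"])
   show "open (- ?K)" by (simp add: open_Compl)
   show "x \<in> - ?K" using that by simp
   show "0 = f y" if "y \<in> - ?K" for y using f0[of y] that by simp
  qed simp
  ultimately have "(\<lambda>v. Df x \<bullet> v) = (\<lambda>v. 0)" by (rule has_derivative_unique)
  then have "Df x \<bullet> Df x = 0" by metis
  then show ?thesis by simp
 qed
qed

lemma ccI: "continuous_on UNIV f ==> compact K ==> K \<subseteq> Om ==> (\<And>x. x \<notin> K ==> f x = 0) ==> cc Om f"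
 by (auto simp: cc_def)

lemma test_fn_cc: assumes "test_fn Om f Df" shows "cc Om f" "cc Om (\<lambda>x. Df x $ k)"
proof -
 obtain K where K: "compact K" "K \<subseteq> Om" "\<And>x. x \<notin> K ==> f x = 0" "\<And>x. x \<notin> K ==> Df x = 0"
  using test_fn_zero_outside[OF assms] by metis
 have c: "C1 f Df" by (rule test_fn_C1[OF assms])
 show "cc Om f" by (rule ccI[OF C1_continuous[OF c] K(1-3)])
 show "cc Om (\<lambda>x. Df x $ k)" by (rule ccI[OF C1_continuous_D[OF c] K(1-2)]) (simp add: K)
qed

lemma test_fn_mono: "test_fn A f Df ==> A \<subseteq> B ==> test_fn B f Df"
 by (auto simp: test_fn_def)

lemma test_fn_mult: assumes f: "C1 f Df" and g: "test_fn Om g Dg"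
 shows "test_fn Om (\<lambda>x. f x * g x) (\<lambda>x. f x *\<^sub>R Dg x + g x *\<^sub>R Df x)"
proof -
 obtain K where K: "compact K" "K \<subseteq> Om" "\<And>x. x \<notin> K ==> g x = 0"
  using test_fn_zero_outside[OF g] by metis
 show ?thesis by (rule test_fnI[OF C1_mult[OF f test_fn_C1[OF g]] K(1,2)]) (simp add: K)
qed

lemma cc_mult: assumes f: "continuous_on UNIV f" and g: "cc Om g" shows "cc Om (\<lambda>x. f x * g x)"
 using assms unfolding cc_def by (auto intro!: continuous_intros)

lemma cc_bounded: assumes "cc Om f" obtains C where "C > 0" "\<And>x. \<bar>f x\<bar> \<le> C"
proof -
 obtain K where K: "compact K" "\<forall>x. x \<notin> K \<longrightarrow> f x = 0" and c: "continuous_on UNIV f"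
  using assms by (auto simp: cc_def)
 have "bounded (f ` K)"
  by (meson K c compact_continuous_image compact_imp_bounded continuous_on_subset subset_UNIV)
 then obtain B where "\<forall>x\<in>K. \<bar>f x\<bar> \<le> B" by (auto simp: bounded_iff)
 with K have "\<bar>f x\<bar> \<le> \<bar>B\<bar> + 1" for x by (cases "x \<in> K") force+
 then show thesis by (intro that[of "\<bar>B\<bar> + 1"]) auto
qed

lemma cc_measurable: "cc Om f ==> f \<in> borel_measurable borel"
 by (auto simp: cc_def intro: borel_measurable_continuous_onI)

lemma cc_bound_indicator:
 assumes "cc Om f" obtains C K where "C > 0" "compact K" "K \<subseteq> Om" "\<And>x. \<bar>f x\<bar> \<le> C * indicator K x"
proof -
 obtain C where C: "C > 0" "\<And>x. \<bar>f x\<bar> \<le> C" using cc_bounded[OF assms] by metis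
 obtain K where K: "compact K" "K \<subseteq> Om" "\<forall>x. x \<notin> K \<longrightarrow> f x = 0"
  using assms by (auto simp: cc_def)
 show thesis by (rule that[OF C(1) K(1,2)]) (use C K in \<open>auto simp: indicator_def\<close>)
qed

section \<open>Locally square integrable functions\<close>

text \<open>Measurability is required on the whole space and integrability only on compact subsets
  of \<open>Om\<close>. Products with indicators and cutoffs are then measurable without restricting
  the measure.\<close>

definition L2loc :: "(real^'n) set => (real^'n => real) => bool" where
 "L2loc Om f \<longleftrightarrow> f \<in> borel_measurable borel \<and>
   (\<forall>K. compact K \<longrightarrow> K \<subseteq> Om \<longrightarrow> integrable lborel (\<lambda>x. indicator K x * (f x)\<^sup>2))"

lemma L2loc_L2: assumes "L2loc Om f" "compact K" "K \<subseteq> Om" shows "L2 lborel (\<lambda>x. indicator K x * f x)"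
proof -
 have "(\<lambda>x. (indicator K x * f x)\<^sup>2) = (\<lambda>x. indicator K x * (f x)\<^sup>2)"
  by (auto simp: power_mult_distrib indicator_def)
 moreover have "K \<in> sets borel" using assms(2) by (simp add: borel_compact)
 ultimately show ?thesis using assms by (auto simp: L2loc_def L2_def)
qed

lemma L2loc_measurable: "L2loc Om f ==> f \<in> borel_measurable borel"
 by (simp add: L2loc_def)

lemma L2_cc_mult: assumes f: "L2loc Om f" and c: "cc Om \<phi>" shows "L2 lborel (\<lambda>x. \<phi> x * f x)"
proof -
 obtain C K where C: "C > 0" "compact K" "K \<subseteq> Om" "\<And>x. \<bar>\<phi> x\<bar> \<le> C * indicator K x"
  using cc_bound_indicator[OF c] by metis
 show ?thesis
 proof (rule L2_bound[OF L2loc_L2[OF f C(2,3)], of _ C])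
  show "(\<lambda>x. \<phi> x * f x) \<in> borel_measurable lborel"
   using cc_measurable[OF c] L2loc_measurable[OF f] by simp
  show "\<bar>\<phi> x * f x\<bar> \<le> C * \<bar>indicator K x * f x\<bar>" for x
   using mult_right_mono[OF C(4)[of x], of "\<bar>f x\<bar>"] by (simp add: abs_mult mult.assoc)
 qed
qed

lemma L2loc_integrable_mult:
 assumes f: "L2loc Om f" and g: "L2loc Om g" and c: "cc Om \<phi>"
 shows "integrable lborel (\<lambda>x. \<phi> x * (f x * g x))"
proof -
 obtain C K where C: "C > 0" "compact K" "K \<subseteq> Om" "\<And>x. \<bar>\<phi> x\<bar> \<le> C * indicator K x"
  using cc_bound_indicator[OF c] by metis
 have "integrable lborel (\<lambda>x. (\<phi> x * f x) * (indicator K x * g x))"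
  by (rule L2_integrable_mult[OF L2_cc_mult[OF f c] L2loc_L2[OF g C(2,3)]])
 moreover have "(\<phi> x * f x) * (indicator K x * g x) = \<phi> x * (f x * g x)" for x
  using C(4)[of x] by (auto simp: indicator_def split: if_splits)
 ultimately show ?thesis by simp
qed

lemma L2loc_continuous: fixes f :: "real^'n => real" assumes "continuous_on UNIV f" shows "L2loc Om f"
 unfolding L2loc_def
proof (intro conjI allI impI)
 show "f \<in> borel_measurable borel" using assms by (rule borel_measurable_continuous_onI)
 fix K :: "(real^'n) set" assume K: "compact K"
 have "integrable lborel (\<lambda>x. indicator K x *\<^sub>R (f x)\<^sup>2)"
  by (rule borel_integrable_compact[OF K]) (intro continuous_intros continuous_on_subset[OF assms], auto)
 then show "integrable lborel (\<lambda>x. indicator K x * (f x)\<^sup>2)" by simp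
qed

lemma cc_integrable_mult: assumes f: "L2loc Om f" and c: "cc Om \<phi>" shows "integrable lborel (\<lambda>x. \<phi> x * f x)"
 using L2loc_integrable_mult[OF f L2loc_continuous[of "\<lambda>x. 1"] c] by simp

lemma cc_integrable: assumes c: "cc Om \<phi>" shows "integrable lborel \<phi>"
 using cc_integrable_mult[OF L2loc_continuous[of "\<lambda>x. 1"] c] by simp

lemma cc_L2: assumes c: "cc Om \<phi>" shows "L2 lborel \<phi>"
 using L2_cc_mult[OF L2loc_continuous[of "\<lambda>x. 1"] c] by simp

lemma L2loc_add: assumes f: "L2loc Om f" and g: "L2loc Om g" shows "L2loc Om (\<lambda>x. f x + g x)"
 unfolding L2loc_def
proof (intro conjI allI impI)
 show "(\<lambda>x. f x + g x) \<in> borel_measurable borel" using f g by (auto simp: L2loc_def)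
 fix K assume K: "compact K" "K \<subseteq> Om"
 have "integrable lborel (\<lambda>x. (indicator K x * f x + indicator K x * g x)\<^sup>2)"
  by (rule L2_integrable_square[OF L2_add[OF L2loc_L2[OF f K] L2loc_L2[OF g K]]])
 moreover have "(\<lambda>x. (indicator K x * f x + indicator K x * g x)\<^sup>2) = (\<lambda>x. indicator K x * (f x + g x)\<^sup>2)"
  by (auto simp: indicator_def)
 ultimately show "integrable lborel (\<lambda>x. indicator K x * (f x + g x)\<^sup>2)" by simp
qed

lemma L2loc_mult: assumes f: "L2loc Om f" and c: "continuous_on UNIV c" shows "L2loc Om (\<lambda>x. c x * f x)"
 unfolding L2loc_def
proof (intro conjI allI impI)
 show "(\<lambda>x. c x * f x) \<in> borel_measurable borel"
  using f borel_measurable_continuous_onI[OF c] by (auto simp: L2loc_def)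
 fix K assume K: "compact K" "K \<subseteq> Om"
 have "bounded (c ` K)"
  by (meson K c compact_continuous_image compact_imp_bounded continuous_on_subset subset_UNIV)
 then obtain B where B: "\<forall>x\<in>K. \<bar>c x\<bar> \<le> B" by (auto simp: bounded_iff)
 have "L2 lborel (\<lambda>x. indicator K x * (c x * f x))"
 proof (rule L2_bound[OF L2loc_L2[OF f K], of _ "\<bar>B\<bar>"])
  show "(\<lambda>x. indicator K x * (c x * f x)) \<in> borel_measurable lborel"
   using f borel_measurable_continuous_onI[OF c] borel_compact[OF K(1)] by (auto simp: L2loc_def)
  show "\<bar>indicator K x * (c x * f x)\<bar> \<le> \<bar>B\<bar> * \<bar>indicator K x * f x\<bar>" for x
   using B by (force simp: indicator_def abs_mult intro!: mult_right_mono)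
 qed
 moreover have "(\<lambda>x. (indicator K x * (c x * f x))\<^sup>2) = (\<lambda>x. indicator K x * (c x * f x)\<^sup>2)"
  by (auto simp: indicator_def)
 ultimately show "integrable lborel (\<lambda>x. indicator K x * (c x * f x)\<^sup>2)" by (simp add: L2_def)
qed

lemma L2loc_uminus: "L2loc Om f ==> L2loc Om (\<lambda>x. - f x)"
 using L2loc_mult[of Om f "\<lambda>x. - 1"] by (simp add: continuous_on_const)

lemma L2loc_diff: "L2loc Om f ==> L2loc Om g ==> L2loc Om (\<lambda>x. f x - g x)"
 using L2loc_add[of Om f "\<lambda>x. - g x"] L2loc_uminus[of Om g] by simp

lemma L2loc_sum: "(\<And>i. i \<in> I ==> L2loc Om (f i)) ==> L2loc Om (\<lambda>x. \<Sum>i\<in>I. f i x)"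
 by (induction I rule: infinite_finite_induct) (auto intro: L2loc_add L2loc_continuous continuous_on_const)

lemma L2loc_mono: "L2loc B f ==> A \<subseteq> B ==> L2loc A f"
 by (auto simp: L2loc_def)

lemma L2_L2loc: fixes f :: "real^'n => real" assumes f: "L2 lborel f" shows "L2loc Om f"
 unfolding L2loc_def
proof (intro conjI allI impI)
 show "f \<in> borel_measurable borel" using f by (simp add: L2_def)
 fix K :: "(real^'n) set" assume K: "compact K"
 show "integrable lborel (\<lambda>x. indicator K x * (f x)\<^sup>2)"
  using integrable_mult_indicator[OF _ L2_integrable_square[OF f], of K] borel_compact[OF K] by simp
qed

section \<open>Translation invariance and integration by parts for test functions\<close>

lemma integral_abs_le:
 fixes f g :: "'a => real"
 assumes "integrable M f" "integrable M g" "\<And>x. \<bar>f x\<bar> \<le> g x"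
 shows "\<bar>\<integral>x. f x \<partial>M\<bar> \<le> (LINT x|M. g x)"
 using integral_abs_bound[of M f] integral_mono[OF integrable_abs[OF assms(1)] assms(2,3)] by linarith

lemma integral_lborel_translate:
 fixes f :: "real^'n => real"
 assumes "f \<in> borel_measurable borel"
 shows "(LBINT x. f (a + x)) = (LBINT x. f x)"
 using integral_distr[of "(+) a" lborel borel f] assms by (simp add: lborel_distr_plus)

lemma integrable_lborel_translate:
 fixes f :: "real^'n => real"
 assumes "integrable lborel f"
 shows "integrable lborel (\<lambda>x. f (a + x))"
proof -
 have "f \<in> borel_measurable borel" using assms by auto
 then show ?thesis
  using integrable_distr_eq[of "(+) a" lborel borel f] assms by (simp add: lborel_distr_plus)
qed

text \<open>Heine-Cantor on a ball whose radius is enlarged by one: if one of two points at distance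
  below one lies outside that ball, then neither belongs to \<open>K\<close> and both values
  vanish.\<close>

lemma compact_support_uniformly_continuous:
 fixes F :: "real^'n => 'b::real_normed_vector"
 assumes c: "continuous_on UNIV F" and K: "compact K" "\<And>x. x \<notin> K ==> F x = 0" and e: "e > 0"
 obtains d where "d > 0" "\<And>x y. dist x y < d ==> dist (F x) (F y) < e"
proof -
 obtain R where R: "K \<subseteq> cball 0 R" using compact_imp_bounded[OF K(1)] by (auto simp: bounded_iff subset_iff)
 have "uniformly_continuous_on (cball 0 (R + 1)) F"
  by (intro compact_uniformly_continuous continuous_on_subset[OF c]) auto
 then obtain d where d: "d > 0" "\<And>x y. x \<in> cball 0 (R+1) ==> y \<in> cball 0 (R+1) ==> dist y x < d ==> dist (F y) (F x) < e"
  using e unfolding uniformly_continuous_on_def by meson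
 show thesis
 proof (rule that[of "min d 1"])
  show "min d 1 > 0" using d by simp
  fix x y :: "real^'n" assume xy: "dist x y < min d 1"
  show "dist (F x) (F y) < e"
  proof (cases "x \<in> cball 0 (R+1) \<and> y \<in> cball 0 (R+1)")
   case True then show ?thesis using d xy by auto
  next
   case False
   have "x \<notin> K \<and> y \<notin> K"
   proof -
    have "x \<notin> cball 0 R \<and> y \<notin> cball 0 R"
     using False xy norm_triangle_sub[of x y] norm_triangle_sub[of y x]
     by (auto simp: dist_norm norm_minus_commute)
    then show ?thesis using R by auto
   qed
   then show ?thesis using K e by simp
  qed
 qed
qed

text \<open>The gradient is uniformly continuous, so the mean value estimate for the first-order
  remainder is uniform in \<open>x\<close>. This uniformity is what allows differentiation under the
  integral sign.\<close>

lemma test_fn_uniform_derivative: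
 fixes f :: "real^'n => real"
 assumes f: "test_fn Om f Df" and e: "e > 0"
 obtains d where "d > 0" "\<And>x h. norm h < d ==> \<bar>f (x + h) - f x - Df x \<bullet> h\<bar> \<le> e * norm h"
proof -
 obtain K where K: "compact K" "\<And>x. x \<notin> K ==> Df x = 0"
  using test_fn_zero_outside[OF f] by metis
 have c: "continuous_on UNIV Df" using f by (simp add: test_fn_def)
 obtain d where d: "d > 0" "\<And>x y. dist x y < d ==> dist (Df x) (Df y) < e"
  using compact_support_uniformly_continuous[OF c K e] by metis
 show thesis
 proof (rule that[OF d(1)])
  fix x h :: "real^'n" assume h: "norm h < d"
  have "norm (f (x + h) - f x - Df x \<bullet> (x + h - x)) \<le> norm (x + h - x) * e"
  proof (rule differentiable_bound_linearization[where a=x and b="x+h" and S="ball x d" and f'="\<lambda>y v. Df y \<bullet> v"])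
   fix t :: real assume t: "t \<in> {0..1}"
   have "norm (t *\<^sub>R h) \<le> norm h" using t by (simp add: mult_left_le_one_le)
   then show "x + t *\<^sub>R (x + h - x) \<in> ball x d" using h by (simp add: dist_norm)
  next
   show "(f has_derivative (\<lambda>v. Df y \<bullet> v)) (at y within ball x d)" for y
    using f by (simp add: test_fn_def has_derivative_at_withinI)
   show "onorm ((\<lambda>v. Df y \<bullet> v) - (\<lambda>v. Df x \<bullet> v)) \<le> e" if "y \<in> ball x d" for y
   proof (rule onorm_le)
    fix v
    have "norm (((\<lambda>v. Df y \<bullet> v) - (\<lambda>v. Df x \<bullet> v)) v) = \<bar>(Df y - Df x) \<bullet> v\<bar>"
     by (simp add: inner_diff_left)
    also have "\<dots> \<le> norm (Df y - Df x) * norm v" by (rule Cauchy_Schwarz_ineq2)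
    also have "\<dots> \<le> e * norm v"
     using d(2)[of x y] that by (intro mult_right_mono) (auto simp: dist_norm norm_minus_commute)
    finally show "norm (((\<lambda>v. Df y \<bullet> v) - (\<lambda>v. Df x \<bullet> v)) v) \<le> e * norm v" .
   qed
  qed (use d in auto)
  then show "\<bar>f (x + h) - f x - Df x \<bullet> h\<bar> \<le> e * norm h" by (simp add: mult.commute)
 qed
qed

text \<open>Differentiate the translation invariance of the integral.\<close>
lemma integral_pderiv_test_fn:
 fixes f :: "real^'n => real"
 assumes f: "test_fn Om f Df"
 shows "(LBINT x. Df x $ k) = 0"
proof -
 obtain K where K: "compact K" "\<And>x. x \<notin> K ==> f x = 0" "\<And>x. x \<notin> K ==> Df x = 0"
  using test_fn_zero_outside[OF f] by metis
 obtain R where R: "K \<subseteq> cball 0 R" using compact_imp_bounded[OF K(1)] by (auto simp: bounded_iff subset_iff)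
 define V where "V = measure lborel (cball (0::real^'n) (R+1))"
 have V: "integrable lborel (indicator (cball (0::real^'n) (R+1)) :: _ => real)"
  "(LBINT x. indicator (cball (0::real^'n) (R+1)) x) = V"
  using emeasure_lborel_cball_finite[of "0::real^'n" "R+1"] by (auto simp: V_def)
 have fi: "integrable lborel f" "integrable lborel (\<lambda>x. Df x $ k)"
  using test_fn_cc[OF f] cc_integrable by blast+
 have "\<bar>\<integral>x. Df x $ k \<partial>lborel\<bar> \<le> e * V" if e: "e > 0" for e
 proof -
  obtain d where d: "d > 0" "\<And>x h. norm h < d ==> \<bar>f (x + h) - f x - Df x \<bullet> h\<bar> \<le> e * norm h"
   using test_fn_uniform_derivative[OF f e] by metis
  \<comment> \<open>Below \<open>d\<close> for the uniform expansion, and below 1 so that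
    \<open>x\<close> and \<open>h + x\<close> both miss \<open>K\<close> as soon as \<open>x\<close>
    leaves the ball of radius \<open>R + 1\<close>.\<close>
  define t where "t = min (d/2) (1/2)"
  have t: "t > 0" "t < d" "t < 1" using d by (auto simp: t_def)
  define h :: "real^'n" where "h = t *\<^sub>R axis k 1"
  have h: "norm h = t" "norm h < d" using t by (auto simp: h_def)
  have b: "\<bar>f (h + x) - f x - t * Df x $ k\<bar> \<le> e * t * indicator (cball 0 (R+1)) x" for x
  proof (cases "x \<in> cball 0 (R+1)")
   case True then show ?thesis using d(2)[OF h(2), of x] h by (simp add: add.commute h_def inner_axis)
  next
   case False
   have "norm (h + x) > R" using False h(1) t norm_triangle_ineq4[of "h + x" h] by simp
   then have "h + x \<notin> K" "x \<notin> K" using R False by auto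
   then show ?thesis using False by (simp add: K)
  qed
  have "(LBINT x. f (h + x) - f x - t * Df x $ k) = - t * (LBINT x. Df x $ k)"
   using fi integrable_lborel_translate[OF fi(1), of h] integral_lborel_translate[of f h]
   by auto
  moreover have "\<bar>\<integral>x. f (h + x) - f x - t * Df x $ k \<partial>lborel\<bar> \<le> (LBINT x. e * t * indicator (cball (0::real^'n) (R+1)) x)"
   by (rule integral_abs_le[OF _ _ b]) (use fi integrable_lborel_translate[OF fi(1), of h] V in auto)
  ultimately have "t * \<bar>\<integral>x. Df x $ k \<partial>lborel\<bar> \<le> t * (e * V)"
   using V t by (simp add: abs_mult)
  then show ?thesis using t by simp
 qed
 note b = this
 have "V \<ge> 0" by (simp add: V_def)
 have "\<bar>\<integral>x. Df x $ k \<partial>lborel\<bar> \<le> 0"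
 proof (rule field_le_epsilon)
  fix e :: real assume "e > 0"
  have "e / (V + 1) * V \<le> e" using \<open>V \<ge> 0\<close> \<open>e > 0\<close> by (simp add: field_simps)
  then show "\<bar>\<integral>x. Df x $ k \<partial>lborel\<bar> \<le> 0 + e" using b[of "e / (V + 1)"] \<open>V \<ge> 0\<close> \<open>e > 0\<close> by simp
 qed
 then show ?thesis by simp
qed

section \<open>Weak derivatives expressed by integrals over the whole space\<close>

lemma weak_pderiv_iff:
 "weak_pderiv Om u k v \<longleftrightarrow> (\<forall>\<phi> D\<phi>. test_fn Om \<phi> D\<phi> \<longrightarrow>
   integrable lborel (\<lambda>x. u x * D\<phi> x $ k) \<and> integrable lborel (\<lambda>x. v x * \<phi> x) \<and>
   (LBINT x. u x * D\<phi> x $ k) = - (LBINT x. v x * \<phi> x))"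
proof -
 have ind: "indicator Om x *\<^sub>R (u x * D\<phi> x $ k) = u x * D\<phi> x $ k"
    "indicator Om x *\<^sub>R (v x * \<phi> x) = v x * \<phi> x" if t: "test_fn Om \<phi> D\<phi>" for \<phi> D\<phi> x
 proof -
  obtain K where "compact K" "K \<subseteq> Om" "\<And>x. x \<notin> K ==> \<phi> x = 0" "\<And>x. x \<notin> K ==> D\<phi> x = 0"
   using test_fn_zero_outside[OF t] by metis
  then have *: "x \<notin> Om ==> \<phi> x = 0 \<and> D\<phi> x = 0" by blast
  show "indicator Om x *\<^sub>R (u x * D\<phi> x $ k) = u x * D\<phi> x $ k"
    "indicator Om x *\<^sub>R (v x * \<phi> x) = v x * \<phi> x"
   by (cases "x \<in> Om"; simp add: *)+
 qed
 then show ?thesis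
  unfolding weak_pderiv_def set_integrable_def set_lebesgue_integral_def by (simp add: ind del: real_scaleR_def)
qed

lemma weak_pderivD:
 assumes "weak_pderiv Om u k v" "test_fn Om \<phi> D\<phi>"
 shows "integrable lborel (\<lambda>x. u x * D\<phi> x $ k)" "integrable lborel (\<lambda>x. v x * \<phi> x)"
   "(LBINT x. u x * D\<phi> x $ k) = - (LBINT x. v x * \<phi> x)"
 using assms unfolding weak_pderiv_iff by blast+

lemma weak_pderivD_null:
 assumes "weak_pderiv Om u k v" "test_fn Om \<phi> D\<phi>"
 shows "null_integral (\<lambda>x. u x * D\<phi> x $ k + v x * \<phi> x)"
 using weak_pderivD[OF assms] by (simp add: has_bochner_integral_iff)

lemma weak_pderiv_L2locI:
 assumes "L2loc Om u" "L2loc Om v"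
  and "\<And>\<phi> D\<phi>. test_fn Om \<phi> D\<phi> ==> (LBINT x. u x * D\<phi> x $ k) = - (LBINT x. v x * \<phi> x)"
 shows "weak_pderiv Om u k v"
 unfolding weak_pderiv_iff
 using assms cc_integrable_mult[OF assms(1)] cc_integrable_mult[OF assms(2)] test_fn_cc
 by (metis (no_types, lifting) Bochner_Integration.integrable_cong mult.commute)

lemma weak_pderiv_mono: "weak_pderiv B u k v ==> A \<subseteq> B ==> weak_pderiv A u k v"
 unfolding weak_pderiv_iff using test_fn_mono by blast

lemma weak_pderiv_C1: assumes f: "C1 f Df" shows "weak_pderiv Om f k (\<lambda>x. Df x $ k)"
proof (rule weak_pderiv_L2locI)
 show "L2loc Om f" "L2loc Om (\<lambda>x. Df x $ k)"
  using C1_continuous[OF f] C1_continuous_D[OF f] L2loc_continuous by blast+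
 fix \<phi> D\<phi> assume t: "test_fn Om \<phi> D\<phi>"
 have "(LBINT x. (f x *\<^sub>R D\<phi> x + \<phi> x *\<^sub>R Df x) $ k) = 0"
  by (rule integral_pderiv_test_fn[OF test_fn_mult[OF f t]])
 moreover have "integrable lborel (\<lambda>x. f x * D\<phi> x $ k)" "integrable lborel (\<lambda>x. \<phi> x * Df x $ k)"
  using cc_integrable[OF cc_mult[OF C1_continuous[OF f] test_fn_cc(2)[OF t]]]
   cc_integrable[OF cc_mult[OF C1_continuous_D[OF f] test_fn_cc(1)[OF t]]] by (auto simp: mult.commute)
 ultimately show "(LBINT x. f x * D\<phi> x $ k) = - (LBINT x. Df x $ k * \<phi> x)"
  by (simp add: mult.commute)
qed

text \<open>Only the point 0 needs an argument: for exponent at least 2 the difference quotient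
  there is bounded by \<open>\<bar>h\<bar>\<close> as soon as
  \<open>\<bar>h\<bar> < 1\<close>.\<close>

lemma DERIV_max0_power:
 assumes "n \<ge> 2"
 shows "((\<lambda>t. (max 0 t)^n) has_real_derivative real n * (max 0 t)^(n-1)) (at (t::real))"
proof -
 consider "t < 0" | "t > 0" | "t = 0" by linarith
 then show ?thesis
 proof cases
  case 1
  have "((\<lambda>t. 0) has_real_derivative 0) (at t)" by simp
  then have "((\<lambda>t. (max 0 t)^n) has_real_derivative 0) (at t)"
   by (rule has_field_derivative_transform_within_open[of _ _ _ "{..<0}"]) (use 1 assms in auto)
  moreover have "max 0 t = 0" using 1 by simp
  ultimately show ?thesis using assms by (simp add: power_0_left)
 next
  case 2
  have "((\<lambda>t. t^n) has_real_derivative real n * t^(n-1)) (at t)"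
   by (auto intro!: derivative_eq_intros)
  then have "((\<lambda>t. (max 0 t)^n) has_real_derivative real n * t^(n-1)) (at t)"
   by (rule has_field_derivative_transform_within_open[of _ _ _ "{0<..}"]) (use 2 in auto)
  then show ?thesis using 2 by (simp add: max_absorb2)
 next
  case 3
  have "((\<lambda>h. ((max 0 (0 + h))^n - (max 0 0)^n) / h) \<longlongrightarrow> 0) (at (0::real))"
  proof (rule Lim_null_comparison)
   show "\<forall>\<^sub>F h in at (0::real). norm (((max 0 (0 + h))^n - (max 0 0)^n) / h) \<le> \<bar>h\<bar>"
   proof -
    have "\<forall>\<^sub>F h in at (0::real). h \<in> {-1<..<1} - {0}"
     by (rule eventually_at_in_open) auto
    then show ?thesis
    proof eventually_elim
     case (elim h)
     have "\<bar>(max 0 h)^n\<bar> \<le> \<bar>h\<bar>^n" by (cases "h > 0") (use assms in \<open>auto simp: power_abs max_absorb1\<close>)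
     also have "\<dots> \<le> \<bar>h\<bar>^2" using elim assms by (intro power_decreasing) auto
     finally have "\<bar>(max 0 h)^n\<bar> / \<bar>h\<bar> \<le> \<bar>h\<bar>\<^sup>2 / \<bar>h\<bar>" by (intro divide_right_mono) auto
     moreover have "\<bar>h\<bar>\<^sup>2 / \<bar>h\<bar> = \<bar>h\<bar>" using elim by (simp add: power2_eq_square del: abs_mult_self_eq)
     ultimately show ?case using assms by (simp add: power_0_left)
    qed
   qed
   show "((\<lambda>h. \<bar>h\<bar>) \<longlongrightarrow> 0) (at (0::real))" by (auto intro!: tendsto_eq_intros)
  qed
  then show ?thesis using 3 assms by (simp add: DERIV_def power_0_left)
 qed
qed

section \<open>Fundamental lemma of the calculus of variations\<close>

text \<open>A product of one-sided truncated squares is positive exactly on the open box. Composing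
  it with \<open>t \<mapsto> n t\<^sup>2 / (1 + n t\<^sup>2)\<close> pushes every positive value to
  1 in the limit.\<close>

lemma box_bump:
 fixes c d :: "real^'n"
 obtains \<phi> D\<phi> where "\<And>n::nat. test_fn (cbox c d) (\<phi> n) (D\<phi> n)" "\<And>n x. \<bar>\<phi> n x\<bar> \<le> indicator (cbox c d) x"
  "\<And>x. (\<lambda>n. \<phi> n x) \<longlonglongrightarrow> indicator (box c d) x"
proof -
 define p where "p x = (\<Prod>i\<in>UNIV. (max 0 (x $ i - c $ i))\<^sup>2 * (max 0 (d $ i - x $ i))\<^sup>2)" for x
 have "\<exists>D. C1 (\<lambda>x. (max 0 (x $ i - c $ i))\<^sup>2 * (max 0 (d $ i - x $ i))\<^sup>2) D" for i
 proof -
  have 1: "C1 (\<lambda>x. x $ i + - c $ i) (\<lambda>x. axis i 1 + 0)" by (intro C1_add C1_coord C1_const)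
  have 2: "C1 (\<lambda>x. d $ i + (- 1) * x $ i) (\<lambda>x. 0 + (-1) *\<^sub>R axis i 1)" by (intro C1_add C1_cmult C1_coord C1_const)
  have h: "((\<lambda>t. (max 0 t)\<^sup>2) has_real_derivative 2 * (max 0 t)) (at t)" for t :: real
   using DERIV_max0_power[of 2 t] by simp
  have h': "continuous_on UNIV (\<lambda>t::real. 2 * max 0 t)" by (intro continuous_intros)
  show ?thesis using C1_mult[OF C1_compose[OF 1 h h'] C1_compose[OF 2 h h']] by auto
 qed
 then have "\<exists>D. C1 p D" unfolding p_def by (rule C1_prod_ex)
 then obtain Dp where Dp: "C1 p Dp" by blast
 have p0: "p x \<ge> 0" for x by (auto simp: p_def intro!: prod_nonneg)
 have pz: "p x = 0" if x: "x \<notin> box c d" for x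
 proof -
  obtain i where "\<not> (c $ i < x $ i \<and> x $ i < d $ i)" using x by (auto simp: mem_box_cart)
  then have "(max 0 (x $ i - c $ i))\<^sup>2 * (max 0 (d $ i - x $ i))\<^sup>2 = 0" by auto
  then show ?thesis unfolding p_def by (intro prod_zero) auto
 qed
 have pp: "p x > 0" if "x \<in> box c d" for x
 proof -
  have i: "x $ i - c $ i > 0" "d $ i - x $ i > 0" for i using that by (auto simp: mem_box_cart)
  show ?thesis unfolding p_def
   by (intro prod_pos ballI mult_pos_pos zero_less_power) (use i in \<open>auto simp: less_max_iff_disj\<close>)
 qed
 \<comment> \<open>The square keeps the denominator positive for every real argument, so that the
   outer function is differentiable on the whole line, as \<open>C1_compose\<close> demands.\<close>
 define \<phi> where "\<phi> n x = real n * (p x)\<^sup>2 / (1 + real n * (p x)\<^sup>2)" for n x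
 define h' where "h' n t = 2 * real n * t / (1 + real n * t\<^sup>2)\<^sup>2" for n :: nat and t :: real
 have ne: "1 + real n * t\<^sup>2 \<noteq> 0" for n and t :: real
  by (metis add_pos_nonneg less_irrefl mult_nonneg_nonneg of_nat_0_le_iff zero_le_power2 zero_less_one)
 have h: "((\<lambda>t. real n * t\<^sup>2 / (1 + real n * t\<^sup>2)) has_real_derivative h' n t) (at t)" for n t
  unfolding h'_def by (auto intro!: derivative_eq_intros simp: ne) (simp add: power2_eq_square field_simps)
 have hc: "continuous_on UNIV (h' n)" for n
  unfolding h'_def using ne by (intro continuous_intros) auto
 have C: "C1 (\<phi> n) (\<lambda>x. h' n (p x) *\<^sub>R Dp x)" for n
  unfolding \<phi>_def by (rule C1_compose[OF Dp h hc])
 show thesis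
 proof (rule that[of \<phi> "\<lambda>n x. h' n (p x) *\<^sub>R Dp x"])
  have z: "\<phi> n x = 0" if "x \<notin> cbox c d" for n x
   using pz[of x] that box_subset_cbox[of c d] by (auto simp: \<phi>_def)
  show "test_fn (cbox c d) (\<phi> n) (\<lambda>x. h' n (p x) *\<^sub>R Dp x)" for n
   by (rule test_fnI[OF C, of "cbox c d"]) (use z in auto)
  show "\<bar>\<phi> n x\<bar> \<le> indicator (cbox c d) x" for n x
  proof (cases "x \<in> cbox c d")
   case True
   have "0 \<le> real n * (p x)\<^sup>2" by simp
   then have "0 \<le> \<phi> n x" "\<phi> n x \<le> 1" unfolding \<phi>_def by (simp_all add: divide_le_eq_1 add_pos_nonneg)
   then show ?thesis using True by simp
  qed (simp add: z)
  show "(\<lambda>n. \<phi> n x) \<longlonglongrightarrow> indicator (box c d) x" for x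
  proof (cases "x \<in> box c d")
   case True
   define q where "q = (p x)\<^sup>2"
   have q: "q > 0" using pp[OF True] by (simp add: q_def)
   have "filterlim (\<lambda>n. 1 + real n * q) at_top sequentially"
    by (intro filterlim_tendsto_add_at_top[OF tendsto_const] filterlim_at_top_mult_tendsto_pos[OF tendsto_const q] filterlim_real_sequentially)
   then have "(\<lambda>n. 1 - 1 / (1 + real n * q)) \<longlonglongrightarrow> 1 - 0"
    by (intro tendsto_diff tendsto_const tendsto_divide_0[OF tendsto_const] filterlim_at_top_imp_at_infinity)
   moreover have "\<phi> n x = 1 - 1 / (1 + real n * q)" for n
    using ne[of n "p x"] unfolding \<phi>_def q_def by (simp add: field_simps)
   ultimately show ?thesis using True by simp
  next
   case False
   then show ?thesis by (simp add: \<phi>_def pz)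
  qed
 qed
qed

text \<open>Bump functions give vanishing integrals over boxes. Boxes are stable under intersection
  and generate the Borel sets, so a Dynkin argument gives vanishing integrals over every Borel part
  of a box, hence the claim on each closed box in \<open>Om\<close>; countably many of these cover
  \<open>Om\<close>.\<close>

lemma fundamental_lemma:
 fixes f :: "real^'n => real"
 assumes Om: "open Om" and f: "f \<in> borel_measurable borel"
  and int: "\<And>K. compact K ==> K \<subseteq> Om ==> integrable lborel (\<lambda>x. indicator K x * f x)"
  and z: "\<And>\<phi> D\<phi>. test_fn Om \<phi> D\<phi> ==> (LBINT x. f x * \<phi> x) = 0"
 shows "AE x in lborel. x \<in> Om \<longrightarrow> f x = 0"
proof -
 have box0: "(LBINT x. indicator (box c d) x * f x) = 0" if cd: "cbox c d \<subseteq> Om" for c d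
 proof -
  obtain \<phi> D\<phi> where p: "\<And>n::nat. test_fn (cbox c d) (\<phi> n) (D\<phi> n)" "\<And>n x. \<bar>\<phi> n x\<bar> \<le> indicator (cbox c d) x"
   "\<And>x. (\<lambda>n. \<phi> n x) \<longlonglongrightarrow> indicator (box c d) x"
   using box_bump by blast
  have "(\<lambda>n. \<integral>x. f x * \<phi> n x \<partial>lborel) \<longlonglongrightarrow> (LBINT x. f x * indicator (box c d) x)"
  proof (rule integral_dominated_convergence[where w = "\<lambda>x. \<bar>indicator (cbox c d) x * f x\<bar>"])
   show "AE x in lborel. (\<lambda>n. f x * \<phi> n x) \<longlonglongrightarrow> f x * indicator (box c d) x"
    by (intro AE_I2 tendsto_intros p)
   show "AE x in lborel. norm (f x * \<phi> n x) \<le> \<bar>indicator (cbox c d) x * f x\<bar>" for n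
    using mult_right_mono[OF p(2)[of n], of "\<bar>f _\<bar>"] by (intro AE_I2) (simp add: abs_mult mult.commute)
   show "(\<lambda>x. f x * \<phi> n x) \<in> borel_measurable lborel" for n
    using f cc_measurable[OF test_fn_cc(1)[OF p(1)]] by simp
  qed (use f int[OF _ cd] in auto)
  moreover have "(LBINT x. f x * \<phi> n x) = 0" for n
   by (rule z[OF test_fn_mono[OF p(1) cd]])
  ultimately show ?thesis by (simp add: LIMSEQ_const_iff mult.commute)
 qed
 have loc: "AE x in lborel. indicator (box a b) x * f x = 0" if ab: "cbox a b \<subseteq> Om" for a b
 proof -
  define F where "F x = indicator (box a b) x * f x" for x
  have F: "integrable lborel F"
  proof (rule Bochner_Integration.integrable_bound[OF int[OF compact_cbox ab]])
   show "AE x in lborel. norm (F x) \<le> norm (indicator (cbox a b) x * f x)"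
    using box_subset_cbox[of a b] by (auto simp: F_def indicator_def)
   show "F \<in> borel_measurable lborel" unfolding F_def using f by simp
  qed
  have "set_lebesgue_integral lborel A F = 0" if "A \<in> sets lborel" for A
  proof -
   have A: "A \<in> sigma_sets UNIV (range (\<lambda>(a, b). box a b::(real^'n) set))"
    using that by (simp add: borel_eq_box)
   have sets: "sigma_sets UNIV (range (\<lambda>(a, b). box a b::(real^'n) set)) = sets lborel"
    by (simp add: borel_eq_box)
   have Fi: "integrable lborel (\<lambda>x. indicator A x *\<^sub>R F x)" if "A \<in> sets lborel" for A
    using integrable_mult_indicator[OF that F] .
   have whole: "(LBINT x. F x) = 0" unfolding F_def by (rule box0[OF ab])
   have st: "Int_stable (range (\<lambda>(a, b). box a b::(real^'n) set))"
    by (auto simp: Int_stable_def box_Int_box)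
   show ?thesis
    using st subset_Pow_Union[of "range (\<lambda>(a, b). box a b::(real^'n) set)", THEN subset_trans, OF Pow_mono[OF subset_UNIV]] A
   proof (induction rule: sigma_sets_induct_disjoint)
    case (basic A)
    then obtain c d where A: "A = box c d" by auto
    obtain c' d' where cd: "box c d \<inter> box a b = box c' d'" using box_Int_box[of c d a b] by blast
    have "indicator A x *\<^sub>R F x = indicator (box c' d') x * f x" for x
     unfolding F_def A cd[symmetric] by (simp add: indicator_inter_arith)
    moreover have "(LBINT x. indicator (box c' d') x * f x) = 0"
    proof (cases "box c' d' = {}")
     case False
     have "closure (box c' d') \<subseteq> closure (cbox a b)"
      by (rule closure_mono) (use cd box_subset_cbox[of a b] in blast)
     then have "cbox c' d' \<subseteq> cbox a b" using closure_box[OF False] by simp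
     then show ?thesis using box0 ab by blast
    qed simp
    ultimately show ?case by (simp add: set_lebesgue_integral_def)
   next
    case (compl A)
    have "indicator (UNIV - A) x *\<^sub>R F x = F x - indicator A x *\<^sub>R F x" for x
     by (auto simp: indicator_def)
    then show ?case
     using compl F Fi[of A] whole sets unfolding set_lebesgue_integral_def by simp
   next
    case (union A)
    have Am: "A i \<in> sets lborel" for i using union(2) sets by auto
    have "(LINT x:(\<Union>i. A i)|lborel. F x) = (\<Sum>i. (LINT x:(A i)|lborel. F x))"
     by (rule lebesgue_integral_countable_add)
       (use Am union(1) Fi[of "\<Union>i. A i"] in \<open>auto simp: disjoint_family_on_def set_integrable_def\<close>)
    then show ?case using union(3) by simp
   qed (auto simp: set_lebesgue_integral_def)
  qed
  then have "AE x in lborel. F x = 0"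
   by (intro density_unique_real[OF F, of "\<lambda>_. 0"]) auto
  then show ?thesis by (simp add: F_def)
 qed
 \<comment> \<open>The cover of \<open>Om\<close> consists of closed boxes, whereas the bumps
   converge to the indicator of the open box; the frontier between them is a null set.\<close>
 have loc': "AE x in lborel. x \<in> cbox a b \<longrightarrow> f x = 0" if ab: "cbox a b \<subseteq> Om" for a b
 proof -
  have "cbox a b - box a b \<in> null_sets lborel"
   using negligible_frontier_interval[of a b]
   by (simp add: negligible_iff_null_sets null_sets_completion_iff)
  then have "AE x in lborel. x \<notin> cbox a b - box a b" by (rule AE_not_in)
  with loc[OF ab] show ?thesis by eventually_elim (auto simp: indicator_def split: if_splits)
 qed
 obtain D where D: "countable D" "D \<subseteq> Pow Om" "\<And>X. X \<in> D ==> \<exists>a b. X = cbox a b" "\<Union>D = Om"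
  using open_countable_Union_open_cbox[OF Om] by metis
 have "AE x in lborel. \<forall>X\<in>D. x \<in> X \<longrightarrow> f x = 0"
  unfolding AE_ball_countable[OF D(1)]
 proof
  fix X assume "X \<in> D"
  then obtain a b where "X = cbox a b" "cbox a b \<subseteq> Om" using D(2,3) by blast
  then show "AE x in lborel. x \<in> X \<longrightarrow> f x = 0" using loc' by simp
 qed
 then show ?thesis by eventually_elim (use D(4) in blast)
qed

section \<open>Riesz representation on test functions and their density in the square integrable
  functions\<close>

lemma L2_complete_sigma_finite:
 assumes M: "sigma_finite_measure M"
  and fn: "\<And>n. L2 M (f n)"
  and C: "\<And>e. e > 0 ==> \<exists>N. \<forall>m\<ge>N. \<forall>n\<ge>N. (LINT x|M. (f m x - f n x)\<^sup>2) < e"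
 obtains f0 where "L2 M f0" "(\<lambda>n. \<integral>x. (f n x - f0 x)\<^sup>2 \<partial>M) \<longlonglongrightarrow> 0"
proof -
 obtain h where h: "h \<in> borel_measurable M" "integral\<^sup>N M h \<noteq> \<infinity>" "\<And>x. x \<in> space M ==> 0 < h x \<and> h x < \<infinity>"
  using sigma_finite_measure.Ex_finite_integrable_function[OF M] by blast
 define w where "w x = (if x \<in> space M then sqrt (enn2real (h x)) else 1)" for x
 have w: "w x > 0" for x using h(3)[of x] by (auto simp: w_def enn2real_positive_iff)
 have [measurable]: "w \<in> borel_measurable M"
  unfolding w_def using h(1) by measurable
 have "L2 M w"
  unfolding L2_def
 proof
  show "integrable M (\<lambda>x. (w x)\<^sup>2)"
  proof (rule integrableI_bounded)
   have "(\<integral>\<^sup>+x. ennreal (norm ((w x)\<^sup>2)) \<partial>M) = integral\<^sup>N M h"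
    by (intro nn_integral_cong) (use h(3) in \<open>auto simp: w_def\<close>)
   then show "(\<integral>\<^sup>+x. ennreal (norm ((w x)\<^sup>2)) \<partial>M) < \<infinity>"
    using h(2) by (simp add: less_top)
  qed measurable
 qed measurable
 from L2_complete[OF this w fn C] that show thesis by blast
qed

text \<open>The almost minimising sequence consists of test functions and is returned together with
  the representing function; \<open>test_fn_dense_L2\<close> reads the density of test functions off
  from it.\<close>

lemma riesz_L2:
 fixes l :: "(real^'n => real) => real"
 assumes llin: "\<And>s t Ds Dt a b. test_fn Om s Ds ==> test_fn Om t Dt ==> l (\<lambda>x. a * s x + b * t x) = a * l s + b * l t"
  and bd: "\<And>s Ds. test_fn Om s Ds ==> (l s)\<^sup>2 \<le> K * (LBINT x. (s x)\<^sup>2)"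
 obtains w s Ds where "L2 lborel w" "\<And>t Dt. test_fn Om t Dt ==> (LBINT x. w x * t x) = l t"
  "\<And>n::nat. test_fn Om (s n) (Ds n)" "(\<lambda>n. \<integral>x. (s n x - w x)\<^sup>2 \<partial>lborel) \<longlonglongrightarrow> 0"
proof -
 define S where "S = {s. \<exists>Ds. test_fn Om s Ds}"
 define B where "B s t = (LBINT x. s x * t x)" for s t :: "real^'n => real"
 have L2S: "L2 lborel s" if "s \<in> S" for s using that cc_L2 test_fn_cc(1) unfolding S_def by blast
 have lin: "(\<lambda>x. a * s x + b * t x) \<in> S" if st: "s \<in> S" "t \<in> S" for s t a b
 proof -
  obtain Ds Dt where D: "test_fn Om s Ds" "test_fn Om t Dt" using st by (auto simp: S_def)
  obtain K1 where K1: "compact K1" "K1 \<subseteq> Om" "\<And>x. x \<notin> K1 ==> s x = 0" using test_fn_zero_outside[OF D(1)] by metis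
  obtain K2 where K2: "compact K2" "K2 \<subseteq> Om" "\<And>x. x \<notin> K2 ==> t x = 0" using test_fn_zero_outside[OF D(2)] by metis
  have "test_fn Om (\<lambda>x. a * s x + b * t x) (\<lambda>x. a *\<^sub>R Ds x + b *\<^sub>R Dt x)"
  proof (rule test_fnI[of _ _ "K1 \<union> K2"])
   show "C1 (\<lambda>x. a * s x + b * t x) (\<lambda>x. a *\<^sub>R Ds x + b *\<^sub>R Dt x)"
    by (intro C1_add C1_cmult test_fn_C1[OF D(1)] test_fn_C1[OF D(2)])
  qed (use K1 K2 in auto)
  then show ?thesis by (auto simp: S_def)
 qed
 obtain s where s: "\<And>n. s n \<in> S"
  and C: "\<And>e. e > 0 ==> \<exists>N::nat. \<forall>m\<ge>N. \<forall>n\<ge>N. B (\<lambda>x. s m x - s n x) (\<lambda>x. s m x - s n x) < e"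
  and lim: "\<And>t. t \<in> S ==> (\<lambda>n. B (s n) t) \<longlonglongrightarrow> l t"
 proof (rule riesz_sequence[of S B l K])
  show "S \<noteq> {}"
   using test_fnI[OF C1_const[of 0], of "{}" Om] by (auto simp: S_def)
  show "B s t = B t s" for s t by (simp add: B_def mult.commute)
  show "B (\<lambda>x. a * s x + b * t x) r = a * B s r + b * B t r" if "s \<in> S" "t \<in> S" "r \<in> S" for s t r a b
   using L2_integrable_mult[OF L2S[OF that(1)] L2S[OF that(3)]] L2_integrable_mult[OF L2S[OF that(2)] L2S[OF that(3)]]
   by (simp add: B_def distrib_right mult.assoc)
  show "l (\<lambda>x. a * s x + b * t x) = a * l s + b * l t" if "s \<in> S" "t \<in> S" for s t a b
   using that llin by (auto simp: S_def)
  show "(l s)\<^sup>2 \<le> K * B s s" if "s \<in> S" for s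
   using that bd by (auto simp: S_def B_def power2_eq_square)
  show "B s s \<ge> 0" for s by (simp add: B_def)
 qed (use lin in auto)
 obtain w where w: "L2 lborel w" "(\<lambda>n. \<integral>x. (s n x - w x)\<^sup>2 \<partial>lborel) \<longlonglongrightarrow> 0"
  by (rule L2_complete_sigma_finite[OF sigma_finite_lborel L2S[OF s] C[unfolded B_def power2_eq_square[symmetric]]])
 obtain Ds where Ds: "\<And>n. test_fn Om (s n) (Ds n)" using s unfolding S_def by (simp, metis)
 show thesis
 proof (rule that[OF w(1) _ Ds w(2)])
  fix t Dt assume t: "test_fn Om t Dt"
  then have "t \<in> S" by (auto simp: S_def)
  have "(\<lambda>n. B (s n) t) \<longlonglongrightarrow> (LBINT x. w x * t x)"
   unfolding B_def by (rule L2_tendsto_integral_mult[OF L2S[OF s] w(1) L2S[OF \<open>t \<in> S\<close>] w(2)])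
  with lim[OF \<open>t \<in> S\<close>] show "(LBINT x. w x * t x) = l t" using LIMSEQ_unique by blast
 qed
qed

lemma L2_imp_loc_integrable:
 fixes f :: "real^'n => real"
 assumes f: "L2loc Om f" and K: "compact K" "K \<subseteq> Om"
 shows "integrable lborel (\<lambda>x. indicator K x * f x)"
proof -
 have "L2 lborel (indicator K :: real^'n => real)"
  using L2loc_L2[OF L2loc_continuous[of "\<lambda>x. 1"] K] by simp
 from L2_integrable_mult[OF L2loc_L2[OF f K] this] show ?thesis
  by (rule Bochner_Integration.integrable_cong[THEN iffD1, rotated 2]) (auto simp: indicator_def)
qed

lemma fundamental_lemma_L2loc:
 assumes "open Om" "L2loc Om f" "L2loc Om h"
  and "\<And>\<phi> D\<phi>. test_fn Om \<phi> D\<phi> ==> (LBINT x. f x * \<phi> x) = (LBINT x. h x * \<phi> x)"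
 shows "AE x in lborel. x \<in> Om \<longrightarrow> f x = h x"
proof -
 have d: "L2loc Om (\<lambda>x. f x - h x)" by (rule L2loc_diff[OF assms(2,3)])
 have "AE x in lborel. x \<in> Om \<longrightarrow> f x - h x = 0"
 proof (rule fundamental_lemma[OF assms(1) L2loc_measurable[OF d] L2_imp_loc_integrable[OF d]])
  fix \<phi> D\<phi> assume t: "test_fn Om \<phi> D\<phi>"
  show "(LBINT x. (f x - h x) * \<phi> x) = 0"
   using cc_integrable_mult[OF assms(2) test_fn_cc(1)[OF t]] cc_integrable_mult[OF assms(3) test_fn_cc(1)[OF t]] assms(4)[OF t]
   by (simp add: left_diff_distrib right_diff_distrib mult.commute)
 qed auto
 then show ?thesis by simp
qed

lemma weak_pderiv_unique:
 assumes "open Om" "weak_pderiv Om u k v" "weak_pderiv Om u k v'" "L2loc Om v" "L2loc Om v'"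
 shows "AE x in lborel. x \<in> Om \<longrightarrow> v x = v' x"
 by (rule fundamental_lemma_L2loc[OF assms(1,4,5)]) (use weak_pderivD(3)[OF assms(2)] weak_pderivD(3)[OF assms(3)] in force)

text \<open>Apply \<open>riesz_L2\<close> to pairing with \<open>f\<close> itself: the representing
  function is a limit of test functions, and by the fundamental lemma it coincides with
  \<open>f\<close>.\<close>

lemma test_fn_dense_L2:
 fixes f :: "real^'n => real"
 assumes f: "L2 lborel f"
 obtains s Ds where "\<And>n::nat. test_fn UNIV (s n) (Ds n)" "(\<lambda>n. \<integral>x. (s n x - f x)\<^sup>2 \<partial>lborel) \<longlonglongrightarrow> 0"
proof -
 have tL2: "L2 lborel t" if "test_fn UNIV t Dt" for t :: "real^'n => real" and Dt
  using that cc_L2 test_fn_cc(1) by blast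
 obtain w s Ds where w: "L2 lborel w" "\<And>t Dt. test_fn UNIV t Dt ==> (LBINT x. w x * t x) = (LBINT x. f x * t x)"
  "\<And>n::nat. test_fn UNIV (s n) (Ds n)" "(\<lambda>n. \<integral>x. (s n x - w x)\<^sup>2 \<partial>lborel) \<longlonglongrightarrow> 0"
 proof (rule riesz_L2[of UNIV "\<lambda>t. \<integral>x. f x * t x \<partial>lborel" "\<integral>x. (f x)\<^sup>2 \<partial>lborel"])
  fix s t :: "real^'n => real" and Ds Dt a b assume "test_fn UNIV s Ds" "test_fn UNIV t Dt"
  then have "integrable lborel (\<lambda>x. f x * s x)" "integrable lborel (\<lambda>x. f x * t x)"
   using L2_integrable_mult[OF f tL2] by blast+
  then show "(LBINT x. f x * (a * s x + b * t x)) = a * (LBINT x. f x * s x) + b * (LBINT x. f x * t x)"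
   by (simp add: distrib_left mult.left_commute)
 next
  fix s :: "real^'n => real" and Ds assume "test_fn UNIV s Ds"
  then show "(LBINT x. f x * s x)\<^sup>2 \<le> (LBINT x. (f x)\<^sup>2) * (LBINT x. (s x)\<^sup>2)"
   using Cauchy_Schwarz_L2[OF f tL2] by blast
 qed blast
 have "AE x in lborel. x \<in> UNIV \<longrightarrow> w x = f x"
  by (rule fundamental_lemma_L2loc[OF open_UNIV L2_L2loc[OF w(1)] L2_L2loc[OF f] w(2)])
 then have "(LBINT x. (s n x - w x)\<^sup>2) = (LBINT x. (s n x - f x)\<^sup>2)" for n
  using L2_measurable[OF w(1)] L2_measurable[OF f] L2_measurable[OF tL2[OF w(3)[of n]]] by (intro integral_cong_AE) auto
 with w(4) show thesis by (intro that[OF w(3)]) simp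
qed

section \<open>Mollification\<close>

definition conv :: "(real^'n => real) => (real^'n => real) => real^'n => real" where
 "conv kp v x = (LBINT y. v y * kp (x - y))"

lemma cc_reflect:
 fixes kp :: "real^'n => real"
 assumes "cc UNIV kp" shows "cc UNIV (\<lambda>y. kp (x - y))"
proof -
 obtain K where K: "compact K" "\<forall>y. y \<notin> K \<longrightarrow> kp y = 0" and c: "continuous_on UNIV kp" using assms by (auto simp: cc_def)
 show ?thesis
 proof (rule ccI[of _ "(\<lambda>z. x - z) ` K"])
  show "continuous_on UNIV (\<lambda>y. kp (x - y))" by (rule continuous_on_compose2[OF c, of UNIV "\<lambda>y. x - y"]) (intro continuous_intros, simp)
  show "compact ((\<lambda>z. x - z) ` K)" by (intro compact_continuous_image continuous_intros K)
  fix y assume y: "y \<notin> (\<lambda>z. x - z) ` K"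
  have "x - y \<notin> K"
  proof
   assume "x - y \<in> K"
   then have "x - (x - y) \<in> (\<lambda>z. x - z) ` K" by (rule imageI)
   with y show False by simp
  qed
  then show "kp (x - y) = 0" using K by simp
 qed auto
qed

lemma test_fn_reflect:
 fixes kp :: "real^'n => real"
 assumes t: "test_fn UNIV kp Dkp" shows "test_fn UNIV (\<lambda>y. kp (x - y)) (\<lambda>y. - Dkp (x - y))"
proof -
 obtain K where K: "compact K" "\<And>y. y \<notin> K ==> kp (x - y) = 0"
  using cc_reflect[OF test_fn_cc(1)[OF t], of x] by (auto simp: cc_def)
 show ?thesis
 proof (rule test_fnI[OF _ K(1)])
  show "C1 (\<lambda>y. kp (x - y)) (\<lambda>y. - Dkp (x - y))"
   unfolding C1_def
  proof (intro conjI allI)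
   fix y
   have "((\<lambda>y. kp (x - y)) has_derivative (\<lambda>v. Dkp (x - y) \<bullet> (- v))) (at y)"
    by (rule has_derivative_compose[of "\<lambda>y. x - y" "\<lambda>v. - v"])
      (use t in \<open>auto simp: test_fn_def intro!: derivative_eq_intros\<close>)
   then show "((\<lambda>y. kp (x - y)) has_derivative (\<lambda>v. - Dkp (x - y) \<bullet> v)) (at y)" by simp
   show "continuous_on UNIV (\<lambda>y. - Dkp (x - y))"
   proof -
    have c: "continuous_on UNIV Dkp" using t by (simp add: test_fn_def)
    have "continuous_on UNIV (\<lambda>y. Dkp (x - y))"
     by (rule continuous_on_compose2[OF c, of UNIV "\<lambda>y. x - y"]) (intro continuous_intros, simp)
    then show ?thesis by (rule continuous_on_minus)
   qed
  qed
 qed (use K in auto)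
qed

lemma conv_integrable:
 assumes v: "integrable lborel v" and c: "cc UNIV kp"
 shows "integrable lborel (\<lambda>y. v y * kp (x - y))"
proof -
 obtain C where C: "\<And>x. \<bar>kp x\<bar> \<le> C" using cc_bounded[OF c] by metis
 show ?thesis
 proof (rule Bochner_Integration.integrable_bound)
  show "integrable lborel (\<lambda>y. C * v y)" using v by simp
  show "(\<lambda>y. v y * kp (x - y)) \<in> borel_measurable lborel"
   using v cc_measurable[OF cc_reflect[OF c, of x]] by simp
  show "AE y in lborel. norm (v y * kp (x - y)) \<le> norm (C * v y)"
  proof (rule AE_I2)
   fix y
   have "\<bar>kp (x - y)\<bar> \<le> \<bar>C\<bar>" using C[of "x - y"] by linarith
   from mult_left_mono[OF this, of "\<bar>v y\<bar>"] show "norm (v y * kp (x - y)) \<le> norm (C * v y)"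
    by (simp add: abs_mult mult.commute)
  qed
 qed
qed

lemma conv_continuous:
 fixes v :: "real^'n => real"
 assumes v: "integrable lborel v" and c: "cc UNIV kp"
 shows "continuous_on UNIV (conv kp v)"
proof -
 obtain K where K: "compact K" "\<And>y. y \<notin> K ==> kp y = 0" and cc: "continuous_on UNIV kp" using c by (auto simp: cc_def)
 define I where "I = (LBINT y. \<bar>v y\<bar>)"
 have I: "I \<ge> 0" by (simp add: I_def)
 show ?thesis
  unfolding continuous_on_iff
 proof (intro ballI allI impI)
  fix x :: "real^'n" and e :: real assume e: "e > 0"
  obtain d where d: "d > 0" "\<And>x y. dist x y < d ==> dist (kp x) (kp y) < e / (I + 1)"
   using compact_support_uniformly_continuous[OF cc K, of "e / (I + 1)"] e I by auto
  have "dist (conv kp v x') (conv kp v x) < e" if xx: "dist x' x < d" for x'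
  proof -
   have "conv kp v x' - conv kp v x = (LBINT y. v y * (kp (x' - y) - kp (x - y)))"
    unfolding conv_def using conv_integrable[OF v c, of x'] conv_integrable[OF v c, of x] by (simp add: right_diff_distrib)
   moreover have "\<bar>\<dots>\<bar> \<le> (LBINT y. e / (I + 1) * \<bar>v y\<bar>)"
   proof (rule integral_abs_le)
    show "integrable lborel (\<lambda>y. v y * (kp (x' - y) - kp (x - y)))"
     using conv_integrable[OF v c, of x'] conv_integrable[OF v c, of x] by (simp add: right_diff_distrib)
    show "\<bar>v y * (kp (x' - y) - kp (x - y))\<bar> \<le> e / (I + 1) * \<bar>v y\<bar>" for y
     using d(2)[of "x' - y" "x - y"] xx mult_left_mono[of "\<bar>kp (x' - y) - kp (x - y)\<bar>" "e / (I+1)" "\<bar>v y\<bar>"]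
     by (simp add: dist_norm abs_mult mult.commute)
   qed (use v in simp)
   moreover have "(LBINT y. e / (I + 1) * \<bar>v y\<bar>) = e / (I + 1) * I" by (simp add: I_def)
   moreover have "\<dots> < e" using e I by (simp add: field_simps)
   ultimately show ?thesis unfolding dist_norm real_norm_def by linarith
  qed
  then show "\<exists>d>0. \<forall>x'\<in>UNIV. dist x' x < d \<longrightarrow> dist (conv kp v x') (conv kp v x) < e" using d(1) by blast
 qed
qed

lemma conv_C1:
 fixes v :: "real^'n => real"
 assumes v: "integrable lborel v" and t: "test_fn UNIV kp Dkp"
 shows "C1 (conv kp v) (\<lambda>x. \<chi> k. conv (\<lambda>z. Dkp z $ k) v x)"
proof -
 note c = test_fn_cc[OF t]
 define I where "I = (LBINT y. \<bar>v y\<bar>)"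
 have I: "I \<ge> 0" by (simp add: I_def)
 define DF where "DF x = (\<chi> k. conv (\<lambda>z. Dkp z $ k) v x)" for x
 have DFi: "DF x \<bullet> h = (LBINT y. v y * (Dkp (x - y) \<bullet> h))" and
   DFint: "integrable lborel (\<lambda>y. v y * (Dkp (x - y) \<bullet> h))" for x h
 proof -
  have i: "integrable lborel (\<lambda>y. v y * Dkp (x - y) $ k * h $ k)" for k
   using conv_integrable[OF v c(2), of x k] by simp
  have eq: "v y * (Dkp (x - y) \<bullet> h) = (\<Oplus>k. v y * Dkp (x - y) $ k * h $ k)" for y
   by (simp add: inner_vec_def sum_distrib_left mult.assoc)
  show "integrable lborel (\<lambda>y. v y * (Dkp (x - y) \<bullet> h))" unfolding eq using i by simp
  have "(LBINT y. v y * (Dkp (x - y) \<bullet> h)) = (\<Oplus>k. \<integral>y. v y * Dkp (x - y) $ k * h $ k \<partial>lborel)"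
   unfolding eq by (rule Bochner_Integration.integral_sum[OF i])
  also have "\<dots> = DF x \<bullet> h" by (simp add: DF_def inner_vec_def conv_def)
  finally show "DF x \<bullet> h = (LBINT y. v y * (Dkp (x - y) \<bullet> h))" by simp
 qed
 have "(conv kp v has_derivative (\<lambda>h. DF x \<bullet> h)) (at x)" for x
  unfolding has_derivative_at_alt
 proof (intro conjI allI impI)
  show "bounded_linear ((\<bullet>) (DF x))" by (rule bounded_linear_inner_right)
  fix e :: real assume e: "e > 0"
  obtain d where d: "d > 0" "\<And>x h. norm h < d ==> \<bar>kp (x + h) - kp x - Dkp x \<bullet> h\<bar> \<le> e / (I+1) * norm h"
   using test_fn_uniform_derivative[OF t, of "e / (I+1)"] e I by auto
  have "norm (conv kp v x' - conv kp v x - DF x \<bullet> (x' - x)) \<le> e * norm (x' - x)" if xx: "norm (x' - x) < d" for x'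
  proof -
   define h where "h = x' - x"
   note i = conv_integrable[OF v c(1), of x'] conv_integrable[OF v c(1), of x] DFint[of x h]
   have "conv kp v x' - conv kp v x - DF x \<bullet> h = (LBINT y. v y * (kp (x' - y) - kp (x - y) - Dkp (x - y) \<bullet> h))"
    unfolding conv_def DFi using i by (simp add: right_diff_distrib)
   moreover have "\<bar>\<dots>\<bar> \<le> (LBINT y. e / (I + 1) * norm h * \<bar>v y\<bar>)"
   proof (rule integral_abs_le)
    show "integrable lborel (\<lambda>y. v y * (kp (x' - y) - kp (x - y) - Dkp (x - y) \<bullet> h))"
     using i by (simp add: right_diff_distrib)
    show "\<bar>v y * (kp (x' - y) - kp (x - y) - Dkp (x - y) \<bullet> h)\<bar> \<le> e / (I + 1) * norm h * \<bar>v y\<bar>" for y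
    proof -
     have "x - y + h = x' - y" by (simp add: h_def)
     then have "\<bar>kp (x' - y) - kp (x - y) - Dkp (x - y) \<bullet> h\<bar> \<le> e / (I+1) * norm h"
      using d(2)[of h "x - y"] xx by (simp add: h_def)
     from mult_left_mono[OF this, of "\<bar>v y\<bar>"] show ?thesis by (simp add: abs_mult mult.commute)
    qed
   qed (use v in simp)
   moreover have "(LBINT y. e / (I + 1) * norm h * \<bar>v y\<bar>) = (e / (I + 1) * I) * norm h" by (simp add: I_def)
   moreover have "\<dots> \<le> e * norm h" using e I by (intro mult_right_mono) (auto simp: field_simps)
   ultimately show ?thesis unfolding real_norm_def h_def by linarith
  qed
  then show "\<exists>d>0. \<forall>y. norm (y - x) < d \<longrightarrow> norm (conv kp v y - conv kp v x - DF x \<bullet> (y - x)) \<le> e * norm (y - x)"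
   using d(1) by blast
 qed
 moreover have "continuous_on UNIV DF"
  unfolding DF_def by (intro continuous_on_vec_lambda conv_continuous[OF v c(2)])
 ultimately show ?thesis unfolding C1_def DF_def by simp
qed

lemma conv_zero_outside:
 assumes v: "\<And>x. x \<notin> K ==> v x = 0" and k: "\<And>z. norm z > d ==> kp z = 0" and x: "x \<notin> (\<Union>y\<in>K. cball y d)"
 shows "conv kp v x = 0"
proof -
 have "v y * kp (x - y) = 0" for y
  using v[of y] k[of "x - y"] x by (cases "y \<in> K") (auto simp: dist_norm norm_minus_commute)
 then show ?thesis unfolding conv_def by (simp only: integral_zero)
qed

text \<open>Symmetry of the Hessian is part of the definition. Mollified functions inherit it from
  the explicit kernel, and all later statements about commuting mixed derivatives are traced back to
  it.\<close>

definition test2 :: "(real^'n) set => (real^'n => real) => (real^'n => real^'n) => (real^'n => real^'n^'n) => bool" where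
 "test2 Om z Dz D2z \<longleftrightarrow> test_fn Om z Dz \<and> (\<forall>k. test_fn Om (\<lambda>x. Dz x $ k) (\<lambda>x. D2z x $ k)) \<and>
   (\<forall>x i j. D2z x $ i $ j = D2z x $ j $ i)"

definition kern :: "real => (real^'n => real) => bool" where
 "kern d kp \<longleftrightarrow> cc UNIV kp \<and> (\<forall>z. kp z \<ge> 0) \<and> (LBINT z. kp z) = 1 \<and> (\<forall>z. norm z > d \<longrightarrow> kp z = 0)"

text \<open>The kernel is a multiple of \<open>max 0 (d\<^sup>2 - |x|\<^sup>2) ^ 3\<close>, which is of class \<open>C\<^sup>2\<close>.\<close>
lemma kernel_exists:
 fixes d :: real
 assumes d: "d > 0"
 obtains kp :: "real^'n => real" and Dkp D2kp where "kern d kp" "test2 UNIV kp Dkp D2kp"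
  "\<And>z. norm z > d ==> Dkp z = 0" "\<And>z. norm z > d ==> D2kp z = 0"
proof -
 define m :: "real^'n => real" where "m x = max 0 (d\<^sup>2 - x \<bullet> x)" for x
 have q: "C1 (\<lambda>x::real^'n. d\<^sup>2 - x \<bullet> x) (\<lambda>x. - 2 *\<^sub>R x)"
  unfolding C1_def
  by (auto intro!: derivative_eq_intros continuous_intros simp: inner_commute)
 have mc: "continuous_on UNIV m"
  unfolding m_def by (intro continuous_intros)
 have m0: "m x = 0" if "norm x > d" for x
 proof -
  have "d\<^sup>2 < (norm x)\<^sup>2" using that d by (intro power_strict_mono) auto
  then show ?thesis by (simp add: m_def power2_norm_eq_inner)
 qed
 have C3: "C1 (\<lambda>x. (m x)^3) (\<lambda>x. (3 * (m x)^2) *\<^sub>R (- 2 *\<^sub>R x))"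
  unfolding m_def using DERIV_max0_power[of 3]
  by (intro C1_compose[OF q, of "\<lambda>t. (max 0 t)^3" "\<lambda>t. 3 * (max 0 t)^2"]) (auto intro!: continuous_intros)
 have C2: "C1 (\<lambda>x. (m x)^2) (\<lambda>x. (2 * m x) *\<^sub>R (- 2 *\<^sub>R x))"
  unfolding m_def using DERIV_max0_power[of 2]
  by (intro C1_compose[OF q, of "\<lambda>t. (max 0 t)^2" "\<lambda>t. 2 * max 0 t"]) (auto intro!: continuous_intros)
 have C2k: "C1 (\<lambda>x. (m x)^2 * (- 6 * x $ k)) (\<lambda>x. (m x)^2 *\<^sub>R (- 6 *\<^sub>R axis k 1) + (- 6 * x $ k) *\<^sub>R ((2 * m x) *\<^sub>R (- 2 *\<^sub>R x)))" for k
  by (intro C1_mult C2 C1_cmult C1_coord)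
 have K: "compact (cball (0::real^'n) d)" "x \<notin> cball (0::real^'n) d ==> m x = 0" for x
  using m0 by auto
 have t3: "test_fn UNIV (\<lambda>x. (m x)^3) (\<lambda>x. (3 * (m x)^2) *\<^sub>R (- 2 *\<^sub>R x))"
  by (rule test_fnI[OF C3 K(1)]) (use K(2) in auto)
 have t2: "test_fn UNIV (\<lambda>x. (m x)^2 * (- 6 * x $ k)) (\<lambda>x. (m x)^2 *\<^sub>R (- 6 *\<^sub>R axis k 1) + (- 6 * x $ k) *\<^sub>R ((2 * m x) *\<^sub>R (- 2 *\<^sub>R x)))" for k
  by (rule test_fnI[OF C2k K(1)]) (use K(2) in auto)
 define I where "I = (LBINT x. (m x)^3)"
 have int: "integrable lborel (\<lambda>x. (m x)^3)" using cc_integrable[OF test_fn_cc(1)[OF t3]] .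
 have I: "I > 0"
 proof -
  have "I \<noteq> 0"
  proof
   assume "I = 0"
   then have "AE x in lborel. (m x)^3 = 0"
    unfolding I_def using int by (subst (asm) integral_nonneg_eq_0_iff_AE) (auto simp: m_def)
   then have "AE x in lborel. m x = 0" by simp
   then have "m 0 = 0"
   proof -
    have "closed {x. m x = 0}" using mc by (intro closed_Collect_eq) (auto intro!: continuous_intros)
    from mem_closed_if_AE_lebesgue[OF this, of 0] AE_completion[OF \<open>AE x in lborel. m x = 0\<close>]
    show ?thesis by simp
   qed
   then show False using d by (simp add: m_def)
  qed
  moreover have "I \<ge> 0" unfolding I_def by (intro integral_nonneg_AE) (auto simp: m_def)
  ultimately show ?thesis by simp
 qed
 define kp where "kp x = (1 / I) * (m x)^3" for x
 define Dkp where "Dkp x = (1 / I) *\<^sub>R ((3 * (m x)^2) *\<^sub>R (- 2 *\<^sub>R x))" for x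
 define D2kp where "D2kp x = (\<chi> k. (1 / I) *\<^sub>R ((m x)^2 *\<^sub>R (- 6 *\<^sub>R axis k 1) + (- 6 * x $ k) *\<^sub>R ((2 * m x) *\<^sub>R (- 2 *\<^sub>R x))))" for x
 have z: "kp x = 0" "Dkp x = 0" "D2kp x = 0" if "norm x > d" for x
  using m0[OF that] by (auto simp: kp_def Dkp_def D2kp_def vec_eq_iff)
 have Ckp: "C1 kp Dkp" unfolding kp_def Dkp_def by (intro C1_cmult C3)
 have tk: "test_fn UNIV kp Dkp"
  by (rule test_fnI[OF Ckp K(1)]) (use z(1) in auto)
 show thesis
 proof (rule that[of kp Dkp D2kp])
  show "kern d kp"
   unfolding kern_def
  proof (intro conjI allI impI)
   show "cc UNIV kp" by (rule test_fn_cc(1)[OF tk])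
   show "kp x \<ge> 0" for x using I by (auto simp: kp_def m_def)
   show "(LBINT x. kp x) = 1" using I by (simp add: kp_def I_def)
  qed (rule z)
  show "test2 UNIV kp Dkp D2kp"
   unfolding test2_def
  proof (intro conjI allI)
   show "test_fn UNIV kp Dkp" by (rule tk)
   fix k
   have e: "Dkp x $ k = (1 / I) * ((m x)^2 * (- 6 * x $ k))" for x by (simp add: Dkp_def)
   show "test_fn UNIV (\<lambda>x. Dkp x $ k) (\<lambda>x. D2kp x $ k)"
   proof (rule test_fnI[OF _ K(1)])
    show "C1 (\<lambda>x. Dkp x $ k) (\<lambda>x. D2kp x $ k)"
     unfolding e D2kp_def vec_lambda_beta by (intro C1_cmult C2k)
   qed (use z(2) in auto)
  next
   show "D2kp x $ i $ j = D2kp x $ j $ i" for x i j by (simp add: D2kp_def axis_def)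
  qed
 qed (use z in auto)
qed

lemma conv_test2:
 assumes t: "test2 UNIV kp Dkp D2kp" and z: "\<And>z. norm z > d ==> kp z = 0" "\<And>z. norm z > d ==> Dkp z = 0"
  and v: "integrable lborel v" and K: "\<And>x. x \<notin> K ==> v x = 0" and K': "compact K'" "K' \<subseteq> Om" "(\<Union>y\<in>K. cball y d) \<subseteq> K'"
 shows "test2 Om (conv kp v) (\<lambda>x. \<chi> k. conv (\<lambda>z. Dkp z $ k) v x) (\<lambda>x. \<chi> k. \<chi> j. conv (\<lambda>z. D2kp z $ k $ j) v x)"
 unfolding test2_def
proof (intro conjI allI)
 show "test_fn Om (conv kp v) (\<lambda>x. \<chi> k. conv (\<lambda>z. Dkp z $ k) v x)"
 proof (rule test_fnI[OF _ K'(1,2)])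
  show "C1 (conv kp v) (\<lambda>x. \<chi> k. conv (\<lambda>z. Dkp z $ k) v x)"
   using t by (intro conv_C1[OF v]) (simp add: test2_def)
  show "conv kp v x = 0" if "x \<notin> K'" for x
   by (rule conv_zero_outside[OF K z(1)]) (use that K'(3) in blast)+
 qed
 fix k
 show "test_fn Om (\<lambda>x. (\<chi> k. conv (\<lambda>z. Dkp z $ k) v x) $ k) (\<lambda>x. (\<chi> k. \<chi> j. conv (\<lambda>z. D2kp z $ k $ j) v x) $ k)"
  unfolding vec_lambda_beta
 proof (rule test_fnI[OF _ K'(1,2)])
  show "C1 (conv (\<lambda>z. Dkp z $ k) v) (\<lambda>x. \<chi> j. conv (\<lambda>z. D2kp z $ k $ j) v x)"
   using t by (intro conv_C1[OF v, of "\<lambda>z. Dkp z $ k" "\<lambda>z. D2kp z $ k"]) (simp add: test2_def)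
  show "conv (\<lambda>z. Dkp z $ k) v x = 0" if "x \<notin> K'" for x
  proof (rule conv_zero_outside[OF K, where d=d])
   show "x \<notin> (\<Union>y\<in>K. cball y d)" using that K'(3) by blast
   show "Dkp y $ k = 0" if "norm y > d" for y using z(2)[OF that] by simp
  qed
 qed
next
 show "(\<chi> k. \<chi> j. conv (\<lambda>z. D2kp z $ k $ j) v x) $ i $ j = (\<chi> k. \<chi> j. conv (\<lambda>z. D2kp z $ k $ j) v x) $ j $ i" for x i j
  using t by (simp add: test2_def)
qed

text \<open>The reflected kernel serves as test function; the minus sign of the reflection cancels
  the one in the definition of a weak derivative.\<close>

lemma conv_weak_pderiv:
 assumes t: "test_fn UNIV kp Dkp" and w: "weak_pderiv UNIV v k v'"
 shows "conv (\<lambda>z. Dkp z $ k) v x = conv kp v' x"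
 using weak_pderivD(3)[OF w test_fn_reflect[OF t, of x]] by (simp add: conv_def)

text \<open>Cauchy-Schwarz with respect to the probability density
  \<open>y \<mapsto> kp (x - y)\<close> bounds the square of the mean by the mean of the square;
  Tonelli and the unit mass of the kernel in the variable \<open>x\<close> do the rest.\<close>

lemma young_L2:
 fixes v :: "real^'n => real"
 assumes k: "kern d kp" and v: "L2 lborel v" "integrable lborel v"
 shows "L2 lborel (conv kp v)" "(LBINT x. (conv kp v x)\<^sup>2) \<le> (LBINT x. (v x)\<^sup>2)"
proof -
 have c: "cc UNIV kp" and k0: "\<And>z. kp z \<ge> 0" and k1: "(LBINT z. kp z) = 1" using k by (auto simp: kern_def)
 have [measurable]: "kp \<in> borel_measurable borel" using cc_measurable[OF c] .
 have [measurable]: "v \<in> borel_measurable borel" using v by (simp add: L2_def)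
 have cm: "conv kp v \<in> borel_measurable borel"
  using conv_continuous[OF v(2) c] by (rule borel_measurable_continuous_onI)
 have ki: "integrable lborel kp" using cc_integrable[OF c] .
 have kx: "(\<integral>\<^sup>+x. ennreal (kp (x - y)) \<partial>lborel) = 1" for y
 proof -
  have "(\<integral>\<^sup>+x. ennreal (kp (x - y)) \<partial>lborel) = (\<integral>\<^sup>+x. ennreal (kp x) \<partial>distr lborel borel ((+) (- y)))"
   by (subst nn_integral_distr) auto
  also have "\<dots> = (\<integral>\<^sup>+x. ennreal (kp x) \<partial>lborel)" by (simp only: lborel_distr_plus)
  also have "\<dots> = 1" using ki k0 k1 by (subst nn_integral_eq_integral) auto
  finally show ?thesis .
 qed
 have ky: "(LBINT y. kp (x - y)) = 1" for x
 proof -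
  \<comment> \<open>Reflection invariance of Lebesgue measure: the affine substitution with factor
    -1 has Jacobian 1.\<close>
  have "(LBINT y. kp (x - y)) = (LBINT y. kp (x - (x + -1 *\<^sub>R y)))"
  proof -
   have "lborel = density (distr lborel borel (\<lambda>y::real^'n. x + (-1) *\<^sub>R y)) (\<lambda>_. \<bar>-1::real\<bar>^DIM(real^'n))"
    by (rule lborel_affine) simp
   then have e: "lborel = distr lborel borel (\<lambda>y::real^'n. x + (-1) *\<^sub>R y)" by (simp add: density_1)
   have "(\<integral>y. kp (x - y) \<partial>distr lborel borel (\<lambda>y::real^'n. x + (-1) *\<^sub>R y)) = (LBINT y. kp (x - (x + -1 *\<^sub>R y)))"
    by (rule integral_distr) auto
   then show ?thesis using e by simp
  qed
  then show ?thesis using k1 by simp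
 qed
 have sq: "(conv kp v x)\<^sup>2 \<le> (LBINT y. (v y)\<^sup>2 * kp (x - y))" and i2: "integrable lborel (\<lambda>y. (v y)\<^sup>2 * kp (x - y))" for x
 proof -
  show i: "integrable lborel (\<lambda>y. (v y)\<^sup>2 * kp (x - y))"
   using conv_integrable[OF _ c, of "\<lambda>y. (v y)\<^sup>2"] v by (simp add: L2_def)
  have ri: "integrable lborel (\<lambda>y. kp (x - y))" using cc_integrable[OF cc_reflect[OF c]] .
  have "L2 lborel (\<lambda>y. v y * sqrt (kp (x - y)))" "L2 lborel (\<lambda>y. sqrt (kp (x - y)))"
   using i ri k0 by (auto simp: L2_def power_mult_distrib)
  from Cauchy_Schwarz_L2[OF this] show "(conv kp v x)\<^sup>2 \<le> (LBINT y. (v y)\<^sup>2 * kp (x - y))"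
   using k0 ky by (simp add: conv_def power_mult_distrib mult.assoc)
 qed
 have nn: "(\<integral>\<^sup>+x. ennreal ((conv kp v x)\<^sup>2) \<partial>lborel) \<le> ennreal (LBINT x. (v x)\<^sup>2)"
 proof -
  have "(\<integral>\<^sup>+x. ennreal ((conv kp v x)\<^sup>2) \<partial>lborel) \<le> (\<integral>\<^sup>+x. \<integral>\<^sup>+y. ennreal ((v y)\<^sup>2 * kp (x - y)) \<partial>lborel \<partial>lborel)"
   using sq i2 k0 by (intro nn_integral_mono) (subst nn_integral_eq_integral, auto intro!: ennreal_leI)
  also have "\<dots> = (\<integral>\<^sup>+y. \<integral>\<^sup>+x. ennreal ((v y)\<^sup>2 * kp (x - y)) \<partial>lborel \<partial>lborel)"
   by (rule lborel_pair.Fubini') measurable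
  also have "\<dots> = (\<integral>\<^sup>+y. ennreal ((v y)\<^sup>2) \<partial>lborel)"
   using kx k0 by (intro nn_integral_cong) (simp add: ennreal_mult nn_integral_cmult)
  also have "\<dots> = ennreal (LBINT x. (v x)\<^sup>2)"
   using v by (subst nn_integral_eq_integral) (auto simp: L2_def)
  finally show ?thesis .
 qed
 show L: "L2 lborel (conv kp v)"
  unfolding L2_def
 proof
  show "integrable lborel (\<lambda>x. (conv kp v x)\<^sup>2)"
   by (rule integrableI_bounded) (use cm nn in \<open>auto intro: le_less_trans\<close>)
 qed (use cm in simp)
 show "(LBINT x. (conv kp v x)\<^sup>2) \<le> (LBINT x. (v x)\<^sup>2)"
  using nn L by (subst (asm) nn_integral_eq_integral) (auto simp: L2_def)
qed

lemma conv_diff: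
 assumes "integrable lborel v" "integrable lborel w" "cc UNIV kp"
 shows "conv kp (\<lambda>x. v x - w x) x = conv kp v x - conv kp w x"
 unfolding conv_def using conv_integrable[OF assms(1,3)] conv_integrable[OF assms(2,3)]
 by (simp add: left_diff_distrib)

lemma L2_compact_support_integrable:
 fixes v :: "real^'n => real"
 assumes v: "L2 lborel v" and K: "compact K" "\<And>x. x \<notin> K ==> v x = 0"
 shows "integrable lborel v"
proof -
 have "integrable lborel (\<lambda>x. indicator K x * v x)"
  by (rule L2_imp_loc_integrable[OF L2_L2loc[OF v] K(1), of UNIV]) auto
 moreover have "(\<lambda>x. indicator K x * v x) = v" using K(2) by (auto simp: indicator_def fun_eq_iff)
 ultimately show ?thesis by simp
qed

text \<open>Uniform continuity makes the difference uniformly small, and it lives in one fixed ball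
  of finite measure.\<close>

lemma mollify_test_fn_tendsto:
 fixes \<phi> :: "real^'n => real"
 assumes t: "test_fn UNIV \<phi> D\<phi>" and k: "\<And>n. kern (d n) (kp n)" and d: "d \<longlonglongrightarrow> 0"
 shows "(\<lambda>n. \<integral>x. (conv (kp n) \<phi> x - \<phi> x)\<^sup>2 \<partial>lborel) \<longlonglongrightarrow> 0"
proof -
 obtain K where K: "compact K" "\<And>x. x \<notin> K ==> \<phi> x = 0" using test_fn_zero_outside[OF t] by metis
 obtain R where R: "K \<subseteq> cball 0 R" using compact_imp_bounded[OF K(1)] by (auto simp: bounded_iff subset_iff)
 define V where "V = measure lborel (cball (0::real^'n) (R+1))"
 have V0: "V \<ge> 0" by (simp add: V_def)
 have V: "integrable lborel (indicator (cball (0::real^'n) (R+1)) :: _ => real)"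
  "(LBINT x. indicator (cball (0::real^'n) (R+1)) x) = V"
  using emeasure_lborel_cball_finite[of "0::real^'n" "R+1"] by (auto simp: V_def)
 have \<phi>c: "continuous_on UNIV \<phi>" "cc UNIV \<phi>" using test_fn_cc(1)[OF t] by (auto simp: cc_def)
 have \<phi>i: "integrable lborel \<phi>" using cc_integrable[OF \<phi>c(2)] .
 show ?thesis
 proof (rule LIMSEQ_I)
  fix e :: real assume e: "e > 0"
  \<comment> \<open>Integrating the uniform bound \<open>q\<^sup>2\<close> over a ball of measure
    \<open>V\<close> must stay strictly below \<open>e\<close>; the added 1 avoids division by
    zero.\<close>
  define q where "q = sqrt (e / (V + 1))"
  have q: "q > 0" "q\<^sup>2 = e / (V + 1)" using e V0 by (auto simp: q_def)
  obtain r where r: "r > 0" "\<And>x y. dist x y < r ==> dist (\<phi> x) (\<phi> y) < q"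
   using compact_support_uniformly_continuous[OF \<phi>c(1) K q(1)] by metis
  obtain N where N: "\<And>n. n \<ge> N ==> \<bar>d n\<bar> < min r 1"
   using LIMSEQ_D[OF d, of "min r 1"] r by auto
  have "norm ((LBINT x. (conv (kp n) \<phi> x - \<phi> x)\<^sup>2) - 0) < e" if n: "n \<ge> N" for n
  proof -
   note kn = k[of n, unfolded kern_def]
   have kc: "cc UNIV (kp n)" using kn by simp
   have ri: "integrable lborel (\<lambda>y. kp n (x - y))" for x using cc_integrable[OF cc_reflect[OF kc]] .
   have k1: "(LBINT y. kp n (x - y)) = 1" for x
   proof -
    have "lborel = density (distr lborel borel (\<lambda>y::real^'n. x + (-1) *\<^sub>R y)) (\<lambda>_. \<bar>-1::real\<bar>^DIM(real^'n))"
     by (rule lborel_affine) simp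
    then have e: "lborel = distr lborel borel (\<lambda>y::real^'n. x + (-1) *\<^sub>R y)" by (simp add: density_1)
    have "(\<integral>y. kp n (x - y) \<partial>distr lborel borel (\<lambda>y::real^'n. x + (-1) *\<^sub>R y)) = (LBINT y. kp n (x - (x + -1 *\<^sub>R y)))"
     by (rule integral_distr) (use cc_measurable[OF kc] in auto)
    then show ?thesis using e kn by simp
   qed
   have b: "\<bar>conv (kp n) \<phi> x - \<phi> x\<bar> \<le> q" for x
   proof -
    have "conv (kp n) \<phi> x - \<phi> x = (LBINT y. (\<phi> y - \<phi> x) * kp n (x - y))"
     using conv_integrable[OF \<phi>i kc, of x] ri[of x] k1[of x] by (simp add: conv_def left_diff_distrib)
    moreover have "\<bar>\<dots>\<bar> \<le> (LBINT y. q * kp n (x - y))"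
    proof (rule integral_abs_le)
     show "integrable lborel (\<lambda>y. (\<phi> y - \<phi> x) * kp n (x - y))"
      using conv_integrable[OF \<phi>i kc, of x] ri[of x] by (simp add: left_diff_distrib)
     show "\<bar>(\<phi> y - \<phi> x) * kp n (x - y)\<bar> \<le> q * kp n (x - y)" for y
     proof (cases "norm (x - y) > d n")
      case True then show ?thesis using kn by simp
     next
      case False
      then have "dist y x < r" using N[OF n] by (auto simp: dist_norm norm_minus_commute)
      then have "\<bar>\<phi> y - \<phi> x\<bar> \<le> q" using r(2) by (force simp: dist_norm)
      then show ?thesis using kn mult_right_mono[of "\<bar>\<phi> y - \<phi> x\<bar>" q "kp n (x - y)"] by (simp add: abs_mult)
     qed
    qed (use ri[of x] in simp)
    ultimately show ?thesis using k1[of x] by simp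
   qed
   have "(conv (kp n) \<phi> x - \<phi> x)\<^sup>2 \<le> q\<^sup>2 * indicator (cball 0 (R+1)) x" for x
   proof (cases "x \<in> cball 0 (R+1)")
    case True then show ?thesis using power_mono[OF b[of x], of 2] by simp
   next
    case False
    have "conv (kp n) \<phi> x = 0"
    proof (rule conv_zero_outside[of K \<phi> "d n"])
     show "x \<notin> (\<Union>y\<in>K. cball y (d n))"
     proof
      assume "x \<in> (\<Union>y\<in>K. cball y (d n))"
      then obtain y where y: "y \<in> K" "dist y x \<le> d n" by auto
      then have "norm y \<le> R" "d n \<le> 1" using R N[OF n] by auto
      then have "norm x \<le> R + 1" using y norm_triangle_sub[of x y] by (simp add: dist_norm norm_minus_commute)
      with False show False by simp
     qed
    qed (use K kn in auto)
    moreover have "\<phi> x = 0" using False R by (intro K(2)) auto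
    ultimately show ?thesis using False by simp
   qed
   then have "(LBINT x. (conv (kp n) \<phi> x - \<phi> x)\<^sup>2) \<le> (LBINT x. q\<^sup>2 * indicator (cball (0::real^'n) (R+1)) x)"
    using V young_L2(1)[OF k cc_L2[OF \<phi>c(2)] \<phi>i, of n] cc_L2[OF \<phi>c(2)]
    by (intro integral_mono L2_integrable_square L2_diff) auto
   also have "\<dots> = e / (V + 1) * V" using V q by simp
   also have "\<dots> < e" using e V0 by (simp add: field_simps)
   finally show ?thesis by simp
  qed
  then show "\<exists>no. \<forall>n\<ge>no. norm ((LBINT x. (conv (kp n) \<phi> x - \<phi> x)\<^sup>2) - 0) < e" by blast
 qed
qed

text \<open>Approximate by a test function. By \<open>young_L2\<close> mollification does not
  increase the norm of the approximation error, so only the test function has to be handled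
  directly.\<close>

lemma mollify_tendsto:
 fixes v :: "real^'n => real"
 assumes v: "L2 lborel v" "integrable lborel v" and k: "\<And>n. kern (d n) (kp n)" and d: "d \<longlonglongrightarrow> 0"
 shows "(\<lambda>n. \<integral>x. (conv (kp n) v x - v x)\<^sup>2 \<partial>lborel) \<longlonglongrightarrow> 0"
proof (rule LIMSEQ_I)
 fix e :: real assume e: "e > 0"
 obtain s Ds where s: "\<And>n::nat. test_fn UNIV (s n) (Ds n)" "(\<lambda>n. \<integral>x. (s n x - v x)\<^sup>2 \<partial>lborel) \<longlonglongrightarrow> 0"
  by (rule test_fn_dense_L2[OF v(1)]) (rule that)
 \<comment> \<open>The three squares are each weighted by 3, and 3 (1/12 + 1/6 + 1/12) = 1.\<close>
 obtain m where m: "(LBINT x. (s m x - v x)\<^sup>2) < e / 12"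
  using LIMSEQ_D[OF s(2), of "e/12"] e by auto
 define \<phi> where "\<phi> = s m"
 have t: "test_fn UNIV \<phi> (Ds m)" by (simp add: \<phi>_def s)
 have \<phi>L: "L2 lborel \<phi>" "integrable lborel \<phi>" using cc_L2 cc_integrable test_fn_cc(1)[OF t] by blast+
 obtain N where N: "\<And>n. n \<ge> N ==> (LBINT x. (conv (kp n) \<phi> x - \<phi> x)\<^sup>2) < e / 6"
  using LIMSEQ_D[OF mollify_test_fn_tendsto[OF t k d], of "e/6"] e by auto
 have "norm ((LBINT x. (conv (kp n) v x - v x)\<^sup>2) - 0) < e" if n: "n \<ge> N" for n
 proof -
  have kc: "cc UNIV (kp n)" using k by (simp add: kern_def)
  define w where "w x = v x - \<phi> x" for x
  have w: "L2 lborel w" "integrable lborel w" unfolding w_def using v \<phi>L by (auto intro: L2_diff)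
  have cw: "conv (kp n) w x = conv (kp n) v x - conv (kp n) \<phi> x" for x
   unfolding w_def by (rule conv_diff[OF v(2) \<phi>L(2) kc])
  note L = young_L2(1)[OF k v, of n] young_L2(1)[OF k w, of n] young_L2(1)[OF k \<phi>L, of n]
  have abc: "(a + b + c)\<^sup>2 \<le> 3 * a\<^sup>2 + 3 * b\<^sup>2 + 3 * c\<^sup>2" for a b c :: real
   using sum_squares_bound[of a b] sum_squares_bound[of a c] sum_squares_bound[of b c]
   by (simp add: power2_eq_square algebra_simps)
  have "(LBINT x. (conv (kp n) v x - v x)\<^sup>2)
    \<le> (LBINT x. 3 * (conv (kp n) w x)\<^sup>2 + 3 * (conv (kp n) \<phi> x - \<phi> x)\<^sup>2 + 3 * (w x)\<^sup>2)"
  proof (rule integral_mono)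
   show "integrable lborel (\<lambda>x. (conv (kp n) v x - v x)\<^sup>2)"
    by (rule L2_integrable_square[OF L2_diff[OF L(1) v(1)]])
   show "integrable lborel (\<lambda>x. 3 * (conv (kp n) w x)\<^sup>2 + 3 * (conv (kp n) \<phi> x - \<phi> x)\<^sup>2 + 3 * (w x)\<^sup>2)"
    using L2_integrable_square[OF L(2)] L2_integrable_square[OF L2_diff[OF L(3) \<phi>L(1)]] L2_integrable_square[OF w(1)] by simp
   show "(conv (kp n) v x - v x)\<^sup>2 \<le> 3 * (conv (kp n) w x)\<^sup>2 + 3 * (conv (kp n) \<phi> x - \<phi> x)\<^sup>2 + 3 * (w x)\<^sup>2" for x
    using abc[of "conv (kp n) w x" "conv (kp n) \<phi> x - \<phi> x" "- w x"] cw[of x] by (simp add: w_def power2_commute[of "\<phi> x" "v x"])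
  qed
  also have "\<dots> = 3 * (LBINT x. (conv (kp n) w x)\<^sup>2) + 3 * (LBINT x. (conv (kp n) \<phi> x - \<phi> x)\<^sup>2) + 3 * (LBINT x. (w x)\<^sup>2)"
   using L2_integrable_square[OF L(2)] L2_integrable_square[OF L2_diff[OF L(3) \<phi>L(1)]] L2_integrable_square[OF w(1)]
   by (subst Bochner_Integration.integral_add) auto
  also have "\<dots> < e"
  proof -
   have "(LBINT x. (w x)\<^sup>2) < e / 12" using m by (simp add: w_def \<phi>_def power2_commute)
   then show ?thesis using young_L2(2)[OF k w, of n] N[OF n] by linarith
  qed
  finally show ?thesis by simp
 qed
 then show "\<exists>no. \<forall>n\<ge>no. norm ((LBINT x. (conv (kp n) v x - v x)\<^sup>2) - 0) < e" by blast
qed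

section \<open>Local Sobolev functions\<close>

text \<open>The weak derivatives are carried along as explicit functions: they are determined only
  almost everywhere, and later pointwise formulas refer to one fixed choice of them.\<close>

definition W1 :: "(real^'n) set => (real^'n => real) => ('n => real^'n => real) => bool" where
 "W1 Om a Da \<longleftrightarrow> L2loc Om a \<and> (\<forall>l. L2loc Om (Da l) \<and> weak_pderiv Om a l (Da l))"

text \<open>The nonsmooth analogue of a test function: compact support inside \<open>Om\<close>,
  weak derivatives on the whole space. Identities proved for smooth test functions are extended to
  these by \<open>linear_extension\<close>.\<close>

definition Wc :: "(real^'n) set => (real^'n => real) => ('n => real^'n => real) => bool" where
 "Wc Om z Dz \<longleftrightarrow> L2 lborel z \<and> (\<forall>l. L2 lborel (Dz l) \<and> weak_pderiv UNIV z l (Dz l)) \<and>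
   (\<exists>K. compact K \<and> K \<subseteq> Om \<and> (\<forall>x. x \<notin> K \<longrightarrow> z x = 0 \<and> (\<forall>l. Dz l x = 0)))"

lemma W1_mono: "W1 B a Da ==> A \<subseteq> B ==> W1 A a Da"
 unfolding W1_def using L2loc_mono weak_pderiv_mono by blast

lemma W1_C1: "C1 f Df ==> W1 Om f (\<lambda>l x. Df x $ l)"
 unfolding W1_def using weak_pderiv_C1 L2loc_continuous C1_continuous C1_continuous_D by blast

lemma W1_add:
 assumes "W1 Om a Da" "W1 Om b Db" shows "W1 Om (\<lambda>x. a x + b x) (\<lambda>l x. Da l x + Db l x)"
 unfolding W1_def
proof (intro conjI allI)
 show L: "L2loc Om (\<lambda>x. a x + b x)" "L2loc Om (\<lambda>x. Da l x + Db l x)" for l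
  using assms by (auto simp: W1_def intro: L2loc_add)
 fix l
 show "weak_pderiv Om (\<lambda>x. a x + b x) l (\<lambda>x. Da l x + Db l x)"
 proof (rule weak_pderiv_L2locI[OF L(1) L(2)])
  fix \<phi> D\<phi> assume t: "test_fn Om \<phi> D\<phi>"
  have "weak_pderiv Om a l (Da l)" "weak_pderiv Om b l (Db l)" using assms by (auto simp: W1_def)
  note this[THEN weak_pderivD(1), OF t] this[THEN weak_pderivD(2), OF t] this[THEN weak_pderivD(3), OF t]
  then show "(LBINT x. (a x + b x) * D\<phi> x $ l) = - (LBINT x. (Da l x + Db l x) * \<phi> x)"
   by (simp add: distrib_right)
 qed
qed

lemma W1_zero: "W1 Om (\<lambda>x. 0) (\<lambda>l x. 0)"
 using W1_C1[OF C1_const[of 0]] by simp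

lemma W1_sum:
 assumes "\<And>i. i \<in> I ==> W1 Om (a i) (Da i)"
 shows "W1 Om (\<lambda>x. \<Sum>i\<in>I. a i x) (\<lambda>l x. \<Sum>i\<in>I. Da i l x)"
 using assms by (induction I rule: infinite_finite_induct) (auto intro: W1_add W1_zero)

lemma weak_pderiv_mult_null:
 assumes w: "weak_pderiv Om a l Da" and f: "C1 f Df" and t: "test_fn Om \<psi> D\<psi>"
 shows "null_integral (\<lambda>x. a x * (f x * D\<psi> x $ l + \<psi> x * Df x $ l) + Da x * (f x * \<psi> x))"
 using weak_pderivD_null[OF w test_fn_mult[OF f t]] by simp

lemma W1_mult:
 assumes a: "W1 Om a Da" and f: "C1 f Df"
 shows "W1 Om (\<lambda>x. f x * a x) (\<lambda>l x. f x * Da l x + a x * Df x $ l)"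
 unfolding W1_def
proof (intro conjI allI)
 have aL: "L2loc Om a" "L2loc Om (Da l)" for l using a by (auto simp: W1_def)
 note fc = C1_continuous[OF f] C1_continuous_D[OF f]
 show L: "L2loc Om (\<lambda>x. f x * a x)" by (rule L2loc_mult[OF aL(1) fc(1)])
 have L3: "L2loc Om (\<lambda>x. a x * Df x $ l)" for l using L2loc_mult[OF aL(1) fc(2)] by (simp add: mult.commute)
 show L2: "L2loc Om (\<lambda>x. f x * Da l x + a x * Df x $ l)" for l
  by (rule L2loc_add[OF L2loc_mult[OF aL(2) fc(1)] L3])
 fix l
 show "weak_pderiv Om (\<lambda>x. f x * a x) l (\<lambda>x. f x * Da l x + a x * Df x $ l)"
 proof (rule weak_pderiv_L2locI[OF L L2])
  fix \<psi> D\<psi> assume t: "test_fn Om \<psi> D\<psi>"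
  have w: "weak_pderiv Om a l (Da l)" using a by (simp add: W1_def)
  have i: "integrable lborel (\<lambda>x. D\<psi> x $ l * (f x * a x))" "integrable lborel (\<lambda>x. \<psi> x * (f x * Da l x + a x * Df x $ l))"
   using cc_integrable_mult[OF L test_fn_cc(2)[OF t]] cc_integrable_mult[OF L2 test_fn_cc(1)[OF t]] .
  have eq: "a x * (f x * D\<psi> x $ l + \<psi> x * Df x $ l) + Da l x * (f x * \<psi> x) =
    D\<psi> x $ l * (f x * a x) + \<psi> x * (f x * Da l x + a x * Df x $ l)" for x by (simp add: algebra_simps)
  have "(LBINT x. D\<psi> x $ l * (f x * a x) + \<psi> x * (f x * Da l x + a x * Df x $ l)) = 0"
   using weak_pderiv_mult_null[OF w f t] unfolding eq by (simp add: has_bochner_integral_iff)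
  then show "(LBINT x. f x * a x * D\<psi> x $ l) = - (LBINT x. (f x * Da l x + a x * Df x $ l) * \<psi> x)"
   using i by (simp add: mult.commute)
 qed
qed

lemma Wc_mult:
 fixes a :: "real^'n => real"
 assumes a: "W1 Om a Da" and t: "test_fn Om \<phi> D\<phi>"
 shows "Wc Om (\<lambda>x. \<phi> x * a x) (\<lambda>l x. \<phi> x * Da l x + a x * D\<phi> x $ l)"
 unfolding Wc_def
proof (intro conjI allI)
 have aL: "L2loc Om a" "L2loc Om (Da l)" for l using a by (auto simp: W1_def)
 show La: "L2 lborel (\<lambda>x. \<phi> x * a x)" by (rule L2_cc_mult[OF aL(1) test_fn_cc(1)[OF t]])
 have "L2 lborel (\<lambda>x. a x * D\<phi> x $ l)" for l using L2_cc_mult[OF aL(1) test_fn_cc(2)[OF t]] by (simp add: mult.commute)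
 then show Lb: "L2 lborel (\<lambda>x. \<phi> x * Da l x + a x * D\<phi> x $ l)" for l
  by (intro L2_add L2_cc_mult[OF aL(2) test_fn_cc(1)[OF t]])
 obtain K where K: "compact K" "K \<subseteq> Om" "\<And>x. x \<notin> K ==> \<phi> x = 0" "\<And>x. x \<notin> K ==> D\<phi> x = 0"
  using test_fn_zero_outside[OF t] by metis
 then show "\<exists>K. compact K \<and> K \<subseteq> Om \<and> (\<forall>x. x \<notin> K \<longrightarrow> \<phi> x * a x = 0 \<and> (\<forall>l. \<phi> x * Da l x + a x * D\<phi> x $ l = 0))"
  by (intro exI[of _ K]) auto
 fix l
 show "weak_pderiv UNIV (\<lambda>x. \<phi> x * a x) l (\<lambda>x. \<phi> x * Da l x + a x * D\<phi> x $ l)"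
 proof (rule weak_pderiv_L2locI[OF L2_L2loc[OF La] L2_L2loc[OF Lb]])
  fix \<psi> :: "real^'n => real" and D\<psi> assume u: "test_fn UNIV \<psi> D\<psi>"
  have w: "weak_pderiv Om a l (Da l)" using a by (simp add: W1_def)
  have i: "integrable lborel (\<lambda>x. D\<psi> x $ l * (\<phi> x * a x))" "integrable lborel (\<lambda>x. \<psi> x * (\<phi> x * Da l x + a x * D\<phi> x $ l))"
   using cc_integrable_mult[OF L2_L2loc[OF La] test_fn_cc(2)[OF u]] cc_integrable_mult[OF L2_L2loc[OF Lb] test_fn_cc(1)[OF u]] .
  have eq: "a x * (\<psi> x * D\<phi> x $ l + \<phi> x * D\<psi> x $ l) + Da l x * (\<psi> x * \<phi> x) =
    D\<psi> x $ l * (\<phi> x * a x) + \<psi> x * (\<phi> x * Da l x + a x * D\<phi> x $ l)" for x by (simp add: algebra_simps)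
  have "(LBINT x. D\<psi> x $ l * (\<phi> x * a x) + \<psi> x * (\<phi> x * Da l x + a x * D\<phi> x $ l)) = 0"
   using weak_pderiv_mult_null[OF w test_fn_C1[OF u] t] unfolding eq by (simp add: has_bochner_integral_iff)
  then show "(LBINT x. \<phi> x * a x * D\<psi> x $ l) = - (LBINT x. (\<phi> x * Da l x + a x * D\<phi> x $ l) * \<psi> x)"
   using i by (simp add: mult.commute)
 qed
qed

lemma Wc_test_fn: assumes t: "test_fn Om \<phi> D\<phi>" shows "Wc Om \<phi> (\<lambda>l x. D\<phi> x $ l)"
 using Wc_mult[OF W1_C1[OF C1_const[of 1]] t] by simp

lemma L2loc_Wc_integrable:
 assumes A: "L2loc Om A" and K: "compact K" "K \<subseteq> Om" "\<And>x. x \<notin> K ==> z x = 0" and z: "L2 lborel z"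
 shows "integrable lborel (\<lambda>x. A x * z x)" "(LBINT x. A x * z x) = (LBINT x. z x * (indicator K x * A x))"
proof -
 have eq: "z x * (indicator K x * A x) = A x * z x" for x using K(3)[of x] by (auto simp: indicator_def)
 show "integrable lborel (\<lambda>x. A x * z x)" using L2_integrable_mult[OF z L2loc_L2[OF A K(1,2)]] unfolding eq .
 show "(LBINT x. A x * z x) = (LBINT x. z x * (indicator K x * A x))" unfolding eq ..
qed

text \<open>Mollifications of \<open>z\<close> are eventually supported in one compact subset of
  \<open>Om\<close> and converge together with their gradients. The hypothesis asks only for
  \<open>test2\<close> functions, so a first-order identity may be verified with the help of second
  derivatives of the test function that do not appear in it.\<close>

lemma linear_extension:
 fixes A :: "real^'n => real"
 assumes Om: "open Om" and A: "L2loc Om A" and a: "\<And>l. L2loc Om (a l)"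
  and H: "\<And>z Dz D2z. test2 Om z Dz D2z ==> (LBINT x. A x * z x + (\<Oplus>l. a l x * Dz x $ l)) = 0"
  and z: "Wc Om z Dz"
 shows "null_integral (\<lambda>x. A x * z x + (\<Oplus>l. a l x * Dz l x))"
proof -
 obtain K where K: "compact K" "K \<subseteq> Om" "\<And>x. x \<notin> K ==> z x = 0" "\<And>x l. x \<notin> K ==> Dz l x = 0"
  using z unfolding Wc_def by blast
 obtain e where e: "e > 0" "(\<Union>x\<in>K. cball x e) \<subseteq> Om"
  using compact_subset_open_imp_cball_epsilon_subset[OF K(1) Om K(2)] by metis
 \<comment> \<open>The closed neighbourhood of \<open>K\<close> is written as a Minkowski sum, which
   makes its compactness immediate.\<close>
 define K' where "K' = (\<Union>x\<in>K. \<Union>y\<in>cball 0 e. {x + y})"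
 have K'eq: "(\<Union>x\<in>K. cball x e) = K'"
 proof -
  have "cball x e = (\<Union>y\<in>cball 0 e. {x + y})" for x :: "real^'n"
  proof -
   have "w \<in> (\<Union>y\<in>cball 0 e. {x + y})" if "w \<in> cball x e" for w
    using that by (intro UN_I[of "w - x"]) (auto simp: dist_norm norm_minus_commute)
   then show ?thesis by (auto simp: dist_norm)
  qed
  from SUP_cong[OF refl this] show ?thesis unfolding K'_def .
 qed
 have "compact K'" unfolding K'_def by (intro compact_sums' K(1) compact_cball)
 have K': "compact K'" "K' \<subseteq> Om" "K \<subseteq> K'"
  using \<open>compact K'\<close> e K'eq by auto
 define d where "d n = e / real (Suc n)" for n
 have d: "d n > 0" "d n \<le> e" for n using e(1) by (auto simp: d_def field_simps)
 have dlim: "d \<longlonglongrightarrow> 0" unfolding d_def by (rule LIMSEQ_Suc[OF lim_const_over_n])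
 have "\<exists>kp Dkp D2kp. kern (d n) kp \<and> test2 UNIV kp Dkp D2kp \<and> (\<forall>z::real^'n. norm z > d n \<longrightarrow> Dkp z = 0)" for n
  by (rule kernel_exists[OF d(1)[of n]]) blast
 then obtain kp Dkp D2kp where k: "\<And>n. kern (d n) (kp n)" "\<And>n. test2 UNIV (kp n) (Dkp n) (D2kp n)"
  "\<And>n z. norm (z::real^'n) > d n ==> Dkp n z = 0" by metis
 have zL: "L2 lborel z" "\<And>l. L2 lborel (Dz l)" "\<And>l. weak_pderiv UNIV z l (Dz l)" using z by (auto simp: Wc_def)
 have zi: "integrable lborel z" by (rule L2_compact_support_integrable[OF zL(1) K(1,3)])
 have Dzi: "integrable lborel (Dz l)" for l by (rule L2_compact_support_integrable[OF zL(2) K(1,4)])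
 have t: "test2 Om (conv (kp n) z) (\<lambda>x. \<chi> l. conv (\<lambda>y. Dkp n y $ l) z x) (\<lambda>x. \<chi> l. \<chi> j. conv (\<lambda>y. D2kp n y $ l $ j) z x)" for n
 proof (rule conv_test2[OF k(2) _ k(3) zi K(3) K'(1,2)])
  show "kp n y = 0" if "norm y > d n" for y using k(1)[of n] that by (simp add: kern_def)
  show "(\<Union>y\<in>K. cball y (d n)) \<subseteq> K'" using d(2)[of n] K'eq by fastforce
 qed
 have De: "conv (\<lambda>y. Dkp n y $ l) z x = conv (kp n) (Dz l) x" for n l x
  by (rule conv_weak_pderiv[OF _ zL(3)]) (use k(2) in \<open>simp add: test2_def\<close>)
 have zero: "conv (kp n) v x = 0" if "x \<notin> K'" "\<And>x. x \<notin> K ==> v x = 0" for n v x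
 proof (rule conv_zero_outside[of K v "d n"])
  show "x \<notin> (\<Union>y\<in>K. cball y (d n))" using d(2)[of n] K'eq that(1) by fastforce
 qed (use that k(1)[of n] in \<open>auto simp: kern_def\<close>)
 have nlim: "(\<lambda>n. \<integral>x. B x * conv (kp n) v x \<partial>lborel) \<longlonglongrightarrow> (LBINT x. B x * v x)"
  and nint: "integrable lborel (\<lambda>x. B x * conv (kp n) v x)" "integrable lborel (\<lambda>x. B x * v x)"
  if B: "L2loc Om B" and v: "L2 lborel v" "integrable lborel v" "\<And>x. x \<notin> K ==> v x = 0" for B v n
 proof -
  have v': "x \<notin> K' ==> v x = 0" for x using v(3) K'(3) by blast
  note yL = young_L2(1)[OF k(1) v(1,2)]
  have zo: "\<And>x. x \<notin> K' ==> conv (kp n) v x = 0" for n using zero v(3) by blast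
  show "integrable lborel (\<lambda>x. B x * conv (kp n) v x)" "integrable lborel (\<lambda>x. B x * v x)"
   by (rule L2loc_Wc_integrable(1)[OF B K'(1,2) zo yL], assumption)
     (rule L2loc_Wc_integrable(1)[OF B K'(1,2) v' v(1)], assumption)
  have e1: "(LBINT x. B x * conv (kp n) v x) = (LBINT x. conv (kp n) v x * (indicator K' x * B x))" for n
   by (rule L2loc_Wc_integrable(2)[OF B K'(1,2) zo yL]) assumption
  have e2: "(LBINT x. B x * v x) = (LBINT x. v x * (indicator K' x * B x))"
   by (rule L2loc_Wc_integrable(2)[OF B K'(1,2) v' v(1)]) assumption
  show "(\<lambda>n. \<integral>x. B x * conv (kp n) v x \<partial>lborel) \<longlonglongrightarrow> (LBINT x. B x * v x)"
   unfolding e1 e2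
   by (rule L2_tendsto_integral_mult[OF yL v(1) L2loc_L2[OF B K'(1,2)] mollify_tendsto[OF v(1,2) k(1) dlim]])
 qed
 have eq0: "(LBINT x. A x * conv (kp n) z x) + (\<Oplus>l. \<integral>x. a l x * conv (kp n) (Dz l) x \<partial>lborel) = 0" for n
 proof -
  have "(LBINT x. A x * conv (kp n) z x + (\<Oplus>l. a l x * conv (kp n) (Dz l) x)) = 0"
   using H[OF t[of n]] by (simp add: De)
  then show ?thesis
   using nint(1)[OF A zL(1) zi K(3)] nint(1)[OF a zL(2) Dzi K(4)]
   by (subst (asm) Bochner_Integration.integral_add) (auto simp: Bochner_Integration.integral_sum)
 qed
 have "(\<lambda>n. (LBINT x. A x * conv (kp n) z x) + (\<Oplus>l. \<integral>x. a l x * conv (kp n) (Dz l) x \<partial>lborel))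
   \<longlonglongrightarrow> (LBINT x. A x * z x) + (\<Oplus>l. \<integral>x. a l x * Dz l x \<partial>lborel)"
  by (intro tendsto_add tendsto_sum nlim[OF A zL(1) zi K(3)] nlim[OF a zL(2) Dzi K(4)])
 then have "(LBINT x. A x * z x) + (\<Oplus>l. \<integral>x. a l x * Dz l x \<partial>lborel) = 0"
  unfolding eq0 by (simp add: LIMSEQ_const_iff)
 then show ?thesis
  using nint(2)[OF A zL(1) zi K(3)] nint(2)[OF a zL(2) Dzi K(4)]
  by (auto simp: has_bochner_integral_iff Bochner_Integration.integral_add Bochner_Integration.integral_sum)
qed

lemma Wc_weak_pderiv:
 fixes b :: "real^'n => real"
 assumes Om: "open Om" and b: "L2loc Om b" "L2loc Om Db" "weak_pderiv Om b i Db" and z: "Wc Om z Dz"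
 shows "null_integral (\<lambda>x. Db x * z x + b x * Dz i x)"
proof -
 have s: "(\<Oplus>l. (if l = i then b x else 0) * f l) = b x * f i" for f :: "'n => real" and x
  by (simp add: if_distrib[of "\<lambda>c. c * _"] cong: if_cong)
 have L: "L2loc Om (\<lambda>x. if l = i then b x else 0)" for l
  by (cases "l = i") (use b(1) in \<open>auto intro: L2loc_continuous\<close>)
 have "null_integral (\<lambda>x. Db x * z x + (\<Oplus>l. (if l = i then b x else 0) * Dz l x))"
 proof (rule linear_extension[OF Om b(2) L _ z])
  fix y Dy D2y assume "test2 Om y Dy D2y"
  then have t: "test_fn Om y Dy" by (simp add: test2_def)
  show "(LBINT x. Db x * y x + (\<Oplus>l. (if l = i then b x else 0) * Dy x $ l)) = 0"
   unfolding s using weak_pderivD_null[OF b(3) t] by (simp add: has_bochner_integral_iff add.commute)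
 qed
 then show ?thesis unfolding s .
qed

text \<open>The product of two such functions is only locally integrable, so the product rule is
  stated in integrated form: the derivative of \<open>b\<close> is tested with
  \<open>\<phi> a\<close>.\<close>

lemma W1_product:
 assumes Om: "open Om" and a: "W1 Om a Da" and b: "W1 Om b Db" and t: "test_fn Om \<phi> D\<phi>"
 shows "null_integral (\<lambda>x. \<phi> x * (a x * Db i x + b x * Da i x) + a x * b x * D\<phi> x $ i)"
proof -
 have "null_integral (\<lambda>x. Db i x * (\<phi> x * a x) + b x * (\<phi> x * Da i x + a x * D\<phi> x $ i))"
  using Wc_weak_pderiv[OF Om _ _ _ Wc_mult[OF a t], of b "Db i" i] b by (simp add: W1_def)
 then show ?thesis by (simp add: algebra_simps)
qed

text \<open>For a smooth \<open>z\<close> both terms become the integral of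
  \<open>- a D\<^sub>i\<^sub>j z\<close>. The identity contains first derivatives only and therefore
  extends to nonsmooth \<open>z\<close>. With derivatives of the solution in place of
  \<open>a\<close> and \<open>z\<close> it does the work of third derivatives, which need not
  exist.\<close>

lemma W1_swap_derivatives:
 fixes a :: "real^'n => real"
 assumes Om: "open Om" and a: "W1 Om a Da" and z: "Wc Om z Dz"
 shows "null_integral (\<lambda>x. Da i x * Dz j x - Da j x * Dz i x)"
proof -
 define c where "c l x = (if l = j then Da i x else 0) - (if l = i then Da j x else 0)" for l x
 have s: "(\<Oplus>l. c l x * f l) = Da i x * f j - Da j x * f i" for f :: "'n => real" and x
  by (simp add: c_def left_diff_distrib sum_subtractf if_distrib[of "\<lambda>c. c * _"] cong: if_cong)
 have aL: "L2loc Om (Da l)" "weak_pderiv Om a l (Da l)" for l using a by (auto simp: W1_def)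
 have if0: "L2loc Om (\<lambda>x. if P then Da l x else 0)" for P l
  by (cases P) (auto intro: aL(1) L2loc_continuous)
 have L: "L2loc Om (c l)" for l
  unfolding c_def by (intro L2loc_diff if0)
 have "null_integral (\<lambda>x. 0 * z x + (\<Oplus>l. c l x * Dz l x))"
 proof (rule linear_extension[OF Om _ L _ z])
  show "L2loc Om (\<lambda>x. 0)" by (rule L2loc_continuous) simp
  fix y Dy D2y assume "test2 Om y Dy D2y"
  then have t: "test_fn Om (\<lambda>x. Dy x $ k) (\<lambda>x. D2y x $ k)" "D2y x $ i $ j = D2y x $ j $ i" for k x by (auto simp: test2_def)
  have "has_bochner_integral lborel (\<lambda>x. (a x * D2y x $ j $ i + Da i x * Dy x $ j) - (a x * D2y x $ i $ j + Da j x * Dy x $ i)) (0 - 0)"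
   by (intro has_bochner_integral_diff weak_pderivD_null[OF aL(2) t(1)])
  then show "(LBINT x. 0 * y x + (\<Oplus>l. c l x * Dy x $ l)) = 0"
   unfolding s by (simp add: t(2) has_bochner_integral_iff)
 qed
 then show ?thesis unfolding s by simp
qed

text \<open>A replacement for weak compactness. The limit of the pairings with \<open>dn\<close>
  exists because the derivative can be moved to the test function; the uniform bound makes it a
  bounded functional, which Riesz represents. No subsequence has to be chosen.\<close>

lemma weak_pderiv_limit:
 fixes v :: "real^'n => real"
 assumes v: "L2loc Om v" and w: "\<And>n. weak_pderiv Om (vn n) h (dn n)" and L: "\<And>n. L2 lborel (dn n)"
  and bd: "\<And>n. (LBINT x. (dn n x)\<^sup>2) \<le> C"
  and lim: "\<And>\<phi> D\<phi>. test_fn Om \<phi> D\<phi> ==> (\<lambda>n. \<integral>x. vn n x * D\<phi> x $ h \<partial>lborel) \<longlonglongrightarrow> (LBINT x. v x * D\<phi> x $ h)"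
 obtains d where "L2 lborel d" "weak_pderiv Om v h d"
  "\<And>\<phi> D\<phi>. test_fn Om \<phi> D\<phi> ==> (\<lambda>n. \<integral>x. dn n x * \<phi> x \<partial>lborel) \<longlonglongrightarrow> (LBINT x. d x * \<phi> x)"
proof -
 define l where "l \<phi> = lim (\<lambda>n. \<integral>x. dn n x * \<phi> x \<partial>lborel)" for \<phi> :: "real^'n => real"
 have conv: "(\<lambda>n. \<integral>x. dn n x * \<phi> x \<partial>lborel) \<longlonglongrightarrow> - (LBINT x. v x * D\<phi> x $ h)" if t: "test_fn Om \<phi> D\<phi>" for \<phi> D\<phi>
 proof -
  have "(LBINT x. dn n x * \<phi> x) = - (LBINT x. vn n x * D\<phi> x $ h)" for n
   using weak_pderivD(3)[OF w t, of n] by simp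
  then show ?thesis using tendsto_minus[OF lim[OF t]] by simp
 qed
 have leq: "l \<phi> = - (LBINT x. v x * D\<phi> x $ h)" if t: "test_fn Om \<phi> D\<phi>" for \<phi> D\<phi>
  unfolding l_def using conv[OF t] by (rule limI)
 have convl: "(\<lambda>n. \<integral>x. dn n x * \<phi> x \<partial>lborel) \<longlonglongrightarrow> l \<phi>" if t: "test_fn Om \<phi> D\<phi>" for \<phi> D\<phi>
  using conv[OF t] leq[OF t] by simp
 have tL: "L2 lborel \<phi>" if "test_fn Om \<phi> D\<phi>" for \<phi> D\<phi> using that cc_L2 test_fn_cc(1) by blast
 show thesis
 proof (rule riesz_L2[of Om l C])
  fix s t Ds Dt a b assume st: "test_fn Om s Ds" "test_fn Om t Dt"
  have "(\<lambda>n. a * (LBINT x. dn n x * s x) + b * (LBINT x. dn n x * t x)) \<longlonglongrightarrow> a * l s + b * l t"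
   by (intro tendsto_intros convl[OF st(1)] convl[OF st(2)])
  moreover have "a * (LBINT x. dn n x * s x) + b * (LBINT x. dn n x * t x) = (LBINT x. dn n x * (a * s x + b * t x))" for n
   using L2_integrable_mult[OF L tL[OF st(1)], of n] L2_integrable_mult[OF L tL[OF st(2)], of n]
   by (simp add: distrib_left mult.left_commute)
  ultimately show "l (\<lambda>x. a * s x + b * t x) = a * l s + b * l t" unfolding l_def by (simp add: limI)
 next
  fix s Ds assume s: "test_fn Om s Ds"
  have "(\<lambda>n. (LBINT x. dn n x * s x)\<^sup>2) \<longlonglongrightarrow> (l s)\<^sup>2" by (intro tendsto_intros convl[OF s])
  moreover have "(LBINT x. dn n x * s x)\<^sup>2 \<le> C * (LBINT x. (s x)\<^sup>2)" for n
   using Cauchy_Schwarz_L2[OF L tL[OF s], of n] mult_right_mono[OF bd[of n], of "\<integral>x. (s x)\<^sup>2 \<partial>lborel"] by simp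
  ultimately show "(l s)\<^sup>2 \<le> C * (LBINT x. (s x)\<^sup>2)" using LIMSEQ_le_const2 by blast
 next
  fix d and s :: "nat => _" and Ds
  assume d: "L2 lborel d" "\<And>t Dt. test_fn Om t Dt ==> (LBINT x. d x * t x) = l t"
  show thesis
  proof (rule that[OF d(1)])
   show "weak_pderiv Om v h d"
    by (rule weak_pderiv_L2locI[OF v L2_L2loc[OF d(1)]]) (use leq d(2) in force)
   show "(\<lambda>n. \<integral>x. dn n x * \<phi> x \<partial>lborel) \<longlonglongrightarrow> (LBINT x. d x * \<phi> x)" if "test_fn Om \<phi> D\<phi>" for \<phi> D\<phi>
    using convl[OF that] d(2)[OF that] by simp
  qed
 qed
qed

section \<open>Interior regularity\<close>

text \<open>Localise to \<open>W = \<eta> v\<close>, which satisfies an equation on the whole space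
  with square integrable right-hand side \<open>H\<close>, and mollify. For the smooth compactly
  supported approximations two integrations by parts show that the weighted square sum of all second
  derivatives has the same integral as the square of the weighted trace, that is, of the mollified
  \<open>H\<close>. \<open>weak_pderiv_limit\<close> passes to the limit.\<close>

lemma interior_regularity_cutoff:
 fixes lam :: "real^'n"
 assumes lam: "\<And>k. lam $ k > 0" and Om: "open Om" and v: "W1 Om v Dv" and F: "L2loc Om F"
  and eq: "\<And>z Dz. test_fn Om z Dz ==> null_integral (\<lambda>x. (\<Oplus>l. lam $ l * (Dv l x * Dz x $ l)) + F x * z x)"
  and eta: "test2 Om \<eta> D\<eta> D2\<eta>"
 obtains w where "\<And>h k. L2 lborel (w h k)"
  "\<And>h k. weak_pderiv UNIV (\<lambda>x. \<eta> x * Dv k x + v x * D\<eta> x $ k) h (w h k)"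
  "\<And>h k. AE x in lborel. w h k x = w k h x"
proof -
 define W where "W x = \<eta> x * v x" for x
 define DW where "DW k x = \<eta> x * Dv k x + v x * D\<eta> x $ k" for k x
 have e1: "test_fn Om \<eta> D\<eta>" and e2: "\<And>k. test_fn Om (\<lambda>x. D\<eta> x $ k) (\<lambda>x. D2\<eta> x $ k)"
  using eta by (auto simp: test2_def)
 have vL: "L2loc Om v" "\<And>k. L2loc Om (Dv k)" "\<And>k. weak_pderiv Om v k (Dv k)" using v by (auto simp: W1_def)
 have WW: "Wc Om W DW"
  unfolding W_def DW_def by (rule Wc_mult[OF v e1])
 then have WL: "L2 lborel W" "\<And>k. L2 lborel (DW k)" "\<And>k. weak_pderiv UNIV W k (DW k)" by (auto simp: Wc_def)
 obtain K where K: "compact K" "\<And>x. x \<notin> K ==> W x = 0" "\<And>x k. x \<notin> K ==> DW k x = 0"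
  using WW unfolding Wc_def by blast
 have Wi: "integrable lborel W" "\<And>k. integrable lborel (DW k)"
  using L2_compact_support_integrable[OF WL(1) K(1,2)] L2_compact_support_integrable[OF WL(2) K(1,3)] by blast+
 \<comment> \<open>Besides the localised right-hand side these are the commutator terms of the
   operator with the cutoff.\<close>
 define H where "H x = \<eta> x * F x + (\<Oplus>l. lam $ l * (2 * (D\<eta> x $ l * Dv l x) + D2\<eta> x $ l $ l * v x))" for x
 have HL: "L2 lborel H"
  unfolding H_def
  by (intro L2_add L2_sum L2_cmult L2_cc_mult[OF F test_fn_cc(1)[OF e1]] L2_cc_mult[OF vL(2) test_fn_cc(2)[OF e1]]
     L2_cc_mult[OF vL(1) test_fn_cc(2)[OF e2]])
 obtain Ke where Ke: "compact Ke" "\<And>x. x \<notin> Ke ==> \<eta> x = 0" "\<And>x. x \<notin> Ke ==> D\<eta> x = 0"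
  using test_fn_zero_outside[OF e1] by metis
 have Ke2: "D2\<eta> x $ l $ l = 0" if x: "x \<notin> Ke" for x l
 proof -
  have "((\<lambda>x. D\<eta> x $ l) has_derivative (\<lambda>v. 0)) (at x)"
  proof (rule has_derivative_transform_within_open[of "\<lambda>x. 0" _ _ _ "- Ke"])
   show "open (- Ke)" using Ke(1) by (simp add: compact_imp_closed open_Compl)
   show "x \<in> - Ke" using x by simp
   show "0 = D\<eta> y $ l" if "y \<in> - Ke" for y using Ke(3)[of y] that by simp
  qed simp
  moreover have "((\<lambda>x. D\<eta> x $ l) has_derivative (\<lambda>v. D2\<eta> x $ l \<bullet> v)) (at x)"
   using e2[of l] by (simp add: test_fn_def)
  ultimately have "(\<lambda>v. D2\<eta> x $ l \<bullet> v) = (\<lambda>v. 0)" using has_derivative_unique by blast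
  from fun_cong[OF this, of "axis l 1"] show ?thesis by (simp add: inner_axis)
 qed
 have Hz: "H x = 0" if "x \<notin> Ke" for x using Ke(2,3)[OF that] Ke2[OF that] by (simp add: H_def)
 have Hi: "integrable lborel H" by (rule L2_compact_support_integrable[OF HL Ke(1) Hz])
 have eqW: "null_integral (\<lambda>x. (\<Oplus>l. lam $ l * (DW l x * D\<psi> x $ l)) + H x * \<psi> x)"
  if t: "test_fn UNIV \<psi> D\<psi>" for \<psi> D\<psi>
 proof -
  have A: "null_integral (\<lambda>x. (\<Oplus>l. lam $ l * (Dv l x * (\<psi> x *\<^sub>R D\<eta> x + \<eta> x *\<^sub>R D\<psi> x) $ l)) + F x * (\<psi> x * \<eta> x))"
   by (rule eq[OF test_fn_mult[OF test_fn_C1[OF t] e1]])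
  have B: "null_integral (\<lambda>x. v x * (\<psi> x *\<^sub>R D2\<eta> x $ l + D\<eta> x $ l *\<^sub>R D\<psi> x) $ l + Dv l x * (\<psi> x * D\<eta> x $ l))" for l
   using weak_pderivD_null[OF vL(3) test_fn_mult[OF test_fn_C1[OF t] e2[of l]], of l] by simp
  have "has_bochner_integral lborel (\<lambda>x. ((\<Oplus>l. lam $ l * (Dv l x * (\<psi> x *\<^sub>R D\<eta> x + \<eta> x *\<^sub>R D\<psi> x) $ l)) + F x * (\<psi> x * \<eta> x))
    + (\<Oplus>l. lam $ l * (v x * (\<psi> x *\<^sub>R D2\<eta> x $ l + D\<eta> x $ l *\<^sub>R D\<psi> x) $ l + Dv l x * (\<psi> x * D\<eta> x $ l)))) (0 + (\<Oplus>l. lam $ l * 0))"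
   by (intro has_bochner_integral_add A has_bochner_integral_sum has_bochner_integral_mult_right B)
  moreover have "((\<Oplus>l. lam $ l * (Dv l x * (\<psi> x *\<^sub>R D\<eta> x + \<eta> x *\<^sub>R D\<psi> x) $ l)) + F x * (\<psi> x * \<eta> x))
    + (\<Oplus>l. lam $ l * (v x * (\<psi> x *\<^sub>R D2\<eta> x $ l + D\<eta> x $ l *\<^sub>R D\<psi> x) $ l + Dv l x * (\<psi> x * D\<eta> x $ l)))
    = (\<Oplus>l. lam $ l * (DW l x * D\<psi> x $ l)) + H x * \<psi> x" for x
   unfolding H_def DW_def distrib_right sum_distrib_right
   by (simp add: algebra_simps sum.distrib sum_distrib_left)
  ultimately show ?thesis by simp
 qed
 define d where "d n = 1 / real (Suc n)" for n
 have d: "d n > 0" for n by (simp add: d_def)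
 have dlim: "d \<longlonglongrightarrow> 0" unfolding d_def by (rule LIMSEQ_Suc[OF lim_const_over_n])
 have "\<exists>kp Dkp D2kp. kern (d n) kp \<and> test2 UNIV kp Dkp D2kp \<and> (\<forall>z::real^'n. norm z > d n \<longrightarrow> Dkp z = 0)" for n
  by (rule kernel_exists[OF d(1)[of n]]) blast
 then obtain kp Dkp D2kp where k: "\<And>n. kern (d n) (kp n)" "\<And>n. test2 UNIV (kp n) (Dkp n) (D2kp n)"
  "\<And>n z. norm (z::real^'n) > d n ==> Dkp n z = 0" by metis
 have k1: "test_fn UNIV (kp n) (Dkp n)" and k2: "test_fn UNIV (\<lambda>x. Dkp n x $ j) (\<lambda>x. D2kp n x $ j)"
  and k3: "D2kp n x $ i $ j = D2kp n x $ j $ i" for n i j x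
  using k(2) by (auto simp: test2_def)
 define P where "P n k = conv (kp n) (DW k)" for n k
 define M where "M n k h x = conv (\<lambda>z. Dkp n z $ h) (DW k) x" for n k h x
 have Pt: "test_fn UNIV (P n k) (\<lambda>x. \<chi> h. M n k h x)" for n k
 proof (rule test_fnI[of _ _ "\<Union>x\<in>K. \<Union>y\<in>cball 0 (d n). {x + y}"])
  show "C1 (P n k) (\<lambda>x. \<chi> h. M n k h x)" unfolding P_def M_def by (rule conv_C1[OF Wi(2) k1])
  show "compact (\<Union>x\<in>K. \<Union>y\<in>cball 0 (d n). {x + y})" by (intro compact_sums' K(1) compact_cball)
  fix x assume x: "x \<notin> (\<Union>x\<in>K. \<Union>y\<in>cball 0 (d n). {x + y})"
  show "P n k x = 0" unfolding P_def
  proof (rule conv_zero_outside[OF K(3)])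
   show "kp n z = 0" if "norm z > d n" for z using that k(1)[of n] by (simp add: kern_def)
   show "x \<notin> (\<Union>y\<in>K. cball y (d n))"
   proof
    assume "x \<in> (\<Union>y\<in>K. cball y (d n))"
    then obtain y where y: "y \<in> K" "dist y x \<le> d n" by auto
    have "x \<in> (\<Union>x\<in>K. \<Union>y\<in>cball 0 (d n). {x + y})"
     by (rule UN_I[OF y(1)], rule UN_I[of "x - y"]) (use y(2) in \<open>auto simp: dist_norm norm_minus_commute\<close>)
    with x show False by simp
   qed
  qed
 qed simp
 have Msq: "L2 lborel (M n k h)" for n k h
  using cc_L2[OF test_fn_cc(2)[OF Pt[of n k], of h]] by simp
 have Msym: "M n k h x = M n h k x" for n k h x
 proof -
  have *: "M n k h x = conv (\<lambda>z. D2kp n z $ h $ k) W x" for k h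
   unfolding M_def by (rule conv_weak_pderiv[OF k2 WL(3), symmetric])
  show ?thesis unfolding * k3[of n _ h k] ..
 qed
 have trace: "(\<Oplus>l. lam $ l * M n l l x) = conv (kp n) H x" for n x
 proof -
  note t = test_fn_reflect[OF k1[of n], of x]
  have i: "integrable lborel (\<lambda>y. DW l y * Dkp n (x - y) $ l)" for l
   by (rule conv_integrable[OF Wi(2) test_fn_cc(2)[OF k1]])
  have i2: "integrable lborel (\<lambda>y. H y * kp n (x - y))"
   by (rule conv_integrable[OF Hi test_fn_cc(1)[OF k1]])
  have "0 = (LBINT y. - (\<Oplus>l. lam $ l * (DW l y * Dkp n (x - y) $ l)) + H y * kp n (x - y))"
   using eqW[OF t] by (simp add: has_bochner_integral_iff sum_negf)
  also have "\<dots> = - (\<Oplus>l. lam $ l * M n l l x) + conv (kp n) H x"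
   unfolding M_def conv_def using i i2
   by (subst Bochner_Integration.integral_add) (auto simp: Bochner_Integration.integral_sum)
  finally show ?thesis by simp
 qed
 have Mb: "(LBINT x. (M n k h x)\<^sup>2) \<le> (LBINT x. (H x)\<^sup>2) / (lam $ k * lam $ h)" for n k h
 proof -
  \<comment> \<open>This exchanges the two derivatives under the integral; summed with the weights
    \<open>lam $ k * lam $ h\<close> it compares the squared trace with the sum of squares.\<close>
  have "null_integral (\<lambda>x. M n k k x * M n h h x - M n k h x * M n h k x)" for k h
   using W1_swap_derivatives[OF open_UNIV W1_C1[OF test_fn_C1[OF Pt[of n k]]] Wc_test_fn[OF Pt[of n h]], of k h] by simp
  then have "has_bochner_integral lborel (\<lambda>x. \<Oplus>k. \<Oplus>h. (lam $ k * lam $ h) * (M n k k x * M n h h x - M n k h x * M n h k x))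
    (\<Oplus>k. \<Oplus>h. (lam $ k * lam $ h) * 0)"
   by (intro has_bochner_integral_sum has_bochner_integral_mult_right) auto
  moreover have "(\<Oplus>k. \<Oplus>h. (lam $ k * lam $ h) * (M n k k x * M n h h x - M n k h x * M n h k x))
    = (conv (kp n) H x)\<^sup>2 - (\<Oplus>k. \<Oplus>h. (lam $ k * lam $ h) * (M n k h x)\<^sup>2)" for x
   unfolding trace[symmetric] power2_eq_square sum_product Msym[of n _ _ x]
   by (simp add: right_diff_distrib sum_subtractf algebra_simps)
  ultimately have 0: "(LBINT x. (conv (kp n) H x)\<^sup>2 - (\<Oplus>k. \<Oplus>h. (lam $ k * lam $ h) * (M n k h x)\<^sup>2)) = 0"
   by (simp add: has_bochner_integral_iff)
  have "(LBINT x. (conv (kp n) H x)\<^sup>2) = (LBINT x. (\<Oplus>k. \<Oplus>h. (lam $ k * lam $ h) * (M n k h x)\<^sup>2))"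
   using 0 L2_integrable_square[OF young_L2(1)[OF k(1) HL Hi]] L2_integrable_square[OF Msq] by simp
  also have "\<dots> \<ge> (LBINT x. (lam $ k * lam $ h) * (M n k h x)\<^sup>2)"
  proof (rule integral_mono)
   show "integrable lborel (\<lambda>x. (lam $ k * lam $ h) * (M n k h x)\<^sup>2)"
    "integrable lborel (\<lambda>x. \<Oplus>k. \<Oplus>h. (lam $ k * lam $ h) * (M n k h x)\<^sup>2)"
    using L2_integrable_square[OF Msq] by auto
   have nn: "0 \<le> (lam $ k * lam $ h) * (M n k h x)\<^sup>2" for k h x
    using lam[of k] lam[of h] by (intro mult_nonneg_nonneg) (auto simp: less_imp_le)
   fix x
   have "(lam $ k * lam $ h) * (M n k h x)\<^sup>2 \<le> (\<Oplus>h. (lam $ k * lam $ h) * (M n k h x)\<^sup>2)"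
    by (rule member_le_sum) (use nn in auto)
   also have "\<dots> \<le> (\<Oplus>k. \<Oplus>h. (lam $ k * lam $ h) * (M n k h x)\<^sup>2)"
    by (rule member_le_sum[of _ _ "\<lambda>k. \<Oplus>h. (lam $ k * lam $ h) * (M n k h x)\<^sup>2"]) (auto intro!: sum_nonneg nn)
   finally show "(lam $ k * lam $ h) * (M n k h x)\<^sup>2 \<le> (\<Oplus>k. \<Oplus>h. (lam $ k * lam $ h) * (M n k h x)\<^sup>2)" .
  qed
  finally have "(lam $ k * lam $ h) * (LBINT x. (M n k h x)\<^sup>2) \<le> (LBINT x. (H x)\<^sup>2)"
   using young_L2(2)[OF k(1) HL Hi, of n] by simp
  then show ?thesis using lam[of k] lam[of h] by (simp add: pos_le_divide_eq mult.commute)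
 qed
 define Q where "Q h k w \<longleftrightarrow> L2 lborel w \<and> weak_pderiv UNIV (DW k) h w \<and>
   (\<forall>\<phi> D\<phi>. test_fn UNIV \<phi> D\<phi> \<longrightarrow> (\<lambda>n. \<integral>x. M n k h x * \<phi> x \<partial>lborel) \<longlonglongrightarrow> (LBINT x. w x * \<phi> x))" for h k w
 have "\<exists>w. Q h k w" for h k
  unfolding Q_def
 proof (rule weak_pderiv_limit[of UNIV "DW k" "\<lambda>n. P n k" h "\<lambda>n. M n k h" "(LBINT x. (H x)\<^sup>2) / (lam $ k * lam $ h)"])
  show "L2loc UNIV (DW k)" by (rule L2_L2loc[OF WL(2)])
  show "weak_pderiv UNIV (P n k) h (M n k h)" for n
   using weak_pderiv_C1[OF test_fn_C1[OF Pt[of n k]], of UNIV h] by simp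
  fix \<phi> :: "real^'n => real" and D\<phi> assume t: "test_fn UNIV \<phi> D\<phi>"
  show "(\<lambda>n. \<integral>x. P n k x * D\<phi> x $ h \<partial>lborel) \<longlonglongrightarrow> (LBINT x. DW k x * D\<phi> x $ h)"
   unfolding P_def
   by (rule L2_tendsto_integral_mult[OF young_L2(1)[OF k(1) WL(2) Wi(2)] WL(2) cc_L2[OF test_fn_cc(2)[OF t]] mollify_tendsto[OF WL(2) Wi(2) k(1) dlim]])
 qed (use Msq Mb in blast)+
 then obtain w where wQ: "\<And>h k. Q h k (w h k)" by metis
 have w: "\<And>h k. L2 lborel (w h k)" "\<And>h k. weak_pderiv UNIV (DW k) h (w h k)"
  "\<And>h k \<phi> D\<phi>. test_fn UNIV \<phi> D\<phi> ==> (\<lambda>n. \<integral>x. M n k h x * \<phi> x \<partial>lborel) \<longlonglongrightarrow> (LBINT x. w h k x * \<phi> x)"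
  using wQ unfolding Q_def by blast+
 show thesis
 proof (rule that[of w])
  show "L2 lborel (w h k)" "weak_pderiv UNIV (\<lambda>x. \<eta> x * Dv k x + v x * D\<eta> x $ k) h (w h k)" for h k
   using w(1,2) unfolding DW_def by auto
  fix h k
  have "AE x in lborel. x \<in> UNIV \<longrightarrow> w h k x = w k h x"
  proof (rule fundamental_lemma_L2loc[OF open_UNIV L2_L2loc[OF w(1)] L2_L2loc[OF w(1)]])
   fix \<phi> :: "real^'n => real" and D\<phi> assume t: "test_fn UNIV \<phi> D\<phi>"
   have Meq: "M n h k = M n k h" for n using Msym by blast
   show "(LBINT x. w h k x * \<phi> x) = (LBINT x. w k h x * \<phi> x)"
    using LIMSEQ_unique[OF w(3)[OF t, of k h, unfolded Meq] w(3)[OF t, of h k, unfolded Meq]] by simp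
  qed
  then show "AE x in lborel. w h k x = w k h x" by simp
 qed
qed

section \<open>Functions of class \<open>C\<^sup>2\<close> and cutoffs\<close>

definition C2 :: "(real^'n => real) => (real^'n => real^'n) => (real^'n => real^'n^'n) => bool" where
 "C2 f Df D2f \<longleftrightarrow> C1 f Df \<and> (\<forall>i. C1 (\<lambda>x. Df x $ i) (\<lambda>x. D2f x $ i)) \<and> (\<forall>x i j. D2f x $ i $ j = D2f x $ j $ i)"

lemma C2_compose:
 assumes f: "C2 f Df D2f" and h: "\<And>t. (h has_real_derivative h' t) (at t)" "\<And>t. (h' has_real_derivative h'' t) (at t)"
  and c: "continuous_on UNIV h''"
 shows "C2 (\<lambda>x. h (f x)) (\<lambda>x. h' (f x) *\<^sub>R Df x) (\<lambda>x. \<chi> i j. h' (f x) * D2f x $ i $ j + h'' (f x) * Df x $ i * Df x $ j)"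
 unfolding C2_def
proof (intro conjI allI)
 have f1: "C1 f Df" and f2: "\<And>i. C1 (\<lambda>x. Df x $ i) (\<lambda>x. D2f x $ i)" and s: "\<And>x i j. D2f x $ i $ j = D2f x $ j $ i"
  using f by (auto simp: C2_def)
 have ch': "continuous_on UNIV h'" using h(2) DERIV_isCont continuous_at_imp_continuous_on by blast
 show "C1 (\<lambda>x. h (f x)) (\<lambda>x. h' (f x) *\<^sub>R Df x)" by (rule C1_compose[OF f1 h(1) ch'])
 fix i
 have "C1 (\<lambda>x. h' (f x) * Df x $ i) (\<lambda>x. h' (f x) *\<^sub>R D2f x $ i + Df x $ i *\<^sub>R (h'' (f x) *\<^sub>R Df x))"
  by (rule C1_mult[OF C1_compose[OF f1 h(2) c] f2])
 moreover have "(\<lambda>x. h' (f x) *\<^sub>R D2f x $ i + Df x $ i *\<^sub>R (h'' (f x) *\<^sub>R Df x)) = (\<lambda>x. (\<chi> i j. h' (f x) * D2f x $ i $ j + h'' (f x) * Df x $ i * Df x $ j) $ i)"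
  by (auto simp: vec_eq_iff)
 ultimately show "C1 (\<lambda>x. (h' (f x) *\<^sub>R Df x) $ i) (\<lambda>x. (\<chi> i j. h' (f x) * D2f x $ i $ j + h'' (f x) * Df x $ i * Df x $ j) $ i)"
  by simp
 show "(\<chi> i j. h' (f x) * D2f x $ i $ j + h'' (f x) * Df x $ i * Df x $ j) $ i $ j = (\<chi> i j. h' (f x) * D2f x $ i $ j + h'' (f x) * Df x $ i * Df x $ j) $ j $ i" for x j
  using s by simp
qed

lemma C2_mult:
 assumes f: "C2 f Df D2f" and g: "C2 g Dg D2g"
 shows "C2 (\<lambda>x. f x * g x) (\<lambda>x. f x *\<^sub>R Dg x + g x *\<^sub>R Df x)
   (\<lambda>x. \<chi> i j. f x * D2g x $ i $ j + Dg x $ i * Df x $ j + (g x * D2f x $ i $ j + Df x $ i * Dg x $ j))"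
 unfolding C2_def
proof (intro conjI allI)
 have f1: "C1 f Df" and f2: "\<And>i. C1 (\<lambda>x. Df x $ i) (\<lambda>x. D2f x $ i)" and fs: "\<And>x i j. D2f x $ i $ j = D2f x $ j $ i"
  using f by (auto simp: C2_def)
 have g1: "C1 g Dg" and g2: "\<And>i. C1 (\<lambda>x. Dg x $ i) (\<lambda>x. D2g x $ i)" and gs: "\<And>x i j. D2g x $ i $ j = D2g x $ j $ i"
  using g by (auto simp: C2_def)
 show "C1 (\<lambda>x. f x * g x) (\<lambda>x. f x *\<^sub>R Dg x + g x *\<^sub>R Df x)" by (rule C1_mult[OF f1 g1])
 fix i
 have "C1 (\<lambda>x. f x * Dg x $ i + g x * Df x $ i) (\<lambda>x. (f x *\<^sub>R D2g x $ i + Dg x $ i *\<^sub>R Df x) + (g x *\<^sub>R D2f x $ i + Df x $ i *\<^sub>R Dg x))"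
  by (intro C1_add C1_mult f1 g1 f2 g2)
 moreover have "(\<lambda>x. (f x *\<^sub>R D2g x $ i + Dg x $ i *\<^sub>R Df x) + (g x *\<^sub>R D2f x $ i + Df x $ i *\<^sub>R Dg x))
   = (\<lambda>x. (\<chi> i j. f x * D2g x $ i $ j + Dg x $ i * Df x $ j + (g x * D2f x $ i $ j + Df x $ i * Dg x $ j)) $ i)"
  by (auto simp: vec_eq_iff)
 ultimately show "C1 (\<lambda>x. (f x *\<^sub>R Dg x + g x *\<^sub>R Df x) $ i) (\<lambda>x. (\<chi> i j. f x * D2g x $ i $ j + Dg x $ i * Df x $ j + (g x * D2f x $ i $ j + Df x $ i * Dg x $ j)) $ i)"
  by simp
 show "(\<chi> i j. f x * D2g x $ i $ j + Dg x $ i * Df x $ j + (g x * D2f x $ i $ j + Df x $ i * Dg x $ j)) $ i $ j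
   = (\<chi> i j. f x * D2g x $ i $ j + Dg x $ i * Df x $ j + (g x * D2f x $ i $ j + Df x $ i * Dg x $ j)) $ j $ i" for x j
  using fs gs by (simp add: algebra_simps)
qed

lemma C2_test2:
 assumes f: "C2 f Df D2f" and K: "compact K" "K \<subseteq> Om" "\<And>x. x \<notin> K ==> f x = 0"
 shows "test2 Om f Df D2f"
proof -
 have t: "test_fn Om f Df" using f by (intro test_fnI[OF _ K]) (simp add: C2_def)
 obtain K' where K': "compact K'" "K' \<subseteq> Om" "\<And>x. x \<notin> K' ==> Df x = 0"
  using test_fn_zero_outside[OF t] by metis
 have "test_fn Om (\<lambda>x. Df x $ i) (\<lambda>x. D2f x $ i)" for i
  by (rule test_fnI[OF _ K'(1,2)]) (use f K'(3) in \<open>auto simp: C2_def\<close>)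
 then show ?thesis using t f by (simp add: test2_def C2_def)
qed

text \<open>The quintic smoothstep, written with truncated powers so that it is visibly of class \<open>C\<^sup>2\<close>.\<close>
definition step :: "real => real" where
 "step t = 6 * (max 0 t)^5 - 15 * (max 0 t)^4 + 10 * (max 0 t)^3
   - (6 * (max 0 (t-1))^5 + 15 * (max 0 (t-1))^4 + 10 * (max 0 (t-1))^3)"
definition step' :: "real => real" where
 "step' t = 30 * (max 0 t)^4 - 60 * (max 0 t)^3 + 30 * (max 0 t)^2
   - (30 * (max 0 (t-1))^4 + 60 * (max 0 (t-1))^3 + 30 * (max 0 (t-1))^2)"
definition step'' :: "real => real" where
 "step'' t = 120 * (max 0 t)^3 - 180 * (max 0 t)^2 + 60 * max 0 t
   - (120 * (max 0 (t-1))^3 + 180 * (max 0 (t-1))^2 + 60 * max 0 (t-1))"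

lemma DERIV_max0_power_shift:
 assumes "n \<ge> 2"
 shows "((\<lambda>t. (max 0 (t - 1))^n) has_real_derivative real n * (max 0 (t - 1))^(n-1)) (at (t::real))"
proof -
 have "((\<lambda>t. (max 0 (t - 1))^n) has_real_derivative (real n * (max 0 (t - 1))^(n-1)) * 1) (at t)"
 proof (rule DERIV_chain2[where f = "\<lambda>t. (max 0 t)^n" and g = "\<lambda>t. t - 1"])
  show "((\<lambda>t. (max 0 t)^n) has_real_derivative real n * (max 0 (t - 1))^(n-1)) (at (t - 1))"
   by (rule DERIV_max0_power[OF assms])
 qed (auto intro!: derivative_eq_intros)
 then show ?thesis by simp
qed

lemma DERIV_step: "(step has_real_derivative step' t) (at t)" "(step' has_real_derivative step'' t) (at t)"
proof -
 note d = DERIV_max0_power[of 5 t] DERIV_max0_power[of 4 t] DERIV_max0_power[of 3 t] DERIV_max0_power[of 2 t]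
  DERIV_max0_power_shift[of 5 t] DERIV_max0_power_shift[of 4 t] DERIV_max0_power_shift[of 3 t] DERIV_max0_power_shift[of 2 t]
 note d' = d[simplified]
 show "(step has_real_derivative step' t) (at t)"
  unfolding step_def[abs_def] step'_def
  by (rule derivative_eq_intros d' refl | simp)+
 show "(step' has_real_derivative step'' t) (at t)"
  unfolding step'_def[abs_def] step''_def
  by (rule derivative_eq_intros d' refl | simp)+
qed

lemma continuous_step: "continuous_on UNIV step" "continuous_on UNIV step'" "continuous_on UNIV step''"
 unfolding step_def[abs_def] step'_def[abs_def] step''_def[abs_def] by (intro continuous_intros)+

lemma step_simps:
 "t \<le> 0 ==> step t = 0" "t \<le> 0 ==> step' t = 0" "t \<ge> 1 ==> step t = 1" "t \<ge> 1 ==> step' t = 0" "0 \<le> step' t" "step' t \<le> 2"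
 "0 \<le> step t" "step t \<le> 1"
proof -
 show a: "step t = 0" "step' t = 0" if "t \<le> 0" for t using that by (auto simp: step_def step'_def max_absorb1)
 have *: "max 0 t = t" "max 0 (t - 1) = t - 1" if "t \<ge> 1" for t :: real using that by auto
 show b: "step t = 1" "step' t = 0" if "t \<ge> 1" for t
  unfolding step_def step'_def *[OF that] by (simp_all add: power_numeral_reduce algebra_simps)
 \<comment> \<open>The factorisation shows the sign at once, and since t (1 - t) is at most 1/4 the
   value is at most 30/16, below 2.\<close>
 have c: "step' t = 30 * (t * (1 - t))\<^sup>2" if "0 \<le> t" "t \<le> 1" for t
  using that by (auto simp: step'_def max_absorb1 max_absorb2 power_numeral_reduce algebra_simps)
 show p: "0 \<le> step' t" for t
  using a(2)[of t] b(2)[of t] c[of t] by (cases "t \<le> 0"; cases "t \<ge> 1") auto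
 show "step' t \<le> 2"
 proof (cases "0 \<le> t \<and> t \<le> 1")
  case True
  have "t * (1 - t) = 1/4 - (t - 1/2)\<^sup>2" by (simp add: power2_eq_square algebra_simps)
  moreover have "0 \<le> (t - 1/2)\<^sup>2" by simp
  ultimately have "t * (1 - t) \<le> 1/4" by linarith
  moreover have "0 \<le> t * (1 - t)" using True by simp
  ultimately have "(t * (1 - t))\<^sup>2 \<le> (1/4)\<^sup>2" by (intro power_mono)
  then show ?thesis using c True by (simp add: power_divide)
 qed (use a(2)[of t] b(2)[of t] in auto)
 have mono: "step s \<le> step t" if "s \<le> t" for s t
  using DERIV_nonneg_imp_nondecreasing[OF that, of step] DERIV_step(1) p by blast
 show "0 \<le> step t" using mono[of "min 0 t" t] a(1)[of "min 0 t"] by simp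
 show "step t \<le> 1" using mono[of t "max 1 t"] b(1)[of "max 1 t"] by simp
qed

text \<open>A cutoff at infinity built on the squared norm, hence smooth also at the origin. It
  equals 1 on the ball of radius \<open>R\<close>, vanishes outside radius \<open>2 R\<close> and
  has gradient of order \<open>1 / R\<close>.\<close>

definition theta :: "real => real^'n => real" where "theta R x = step (2 - (x \<bullet> x) / R\<^sup>2)"
definition Dtheta :: "real => real^'n => real^'n" where "Dtheta R x = (- 2 * step' (2 - (x \<bullet> x) / R\<^sup>2) / R\<^sup>2) *\<^sub>R x"

lemma theta_C2: "\<exists>D2. C2 (theta R) (Dtheta R) D2"
proof -
 have c1: "C1 (\<lambda>x::real^'n. 2 - (x \<bullet> x) / R\<^sup>2) (\<lambda>x. (- 2 / R\<^sup>2) *\<^sub>R x)"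
  unfolding C1_def divide_inverse
  by (auto intro!: derivative_eq_intros continuous_intros simp: inner_commute algebra_simps)
 have c2: "C1 (\<lambda>x::real^'n. ((- 2 / R\<^sup>2) *\<^sub>R x) $ i) (\<lambda>x. (\<chi> i j. if i = j then - 2 / R\<^sup>2 else 0) $ i)" for i
 proof -
  have "C1 (\<lambda>x::real^'n. (- 2 / R\<^sup>2) * x $ i) (\<lambda>x. (- 2 / R\<^sup>2) *\<^sub>R axis i 1)" by (intro C1_cmult C1_coord)
  moreover have "(- 2 / R\<^sup>2) *\<^sub>R axis i 1 = (\<chi> i j. if i = j then - 2 / R\<^sup>2 else 0) $ i" by (auto simp: vec_eq_iff axis_def)
  ultimately show ?thesis by simp
 qed
 have "C2 (\<lambda>x::real^'n. 2 - (x \<bullet> x) / R\<^sup>2) (\<lambda>x. (- 2 / R\<^sup>2) *\<^sub>R x) (\<lambda>x. \<chi> i j. if i = j then - 2 / R\<^sup>2 else 0)"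
  using c1 c2 by (auto simp: C2_def)
 from C2_compose[OF this DERIV_step continuous_step(3)]
 show ?thesis unfolding theta_def[abs_def] Dtheta_def[abs_def] by (intro exI) (simp add: mult.commute)
qed

lemma theta_bounds:
 fixes x :: "real^'n"
 assumes R: "R > 0"
 shows "0 \<le> theta R x" "theta R x \<le> 1" "norm x \<le> R ==> theta R x = 1" "norm x \<ge> 2 * R ==> theta R x = 0"
  "norm (Dtheta R x) \<le> 8 / R" "norm x \<ge> 2 * R ==> Dtheta R x = 0"
proof -
 define q where "q = 2 - (x \<bullet> x) / R\<^sup>2"
 show "0 \<le> theta R x" "theta R x \<le> 1" by (auto simp: theta_def step_simps)
 have i: "x \<bullet> x = (norm x)\<^sup>2" by (simp add: power2_norm_eq_inner)
 show "theta R x = 1" if "norm x \<le> R"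
 proof -
  have "(norm x)\<^sup>2 \<le> R\<^sup>2" using that by (intro power_mono) auto
  then have "(x \<bullet> x) / R\<^sup>2 \<le> 1" using R by (simp add: i divide_le_eq)
  then show ?thesis by (simp add: theta_def step_simps)
 qed
 have far: "q \<le> 0" if "norm x \<ge> 2 * R"
 proof -
  have "(2 * R)\<^sup>2 \<le> (norm x)\<^sup>2" using that R by (intro power_mono) auto
  then have "(x \<bullet> x) / R\<^sup>2 \<ge> 4" using R by (simp add: i le_divide_eq power_mult_distrib)
  then show ?thesis by (simp add: q_def)
 qed
 show "theta R x = 0" if "norm x \<ge> 2 * R" using far[OF that] by (simp add: theta_def q_def step_simps)
 show D0: "Dtheta R x = 0" if "norm x \<ge> 2 * R" using far[OF that] by (simp add: Dtheta_def q_def step_simps)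
 show "norm (Dtheta R x) \<le> 8 / R"
 proof (cases "norm x \<ge> 2 * R")
  case False
  have "norm (Dtheta R x) = 2 * step' q / R\<^sup>2 * norm x" using step_simps(5)[of q] by (simp add: Dtheta_def q_def abs_mult)
  also have "\<dots> \<le> 2 * 2 / R\<^sup>2 * (2 * R)"
   using False step_simps(5,6)[of q] R by (intro mult_mono divide_right_mono mult_left_mono) auto
  also have "\<dots> = 8 / R" using R by (simp add: power2_eq_square)
  finally show ?thesis .
 qed (use D0 R in simp)
qed

section \<open>The Gaussian weight\<close>

definition gw :: "real^'n => real^'n => real" where
 "gw lam x = (\<Prod>k\<in>UNIV. normal_density 0 (sqrt (lam$k)) (x$k))"

lemma gw_pos: assumes "\<And>k. lam $ k > 0" shows "gw lam x > 0"
 unfolding gw_def by (intro prod_pos) (simp add: assms normal_density_pos)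

text \<open>Multiplied by \<open>lam $ k\<close>, the k-th derivative of the density is
  \<open>- x $ k\<close> times the density. This relation produces the drift of the
  Ornstein-Uhlenbeck operator whenever the weight is integrated by parts.\<close>

lemma C1_gw:
 assumes lam: "\<And>k. lam $ k > 0"
 shows "C1 (gw lam) (\<lambda>x. \<chi> k. - (x $ k / lam $ k) * gw lam x)"
proof -
 define c where "c = (\<Prod>k\<in>UNIV. 1 / sqrt (2 * pi * lam $ k))"
 have eq: "gw lam x = c * exp (\<Oplus>k. (- 1 / (2 * lam $ k)) * (x $ k * x $ k))" for x
  unfolding gw_def c_def normal_density_def using lam
  by (simp add: exp_sum prod.distrib[symmetric] power2_eq_square less_imp_le)
 have q: "C1 (\<lambda>x. \<Oplus>k. (- 1 / (2 * lam $ k)) * (x $ k * x $ k)) (\<lambda>x. \<Oplus>k. (- 1 / (2 * lam $ k)) *\<^sub>R (x $ k *\<^sub>R axis k 1 + x $ k *\<^sub>R axis k 1))"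
  by (intro C1_sum C1_cmult C1_mult C1_coord)
 have qe: "(\<Oplus>k. (- 1 / (2 * lam $ k)) *\<^sub>R (x $ k *\<^sub>R axis k 1 + x $ k *\<^sub>R axis k 1)) = (\<chi> k. - (x $ k / lam $ k))" for x
  unfolding vec_eq_iff
 proof
  fix i
  have "(\<Oplus>k. (- 1 / (2 * lam $ k)) *\<^sub>R (x $ k *\<^sub>R axis k 1 + x $ k *\<^sub>R axis k 1)) $ i = (\<Oplus>k. if k = i then - (x $ i / lam $ i) else 0)"
   unfolding sum_component by (intro sum.cong refl) (auto simp: axis_def)
  then show "(\<Oplus>k. (- 1 / (2 * lam $ k)) *\<^sub>R (x $ k *\<^sub>R axis k 1 + x $ k *\<^sub>R axis k 1)) $ i = (\<chi> k. - (x $ k / lam $ k)) $ i"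
   by simp
 qed
 have "C1 (gw lam) (\<lambda>x. c *\<^sub>R (exp (\<Oplus>k. (- 1 / (2 * lam $ k)) * (x $ k * x $ k)) *\<^sub>R (\<chi> k. - (x $ k / lam $ k))))"
  unfolding eq[abs_def] using C1_cmult[OF C1_compose[OF q[unfolded qe], of exp exp], of c]
  by (simp add: DERIV_exp continuous_on_exp[OF continuous_on_id, simplified])
 moreover have "(\<lambda>x. c *\<^sub>R (exp (\<Oplus>k. (- 1 / (2 * lam $ k)) * (x $ k * x $ k)) *\<^sub>R (\<chi> k. - (x $ k / lam $ k)))) = (\<lambda>x. \<chi> k. - (x $ k / lam $ k) * gw lam x)"
  by (auto simp: vec_eq_iff eq fun_eq_iff)
 ultimately show ?thesis by simp
qed

lemma gauss_eq: "gauss lam = density lborel (\<lambda>x. ennreal (gw lam x))"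
 by (simp add: gauss_def gw_def)

lemma gauss_integral:
 assumes lam: "\<And>k. lam $ k > 0" and f: "f \<in> borel_measurable borel"
 shows "integral\<^sup>L (gauss lam) f = (LBINT x. gw lam x * f x)"
  "integrable (gauss lam) f \<longleftrightarrow> integrable lborel (\<lambda>x. gw lam x * f x)"
proof -
 have [measurable]: "gw lam \<in> borel_measurable borel"
  using C1_continuous[OF C1_gw[OF lam]] by (rule borel_measurable_continuous_onI)
 have nn: "AE x in lborel. 0 \<le> gw lam x" using gw_pos[OF lam] less_imp_le by (intro AE_I2) blast
 show "integral\<^sup>L (gauss lam) f = (LBINT x. gw lam x * f x)"
  unfolding gauss_eq using f nn by (subst integral_density) auto
 show "integrable (gauss lam) f \<longleftrightarrow> integrable lborel (\<lambda>x. gw lam x * f x)"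
  unfolding gauss_eq using f nn by (subst integrable_density) auto
qed

text \<open>Hoelder continuity makes the Hessian continuous. Its symmetry is obtained weakly:
  against a \<open>test2\<close> function both mixed derivatives can be moved over completely, so
  the antisymmetric part integrates to zero against all test functions, and being continuous it
  vanishes everywhere.\<close>

lemma C2alpha_loc_C2:
 fixes g :: "real^'n => real"
 assumes al: "\<alpha> > 0" and g: "C2alpha_loc \<alpha> g Dg D2g"
 shows "C2 g Dg D2g"
proof -
 have d: "(g has_derivative (\<lambda>v. Dg x \<bullet> v)) (at x)" "(Dg has_derivative (\<lambda>v. D2g x *v v)) (at x)" for x
  using g by (auto simp: C2alpha_loc_def)
 have cDg: "continuous_on UNIV Dg"
  by (intro continuous_at_imp_continuous_on ballI has_derivative_continuous[OF d(2)])
 have cD2: "continuous_on UNIV D2g"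
 proof (rule continuous_at_imp_continuous_on, rule ballI)
  fix x
  obtain M where M: "\<And>y z. y \<in> cball x 1 ==> z \<in> cball x 1 ==> norm (D2g y - D2g z) \<le> M * dist y z powr \<alpha>"
   using g compact_cball unfolding C2alpha_loc_def by metis
  have "((\<lambda>y. D2g y - D2g x) \<longlongrightarrow> 0) (at x)"
  proof (rule Lim_null_comparison)
   show "\<forall>\<^sub>F y in at x. norm (D2g y - D2g x) \<le> M * dist y x powr \<alpha>"
   proof -
    have "\<forall>\<^sub>F y in at x. y \<in> ball x 1" by (auto simp: eventually_at dist_commute intro!: exI[of _ 1])
    then show ?thesis by eventually_elim (use M[of _ x] in auto)
   qed
   have "((\<lambda>y. dist y x powr \<alpha>) \<longlongrightarrow> 0 powr \<alpha>) (at x)"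
    by (rule tendsto_powr2) (use al in \<open>auto intro!: tendsto_eq_intros\<close>)
   then show "((\<lambda>y. M * dist y x powr \<alpha>) \<longlongrightarrow> 0) (at x)" by (intro tendsto_mult_right_zero) simp
  qed
  then show "isCont D2g x" unfolding isCont_def by (rule LIM_zero_cancel)
 qed
 have g1: "C1 g Dg" using d cDg by (simp add: C1_def)
 have g2: "C1 (\<lambda>x. Dg x $ i) (\<lambda>x. D2g x $ i)" for i
  unfolding C1_def
 proof (intro conjI allI)
  fix x
  have "((\<lambda>x. Dg x $ i) has_derivative (\<lambda>v. (D2g x *v v) $ i)) (at x)"
   by (rule bounded_linear.has_derivative[OF bounded_linear_vec_nth d(2)])
  then show "((\<lambda>x. Dg x $ i) has_derivative (\<lambda>v. D2g x $ i \<bullet> v)) (at x)"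
   by (simp add: matrix_vector_mul_component)
  show "continuous_on UNIV (\<lambda>x. D2g x $ i)" using cD2 by (intro continuous_intros)
 qed
 have sym: "D2g x $ i $ j = D2g x $ j $ i" for x i j
 proof -
  define A where "A x = D2g x $ i $ j - D2g x $ j $ i" for x
  have Ac: "continuous_on UNIV A" unfolding A_def using cD2 by (intro continuous_intros)
  have "AE x in lborel. x \<in> UNIV \<longrightarrow> A x = 0"
  proof (rule fundamental_lemma_L2loc[OF open_UNIV L2loc_continuous[OF Ac] L2loc_continuous])
   fix \<phi> :: "real^'n => real" and D\<phi> assume t: "test_fn UNIV \<phi> D\<phi>"
   \<comment> \<open>Zero coefficients for the gradient: the extension lemma is used only to pass
     from \<open>test2\<close> functions to all test functions.\<close>
   have "null_integral (\<lambda>x. A x * \<phi> x + (\<Oplus>l. 0 * D\<phi> x $ l))"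
   proof (rule linear_extension[OF open_UNIV L2loc_continuous[OF Ac] L2loc_continuous _ Wc_test_fn[OF t], of "\<lambda>l x. 0"])
    fix z :: "real^'n => real" and Dz D2z assume z: "test2 UNIV z Dz D2z"
    have z1: "test_fn UNIV z Dz" "\<And>l. test_fn UNIV (\<lambda>x. Dz x $ l) (\<lambda>x. D2z x $ l)" "\<And>x i j. D2z x $ i $ j = D2z x $ j $ i"
     using z by (auto simp: test2_def)
    have w: "has_bochner_integral lborel (\<lambda>x. (Dg x $ i * Dz x $ j + D2g x $ i $ j * z x) - (g x * D2z x $ j $ i + Dg x $ i * Dz x $ j)) (0 - 0)" for i j
     by (intro has_bochner_integral_diff weak_pderivD_null[OF weak_pderiv_C1[OF g1] z1(2)] weak_pderivD_null[OF weak_pderiv_C1[OF g2] z1(1)])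
    have "null_integral (\<lambda>x. A x * z x + (\<Oplus>l. 0 * Dz x $ l))"
     using has_bochner_integral_diff[OF w[of i j] w[of j i]] by (simp add: A_def z1(3)[of _ i j] algebra_simps)
    then show "(LBINT x. A x * z x + (\<Oplus>l. 0 * Dz x $ l)) = 0" by (simp add: has_bochner_integral_iff)
   qed (rule continuous_on_const)
   then show "(LBINT x. A x * \<phi> x) = (LBINT x. 0 * \<phi> x)" by (simp add: has_bochner_integral_iff)
  qed (rule continuous_on_const)
  then have "AE x in lborel. x \<in> {x. A x = 0}" by simp
  from mem_closed_if_AE_lebesgue[OF _ AE_completion[OF this], of x] have "A x = 0"
   using closed_Collect_eq[OF Ac continuous_on_const[of UNIV 0]] by simp
  then show ?thesis by (simp add: A_def)
 qed
 show ?thesis unfolding C2_def using g1 g2 sym by blast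
qed

lemma sets_gauss [simp, measurable_cong]: "sets (gauss lam) = sets borel"
 by (simp add: gauss_def)

lemma space_gauss [simp]: "space (gauss lam) = UNIV"
 by (simp add: gauss_def)

lemma measurable_gauss: "borel_measurable (gauss lam) = borel_measurable borel"
 by (rule measurable_cong_sets) simp_all

lemma sigma_finite_gauss: assumes lam: "\<And>k. lam $ k > 0" shows "sigma_finite_measure (gauss lam)"
proof -
 have [measurable]: "gw lam \<in> borel_measurable borel"
  using C1_continuous[OF C1_gw[OF lam]] by (rule borel_measurable_continuous_onI)
 show ?thesis unfolding gauss_eq
  by (subst sigma_finite_measure.sigma_finite_iff_density_finite[OF sigma_finite_lborel]) auto
qed

lemma AE_gauss: assumes lam: "\<And>k. lam $ k > 0" shows "(AE x in gauss lam. P x) \<longleftrightarrow> (AE x in lborel. P x)"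
proof -
 have [measurable]: "gw lam \<in> borel_measurable borel"
  using C1_continuous[OF C1_gw[OF lam]] by (rule borel_measurable_continuous_onI)
 show ?thesis unfolding gauss_eq using gw_pos[OF lam] by (subst AE_density) auto
qed

lemma L2_gauss_iff:
 assumes lam: "\<And>k. lam $ k > 0"
 shows "L2 (gauss lam) f \<longleftrightarrow> f \<in> borel_measurable borel \<and> integrable lborel (\<lambda>x. gw lam x * (f x)\<^sup>2)"
 unfolding L2_def measurable_gauss using gauss_integral(2)[OF lam, of "\<lambda>x. (f x)\<^sup>2"] by auto

lemma gw_inverse_continuous: assumes lam: "\<And>k. lam $ k > 0" shows "continuous_on UNIV (\<lambda>x. 1 / gw lam x)"
 using C1_continuous[OF C1_gw[OF lam]] gw_pos[OF lam] by (intro continuous_intros) (auto simp: less_le)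

lemma L2_gauss_L2loc:
 assumes lam: "\<And>k. lam $ k > 0" and f: "L2 (gauss lam) f" shows "L2loc Om f"
 unfolding L2loc_def
proof (intro conjI allI impI)
 show fm: "f \<in> borel_measurable borel" using f L2_gauss_iff[OF lam] by blast
 fix K :: "(real^'a) set" assume K: "compact K"
 have i: "integrable lborel (\<lambda>x. gw lam x * (f x)\<^sup>2)" using f L2_gauss_iff[OF lam] by blast
 have "bounded ((\<lambda>x. 1 / gw lam x) ` K)"
  by (intro compact_imp_bounded compact_continuous_image K continuous_on_subset[OF gw_inverse_continuous[OF lam]]) auto
 then obtain C where C: "\<And>x. x \<in> K ==> \<bar>1 / gw lam x\<bar> \<le> C" by (auto simp: bounded_iff)
 show "integrable lborel (\<lambda>x. indicator K x * (f x)\<^sup>2)"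
 proof (rule Bochner_Integration.integrable_bound)
  show "integrable lborel (\<lambda>x. C * (gw lam x * (f x)\<^sup>2))" using i by simp
  show "(\<lambda>x. indicator K x * (f x)\<^sup>2) \<in> borel_measurable lborel"
   using fm borel_compact[OF K] by simp
  show "AE x in lborel. norm (indicator K x * (f x)\<^sup>2) \<le> norm (C * (gw lam x * (f x)\<^sup>2))"
  proof (rule AE_I2)
   fix x
   show "norm (indicator K x * (f x)\<^sup>2) \<le> norm (C * (gw lam x * (f x)\<^sup>2))"
   proof (cases "x \<in> K")
    case True
    have p: "gw lam x > 0" by (rule gw_pos[OF lam])
    have "1 \<le> C * gw lam x" using C[OF True] p by (simp add: field_simps)
    then have "1 * (f x)\<^sup>2 \<le> C * gw lam x * (f x)\<^sup>2" by (rule mult_right_mono) simp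
    then show ?thesis using True by (simp add: mult.assoc)
   qed simp
  qed
 qed
qed

lemma cc_L2_gauss: assumes lam: "\<And>k. lam $ k > 0" and c: "cc Om \<phi>" shows "L2 (gauss lam) \<phi>"
proof -
 have "integrable lborel (\<lambda>x. \<phi> x * (gw lam x * \<phi> x))"
  using L2_integrable_mult[OF cc_L2[OF c] cc_L2[OF cc_mult[OF C1_continuous[OF C1_gw[OF lam]] c]]] .
 then show ?thesis unfolding L2_gauss_iff[OF lam] using cc_measurable[OF c] by (simp add: power2_eq_square mult.left_commute)
qed

lemma integral_cc_gauss:
 assumes lam: "\<And>k. lam $ k > 0" and f: "f \<in> borel_measurable borel" and c: "cc Om \<phi>"
 shows "(LBINT x. f x * \<phi> x) = (LINT x|gauss lam. f x * (1 / gw lam x * \<phi> x))"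
proof -
 have [measurable]: "gw lam \<in> borel_measurable borel"
  using C1_continuous[OF C1_gw[OF lam]] by (rule borel_measurable_continuous_onI)
 have "gw lam x * (f x * (1 / gw lam x * \<phi> x)) = f x * \<phi> x" for x using gw_pos[OF lam, of x] by simp
 then show ?thesis using f cc_measurable[OF c] by (subst gauss_integral[OF lam]) auto
qed

section \<open>Weighted Sobolev space and the penalised problem\<close>

definition HW :: "real^'n => (real^'n => real) => ('n => real^'n => real) => bool" where
 "HW lam u Du \<longleftrightarrow> L2 (gauss lam) u \<and> (\<forall>l. L2 (gauss lam) (Du l) \<and> weak_pderiv UNIV u l (Du l))"

lemma HW_W1: assumes lam: "\<And>k. lam $ k > 0" and "HW lam u Du" shows "W1 Om u Du"
 using assms(2) L2_gauss_L2loc[OF lam] weak_pderiv_mono[of UNIV] unfolding HW_def W1_def by blast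

lemma HW_lincomb:
 assumes lam: "\<And>k. lam $ k > 0" and u: "HW lam u Du" and v: "HW lam v Dv"
 shows "HW lam (\<lambda>x. a * u x + b * v x) (\<lambda>l x. a * Du l x + b * Dv l x)"
proof -
 have "W1 UNIV (\<lambda>x. a * u x + b * v x) (\<lambda>l x. (a * Du l x + u x * (0::real^'a) $ l) + (b * Dv l x + v x * (0::real^'a) $ l))"
  by (intro W1_add W1_mult[OF _ C1_const] HW_W1[OF lam u] HW_W1[OF lam v])
 then show ?thesis using u v unfolding HW_def W1_def by (auto intro!: L2_add L2_cmult)
qed

lemma HW_test_fn: assumes lam: "\<And>k. lam $ k > 0" and t: "test_fn Om z Dz" shows "HW lam z (\<lambda>l x. Dz x $ l)"
 unfolding HW_def using cc_L2_gauss[OF lam] test_fn_cc[OF t] weak_pderiv_C1[OF test_fn_C1[OF t]] by blast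

text \<open>Dividing a test function by the Gaussian density leaves a bounded compactly supported
  function, so convergence in the weighted space implies convergence of the unweighted
  pairings.\<close>

lemma weak_pderiv_closed:
 assumes lam: "\<And>k. lam $ k > 0"
  and u: "\<And>n. L2 (gauss lam) (un n)" "L2 (gauss lam) u" "(\<lambda>n. \<integral>x. (un n x - u x)\<^sup>2 \<partial>gauss lam) \<longlonglongrightarrow> 0"
  and d: "\<And>n. L2 (gauss lam) (dn n)" "L2 (gauss lam) d" "(\<lambda>n. \<integral>x. (dn n x - d x)\<^sup>2 \<partial>gauss lam) \<longlonglongrightarrow> 0"
  and w: "\<And>n. weak_pderiv UNIV (un n) l (dn n)"
 shows "weak_pderiv UNIV u l d"
proof (rule weak_pderiv_L2locI[OF L2_gauss_L2loc[OF lam u(2)] L2_gauss_L2loc[OF lam d(2)]])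
 fix \<phi> :: "real^'a => real" and D\<phi> assume t: "test_fn UNIV \<phi> D\<phi>"
 have lim: "(\<lambda>n. \<integral>x. un n x * \<psi> x \<partial>lborel) \<longlonglongrightarrow> (LBINT x. u x * \<psi> x)"
  if u: "\<And>n. L2 (gauss lam) (un n)" "L2 (gauss lam) u" "(\<lambda>n. \<integral>x. (un n x - u x)\<^sup>2 \<partial>gauss lam) \<longlonglongrightarrow> 0" and c: "cc UNIV \<psi>"
  for un u and \<psi> :: "real^'a => real"
 proof -
  have m: "u \<in> borel_measurable borel" "un n \<in> borel_measurable borel" for n
   using u(1,2) L2_gauss_iff[OF lam] by blast+
  show ?thesis
   unfolding integral_cc_gauss[OF lam m(1) c] integral_cc_gauss[OF lam m(2) c]
   by (rule L2_tendsto_integral_mult[OF u(1,2) _ u(3)])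
     (rule cc_L2_gauss[OF lam cc_mult[OF gw_inverse_continuous[OF lam] c]])
 qed
 have "(\<lambda>n. - (LBINT x. dn n x * \<phi> x)) \<longlonglongrightarrow> (LBINT x. u x * D\<phi> x $ l)"
  using lim[OF u test_fn_cc(2)[OF t, of l]] weak_pderivD(3)[OF w t] by simp
 moreover have "(\<lambda>n. - (LBINT x. dn n x * \<phi> x)) \<longlonglongrightarrow> - (LBINT x. d x * \<phi> x)"
  by (intro tendsto_minus lim[OF d test_fn_cc(1)[OF t]])
 ultimately show "(LBINT x. u x * D\<phi> x $ l) = - (LBINT x. d x * \<phi> x)" by (rule LIMSEQ_unique)
qed

text \<open>The almost minimisers of \<open>riesz_sequence\<close> are Cauchy in the function and in
  every derivative. \<open>weak_pderiv_closed\<close> identifies the limits of the derivatives as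
  the derivatives of the limit.\<close>

lemma lax_milgram_HW:
 fixes lam :: "real^'n"
 assumes lam: "\<And>k. lam $ k > 0" and lmb: "lmb > 0"
  and V: "V \<in> borel_measurable borel" "\<And>x. 0 \<le> V x" "\<And>x. V x \<le> C" and f: "L2 (gauss lam) f"
 obtains u Du where "HW lam u Du"
  "\<And>\<psi> D\<psi>. HW lam \<psi> D\<psi> ==> (LINT x|gauss lam. ((lmb + V x) * u x) * \<psi> x)
    + (\<Oplus>l. lam $ l / 2 * (LINT x|gauss lam. Du l x * D\<psi> l x)) = (LINT x|gauss lam. f x * \<psi> x)"
proof -
 define M where "M = gauss lam"
 \<comment> \<open>A function and its gradient are encoded as one real function on
   \<open>'n option \<times> (real^'n)\<close>: the component \<open>None\<close> holds the
   function, \<open>Some l\<close> the l-th derivative. In this form the pair fits the abstract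
   Riesz lemma, whose space consists of real functions.\<close>
 define S where "S = {s :: 'n option \<times> (real^'n) => real. HW lam (\<lambda>x. s (None, x)) (\<lambda>l x. s (Some l, x))}"
 define V' where "V' x = lmb + V x" for x
 have V'm: "V' \<in> borel_measurable M" unfolding V'_def M_def measurable_gauss using V(1) by simp
 have V'b: "\<bar>V' x\<bar> \<le> lmb + C" "V' x \<ge> lmb" for x using V(2,3)[of x] lmb by (auto simp: V'_def)
 define B where "B s t = (LINT x|M. (V' x * s (None, x)) * t (None, x)) + (\<Oplus>l. lam $ l / 2 * (LINT x|M. s (Some l, x) * t (Some l, x)))"
  for s t :: "'n option \<times> (real^'n) => real"
 define l where "l s = (LINT x|M. f x * s (None, x))" for s :: "'n option \<times> (real^'n) => real"
 have SL: "L2 M (\<lambda>x. s (None, x))" "L2 M (\<lambda>x. s (Some k, x))" "weak_pderiv UNIV (\<lambda>x. s (None, x)) k (\<lambda>x. s (Some k, x))" if "s \<in> S" for s k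
  using that by (auto simp: S_def HW_def M_def)
 have VL: "L2 M (\<lambda>x. V' x * v x)" if "L2 M v" for v by (rule L2_bounded_mult[OF that V'm V'b(1)])
 have lin: "(\<lambda>x. a * s x + b * t x) \<in> S" if "s \<in> S" "t \<in> S" for s t a b
  using HW_lincomb[OF lam, of "\<lambda>x. s (None, x)" "\<lambda>l x. s (Some l, x)" "\<lambda>x. t (None, x)" "\<lambda>l x. t (Some l, x)" a b] that by (simp add: S_def)
 have sq: "V' x * a * a = V' x * a\<^sup>2" for x a by (simp add: power2_eq_square)
 have lower: "lmb * (LINT x|M. (s (None, x))\<^sup>2) \<le> B s s" "lam $ k / 2 * (LINT x|M. (s (Some k, x))\<^sup>2) \<le> B s s" "0 \<le> B s s" if s: "s \<in> S" for s k
 proof -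
  have i1: "integrable M (\<lambda>x. V' x * (s (None, x))\<^sup>2)"
   using L2_integrable_mult[OF VL[OF SL(1)[OF s]] SL(1)[OF s]] by (simp only: sq)
  have "(LINT x|M. lmb * (s (None, x))\<^sup>2) \<le> (LINT x|M. V' x * (s (None, x))\<^sup>2)"
   by (rule integral_mono[OF _ i1]) (use L2_integrable_square[OF SL(1)[OF s]] V'b(2) in \<open>auto intro!: mult_right_mono\<close>)
  then have a: "lmb * (LINT x|M. (s (None, x))\<^sup>2) \<le> (LINT x|M. V' x * s (None, x) * s (None, x))" by (simp only: sq) simp
  have b: "0 \<le> lam $ k / 2 * (LINT x|M. s (Some k, x) * s (Some k, x))" for k
   using lam[of k] by (intro mult_nonneg_nonneg) (auto simp: less_imp_le intro!: integral_nonneg_AE)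
  have "0 \<le> lmb * (LINT x|M. (s (None, x))\<^sup>2)" using lmb by simp
  then show "lmb * (LINT x|M. (s (None, x))\<^sup>2) \<le> B s s" "0 \<le> B s s"
   unfolding B_def using a sum_nonneg[of UNIV "\<lambda>k. lam $ k / 2 * (LINT x|M. s (Some k, x) * s (Some k, x))"] b by auto
  have "lam $ k / 2 * (LINT x|M. s (Some k, x) * s (Some k, x)) \<le> (\<Oplus>k. lam $ k / 2 * (LINT x|M. s (Some k, x) * s (Some k, x)))"
   by (rule member_le_sum) (use b in auto)
  then show "lam $ k / 2 * (LINT x|M. (s (Some k, x))\<^sup>2) \<le> B s s"
   unfolding B_def using a \<open>0 \<le> lmb * (LINT x|M. (s (None, x))\<^sup>2)\<close> by (simp add: power2_eq_square)
 qed
 have fM: "L2 M f" using f by (simp add: M_def)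
 obtain s where s: "\<And>n. s n \<in> S"
  and C: "\<And>e. e > 0 ==> \<exists>N::nat. \<forall>m\<ge>N. \<forall>n\<ge>N. B (\<lambda>x. s m x - s n x) (\<lambda>x. s m x - s n x) < e"
  and lim: "\<And>t. t \<in> S ==> (\<lambda>n. B (s n) t) \<longlonglongrightarrow> l t"
 proof (rule riesz_sequence[of S B l "(LINT x|M. (f x)\<^sup>2) / lmb"])
  have "HW lam (\<lambda>x. 0) (\<lambda>l x. 0)" using W1_zero[of "UNIV::(real^'n) set"] by (simp add: HW_def W1_def)
  then show "S \<noteq> {}" by (auto simp: S_def intro!: exI[of _ "\<lambda>p. 0"])
  show "B s t = B t s" for s t by (simp add: B_def mult.commute mult.left_commute)
  show "B (\<lambda>x. a * s x + b * t x) r = a * B s r + b * B t r" if str: "s \<in> S" "t \<in> S" "r \<in> S" for s t r a b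
  proof -
   have 1: "(LINT x|M. (V' x * (a * s (None, x) + b * t (None, x))) * r (None, x)) = a * (LINT x|M. (V' x * s (None, x)) * r (None, x)) + b * (LINT x|M. (V' x * t (None, x)) * r (None, x))"
    using L2_integrable_mult[OF VL[OF SL(1)[OF str(1)]] SL(1)[OF str(3)]] L2_integrable_mult[OF VL[OF SL(1)[OF str(2)]] SL(1)[OF str(3)]]
    by (simp add: distrib_left distrib_right mult.assoc mult.left_commute)
   have 2: "(LINT x|M. (a * s (Some k, x) + b * t (Some k, x)) * r (Some k, x)) = a * (LINT x|M. s (Some k, x) * r (Some k, x)) + b * (LINT x|M. t (Some k, x) * r (Some k, x))" for k
    using L2_integrable_mult[OF SL(2)[OF str(1)] SL(2)[OF str(3)]] L2_integrable_mult[OF SL(2)[OF str(2)] SL(2)[OF str(3)]]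
    by (simp add: distrib_left distrib_right mult.assoc mult.left_commute)
   show ?thesis unfolding B_def 1 2 by (simp add: distrib_left sum.distrib sum_distrib_left mult.left_commute)
  qed
  show "l (\<lambda>x. a * s x + b * t x) = a * l s + b * l t" if "s \<in> S" "t \<in> S" for s t a b
   unfolding l_def using L2_integrable_mult[OF fM SL(1)[OF that(1)]] L2_integrable_mult[OF fM SL(1)[OF that(2)]]
   by (simp add: distrib_left mult.left_commute)
  show "(l s)\<^sup>2 \<le> (LINT x|M. (f x)\<^sup>2) / lmb * B s s" if "s \<in> S" for s
  proof -
   have "(l s)\<^sup>2 \<le> (LINT x|M. (f x)\<^sup>2) * (LINT x|M. (s (None, x))\<^sup>2)" unfolding l_def by (rule Cauchy_Schwarz_L2[OF fM SL(1)[OF that]])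
   also have "\<dots> \<le> (LINT x|M. (f x)\<^sup>2) * (B s s / lmb)"
    using lower(1)[OF that] lmb by (intro mult_left_mono) (auto simp: field_simps)
   finally show ?thesis by simp
  qed
 qed (use lin lower(3) in auto)
 have dS: "(\<lambda>x. s m x - s n x) \<in> S" for m n using lin[OF s[of m] s[of n], of 1 "-1"] by simp
 have sf: "sigma_finite_measure M" unfolding M_def by (rule sigma_finite_gauss[OF lam])
 obtain u where u: "L2 M u" "(\<lambda>n. \<integral>x. (s n (None, x) - u x)\<^sup>2 \<partial>M) \<longlonglongrightarrow> 0"
 proof (rule L2_complete_sigma_finite[OF sf, of "\<lambda>n x. s n (None, x)"])
  show "L2 M (\<lambda>x. s n (None, x))" for n by (rule SL(1)[OF s])
  fix e :: real assume "e > 0"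
  then obtain N where N: "\<forall>m\<ge>N. \<forall>n\<ge>N. B (\<lambda>x. s m x - s n x) (\<lambda>x. s m x - s n x) < lmb * e" using C[of "lmb * e"] lmb by auto
  have "(LINT x|M. (s m (None, x) - s n (None, x))\<^sup>2) < e" if "m \<ge> N" "n \<ge> N" for m n
  proof -
   have "lmb * (LINT x|M. (s m (None, x) - s n (None, x))\<^sup>2) < lmb * e"
    using lower(1)[OF dS[of m n]] N that by fastforce
   then show ?thesis using lmb by simp
  qed
  then show "\<exists>N. \<forall>m\<ge>N. \<forall>n\<ge>N. (LINT x|M. (s m (None, x) - s n (None, x))\<^sup>2) < e" by blast
 qed (rule that)
 have "\<exists>d. L2 M d \<and> (\<lambda>n. \<integral>x. (s n (Some k, x) - d x)\<^sup>2 \<partial>M) \<longlonglongrightarrow> 0" for k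
 proof (rule L2_complete_sigma_finite[OF sf, of "\<lambda>n x. s n (Some k, x)"])
  show "L2 M (\<lambda>x. s n (Some k, x))" for n by (rule SL(2)[OF s])
  fix e :: real assume "e > 0"
  then obtain N where N: "\<forall>m\<ge>N. \<forall>n\<ge>N. B (\<lambda>x. s m x - s n x) (\<lambda>x. s m x - s n x) < lam $ k / 2 * e" using C[of "lam $ k / 2 * e"] lam[of k] by auto
  have "(LINT x|M. (s m (Some k, x) - s n (Some k, x))\<^sup>2) < e" if "m \<ge> N" "n \<ge> N" for m n
  proof -
   have "lam $ k / 2 * (LINT x|M. (s m (Some k, x) - s n (Some k, x))\<^sup>2) < lam $ k / 2 * e"
    using lower(2)[OF dS[of m n], of k] N that by fastforce
   then show ?thesis using lam[of k] by simp
  qed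
  then show "\<exists>N. \<forall>m\<ge>N. \<forall>n\<ge>N. (LINT x|M. (s m (Some k, x) - s n (Some k, x))\<^sup>2) < e" by blast
 qed blast
 then have "\<forall>k. \<exists>d. L2 M d \<and> (\<lambda>n. \<integral>x. (s n (Some k, x) - d x)\<^sup>2 \<partial>M) \<longlonglongrightarrow> 0" ..
 from choice[OF this] obtain Du where "\<forall>k. L2 M (Du k) \<and> (\<lambda>n. \<integral>x. (s n (Some k, x) - Du k x)\<^sup>2 \<partial>M) \<longlonglongrightarrow> 0" ..
 then have Du: "L2 M (Du k)" "(\<lambda>n. \<integral>x. (s n (Some k, x) - Du k x)\<^sup>2 \<partial>M) \<longlonglongrightarrow> 0" for k by simp_all
 have H: "HW lam u Du"
  unfolding HW_def M_def[symmetric]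
 proof (intro conjI allI)
  show "weak_pderiv UNIV u k (Du k)" for k
   by (rule weak_pderiv_closed[OF lam, folded M_def, OF SL(1)[OF s] u SL(2)[OF s] Du SL(3)[OF s]])
 qed (use u Du in auto)
 show thesis
 proof (rule that[OF H])
  fix \<psi> D\<psi> assume p: "HW lam \<psi> D\<psi>"
  define t where "t = (\<lambda>p. case p of (None, x) => \<psi> x | (Some k, x) => D\<psi> k x)"
  have t: "t \<in> S" "\<And>x. t (None, x) = \<psi> x" "\<And>k x. t (Some k, x) = D\<psi> k x" using p by (auto simp: t_def S_def)
  have pL: "L2 M \<psi>" "\<And>k. L2 M (D\<psi> k)" using p by (auto simp: HW_def M_def)
  have c: "V' x * a * b = a * (V' x * b)" for x a b by simp
  have "(\<lambda>n. B (s n) t) \<longlonglongrightarrow> (LINT x|M. V' x * u x * \<psi> x) + (\<Oplus>l. lam $ l / 2 * (LINT x|M. Du l x * D\<psi> l x))"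
   unfolding B_def t c
   by (intro tendsto_intros L2_tendsto_integral_mult[OF SL(1)[OF s] u(1) VL[OF pL(1)] u(2)]
      L2_tendsto_integral_mult[OF SL(2)[OF s] Du(1) pL(2) Du(2)])
  from LIMSEQ_unique[OF this lim[OF t(1)]]
  show "(LINT x|gauss lam. ((lmb + V x) * u x) * \<psi> x)
    + (\<Oplus>l. lam $ l / 2 * (LINT x|gauss lam. Du l x * D\<psi> l x)) = (LINT x|gauss lam. f x * \<psi> x)"
   by (simp add: l_def t V'_def M_def)
 qed
qed

section \<open>Sublevel domains and the penalised problem on the whole space\<close>

locale regular_domain =
 fixes lam :: "real^'n" and g :: "real^'n => real" and Dg :: "real^'n => real^'n" and D2g :: "real^'n => real^'n^'n"
 assumes lam: "\<And>k. lam $ k > 0" and gC2: "C2 g Dg D2g" and Dg_nz: "\<And>x. g x = 0 ==> Dg x \<noteq> 0"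
begin

abbreviation "Om \<equiv> {x. g x < 0}"

lemma gC1: "C1 g Dg" and DgC1: "C1 (\<lambda>x. Dg x $ i) (\<lambda>x. D2g x $ i)" and D2g_sym: "D2g x $ i $ j = D2g x $ j $ i"
 using gC2 by (auto simp: C2_def)

lemma g_continuous: "continuous_on UNIV g" by (rule C1_continuous[OF gC1])
lemma Dg_continuous: "continuous_on UNIV (\<lambda>x. Dg x $ i)" by (rule C1_continuous[OF DgC1])
lemma D2g_continuous: "continuous_on UNIV (\<lambda>x. D2g x $ i $ j)" by (rule C1_continuous_D[OF DgC1])
lemma g_measurable [measurable]: "g \<in> borel_measurable borel" by (rule borel_measurable_continuous_onI[OF g_continuous])

lemma open_Om: "open Om"
 using open_Collect_less[OF g_continuous continuous_on_const[of UNIV 0]] .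

lemma theta_test2: "R > 0 ==> \<exists>D2. test2 UNIV (theta R :: real^'n => real) (Dtheta R) D2"
proof -
 assume R: "R > 0"
 obtain D2 where "C2 (theta R :: real^'n => real) (Dtheta R) D2" using theta_C2 by blast
 then have "test2 UNIV (theta R :: real^'n => real) (Dtheta R) D2"
 proof (rule C2_test2[of _ _ _ "cball 0 (2 * R)"])
  show "theta R x = 0" if "x \<notin> cball 0 (2 * R)" for x :: "real^'n" using theta_bounds(4)[OF R, of x] that by simp
 qed auto
 then show ?thesis by blast
qed

lemma theta_test: "R > 0 ==> test_fn UNIV (theta R :: real^'n => real) (Dtheta R)"
 using theta_test2 by (auto simp: test2_def)

text \<open>Integrating \<open>div (theta arctan(g/e) Dg)\<close> bounds \<open>1/e\<close> times the \<open>theta |Dg|\<^sup>2\<close>-mass of the zero set.\<close>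
lemma AE_g_nonzero: "AE x in lborel. g x \<noteq> 0"
proof -
 have "AE x in lborel. norm x \<le> R \<longrightarrow> g x \<noteq> 0" if R: "R > 0" for R
 proof -
  let ?th = "theta R :: real^'n => real"
  define q where "q x = (\<Oplus>i. (Dg x $ i)\<^sup>2)" for x
  define b where "b x = (\<Oplus>i. (Dg x $ i *\<^sub>R Dtheta R x + ?th x *\<^sub>R D2g x $ i) $ i)" for x
  have tB: "test_fn UNIV (\<lambda>x. Dg x $ i * ?th x) (\<lambda>x. Dg x $ i *\<^sub>R Dtheta R x + ?th x *\<^sub>R D2g x $ i)" for i
   by (rule test_fn_mult[OF DgC1 theta_test[OF R]])
  have bi: "integrable lborel b" unfolding b_def
   by (intro Bochner_Integration.integrable_sum cc_integrable[OF test_fn_cc(2)[OF tB]])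
  have cq: "continuous_on UNIV q" unfolding q_def by (intro continuous_intros Dg_continuous)
  have ccq: "cc UNIV (\<lambda>x. q x * ?th x)" by (rule cc_mult[OF cq test_fn_cc(1)[OF theta_test[OF R]]])
  define Z where "Z = {x. g x = 0}"
  have [measurable]: "Z \<in> sets borel" unfolding Z_def by measurable
  have zi: "integrable lborel (\<lambda>x. indicator Z x * (q x * ?th x))"
   using integrable_mult_indicator[OF _ cc_integrable[OF ccq], of Z] by simp
  have est: "(LBINT x. indicator Z x * (q x * ?th x)) \<le> e * (2 * (LBINT x. \<bar>b x\<bar>))" if e: "e > 0" for e
  proof -
   define h' where "h' t = (1 / e) / (1 + (t / e)\<^sup>2)" for t
   have pos1: "1 + (t / e)\<^sup>2 > 0" for t by (rule add_pos_nonneg) auto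
   have dh: "((\<lambda>t. arctan (t / e)) has_real_derivative h' t) (at t)" for t
    unfolding h'_def using e by (auto intro!: derivative_eq_intros simp: field_simps)
   have ch: "continuous_on UNIV h'" unfolding h'_def using pos1 e by (intro continuous_intros) (auto simp: less_le)
   have A: "C1 (\<lambda>x. arctan (g x / e)) (\<lambda>x. h' (g x) *\<^sub>R Dg x)" by (rule C1_compose[OF gC1 dh ch])
   have "(LBINT x. (arctan (g x / e) *\<^sub>R (Dg x $ i *\<^sub>R Dtheta R x + ?th x *\<^sub>R D2g x $ i) + (Dg x $ i * ?th x) *\<^sub>R (h' (g x) *\<^sub>R Dg x)) $ i) = 0" for i
    by (rule integral_pderiv_test_fn[OF test_fn_mult[OF A tB]])
   moreover have ii: "integrable lborel (\<lambda>x. (arctan (g x / e) *\<^sub>R (Dg x $ i *\<^sub>R Dtheta R x + ?th x *\<^sub>R D2g x $ i) + (Dg x $ i * ?th x) *\<^sub>R (h' (g x) *\<^sub>R Dg x)) $ i)" for i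
    by (rule cc_integrable[OF test_fn_cc(2)[OF test_fn_mult[OF A tB]]])
   ultimately have "(LBINT x. (\<Oplus>i. (arctan (g x / e) *\<^sub>R (Dg x $ i *\<^sub>R Dtheta R x + ?th x *\<^sub>R D2g x $ i) + (Dg x $ i * ?th x) *\<^sub>R (h' (g x) *\<^sub>R Dg x)) $ i)) = 0"
    by (subst Bochner_Integration.integral_sum) auto
   moreover have "(\<Oplus>i. (arctan (g x / e) *\<^sub>R (Dg x $ i *\<^sub>R Dtheta R x + ?th x *\<^sub>R D2g x $ i) + (Dg x $ i * ?th x) *\<^sub>R (h' (g x) *\<^sub>R Dg x)) $ i)
     = arctan (g x / e) * b x + h' (g x) * (q x * ?th x)" for x
    by (simp add: b_def q_def sum.distrib sum_distrib_left sum_distrib_right power2_eq_square algebra_simps)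
   ultimately have z: "(LBINT x. arctan (g x / e) * b x + h' (g x) * (q x * ?th x)) = 0" by simp
   have i1: "integrable lborel (\<lambda>x. h' (g x) * (q x * ?th x))"
    by (intro cc_integrable[OF cc_mult[OF _ ccq]] continuous_on_compose2[OF ch g_continuous]) auto
   have arc: "\<bar>arctan t\<bar> \<le> 2" for t using arctan_bounded[of t] pi_less_4 by linarith
   have i2: "integrable lborel (\<lambda>x. arctan (g x / e) * b x)"
   proof (rule Bochner_Integration.integrable_bound)
    show "integrable lborel (\<lambda>x. 2 * b x)" using bi by simp
    show "(\<lambda>x. arctan (g x / e) * b x) \<in> borel_measurable lborel"
     using borel_measurable_integrable[OF bi] borel_measurable_continuous_onI[OF C1_continuous[OF A]] by simp
    show "AE x in lborel. norm (arctan (g x / e) * b x) \<le> norm (2 * b x)"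
     using arc by (intro AE_I2) (simp add: abs_mult mult_right_mono)
   qed
   have "(LBINT x. h' (g x) * (q x * ?th x)) = - (LBINT x. arctan (g x / e) * b x)"
    using z i1 i2 by simp
   also have "\<dots> \<le> (LBINT x. 2 * \<bar>b x\<bar>)"
    using integral_abs_le[OF i2, of "\<lambda>x. 2 * \<bar>b x\<bar>"] bi arc by (simp add: abs_mult mult_right_mono)
   finally have le: "(LBINT x. h' (g x) * (q x * ?th x)) \<le> 2 * (LBINT x. \<bar>b x\<bar>)" by simp
   have q0: "0 \<le> q x * ?th x" for x using theta_bounds(1)[OF R, of x] by (auto simp: q_def intro!: mult_nonneg_nonneg sum_nonneg)
   \<comment> \<open>On the zero set \<open>h'\<close> takes its value at 0, which is exactly
     \<open>1 / e\<close>; elsewhere nonnegativity is enough.\<close>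
   have "(LBINT x. (1 / e) * (indicator Z x * (q x * ?th x))) \<le> (LBINT x. h' (g x) * (q x * ?th x))"
   proof (rule integral_mono[OF _ i1])
    show "integrable lborel (\<lambda>x. (1 / e) * (indicator Z x * (q x * ?th x)))" using zi by simp
    show "(1 / e) * (indicator Z x * (q x * ?th x)) \<le> h' (g x) * (q x * ?th x)" for x
    proof (cases "x \<in> Z")
     case False
     have "0 \<le> h' (g x)" unfolding h'_def using e pos1[of "g x"] by simp
     then show ?thesis using False q0[of x] by simp
    qed (simp add: Z_def h'_def)
   qed
   then have "1 / e * (LBINT x. indicator Z x * (q x * ?th x)) \<le> 2 * (LBINT x. \<bar>b x\<bar>)" using le by simp
   moreover have "a \<le> e * c" if "1 / e * a \<le> c" for a c using that e by (simp add: field_simps)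
   ultimately show ?thesis by blast
  qed
  have z0: "0 \<le> (LBINT x. indicator Z x * (q x * ?th x))"
   using theta_bounds(1)[OF R] by (intro integral_nonneg_AE AE_I2) (auto simp: q_def intro!: mult_nonneg_nonneg sum_nonneg)
  have "(LBINT x. indicator Z x * (q x * ?th x)) \<le> 0"
  proof (rule field_le_epsilon)
   fix e :: real assume e: "e > 0"
   define c where "c = 2 * (LBINT x. \<bar>b x\<bar>)"
   have c: "c \<ge> 0" by (simp add: c_def)
   have "(LBINT x. indicator Z x * (q x * ?th x)) \<le> e / (c + 1) * c"
    using est[of "e / (c + 1)"] e c unfolding c_def[symmetric] by simp
   also have "\<dots> \<le> e" using e c by (simp add: field_simps)
   finally show "(LBINT x. indicator Z x * (q x * ?th x)) \<le> 0 + e" by simp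
  qed
  with z0 have "(LBINT x. indicator Z x * (q x * ?th x)) = 0" by linarith
  then have "AE x in lborel. indicator Z x * (q x * ?th x) = 0"
   using theta_bounds(1)[OF R] by (subst (asm) integral_nonneg_eq_0_iff_AE[OF zi]) (auto simp: q_def intro!: AE_I2 mult_nonneg_nonneg sum_nonneg)
  then show ?thesis
  proof eventually_elim
   case (elim x)
   show ?case
   proof (intro impI notI)
    assume x: "norm x \<le> R" "g x = 0"
    then have "q x = 0" using elim theta_bounds(3)[OF R x(1)] by (simp add: Z_def)
    then have "Dg x = 0" unfolding q_def by (subst (asm) sum_nonneg_eq_0_iff) (auto simp: vec_eq_iff)
    then show False using Dg_nz[OF x(2)] by simp
   qed
  qed
 qed
 then have "AE x in lborel. \<forall>n::nat. norm x \<le> real (Suc n) \<longrightarrow> g x \<noteq> 0" by (subst AE_all_countable) auto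
 then show ?thesis
 proof eventually_elim
  case (elim x)
  obtain n where "norm x \<le> real n" using real_arch_simple by blast
  then show ?case using elim[rule_format, of n] by simp
 qed
qed

text \<open>Bounded, so that the penalised form stays continuous on \<open>HW\<close>; zero on the
  closed sublevel set and positive where \<open>g > 0\<close>; and of class \<open>C1\<close> with
  gradient parallel to \<open>Dg\<close>, which is why tangential differentiation does not see
  it.\<close>

definition pen :: "real^'n => real" where "pen x = (max 0 (g x))\<^sup>2 / (1 + (max 0 (g x))\<^sup>2)"
definition pen' :: "real => real" where "pen' t = 2 * max 0 t / (1 + (max 0 t)\<^sup>2)\<^sup>2"

lemma pen_C1: "C1 pen (\<lambda>x. pen' (g x) *\<^sub>R Dg x)"
proof -
 have pos: "1 + (max 0 t)\<^sup>2 \<noteq> 0" for t :: real using add_pos_nonneg[of 1 "(max 0 t)\<^sup>2"] by simp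
 have d: "((\<lambda>t. (max 0 t)\<^sup>2) has_real_derivative 2 * max 0 t) (at t)" for t :: real using DERIV_max0_power[of 2 t] by simp
 have "((\<lambda>t. (max 0 t)\<^sup>2 / (1 + (max 0 t)\<^sup>2)) has_real_derivative
   ((2 * max 0 t) * (1 + (max 0 t)\<^sup>2) - (max 0 t)\<^sup>2 * (2 * max 0 t)) / ((1 + (max 0 t)\<^sup>2) * (1 + (max 0 t)\<^sup>2))) (at t)" for t
  by (intro DERIV_divide d pos DERIV_add[OF DERIV_const, simplified])
 moreover have "((2 * max 0 t) * (1 + (max 0 t)\<^sup>2) - (max 0 t)\<^sup>2 * (2 * max 0 t)) / ((1 + (max 0 t)\<^sup>2) * (1 + (max 0 t)\<^sup>2)) = pen' t" for t
  by (simp add: pen'_def power2_eq_square algebra_simps)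
 ultimately have "((\<lambda>t. (max 0 t)\<^sup>2 / (1 + (max 0 t)\<^sup>2)) has_real_derivative pen' t) (at t)" for t by simp
 moreover have "continuous_on UNIV pen'" unfolding pen'_def using pos by (intro continuous_intros) auto
 ultimately show ?thesis unfolding pen_def[abs_def] by (rule C1_compose[OF gC1])
qed

lemma pen_bounds: "0 \<le> pen x" "pen x \<le> 1" "g x < 0 ==> pen x = 0" "g x > 0 ==> pen x > 0"
proof -
 have p: "1 + (max 0 (g x))\<^sup>2 > 0" by (rule add_pos_nonneg) auto
 show "0 \<le> pen x" "pen x \<le> 1" using p by (auto simp: pen_def divide_le_eq)
 show "g x < 0 ==> pen x = 0" by (simp add: pen_def max_absorb1)
 show "g x > 0 ==> pen x > 0" using p by (simp add: pen_def max_absorb2)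
qed

lemma pen_measurable [measurable]: "pen \<in> borel_measurable borel"
 by (rule borel_measurable_continuous_onI[OF C1_continuous[OF pen_C1]])

definition Efm :: "real => (real^'n => real) => ('n => real^'n => real) => (real^'n => real) => ('n => real^'n => real) => real" where
 "Efm lmb u Du v Dv = lmb * (LINT x|gauss lam. u x * v x) + (\<Oplus>l. lam $ l / 2 * (LINT x|gauss lam. Du l x * Dv l x))"

lemma L2_square_diff:
 assumes "L2 M a" "L2 M b"
 shows "(LINT x|M. (a x - b x) * (a x - b x)) = (LINT x|M. a x * a x) - 2 * (LINT x|M. a x * b x) + (LINT x|M. b x * b x)"
proof -
 have "(\<lambda>x. (a x - b x) * (a x - b x)) = (\<lambda>x. a x * a x - 2 * (a x * b x) + b x * b x)" by (auto simp: algebra_simps)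
 then show ?thesis
  using L2_integrable_mult[OF assms(1) assms(1)] L2_integrable_mult[OF assms] L2_integrable_mult[OF assms(2) assms(2)] by simp
qed

lemma Efm_diff:
 assumes u: "HW lam u Du" and v: "HW lam v Dv"
 shows "Efm lmb (\<lambda>x. u x - v x) (\<lambda>l x. Du l x - Dv l x) (\<lambda>x. u x - v x) (\<lambda>l x. Du l x - Dv l x)
   = Efm lmb u Du u Du - 2 * Efm lmb u Du v Dv + Efm lmb v Dv v Dv"
proof -
 have L: "L2 (gauss lam) u" "L2 (gauss lam) v" "L2 (gauss lam) (Du l)" "L2 (gauss lam) (Dv l)" for l
  using u v by (auto simp: HW_def)
 show ?thesis unfolding Efm_def L2_square_diff[OF L(1,2)] L2_square_diff[OF L(3,4)]
  by (simp add: distrib_left right_diff_distrib sum.distrib sum_subtractf sum_distrib_left)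
qed

lemma Efm_lower:
 assumes "lmb > 0"
 shows "lmb * (LINT x|gauss lam. (u x)\<^sup>2) \<le> Efm lmb u Du u Du" "lam $ k / 2 * (LINT x|gauss lam. (Du k x)\<^sup>2) \<le> Efm lmb u Du u Du"
proof -
 have b: "0 \<le> lam $ k / 2 * (LINT x|gauss lam. Du k x * Du k x)" for k
  using lam[of k] by (intro mult_nonneg_nonneg) (auto simp: less_imp_le intro!: integral_nonneg_AE)
 have a: "0 \<le> lmb * (LINT x|gauss lam. u x * u x)" using assms by (auto intro!: integral_nonneg_AE)
 show "lmb * (LINT x|gauss lam. (u x)\<^sup>2) \<le> Efm lmb u Du u Du"
  unfolding Efm_def power2_eq_square using sum_nonneg[of UNIV "\<lambda>k. lam $ k / 2 * (LINT x|gauss lam. Du k x * Du k x)"] b by simp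
 have "lam $ k / 2 * (LINT x|gauss lam. Du k x * Du k x) \<le> (\<Oplus>k. lam $ k / 2 * (LINT x|gauss lam. Du k x * Du k x))"
  by (rule member_le_sum) (use b in auto)
 then show "lam $ k / 2 * (LINT x|gauss lam. (Du k x)\<^sup>2) \<le> Efm lmb u Du u Du"
  unfolding Efm_def power2_eq_square using a by simp
qed

lemma HW_diff: "HW lam u Du ==> HW lam v Dv ==> HW lam (\<lambda>x. u x - v x) (\<lambda>l x. Du l x - Dv l x)"
 using HW_lincomb[OF lam, of u Du v Dv 1 "-1"] by simp

text \<open>The number \<open>e n\<close> is minus the minimal value of the n-th energy. It
  decreases as the penalty grows, and the energy of a difference of two solutions is at most the
  difference of these numbers; so the whole sequence converges strongly. The bound
  \<open>n P (un n) (un n) \<le> e n\<close> forces the limit to vanish where \<open>g > 0\<close>,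
  and uniqueness for the Dirichlet problem identifies it with \<open>U\<close>.\<close>

lemma penalised_approximation:
 assumes lmb: "lmb > 0" and f: "L2 (gauss lam) f" and U: "HW lam U DU" "AE x in lborel. g x > 0 \<longrightarrow> U x = 0"
  and eqU: "\<And>\<psi> D\<psi>. HW lam \<psi> D\<psi> ==> AE x in lborel. g x > 0 \<longrightarrow> \<psi> x = 0 ==> Efm lmb U DU \<psi> D\<psi> = (LINT x|gauss lam. f x * \<psi> x)"
 obtains un Dun where "\<And>n::nat. HW lam (un n) (Dun n)"
  "\<And>n \<psi> D\<psi>. HW lam \<psi> D\<psi> ==> Efm lmb (un n) (Dun n) \<psi> D\<psi> + real n * (LINT x|gauss lam. (pen x * un n x) * \<psi> x) = (LINT x|gauss lam. f x * \<psi> x)"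
  "(\<lambda>n. \<integral>x. (un n x - U x)\<^sup>2 \<partial>gauss lam) \<longlonglongrightarrow> 0"
  "\<And>l. (\<lambda>n. \<integral>x. (Dun n l x - DU l x)\<^sup>2 \<partial>gauss lam) \<longlonglongrightarrow> 0"
proof -
 define M where "M = gauss lam"
 have pL: "L2 M (\<lambda>x. pen x * v x)" if "L2 M v" for v
  by (rule L2_bounded_mult[OF that, of pen 1]) (auto simp: M_def measurable_gauss pen_bounds)
 define F where "F \<psi> = (LINT x|M. f x * \<psi> x)" for \<psi>
 define P where "P u v = (LINT x|M. (pen x * u x) * v x)" for u v
 have "\<exists>u Du. HW lam u Du \<and> (\<forall>\<psi> D\<psi>. HW lam \<psi> D\<psi> \<longrightarrow> Efm lmb u Du \<psi> D\<psi> + real n * P u \<psi> = F \<psi>)" for n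
 proof (rule lax_milgram_HW[OF lam lmb, of "\<lambda>x. real n * pen x" "real n" f])
  fix u Du assume u: "HW lam u Du"
   and e: "\<And>\<psi> D\<psi>. HW lam \<psi> D\<psi> ==> (LINT x|gauss lam. ((lmb + real n * pen x) * u x) * \<psi> x)
    + (\<Oplus>l. lam $ l / 2 * (LINT x|gauss lam. Du l x * D\<psi> l x)) = (LINT x|gauss lam. f x * \<psi> x)"
  have "Efm lmb u Du \<psi> D\<psi> + real n * P u \<psi> = F \<psi>" if p: "HW lam \<psi> D\<psi>" for \<psi> D\<psi>
  proof -
   have L: "L2 M u" "L2 M \<psi>" using u p by (auto simp: HW_def M_def)
   have "(LINT x|M. ((lmb + real n * pen x) * u x) * \<psi> x) = lmb * (LINT x|M. u x * \<psi> x) + real n * P u \<psi>"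
    unfolding P_def using L2_integrable_mult[OF L] L2_integrable_mult[OF pL[OF L(1)] L(2)]
    by (simp add: distrib_right mult.assoc)
   then show ?thesis using e[OF p] by (simp add: Efm_def F_def M_def)
  qed
  then show ?thesis using u by blast
 qed (use f pen_bounds(1) mult_left_le[OF pen_bounds(2)] in auto)
 then have "\<forall>n. \<exists>p. HW lam (fst p) (snd p) \<and> (\<forall>\<psi> D\<psi>. HW lam \<psi> D\<psi> \<longrightarrow> Efm lmb (fst p) (snd p) \<psi> D\<psi> + real n * P (fst p) \<psi> = F \<psi>)" by fastforce
 from choice[OF this] obtain p where p: "\<And>n. HW lam (fst (p n)) (snd (p n))"
  "\<And>n \<psi> D\<psi>. HW lam \<psi> D\<psi> ==> Efm lmb (fst (p n)) (snd (p n)) \<psi> D\<psi> + real n * P (fst (p n)) \<psi> = F \<psi>" by blast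
 define un where "un n = fst (p n)" for n
 define Dun where "Dun n = snd (p n)" for n
 have H: "HW lam (un n) (Dun n)" and eq: "HW lam \<psi> D\<psi> ==> Efm lmb (un n) (Dun n) \<psi> D\<psi> + real n * P (un n) \<psi> = F \<psi>" for n \<psi> D\<psi>
  using p by (auto simp: un_def Dun_def)
 have uL: "L2 M (un n)" "L2 M (Dun n l)" "weak_pderiv UNIV (un n) l (Dun n l)" for n l using H[of n] by (auto simp: HW_def M_def)
 have P0: "P v v \<ge> 0" for v
  unfolding P_def using pen_bounds(1) by (intro integral_nonneg_AE AE_I2) (simp add: mult.assoc)
 define e where "e n = F (un n)" for n
 have E0: "Efm lmb v Dv v Dv \<ge> 0" for v Dv
 proof -
  have "0 \<le> lmb * (LINT x|gauss lam. (v x)\<^sup>2)" using lmb by simp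
  then show ?thesis using Efm_lower(1)[OF lmb, of v Dv] by linarith
 qed
 have e0: "e n \<ge> 0" and eP: "real n * P (un n) (un n) \<le> e n" for n
  using eq[OF H[of n], of n] E0[of "un n" "Dun n"] mult_nonneg_nonneg[OF of_nat_0_le_iff P0[of "un n"], of n]
  unfolding e_def by linarith+
 \<comment> \<open>Adding the nonnegative penalty of the difference at level \<open>n\<close>
   completes the expression to penalised forms, each of which is evaluated by an equation; the
   excess penalty at level \<open>m\<close> has a favourable sign.\<close>
 have diff: "Efm lmb (\<lambda>x. un n x - un m x) (\<lambda>l x. Dun n l x - Dun m l x) (\<lambda>x. un n x - un m x) (\<lambda>l x. Dun n l x - Dun m l x) \<le> e n - e m"
  if nm: "n \<le> m" for n m
 proof -
  have pd: "P (\<lambda>x. un n x - un m x) (\<lambda>x. un n x - un m x) = P (un n) (un n) - 2 * P (un n) (un m) + P (un m) (un m)"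
  proof -
   have "(\<lambda>x. (pen x * (un n x - un m x)) * (un n x - un m x)) = (\<lambda>x. (pen x * un n x) * un n x - 2 * ((pen x * un n x) * un m x) + (pen x * un m x) * un m x)"
    by (auto simp: algebra_simps)
   then show ?thesis unfolding P_def
    using L2_integrable_mult[OF pL[OF uL(1)[of n]] uL(1)[of n]] L2_integrable_mult[OF pL[OF uL(1)[of n]] uL(1)[of m]]
     L2_integrable_mult[OF pL[OF uL(1)[of m]] uL(1)[of m]] by simp
  qed
  have "Efm lmb (\<lambda>x. un n x - un m x) (\<lambda>l x. Dun n l x - Dun m l x) (\<lambda>x. un n x - un m x) (\<lambda>l x. Dun n l x - Dun m l x)
    \<le> Efm lmb (un n) (Dun n) (un n) (Dun n) - 2 * Efm lmb (un n) (Dun n) (un m) (Dun m) + Efm lmb (un m) (Dun m) (un m) (Dun m)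
     + real n * P (\<lambda>x. un n x - un m x) (\<lambda>x. un n x - un m x)"
   unfolding Efm_diff[OF H H] using P0 by simp
  also have "\<dots> = (Efm lmb (un n) (Dun n) (un n) (Dun n) + real n * P (un n) (un n)) - 2 * (Efm lmb (un n) (Dun n) (un m) (Dun m) + real n * P (un n) (un m))
    + (Efm lmb (un m) (Dun m) (un m) (Dun m) + real m * P (un m) (un m)) - (real m - real n) * P (un m) (un m)"
   unfolding pd by (simp add: algebra_simps)
  also have "\<dots> = e n - 2 * e m + e m - (real m - real n) * P (un m) (un m)"
   by (simp only: eq[OF H] e_def)
  also have "\<dots> \<le> e n - e m" using P0[of "un m"] nm by simp
  finally show ?thesis .
 qed
 have dec: "decseq e" unfolding decseq_def
 proof (intro allI impI)
  fix m n :: nat assume "m \<le> n"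
  from diff[OF this] E0[of "\<lambda>x. un m x - un n x" "\<lambda>l x. Dun m l x - Dun n l x"] show "e n \<le> e m" by linarith
 qed
 obtain L where L: "e \<longlonglongrightarrow> L" using decseq_convergent[OF dec, of 0] e0 by blast
 have Cau: "\<exists>N. \<forall>m\<ge>N. \<forall>n\<ge>N. c * (LINT x|M. (a m x - a n x)\<^sup>2) < r"
  if r: "r > 0" and a: "\<And>m n. m \<le> n ==> c * (LINT x|M. (a m x - a n x)\<^sup>2) \<le> e m - e n" for r c :: real and a :: "nat => real^'n => real"
 proof -
  obtain N where N: "\<And>n. n \<ge> N ==> \<bar>e n - L\<bar> < r / 2" using LIMSEQ_D[OF L, of "r/2"] r by auto
  have "c * (LINT x|M. (a m x - a n x)\<^sup>2) < r" if mn: "m \<ge> N" "n \<ge> N" for m n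
  proof (cases "m \<le> n")
   case True then show ?thesis using a[OF True] N[OF mn(1)] N[OF mn(2)] by linarith
  next
   case False
   have "c * (LINT x|M. (a m x - a n x)\<^sup>2) = c * (LINT x|M. (a n x - a m x)\<^sup>2)" by (simp add: power2_commute)
   then show ?thesis using a[of n m] False N[OF mn(1)] N[OF mn(2)] by linarith
  qed
  then show ?thesis by blast
 qed
 have sf: "sigma_finite_measure M" unfolding M_def by (rule sigma_finite_gauss[OF lam])
 have comp: "\<exists>b. L2 M b \<and> (\<lambda>n. \<integral>x. (a n x - b x)\<^sup>2 \<partial>M) \<longlonglongrightarrow> 0"
  if c: "c > 0" and aL: "\<And>n. L2 M (a n)" and a: "\<And>m n. m \<le> n ==> c * (LINT x|M. (a m x - a n x)\<^sup>2) \<le> e m - e n" for c :: real and a :: "nat => real^'n => real"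
 proof (rule L2_complete_sigma_finite[OF sf aL])
  fix r :: real assume r: "r > 0"
  obtain N where "\<forall>m\<ge>N. \<forall>n\<ge>N. c * (LINT x|M. (a m x - a n x)\<^sup>2) < c * r" using Cau[OF _ a, of "c * r"] c r by auto
  then show "\<exists>N. \<forall>m\<ge>N. \<forall>n\<ge>N. (LINT x|M. (a m x - a n x)\<^sup>2) < r" using c by (intro exI[of _ N]) simp
 qed blast
 obtain u where u: "L2 M u" "(\<lambda>n. \<integral>x. (un n x - u x)\<^sup>2 \<partial>M) \<longlonglongrightarrow> 0"
 proof -
  have "\<exists>b. L2 M b \<and> (\<lambda>n. \<integral>x. (un n x - b x)\<^sup>2 \<partial>M) \<longlonglongrightarrow> 0"
   by (rule comp[OF lmb uL(1)]) (use order_trans[OF Efm_lower(1)[OF lmb] diff] in \<open>simp add: M_def\<close>)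
  then show thesis using that by blast
 qed
 have "\<forall>l. \<exists>b. L2 M b \<and> (\<lambda>n. \<integral>x. (Dun n l x - b x)\<^sup>2 \<partial>M) \<longlonglongrightarrow> 0"
 proof
  fix l
  show "\<exists>b. L2 M b \<and> (\<lambda>n. \<integral>x. (Dun n l x - b x)\<^sup>2 \<partial>M) \<longlonglongrightarrow> 0"
   by (rule comp[OF _ uL(2), of "lam $ l / 2"]) (use lam[of l] order_trans[OF Efm_lower(2)[OF lmb] diff] in \<open>simp_all add: M_def\<close>)
 qed
 from choice[OF this] obtain Du where Du: "\<And>l. L2 M (Du l)" "\<And>l. (\<lambda>n. \<integral>x. (Dun n l x - Du l x)\<^sup>2 \<partial>M) \<longlonglongrightarrow> 0" by blast
 have Hu: "HW lam u Du"
  unfolding HW_def M_def[symmetric] using u(1) Du(1) weak_pderiv_closed[OF lam, folded M_def, OF uL(1) u uL(2) Du uL(3)] by blast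
 \<comment> \<open>The penalty functional is a semi-inner product, so Cauchy-Schwarz and the decay
   of \<open>P (un n) (un n)\<close> like \<open>1 / n\<close> make \<open>P (un n) u\<close> tend
   to zero, while it also tends to \<open>P u u\<close>.\<close>
 have "P u u = 0"
 proof -
  have "(\<lambda>n. P (un n) u) \<longlonglongrightarrow> P u u"
   unfolding P_def using L2_tendsto_integral_mult[OF uL(1) u(1) pL[OF u(1)] u(2)] by (simp add: mult.commute mult.left_commute)
  moreover have "(\<lambda>n. P (un n) u) \<longlonglongrightarrow> 0"
  proof (rule Lim_null_comparison)
   have cs: "(P a u)\<^sup>2 \<le> P a a * P u u" if "L2 M a" for a
   proof -
    have sq: "L2 M (\<lambda>x. sqrt (pen x) * v x)" if "L2 M v" for v
     by (rule L2_bounded_mult[OF that, of "\<lambda>x. sqrt (pen x)" 1]) (auto simp: M_def measurable_gauss pen_bounds)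
    have r: "(sqrt (pen x) * a) * (sqrt (pen x) * b) = (pen x * a) * b" for x a b
    proof -
     have "sqrt (pen x) * sqrt (pen x) = pen x" using pen_bounds(1)[of x] by simp
     then show ?thesis by (metis mult.assoc mult.left_commute)
    qed
    show ?thesis using Cauchy_Schwarz_L2[OF sq[OF that] sq[OF u(1)]] unfolding power2_eq_square r P_def .
   qed
   show "\<forall>\<^sub>F n in sequentially. norm (P (un n) u) \<le> sqrt (e 0 * P u u / real n)"
   proof (rule eventually_sequentiallyI[of 1])
    fix n :: nat assume n: "n \<ge> 1"
    have "e n \<le> e 0" using dec by (auto simp: decseq_def)
    then have "P (un n) (un n) \<le> e 0 / real n" using eP[of n] n by (simp add: field_simps)
    then have "(P (un n) u)\<^sup>2 \<le> e 0 / real n * P u u" using cs[OF uL(1)[of n]] mult_right_mono[OF _ P0[of u]] by fastforce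
    then show "norm (P (un n) u) \<le> sqrt (e 0 * P u u / real n)" by (simp add: real_le_rsqrt)
   qed
   have "(\<lambda>n. sqrt (e 0 * P u u / real n)) \<longlonglongrightarrow> sqrt 0" by (intro tendsto_real_sqrt lim_const_over_n)
   then show "(\<lambda>n. sqrt (e 0 * P u u / real n)) \<longlonglongrightarrow> 0" by simp
  qed
  ultimately show ?thesis by (rule LIMSEQ_unique)
 qed
 have u0: "AE x in lborel. g x > 0 \<longrightarrow> u x = 0"
 proof -
  have i: "integrable M (\<lambda>x. (pen x * u x) * u x)" by (rule L2_integrable_mult[OF pL[OF u(1)] u(1)])
  have "AE x in M. (pen x * u x) * u x = 0"
   using \<open>P u u = 0\<close> unfolding P_def by (subst (asm) integral_nonneg_eq_0_iff_AE[OF i]) (auto simp: mult.assoc pen_bounds)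
  then have "AE x in lborel. (pen x * u x) * u x = 0" unfolding M_def AE_gauss[OF lam] .
  then show ?thesis by eventually_elim (use pen_bounds(4) in force)
 qed
 have equ: "Efm lmb u Du \<psi> D\<psi> = F \<psi>" if p: "HW lam \<psi> D\<psi>" "AE x in lborel. g x > 0 \<longrightarrow> \<psi> x = 0" for \<psi> D\<psi>
 proof -
  have L: "L2 M \<psi>" "L2 M (D\<psi> l)" for l using p by (auto simp: HW_def M_def)
  have "P (un n) \<psi> = 0" for n
  proof -
   have "AE x in M. (pen x * un n x) * \<psi> x = 0"
    unfolding M_def AE_gauss[OF lam] using p(2) AE_g_nonzero
   proof eventually_elim
    case (elim x) then show ?case using pen_bounds(3)[of x] by (cases "g x > 0") auto
   qed
   then show ?thesis unfolding P_def by (rule integral_eq_zero_AE)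
  qed
  then have "Efm lmb (un n) (Dun n) \<psi> D\<psi> = F \<psi>" for n using eq[OF p(1), of n] by simp
  moreover have "(\<lambda>n. Efm lmb (un n) (Dun n) \<psi> D\<psi>) \<longlonglongrightarrow> Efm lmb u Du \<psi> D\<psi>"
   unfolding Efm_def M_def[symmetric]
   by (intro tendsto_intros L2_tendsto_integral_mult[OF uL(1) u(1) L(1) u(2)] L2_tendsto_integral_mult[OF uL(2) Du(1) L(2) Du(2)])
  ultimately show ?thesis by (simp add: LIMSEQ_const_iff)
 qed
 have d0: "AE x in lborel. g x > 0 \<longrightarrow> U x - u x = 0" using U(2) u0 by eventually_elim auto
 \<comment> \<open>Both functions solve the Dirichlet problem and their difference is an admissible
   test function, so its energy is zero.\<close>
 have Ed: "Efm lmb (\<lambda>x. U x - u x) (\<lambda>l x. DU l x - Du l x) (\<lambda>x. U x - u x) (\<lambda>l x. DU l x - Du l x) = 0"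
 proof -
  note Hd = HW_diff[OF U(1) Hu]
  have L: "L2 M U" "L2 M (DU l)" "L2 M (\<lambda>x. U x - u x)" "L2 M (\<lambda>x. DU l x - Du l x)" for l
   using U(1) Hd by (auto simp: HW_def M_def)
  have "Efm lmb (\<lambda>x. U x - u x) (\<lambda>l x. DU l x - Du l x) (\<lambda>x. U x - u x) (\<lambda>l x. DU l x - Du l x)
   = Efm lmb U DU (\<lambda>x. U x - u x) (\<lambda>l x. DU l x - Du l x) - Efm lmb u Du (\<lambda>x. U x - u x) (\<lambda>l x. DU l x - Du l x)"
   unfolding Efm_def M_def[symmetric]
   using L2_integrable_mult[OF L(1,3)] L2_integrable_mult[OF u(1) L(3)] L2_integrable_mult[OF L(2,4)] L2_integrable_mult[OF Du(1) L(4)]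
   by (simp add: left_diff_distrib[of "U _"] left_diff_distrib[of "DU _ _"] right_diff_distrib[of lmb] right_diff_distrib[of "lam $ _"] diff_divide_distrib sum_subtractf)
  then show ?thesis using eqU[OF Hd d0] equ[OF Hd d0] by (simp add: F_def M_def)
 qed
 have AEeq: "AE x in M. a x = b x" if "c * (LINT x|M. (a x - b x)\<^sup>2) \<le> 0" "c > 0" "L2 M a" "L2 M b" for a b and c :: real
 proof -
  have "(LINT x|M. (a x - b x)\<^sup>2) \<le> 0" using that(1,2) by (simp add: mult_le_0_iff)
  moreover have "(LINT x|M. (a x - b x)\<^sup>2) \<ge> 0" by simp
  ultimately have "(LINT x|M. (a x - b x)\<^sup>2) = 0" by linarith
  then show ?thesis
   using L2_integrable_square[OF L2_diff[OF that(3,4)]] by (subst (asm) integral_nonneg_eq_0_iff_AE) auto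
 qed
 have UL: "L2 M U" "L2 M (DU l)" for l using U(1) by (auto simp: HW_def M_def)
 have same: "(LINT x|M. (a x - v x)\<^sup>2) = (LINT x|M. (a x - w x)\<^sup>2)" if "AE x in M. v x = w x" "L2 M a" "L2 M v" "L2 M w" for a v w
  using L2_measurable[OF that(2)] L2_measurable[OF that(3)] L2_measurable[OF that(4)] that(1) by (intro integral_cong_AE) auto
 have A1: "AE x in M. U x = u x"
  by (rule AEeq[OF _ lmb UL(1) u(1)]) (use Efm_lower(1)[OF lmb, of "\<lambda>x. U x - u x" "\<lambda>l x. DU l x - Du l x"] Ed in \<open>simp add: M_def\<close>)
 have A2: "AE x in M. DU l x = Du l x" for l
  by (rule AEeq[OF _ _ UL(2) Du(1), of "lam $ l / 2"]) (use lam[of l] Efm_lower(2)[OF lmb, of l "\<lambda>l x. DU l x - Du l x" "\<lambda>x. U x - u x"] Ed in \<open>simp_all add: M_def\<close>)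
 show thesis
 proof (rule that[of un Dun])
  show "HW lam (un n) (Dun n)" for n by (rule H)
  show "Efm lmb (un n) (Dun n) \<psi> D\<psi> + real n * (LINT x|gauss lam. (pen x * un n x) * \<psi> x) = (LINT x|gauss lam. f x * \<psi> x)"
   if "HW lam \<psi> D\<psi>" for n \<psi> D\<psi> using eq[OF that] by (simp add: P_def F_def M_def)
  show "(\<lambda>n. \<integral>x. (un n x - U x)\<^sup>2 \<partial>gauss lam) \<longlonglongrightarrow> 0"
   using u(2) same[OF A1 uL(1) UL(1) u(1)] by (simp add: M_def)
  show "(\<lambda>n. \<integral>x. (Dun n l x - DU l x)\<^sup>2 \<partial>gauss lam) \<longlonglongrightarrow> 0" for l
   using Du(2)[of l] same[OF A2 uL(2) UL(2) Du(1)] by (simp add: M_def)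
 qed
qed

end

section \<open>Tangential regularity up to the boundary\<close>

lemma weak_pderiv_cong_on:
 assumes w: "weak_pderiv UNIV a l d" and U: "\<And>x. x \<in> U ==> a x = b x"
 shows "weak_pderiv U b l d"
 unfolding weak_pderiv_iff
proof (intro allI impI)
 fix \<phi> D\<phi> assume t: "test_fn U \<phi> D\<phi>"
 note w' = weak_pderivD[OF w test_fn_mono[OF t subset_UNIV]]
 obtain K where K: "K \<subseteq> U" "\<And>x. x \<notin> K ==> D\<phi> x = 0" using test_fn_zero_outside[OF t] by metis
 have ab: "a x * D\<phi> x $ l = b x * D\<phi> x $ l" for x using U[of x] K by (cases "x \<in> K") auto
 have e: "(\<lambda>x. b x * D\<phi> x $ l) = (\<lambda>x. a x * D\<phi> x $ l)" by (rule ext, rule ab[symmetric])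
 show "integrable lborel (\<lambda>x. b x * D\<phi> x $ l) \<and> integrable lborel (\<lambda>x. d x * \<phi> x) \<and> (LBINT x. b x * D\<phi> x $ l) = - (LBINT x. d x * \<phi> x)"
  unfolding e using w' by simp
qed

lemma weak_pderiv_cong_AE:
 assumes w: "weak_pderiv Om a l d" and "L2loc Om a" "L2loc Om a'" "L2loc Om d" "L2loc Om d'"
  and A: "AE x in lborel. x \<in> Om \<longrightarrow> a x = a' x" "AE x in lborel. x \<in> Om \<longrightarrow> d x = d' x"
 shows "weak_pderiv Om a' l d'"
proof (rule weak_pderiv_L2locI[OF assms(3,5)])
 fix \<phi> D\<phi> assume t: "test_fn Om \<phi> D\<phi>"
 obtain K where K: "K \<subseteq> Om" "\<And>x. x \<notin> K ==> \<phi> x = 0" "\<And>x. x \<notin> K ==> D\<phi> x = 0" using test_fn_zero_outside[OF t] by metis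
 note m = L2loc_measurable[OF assms(2)] L2loc_measurable[OF assms(3)] L2loc_measurable[OF assms(4)] L2loc_measurable[OF assms(5)]
  cc_measurable[OF test_fn_cc(1)[OF t]] cc_measurable[OF test_fn_cc(2)[OF t, of l]]
 have "(LBINT x. a' x * D\<phi> x $ l) = (LBINT x. a x * D\<phi> x $ l)"
 proof (rule integral_cong_AE)
  show "AE x in lborel. a' x * D\<phi> x $ l = a x * D\<phi> x $ l" using A(1)
  proof eventually_elim
   case (elim x) then show ?case using K(1) K(3)[of x] by (cases "x \<in> K") auto
  qed
 qed (use m in auto)
 moreover have "(LBINT x. d' x * \<phi> x) = (LBINT x. d x * \<phi> x)"
 proof (rule integral_cong_AE)
  show "AE x in lborel. d' x * \<phi> x = d x * \<phi> x" using A(2)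
  proof eventually_elim
   case (elim x) then show ?case using K(1) K(2)[of x] by (cases "x \<in> K") auto
  qed
 qed (use m in auto)
 ultimately show "(LBINT x. a' x * D\<phi> x $ l) = - (LBINT x. d' x * \<phi> x)"
  using weak_pderivD(3)[OF w t] by simp
qed

lemma interior_regularity:
 fixes lam :: "real^'n"
 assumes lam: "\<And>k. lam $ k > 0" and Om: "open Om" and v: "W1 Om v Dv" and F: "L2loc Om F"
  and eq: "\<And>z Dz. test_fn Om z Dz ==> null_integral (\<lambda>x. (\<Oplus>l. lam $ l * (Dv l x * Dz x $ l)) + F x * z x)"
  and eta: "test2 Om \<eta> D\<eta> D2\<eta>" and U: "open U" "U \<subseteq> Om" "\<And>x. x \<in> U ==> \<eta> x = 1"
 obtains w where "\<And>h k. L2 lborel (w h k)" "\<And>k. W1 U (Dv k) (\<lambda>h. w h k)" "\<And>h k x. w h k x = w k h x"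
proof -
 obtain w where w: "\<And>h k. L2 lborel (w h k)"
  "\<And>h k. weak_pderiv UNIV (\<lambda>x. \<eta> x * Dv k x + v x * D\<eta> x $ k) h (w h k)"
  "\<And>h k. AE x in lborel. w h k x = w k h x"
  by (rule interior_regularity_cutoff[OF lam Om v F _ eta]) (assumption | rule eq | rule that)+
 have D0: "D\<eta> x = 0" if x: "x \<in> U" for x
 proof -
  have "(\<eta> has_derivative (\<lambda>v. 0)) (at x)"
   by (rule has_derivative_transform_within_open[of "\<lambda>x. 1" _ _ _ U]) (use x U in auto)
  moreover have "(\<eta> has_derivative (\<lambda>v. D\<eta> x \<bullet> v)) (at x)" using eta by (simp add: test2_def test_fn_def)
  ultimately have "(\<lambda>v. D\<eta> x \<bullet> v) = (\<lambda>v. 0)" using has_derivative_unique by blast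
  then have "D\<eta> x \<bullet> D\<eta> x = 0" by metis
  then show ?thesis by simp
 qed
 \<comment> \<open>Averaging the two mixed derivatives makes the symmetry hold at every point
   instead of almost everywhere.\<close>
 define w' where "w' h k x = (w h k x + w k h x) / 2" for h k x
 have L: "L2 lborel (w' h k)" for h k
  using L2_cmult[OF L2_add[OF w(1)[of h k] w(1)[of k h]], of "1/2"] by (simp add: w'_def[abs_def])
 have DvL: "L2loc U (Dv k)" for k using v U(2) L2loc_mono unfolding W1_def by blast
 show thesis
 proof (rule that[of w'])
  show "L2 lborel (w' h k)" "w' h k x = w' k h x" for h k x by (auto simp: L) (simp add: w'_def)
  fix k
  have "weak_pderiv U (Dv k) h (w' h k)" for h
  proof (rule weak_pderiv_cong_AE[OF _ DvL DvL L2_L2loc[OF w(1)] L2_L2loc[OF L]])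
   show "weak_pderiv U (Dv k) h (w h k)" by (rule weak_pderiv_cong_on[OF w(2)]) (simp add: D0 U(3))
   show "AE x in lborel. x \<in> U \<longrightarrow> w h k x = w' h k x" using w(3)[of h k] by eventually_elim (simp add: w'_def)
  qed auto
  then show "W1 U (Dv k) (\<lambda>h. w' h k)" unfolding W1_def using DvL L2_L2loc[OF L] by blast
 qed
qed

context regular_domain
begin

lemma C1_gw_inverse: "C1 (\<lambda>x. 1 / gw lam x) (\<lambda>x. \<chi> k. (x $ k / lam $ k) * (1 / gw lam x))"
 unfolding C1_def
proof (intro conjI allI)
 fix x
 have p: "gw lam x \<noteq> 0" using gw_pos[OF lam, of x] by simp
 have "((\<lambda>x. 1 / gw lam x) has_derivative (\<lambda>v. - ((\<chi> k. - (x $ k / lam $ k) * gw lam x) \<bullet> v) / (gw lam x)\<^sup>2)) (at x)"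
  using C1_derivD[OF C1_gw[OF lam], of x] p by (auto intro!: derivative_eq_intros simp: power2_eq_square field_simps)
 moreover have "- ((\<chi> k. - (x $ k / lam $ k) * gw lam x) \<bullet> v) / (gw lam x)\<^sup>2 = (\<chi> k. (x $ k / lam $ k) * (1 / gw lam x)) \<bullet> v" for v
  using p by (simp add: inner_vec_def sum_negf sum_divide_distrib power2_eq_square field_simps)
 ultimately show "((\<lambda>x. 1 / gw lam x) has_derivative (\<lambda>v. (\<chi> k. (x $ k / lam $ k) * (1 / gw lam x)) \<bullet> v)) (at x)" by simp
 show "continuous_on UNIV (\<lambda>x. \<chi> k. (x $ k / lam $ k) * (1 / gw lam x))"
  using lam by (intro continuous_intros gw_inverse_continuous[OF lam]) (auto simp: less_le)
qed

text \<open>Testing the Gaussian form with \<open>z\<close> divided by the density removes the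
  weight. Differentiating the inverse density produces the drift
  \<open>\<langle>x, Du\<rangle>\<close>, and the equation is doubled to clear the factor
  1/2.\<close>

lemma lebesgue_form:
 assumes u: "HW lam u Du" and f: "L2 (gauss lam) f" and V: "V \<in> borel_measurable borel" "\<And>x. 0 \<le> V x" "\<And>x. V x \<le> C"
  and eq: "\<And>z Dz. test_fn A z Dz ==> Efm lmb u Du z (\<lambda>l x. Dz x $ l) + (LINT x|gauss lam. (V x * u x) * z x) = (LINT x|gauss lam. f x * z x)"
  and z: "test_fn A z Dz"
 shows "null_integral (\<lambda>x. (\<Oplus>l. lam $ l * (Du l x * Dz x $ l)) + (2 * lmb * u x + 2 * (V x * u x) + (\<Oplus>l. x $ l * Du l x) - 2 * f x) * z x)"
proof -
 define \<psi> where "\<psi> x = 1 / gw lam x * z x" for x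
 define D\<psi> where "D\<psi> x = (1 / gw lam x) *\<^sub>R Dz x + z x *\<^sub>R (\<chi> k. (x $ k / lam $ k) * (1 / gw lam x))" for x
 have t: "test_fn A \<psi> D\<psi>" unfolding \<psi>_def D\<psi>_def by (rule test_fn_mult[OF C1_gw_inverse z])
 have conv: "(LINT x|gauss lam. a x * b x) = (LBINT x. gw lam x * (a x * b x))"
  "integrable lborel (\<lambda>x. gw lam x * (a x * b x))" if "L2 (gauss lam) a" "cc A b" for a b
 proof -
  have m: "a \<in> borel_measurable borel" "b \<in> borel_measurable borel" using that L2_gauss_iff[OF lam] cc_measurable by blast+
  then show "(LINT x|gauss lam. a x * b x) = (LBINT x. gw lam x * (a x * b x))"
   by (intro gauss_integral[OF lam]) simp
  show "integrable lborel (\<lambda>x. gw lam x * (a x * b x))"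
   using L2_integrable_mult[OF that(1) cc_L2_gauss[OF lam that(2)]] gauss_integral(2)[OF lam, of "\<lambda>x. a x * b x"] m by simp
 qed
 have gw0: "gw lam x \<noteq> 0" for x using gw_pos[OF lam, of x] by simp
 have L: "L2 (gauss lam) u" "\<And>l. L2 (gauss lam) (Du l)" using u by (auto simp: HW_def)
 have VL: "L2 (gauss lam) (\<lambda>x. V x * u x)"
  by (rule L2_bounded_mult[OF L(1), of V C]) (use V in \<open>auto simp: measurable_gauss\<close>)
 have i: "has_bochner_integral lborel (\<lambda>x. gw lam x * (a x * b x)) (LINT x|gauss lam. a x * b x)" if "L2 (gauss lam) a" "cc A b" for a b
  using conv[OF that] by (simp add: has_bochner_integral_iff)
 have "has_bochner_integral lborel (\<lambda>x. 2 * (lmb * (gw lam x * (u x * \<psi> x)) + (\<Oplus>l. lam $ l / 2 * (gw lam x * (Du l x * D\<psi> x $ l))) + gw lam x * ((V x * u x) * \<psi> x) - gw lam x * (f x * \<psi> x)))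
   (2 * (lmb * (LINT x|gauss lam. u x * \<psi> x) + (\<Oplus>l. lam $ l / 2 * (LINT x|gauss lam. Du l x * D\<psi> x $ l)) + (LINT x|gauss lam. (V x * u x) * \<psi> x) - (LINT x|gauss lam. f x * \<psi> x)))"
  by (intro has_bochner_integral_diff has_bochner_integral_add has_bochner_integral_mult_right has_bochner_integral_sum
     i L VL f test_fn_cc[OF t])
 moreover have "2 * (lmb * (LINT x|gauss lam. u x * \<psi> x) + (\<Oplus>l. lam $ l / 2 * (LINT x|gauss lam. Du l x * D\<psi> x $ l)) + (LINT x|gauss lam. (V x * u x) * \<psi> x) - (LINT x|gauss lam. f x * \<psi> x)) = 0"
  using eq[OF t] by (simp add: Efm_def)
 moreover have "2 * (lmb * (gw lam x * (u x * \<psi> x)) + (\<Oplus>l. lam $ l / 2 * (gw lam x * (Du l x * D\<psi> x $ l))) + gw lam x * ((V x * u x) * \<psi> x) - gw lam x * (f x * \<psi> x))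
   = (\<Oplus>l. lam $ l * (Du l x * Dz x $ l)) + (2 * lmb * u x + 2 * (V x * u x) + (\<Oplus>l. x $ l * Du l x) - 2 * f x) * z x" for x
 proof -
  have a: "gw lam x * (c * \<psi> x) = c * z x" for c using gw0[of x] by (simp add: \<psi>_def)
  have b: "lam $ l / 2 * (gw lam x * (Du l x * D\<psi> x $ l)) = (lam $ l * (Du l x * Dz x $ l) + x $ l * Du l x * z x) / 2" for l
  proof -
   have "gw lam x * D\<psi> x $ l = Dz x $ l + z x * (x $ l / lam $ l)" using gw0[of x] by (simp add: D\<psi>_def distrib_left)
   then have "gw lam x * (Du l x * D\<psi> x $ l) = Du l x * (Dz x $ l + z x * (x $ l / lam $ l))" by (metis mult.left_commute)
   then show ?thesis using lam[of l] by (simp add: field_simps)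
  qed
  show ?thesis unfolding a b
   by (simp add: sum_divide_distrib[symmetric] sum.distrib sum_distrib_left sum_distrib_right algebra_simps)
 qed
 ultimately show ?thesis by simp
qed

lemma tangential_identity:
 assumes U: "open U" and v: "W1 U v Dv" and w: "\<And>k. W1 U (Dv k) (\<lambda>h. w h k)" "\<And>h k x. w h k x = w k h x" and F0: "L2loc U F0"
  and eq: "\<And>z Dz. test_fn U z Dz ==> null_integral (\<lambda>x. (\<Oplus>l. lam $ l * (Dv l x * Dz x $ l)) + (F0 x + c * (pen x * v x)) * z x)"
  and t_def: "\<And>x. t x = Dg x $ i * Dv j x - Dg x $ j * Dv i x"
  and Dt_def: "\<And>l x. Dt l x = (Dg x $ i * w l j x + Dv j x * D2g x $ i $ l) - (Dg x $ j * w l i x + Dv i x * D2g x $ j $ l)"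
  and b_def: "\<And>l x. b l x = lam $ l * (Dv j x * D2g x $ i $ l - Dv i x * D2g x $ j $ l)
    + (if l = j then (\<Oplus>m. lam $ m * (Dv m x * D2g x $ i $ m)) + F0 x * Dg x $ i else 0)
    - (if l = i then (\<Oplus>m. lam $ m * (Dv m x * D2g x $ j $ m)) + F0 x * Dg x $ j else 0)"
  and z: "Wc U z Dz"
 shows "null_integral (\<lambda>x. (- c * (pen x * t x)) * z x + (\<Oplus>l. (- lam $ l * Dt l x + b l x) * Dz l x))"
  "W1 U t Dt" "\<And>l. L2loc U (b l)"
proof -
 have vL: "L2loc U v" "\<And>k. L2loc U (Dv k)" "\<And>k. weak_pderiv U v k (Dv k)" using v by (auto simp: W1_def)
 have wL: "\<And>h k. L2loc U (w h k)" "\<And>h k. weak_pderiv U (Dv k) h (w h k)" using w(1) by (auto simp: W1_def)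
 have W1t: "W1 U (\<lambda>x. Dg x $ i * Dv j x + (- 1) * (Dg x $ j * Dv i x))
   (\<lambda>l x. (Dg x $ i * w l j x + Dv j x * D2g x $ i $ l) + ((- 1) * (Dg x $ j * w l i x + Dv i x * D2g x $ j $ l) + (Dg x $ j * Dv i x) * (0::real^'n) $ l))"
  by (intro W1_add W1_mult[OF _ C1_const] W1_mult[OF w(1) DgC1])
 show W: "W1 U t Dt"
 proof -
  have "t = (\<lambda>x. Dg x $ i * Dv j x + (- 1) * (Dg x $ j * Dv i x))" using t_def by auto
  moreover have "Dt = (\<lambda>l x. (Dg x $ i * w l j x + Dv j x * D2g x $ i $ l) + ((- 1) * (Dg x $ j * w l i x + Dv i x * D2g x $ j $ l) + (Dg x $ j * Dv i x) * (0::real^'n) $ l))"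
   by (intro ext) (simp add: Dt_def)
  ultimately show ?thesis using W1t by simp
 qed
 have mD: "L2loc U (\<lambda>x. Dv k x * D2g x $ p $ q)" for k p q
  using L2loc_mult[OF vL(2) D2g_continuous] by (simp add: mult.commute)
 have mF: "L2loc U (\<lambda>x. F0 x * Dg x $ p)" for p using L2loc_mult[OF F0 Dg_continuous] by (simp add: mult.commute)
 have cm: "L2loc U (\<lambda>x. k * a x)" if "L2loc U a" for k a using L2loc_mult[OF that continuous_on_const] .
 have if0: "L2loc U (\<lambda>x. if P then a x else 0)" if "L2loc U a" for P a using that L2loc_continuous[of "\<lambda>x. 0"] by (cases P) auto
 show bL: "L2loc U (b l)" for l
 proof -
  have e: "b l = (\<lambda>x. lam $ l * (Dv j x * D2g x $ i $ l - Dv i x * D2g x $ j $ l)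
    + (if l = j then (\<Oplus>m. lam $ m * (Dv m x * D2g x $ i $ m)) + F0 x * Dg x $ i else 0)
    - (if l = i then (\<Oplus>m. lam $ m * (Dv m x * D2g x $ j $ m)) + F0 x * Dg x $ j else 0))" using b_def by auto
  show ?thesis unfolding e by (intro L2loc_diff L2loc_add cm mD if0 L2loc_sum mF)
 qed
 have tL: "L2loc U t" "\<And>l. L2loc U (Dt l)" using W by (auto simp: W1_def)
 show "null_integral (\<lambda>x. (- c * (pen x * t x)) * z x + (\<Oplus>l. (- lam $ l * Dt l x + b l x) * Dz l x))"
 proof (rule linear_extension[OF U _ _ _ z])
  show "L2loc U (\<lambda>x. - c * (pen x * t x))" by (rule cm[OF L2loc_mult[OF tL(1) C1_continuous[OF pen_C1]]])
  show "L2loc U (\<lambda>x. - lam $ l * Dt l x + b l x)" for l by (rule L2loc_add[OF cm[OF tL(2)] bL])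
  fix y Dy D2y assume "test2 U y Dy D2y"
  then have y1: "test_fn U y Dy" and y2: "\<And>k. test_fn U (\<lambda>x. Dy x $ k) (\<lambda>x. D2y x $ k)" and ys: "\<And>x p q. D2y x $ p $ q = D2y x $ q $ p"
   by (auto simp: test2_def)
  \<comment> \<open>The transported test function
    \<open>D\<^sub>ig D\<^sub>jy - D\<^sub>jg D\<^sub>iy\<close>; it contains first derivatives of
    \<open>y\<close>, which is why \<open>y\<close> is taken from \<open>test2\<close>.\<close>
  have tz: "test_fn U (\<lambda>x. Dg x $ i * Dy x $ j + (- 1) * (Dg x $ j * Dy x $ i))
    (\<lambda>x. (Dg x $ i *\<^sub>R D2y x $ j + Dy x $ j *\<^sub>R D2g x $ i) + (- 1) *\<^sub>R (Dg x $ j *\<^sub>R D2y x $ i + Dy x $ i *\<^sub>R D2g x $ j))"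
  proof -
   obtain K where K: "compact K" "K \<subseteq> U" "\<And>x. x \<notin> K ==> Dy x = 0" using test_fn_zero_outside[OF y1] by metis
   show ?thesis
   proof (rule test_fnI[OF _ K(1,2)])
    show "C1 (\<lambda>x. Dg x $ i * Dy x $ j + (- 1) * (Dg x $ j * Dy x $ i))
     (\<lambda>x. (Dg x $ i *\<^sub>R D2y x $ j + Dy x $ j *\<^sub>R D2g x $ i) + (- 1) *\<^sub>R (Dg x $ j *\<^sub>R D2y x $ i + Dy x $ i *\<^sub>R D2g x $ j))"
     by (intro C1_add C1_cmult C1_mult DgC1 test_fn_C1[OF y2])
   qed (simp add: K(3))
  qed
  note E1 = eq[OF tz]
  have E2: "null_integral (\<lambda>x. Dv l x * (Dg x $ p *\<^sub>R D2y x $ l + Dy x $ l *\<^sub>R D2g x $ p) $ q + w q l x * (Dg x $ p * Dy x $ l))" for l p q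
   by (rule weak_pderivD_null[OF wL(2) test_fn_mult[OF DgC1 y2]])
  \<comment> \<open>Moves the derivative of \<open>y\<close> off the penalty term. The terms with
    \<open>pen'\<close> are multiples of \<open>D\<^sub>ig D\<^sub>jg\<close> and cancel in the
    antisymmetric difference.\<close>
  have E3: "null_integral (\<lambda>x. v x * (pen x *\<^sub>R (Dg x $ p *\<^sub>R Dy x + y x *\<^sub>R D2g x $ p) + (Dg x $ p * y x) *\<^sub>R (pen' (g x) *\<^sub>R Dg x)) $ q + Dv q x * (pen x * (Dg x $ p * y x)))" for p q
   by (rule weak_pderivD_null[OF vL(3) test_fn_mult[OF pen_C1 test_fn_mult[OF DgC1 y1]]])
  have "has_bochner_integral lborel (\<lambda>x.
   ((\<Oplus>l. lam $ l * (Dv l x * ((Dg x $ i *\<^sub>R D2y x $ j + Dy x $ j *\<^sub>R D2g x $ i) + (- 1) *\<^sub>R (Dg x $ j *\<^sub>R D2y x $ i + Dy x $ i *\<^sub>R D2g x $ j)) $ l))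
    + (F0 x + c * (pen x * v x)) * (Dg x $ i * Dy x $ j + (- 1) * (Dg x $ j * Dy x $ i)))
   - (\<Oplus>l. lam $ l * ((Dv l x * (Dg x $ i *\<^sub>R D2y x $ l + Dy x $ l *\<^sub>R D2g x $ i) $ j + w j l x * (Dg x $ i * Dy x $ l))
       - (Dv l x * (Dg x $ j *\<^sub>R D2y x $ l + Dy x $ l *\<^sub>R D2g x $ j) $ i + w i l x * (Dg x $ j * Dy x $ l))))
   - c * ((v x * (pen x *\<^sub>R (Dg x $ i *\<^sub>R Dy x + y x *\<^sub>R D2g x $ i) + (Dg x $ i * y x) *\<^sub>R (pen' (g x) *\<^sub>R Dg x)) $ j + Dv j x * (pen x * (Dg x $ i * y x)))
      - (v x * (pen x *\<^sub>R (Dg x $ j *\<^sub>R Dy x + y x *\<^sub>R D2g x $ j) + (Dg x $ j * y x) *\<^sub>R (pen' (g x) *\<^sub>R Dg x)) $ i + Dv i x * (pen x * (Dg x $ j * y x)))))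
   (0 - (\<Oplus>l. lam $ l * (0 - 0)) - c * (0 - 0))"
   by (intro has_bochner_integral_diff has_bochner_integral_sum has_bochner_integral_mult_right E1 E2 E3)
  moreover have "((\<Oplus>l. lam $ l * (Dv l x * ((Dg x $ i *\<^sub>R D2y x $ j + Dy x $ j *\<^sub>R D2g x $ i) + (- 1) *\<^sub>R (Dg x $ j *\<^sub>R D2y x $ i + Dy x $ i *\<^sub>R D2g x $ j)) $ l))
    + (F0 x + c * (pen x * v x)) * (Dg x $ i * Dy x $ j + (- 1) * (Dg x $ j * Dy x $ i)))
   - (\<Oplus>l. lam $ l * ((Dv l x * (Dg x $ i *\<^sub>R D2y x $ l + Dy x $ l *\<^sub>R D2g x $ i) $ j + w j l x * (Dg x $ i * Dy x $ l))
       - (Dv l x * (Dg x $ j *\<^sub>R D2y x $ l + Dy x $ l *\<^sub>R D2g x $ j) $ i + w i l x * (Dg x $ j * Dy x $ l))))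
   - c * ((v x * (pen x *\<^sub>R (Dg x $ i *\<^sub>R Dy x + y x *\<^sub>R D2g x $ i) + (Dg x $ i * y x) *\<^sub>R (pen' (g x) *\<^sub>R Dg x)) $ j + Dv j x * (pen x * (Dg x $ i * y x)))
      - (v x * (pen x *\<^sub>R (Dg x $ j *\<^sub>R Dy x + y x *\<^sub>R D2g x $ j) + (Dg x $ j * y x) *\<^sub>R (pen' (g x) *\<^sub>R Dg x)) $ i + Dv i x * (pen x * (Dg x $ j * y x))))
   = (- c * (pen x * t x)) * y x + (\<Oplus>l. (- lam $ l * Dt l x + b l x) * Dy x $ l)" for x
  proof -
   let ?X = "\<lambda>l. lam $ l * (Dv l x * ((Dg x $ i *\<^sub>R D2y x $ j + Dy x $ j *\<^sub>R D2g x $ i) + (- 1) *\<^sub>R (Dg x $ j *\<^sub>R D2y x $ i + Dy x $ i *\<^sub>R D2g x $ j)) $ l)"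
   let ?Y = "\<lambda>l. lam $ l * ((Dv l x * (Dg x $ i *\<^sub>R D2y x $ l + Dy x $ l *\<^sub>R D2g x $ i) $ j + w j l x * (Dg x $ i * Dy x $ l)) - (Dv l x * (Dg x $ j *\<^sub>R D2y x $ l + Dy x $ l *\<^sub>R D2g x $ j) $ i + w i l x * (Dg x $ j * Dy x $ l)))"
   let ?P = "\<lambda>l. (- lam $ l * Dt l x) * Dy x $ l + (lam $ l * (Dv j x * D2g x $ i $ l - Dv i x * D2g x $ j $ l)) * Dy x $ l"
   let ?S = "\<lambda>p. \<Oplus>m. lam $ m * (Dv m x * D2g x $ p $ m)"
   have pt: "?X l - ?Y l = ?P l + (lam $ l * (Dv l x * D2g x $ i $ l)) * Dy x $ j - (lam $ l * (Dv l x * D2g x $ j $ l)) * Dy x $ i" for l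
    by (simp add: Dt_def ys[of x l] D2g_sym[of x j i] w(2)[of l] algebra_simps)
   have sumeq: "sum ?X UNIV - sum ?Y UNIV = sum ?P UNIV + ?S i * Dy x $ j - ?S j * Dy x $ i"
    unfolding sum_subtractf[symmetric] pt by (simp only: sum_subtractf sum.distrib sum_distrib_right)
   have bs: "(\<Oplus>l. (- lam $ l * Dt l x + b l x) * Dy x $ l)
    = sum ?P UNIV + (?S i + F0 x * Dg x $ i) * Dy x $ j - (?S j + F0 x * Dg x $ j) * Dy x $ i"
    unfolding b_def
    by (simp add: distrib_right left_diff_distrib sum.distrib sum_subtractf if_distrib[of "\<lambda>c. c * _"] cong: if_cong)
   have alg: "(F0 x + c * (pen x * v x)) * (Dg x $ i * Dy x $ j + (- 1) * (Dg x $ j * Dy x $ i))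
    - c * ((v x * (pen x *\<^sub>R (Dg x $ i *\<^sub>R Dy x + y x *\<^sub>R D2g x $ i) + (Dg x $ i * y x) *\<^sub>R (pen' (g x) *\<^sub>R Dg x)) $ j + Dv j x * (pen x * (Dg x $ i * y x)))
      - (v x * (pen x *\<^sub>R (Dg x $ j *\<^sub>R Dy x + y x *\<^sub>R D2g x $ j) + (Dg x $ j * y x) *\<^sub>R (pen' (g x) *\<^sub>R Dg x)) $ i + Dv i x * (pen x * (Dg x $ j * y x))))
    = (- c * (pen x * t x)) * y x + F0 x * Dg x $ i * Dy x $ j - F0 x * Dg x $ j * Dy x $ i"
    by (simp add: t_def D2g_sym[of x j i] algebra_simps)
   show ?thesis unfolding bs using sumeq alg unfolding distrib_right[of "?S _"] by linarith
  qed
  ultimately show "(LBINT x. (- c * (pen x * t x)) * y x + (\<Oplus>l. (- lam $ l * Dt l x + b l x) * Dy x $ l)) = 0"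
   by (simp add: has_bochner_integral_iff)
 qed
qed

end

text \<open>The difference of the two sides is a sum of three squares. In the application
  \<open>y\<close> is the cut-off derivative of \<open>t\<close> and \<open>p\<close> is
  \<open>t\<close> times the derivative of the cutoff.\<close>

lemma caccioppoli_young:
 fixes L y p B :: real assumes L: "L > 0"
 shows "- 2 * L * y * p + B * y + 2 * B * p \<le> L * y\<^sup>2 / 2 + 5 * L * p\<^sup>2 + 2 * B\<^sup>2 / L"
proof -
 have "0 \<le> L * (y / 2 + 2 * p)\<^sup>2" "0 \<le> (L * y / 2 - B)\<^sup>2 / L" "0 \<le> (L * p - B)\<^sup>2 / L" using L by auto
 then have "0 \<le> L * (y / 2 + 2 * p)\<^sup>2 + (L * y / 2 - B)\<^sup>2 / L + (L * p - B)\<^sup>2 / L" by linarith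
 also have "\<dots> = L * y\<^sup>2 / 2 + 5 * L * p\<^sup>2 + 2 * B\<^sup>2 / L - (- 2 * L * y * p + B * y + 2 * B * p)"
  using L by (simp add: power2_eq_square field_simps)
 finally show ?thesis by simp
qed

lemma gauss_tendsto_cc:
 assumes lam: "\<And>k. lam $ k > 0"
  and u: "\<And>n. L2 (gauss lam) (un n)" "L2 (gauss lam) u" "(\<lambda>n. \<integral>x. (un n x - u x)\<^sup>2 \<partial>gauss lam) \<longlonglongrightarrow> 0" and c: "cc A \<psi>"
 shows "(\<lambda>n. \<integral>x. un n x * \<psi> x \<partial>lborel) \<longlonglongrightarrow> (LBINT x. u x * \<psi> x)"
proof -
 have m: "u \<in> borel_measurable borel" "un n \<in> borel_measurable borel" for n
  using u(1,2) L2_gauss_iff[OF lam] by blast+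
 show ?thesis
  unfolding integral_cc_gauss[OF lam m(1) c] integral_cc_gauss[OF lam m(2) c]
  by (rule L2_tendsto_integral_mult[OF u(1,2) _ u(3)])
    (rule cc_L2_gauss[OF lam cc_mult[OF gw_inverse_continuous[OF lam] c]])
qed

section \<open>Tangential estimate uniform in the penalty parameter\<close>

context regular_domain
begin

definition tang :: "'n => 'n => ('n => real^'n => real) => real^'n => real" where
 "tang i j Dv x = Dg x $ i * Dv j x - Dg x $ j * Dv i x"

definition Nrm :: "(real^'n => real) => ('n => real^'n => real) => (real^'n => real) => real^'n => real" where
 "Nrm v Dv f x = (v x)\<^sup>2 + (\<Oplus>k. (Dv k x)\<^sup>2) + (f x)\<^sup>2"

lemma Nrm_bounds: "\<bar>v x\<bar> \<le> sqrt (Nrm v Dv f x)" "\<bar>Dv k x\<bar> \<le> sqrt (Nrm v Dv f x)" "\<bar>f x\<bar> \<le> sqrt (Nrm v Dv f x)" "0 \<le> Nrm v Dv f x"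
proof -
 have s: "0 \<le> (\<Oplus>k. (Dv k x)\<^sup>2)" by (intro sum_nonneg) auto
 have k: "(Dv k x)\<^sup>2 \<le> (\<Oplus>k. (Dv k x)\<^sup>2)" by (rule member_le_sum) auto
 have "(v x)\<^sup>2 \<le> Nrm v Dv f x" "(Dv k x)\<^sup>2 \<le> Nrm v Dv f x" "(f x)\<^sup>2 \<le> Nrm v Dv f x"
  unfolding Nrm_def using s k zero_le_power2[of "v x"] zero_le_power2[of "f x"] by linarith+
 then show "\<bar>v x\<bar> \<le> sqrt (Nrm v Dv f x)" "\<bar>Dv k x\<bar> \<le> sqrt (Nrm v Dv f x)" "\<bar>f x\<bar> \<le> sqrt (Nrm v Dv f x)"
  by (auto intro!: real_le_rsqrt)
 show "0 \<le> Nrm v Dv f x" unfolding Nrm_def using s by simp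
qed

text \<open>Caccioppoli's inequality for the tangential identity, tested with the squared cutoff
  times \<open>t\<close>. The penalty term has a good sign and is discarded, so the constant does
  not depend on \<open>n\<close>.\<close>

lemma tangential_bound:
 assumes R: "R > 0" and lmb: "lmb \<ge> 0"
 obtains C where "C \<ge> 0" "\<forall>n v Dv f. HW lam v Dv \<longrightarrow> L2 (gauss lam) f \<longrightarrow>
   (\<forall>\<psi> D\<psi>. HW lam \<psi> D\<psi> \<longrightarrow> Efm lmb v Dv \<psi> D\<psi> + real n * (LINT x|gauss lam. (pen x * v x) * \<psi> x) = (LINT x|gauss lam. f x * \<psi> x)) \<longrightarrow>
   (\<exists>d. \<forall>l. L2 lborel (d l) \<and> weak_pderiv UNIV (\<lambda>x. theta R x * tang i j Dv x) l (d l) \<and>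
    (LBINT x. (d l x)\<^sup>2) \<le> C * (LINT x|gauss lam. Nrm v Dv f x))"
proof -
 let ?th = "theta R :: real^'n => real"
 \<comment> \<open>\<open>\<gamma>\<close> and \<open>\<beta>\<close> are pointwise majorants of the
   right-hand side \<open>F0\<close> and of the vector \<open>b\<close> below, both relative to the
   square root of \<open>Nrm\<close>.\<close>
 define \<gamma> where "\<gamma> x = 2 * lmb + (\<Oplus>l. \<bar>x $ l\<bar>) + 2" for x :: "real^'n"
 define \<beta> where "\<beta> l x = lam $ l * (\<bar>D2g x $ i $ l\<bar> + \<bar>D2g x $ j $ l\<bar>) + ((\<Oplus>m. lam $ m * \<bar>D2g x $ i $ m\<bar>) + \<gamma> x * \<bar>Dg x $ i\<bar>)
   + ((\<Oplus>m. lam $ m * \<bar>D2g x $ j $ m\<bar>) + \<gamma> x * \<bar>Dg x $ j\<bar>)" for l x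
 define kp where "kp x = (\<Oplus>l. 5 * lam $ l * (Dtheta R x $ l)\<^sup>2 * (\<bar>Dg x $ i\<bar> + \<bar>Dg x $ j\<bar>)\<^sup>2 + 2 * (?th x)\<^sup>2 * (\<beta> l x)\<^sup>2 / lam $ l)" for x
 note th = theta_test[OF R]
 have lam0: "lam $ l \<noteq> 0" for l using lam[of l] by simp
 have c\<gamma>: "continuous_on UNIV \<gamma>" unfolding \<gamma>_def by (intro continuous_intros)
 have c\<beta>: "continuous_on UNIV (\<beta> l)" for l unfolding \<beta>_def by (intro continuous_intros Dg_continuous D2g_continuous c\<gamma>)
 have ckp: "continuous_on UNIV kp"
  unfolding kp_def
  by (intro continuous_intros Dg_continuous c\<beta> C1_continuous[OF test_fn_C1[OF th]] C1_continuous_D[OF test_fn_C1[OF th]] ballI lam0)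
 have cckp: "cc UNIV (\<lambda>x. 1 / gw lam x * kp x)"
 proof (rule cc_mult[OF gw_inverse_continuous[OF lam]], rule ccI[OF ckp, of "cball 0 (2*R)"])
  fix x :: "real^'n" assume "x \<notin> cball 0 (2*R)"
  then have "norm x \<ge> 2 * R" by simp
  then show "kp x = 0" using theta_bounds(4,6)[OF R, of x] by (simp add: kp_def)
 qed auto
 obtain C where C: "C > 0" "\<And>x. \<bar>1 / gw lam x * kp x\<bar> \<le> C" by (rule cc_bounded[OF cckp]) (rule that)
 have kpC: "kp x \<le> C * gw lam x" for x
  using C(2)[of x] gw_pos[OF lam, of x] by (simp add: field_simps abs_le_iff)
 \<comment> \<open>The factor 5 rounds up 22/5 = 2 * 2 + 2 * (1/5), which comes from the bounds for
   the two parts of the derivative of the cut-off tangential derivative.\<close>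
 define C' where "C' = (\<Oplus>l. 5 / lam $ l) * C"
 have C'l: "5 / lam $ l * C \<le> C'" for l
  unfolding C'_def using C(1) lam less_imp_le by (intro mult_right_mono member_le_sum) auto
 have "C' \<ge> 0" unfolding C'_def using C(1) lam less_imp_le by (intro mult_nonneg_nonneg sum_nonneg) auto
 then show thesis
 proof (rule that, intro allI impI)
  fix n v Dv f assume v: "HW lam v Dv" and f: "L2 (gauss lam) f"
   and "\<forall>\<psi> D\<psi>. HW lam \<psi> D\<psi> \<longrightarrow> Efm lmb v Dv \<psi> D\<psi> + real n * (LINT x|gauss lam. (pen x * v x) * \<psi> x) = (LINT x|gauss lam. f x * \<psi> x)"
  then have eq: "HW lam \<psi> D\<psi> ==> Efm lmb v Dv \<psi> D\<psi> + real n * (LINT x|gauss lam. (pen x * v x) * \<psi> x) = (LINT x|gauss lam. f x * \<psi> x)" for \<psi> D\<psi> by blast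
  \<comment> \<open>A neighbourhood of the support of the cutoff. Interior regularity on it is used
    qualitatively for each fixed \<open>n\<close>; it only makes the computation legitimate, and the
    uniform bound comes from the identity.\<close>
  define U where "U = ball (0::real^'n) (3 * R)"
  define F0 where "F0 x = 2 * lmb * v x + (\<Oplus>l. x $ l * Dv l x) - 2 * f x" for x
  have vL: "L2 (gauss lam) v" "\<And>l. L2 (gauss lam) (Dv l)" using v by (auto simp: HW_def)
  have W1v: "W1 A v Dv" for A by (rule HW_W1[OF lam v])
  have loc: "L2loc A v" "L2loc A (Dv l)" "L2loc A f" for A l using L2_gauss_L2loc[OF lam] vL f by blast+
  have F0L: "L2loc A F0" for A
   unfolding F0_def by (intro L2loc_diff L2loc_add L2loc_sum L2loc_mult[OF loc(1)] L2loc_mult[OF loc(2)] L2loc_mult[OF loc(3)] continuous_intros)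
  have eqL: "null_integral (\<lambda>x. (\<Oplus>l. lam $ l * (Dv l x * Dz x $ l)) + (F0 x + (2 * real n) * (pen x * v x)) * z x)"
   if z: "test_fn UNIV z Dz" for z Dz
  proof -
   have "null_integral (\<lambda>x. (\<Oplus>l. lam $ l * (Dv l x * Dz x $ l)) + (2 * lmb * v x + 2 * ((real n * pen x) * v x) + (\<Oplus>l. x $ l * Dv l x) - 2 * f x) * z x)"
   proof (rule lebesgue_form[OF v f, of _ "real n" UNIV, OF _ _ _ _ z])
    show "(\<lambda>x. real n * pen x) \<in> borel_measurable borel" by simp
    show "0 \<le> real n * pen x" "real n * pen x \<le> real n" for x using pen_bounds(1)[of x] mult_left_le[OF pen_bounds(2)[of x]] by auto
    fix y :: "real^'n => real" and Dy assume y: "test_fn UNIV y Dy"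
    have "(LINT x|gauss lam. (real n * pen x * v x) * y x) = real n * (LINT x|gauss lam. (pen x * v x) * y x)" by (simp add: mult.assoc)
    then show "Efm lmb v Dv y (\<lambda>l x. Dy x $ l) + (LINT x|gauss lam. (real n * pen x * v x) * y x) = (LINT x|gauss lam. f x * y x)"
     using eq[OF HW_test_fn[OF lam y]] by simp
   qed
   moreover have "2 * lmb * v x + 2 * ((real n * pen x) * v x) + (\<Oplus>l. x $ l * Dv l x) - 2 * f x = F0 x + (2 * real n) * (pen x * v x)" for x
    by (simp add: F0_def)
   ultimately show ?thesis by simp
  qed
  obtain D2 where eta: "test2 UNIV (theta (3 * R) :: real^'n => real) (Dtheta (3 * R)) D2" using theta_test2[of "3 * R"] R by auto
  have FL: "L2loc UNIV (\<lambda>x. F0 x + (2 * real n) * (pen x * v x))"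
   by (intro L2loc_add F0L L2loc_mult[OF L2loc_mult[OF loc(1) C1_continuous[OF pen_C1]] continuous_on_const])
  obtain w where w: "\<And>h k. L2 lborel (w h k)" "\<And>k. W1 U (Dv k) (\<lambda>h. w h k)" "\<And>h k x. w h k x = w k h x"
  proof (rule interior_regularity[OF lam open_UNIV W1v FL _ eta, of U])
   show "theta (3 * R) x = 1" if "x \<in> U" for x using that theta_bounds(3)[of "3*R" x] R by (simp add: U_def)
  qed (use eqL that in \<open>auto simp: U_def\<close>)
  define t where "t = tang i j Dv"
  define Dt where "Dt l x = (Dg x $ i * w l j x + Dv j x * D2g x $ i $ l) - (Dg x $ j * w l i x + Dv i x * D2g x $ j $ l)" for l x
  define b where "b l x = lam $ l * (Dv j x * D2g x $ i $ l - Dv i x * D2g x $ j $ l)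
    + (if l = j then (\<Oplus>m. lam $ m * (Dv m x * D2g x $ i $ m)) + F0 x * Dg x $ i else 0)
    - (if l = i then (\<Oplus>m. lam $ m * (Dv m x * D2g x $ j $ m)) + F0 x * Dg x $ j else 0)" for l x
  have t': "t x = Dg x $ i * Dv j x - Dg x $ j * Dv i x" for x by (simp add: t_def tang_def)
  have thU: "test_fn U ?th (Dtheta R)"
  proof (rule test_fnI[OF test_fn_C1[OF th], of "cball 0 (2*R)"])
   show "cball 0 (2*R) \<subseteq> U" using R by (auto simp: U_def)
   show "theta R x = 0" if "x \<notin> cball 0 (2*R)" for x :: "real^'n" using theta_bounds(4)[OF R, of x] that by simp
  qed simp
  have thU2: "test_fn U (\<lambda>x. ?th x * ?th x) (\<lambda>x. ?th x *\<^sub>R Dtheta R x + ?th x *\<^sub>R Dtheta R x)"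
   by (rule test_fn_mult[OF test_fn_C1[OF th] thU])
  have eqU: "null_integral (\<lambda>x. (\<Oplus>l. lam $ l * (Dv l x * Dz x $ l)) + (F0 x + (2 * real n) * (pen x * v x)) * z x)"
   if "test_fn U z Dz" for z Dz using eqL[OF test_fn_mono[OF that subset_UNIV]] .
  have oU: "open U" by (simp add: U_def)
  note TI = tangential_identity[OF oU W1v w(2,3) F0L eqU t' Dt_def b_def]
  have any: "Wc U (\<lambda>x. ?th x * ?th x) (\<lambda>l x. (?th x *\<^sub>R Dtheta R x + ?th x *\<^sub>R Dtheta R x) $ l)" by (rule Wc_test_fn[OF thU2])
  have W1t: "W1 U t Dt" and bL: "L2loc U (b l)" for l using TI(2,3)[OF _ any] by blast+
  have tL: "L2loc U t" "\<And>l. L2loc U (Dt l)" using W1t by (auto simp: W1_def)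
  define z where "z x = (?th x * ?th x) * t x" for x
  define Dz where "Dz l x = (?th x * ?th x) * Dt l x + t x * (?th x *\<^sub>R Dtheta R x + ?th x *\<^sub>R Dtheta R x) $ l" for l x
  have "Wc U z Dz" unfolding z_def Dz_def by (rule Wc_mult[OF W1t thU2])
  note N = TI(1)[OF _ this]
  define NN where "NN x = (- (2 * real n) * (pen x * t x)) * z x + (\<Oplus>l. (- lam $ l * Dt l x + b l x) * Dz l x)" for x
  have Ni: "integrable lborel NN" "(LBINT x. NN x) = 0" using N[folded NN_def] by (auto simp: has_bochner_integral_iff)
  define Q where "Q x = (\<Oplus>l. 5 * lam $ l * (Dtheta R x $ l * t x)\<^sup>2 + 2 * (b l x * ?th x)\<^sup>2 / lam $ l)" for x
  \<comment> \<open>The nonpositive penalty contribution to \<open>NN\<close> is dropped here; half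
    of the quadratic term survives Young's inequality.\<close>
  have ptw: "(\<Oplus>l. lam $ l * (?th x * Dt l x)\<^sup>2 / 2) \<le> Q x - NN x" for x
  proof -
   have p: "0 \<le> 2 * real n * (pen x * (?th x * t x)\<^sup>2)" using pen_bounds(1)[of x] by simp
   have NNe: "NN x = - (2 * real n * (pen x * (?th x * t x)\<^sup>2)) + (\<Oplus>l. - lam $ l * (?th x * Dt l x)\<^sup>2
     + (- 2 * lam $ l * (?th x * Dt l x) * (Dtheta R x $ l * t x) + (b l x * ?th x) * (?th x * Dt l x) + 2 * (b l x * ?th x) * (Dtheta R x $ l * t x)))"
    unfolding NN_def z_def Dz_def by (simp add: power2_eq_square algebra_simps)
   have "(\<Oplus>l. - lam $ l * (?th x * Dt l x)\<^sup>2
     + (- 2 * lam $ l * (?th x * Dt l x) * (Dtheta R x $ l * t x) + (b l x * ?th x) * (?th x * Dt l x) + 2 * (b l x * ?th x) * (Dtheta R x $ l * t x)))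
    \<le> (\<Oplus>l. - lam $ l * (?th x * Dt l x)\<^sup>2
     + (lam $ l * (?th x * Dt l x)\<^sup>2 / 2 + 5 * lam $ l * (Dtheta R x $ l * t x)\<^sup>2 + 2 * (b l x * ?th x)\<^sup>2 / lam $ l))"
    by (intro sum_mono add_left_mono caccioppoli_young lam)
   also have "\<dots> = Q x - (\<Oplus>l. lam $ l * (?th x * Dt l x)\<^sup>2 / 2)"
    unfolding Q_def sum_subtractf[symmetric] by (intro sum.cong refl) (simp add: field_simps)
   finally show ?thesis unfolding NNe using p by linarith
  qed
  have Qb: "Q x \<le> C * (gw lam x * Nrm v Dv f x)" for x
  proof -
   define s where "s = sqrt (Nrm v Dv f x)"
   have s: "s \<ge> 0" "s\<^sup>2 = Nrm v Dv f x" using Nrm_bounds(4)[of v Dv f x] by (auto simp: s_def)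
   have sb: "\<bar>v x\<bar> \<le> s" "\<bar>Dv k x\<bar> \<le> s" "\<bar>f x\<bar> \<le> s" for k unfolding s_def by (rule Nrm_bounds)+
   have ml: "\<bar>a * b\<bar> \<le> \<bar>b\<bar> * s" if "\<bar>a\<bar> \<le> s" for a b using mult_left_mono[OF that, of "\<bar>b\<bar>"] by (simp add: abs_mult mult.commute)
   have tb: "\<bar>t x\<bar> \<le> (\<bar>Dg x $ i\<bar> + \<bar>Dg x $ j\<bar>) * s"
    unfolding t' using ml[OF sb(2)[of j], of "Dg x $ i"] ml[OF sb(2)[of i], of "Dg x $ j"]
    by (simp add: mult.commute distrib_left)
   have xs: "\<bar>\<Oplus>l. x $ l * Dv l x\<bar> \<le> (\<Oplus>l. \<bar>x $ l\<bar>) * s"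
   proof -
    have "\<bar>\<Oplus>l. x $ l * Dv l x\<bar> \<le> (\<Oplus>l. \<bar>x $ l * Dv l x\<bar>)" by (rule sum_abs)
    also have "\<dots> \<le> (\<Oplus>l. \<bar>x $ l\<bar> * s)"
    proof (rule sum_mono)
     show "\<bar>x $ l * Dv l x\<bar> \<le> \<bar>x $ l\<bar> * s" for l using ml[OF sb(2)[of l], of "x $ l"] by (simp add: mult.commute)
    qed
    finally show ?thesis by (simp add: sum_distrib_right)
   qed
   have F0b: "\<bar>F0 x\<bar> \<le> \<gamma> x * s"
   proof -
    have "\<bar>2 * lmb * v x\<bar> \<le> 2 * lmb * s" using sb(1) lmb by (simp add: abs_mult mult_left_mono)
    then show ?thesis using xs sb(3) unfolding F0_def \<gamma>_def distrib_right by linarith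
   qed
   have DD: "\<bar>Dv k x * D2g x $ p $ q\<bar> \<le> \<bar>D2g x $ p $ q\<bar> * s" for k p q by (rule ml[OF sb(2)])
   have SS: "\<bar>(\<Oplus>m. lam $ m * (Dv m x * D2g x $ p $ m)) + F0 x * Dg x $ p\<bar> \<le> ((\<Oplus>m. lam $ m * \<bar>D2g x $ p $ m\<bar>) + \<gamma> x * \<bar>Dg x $ p\<bar>) * s" for p
   proof -
    have "\<bar>\<Oplus>m. lam $ m * (Dv m x * D2g x $ p $ m)\<bar> \<le> (\<Oplus>m. \<bar>lam $ m * (Dv m x * D2g x $ p $ m)\<bar>)" by (rule sum_abs)
    also have "\<dots> \<le> (\<Oplus>m. lam $ m * (\<bar>D2g x $ p $ m\<bar> * s))"
    proof (rule sum_mono)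
     fix m show "\<bar>lam $ m * (Dv m x * D2g x $ p $ m)\<bar> \<le> lam $ m * (\<bar>D2g x $ p $ m\<bar> * s)"
      using mult_left_mono[OF DD[of m p m], of "lam $ m"] lam[of m] by (simp add: abs_mult)
    qed
    finally have 1: "\<bar>\<Oplus>m. lam $ m * (Dv m x * D2g x $ p $ m)\<bar> \<le> (\<Oplus>m. lam $ m * \<bar>D2g x $ p $ m\<bar>) * s"
     by (simp add: sum_distrib_right mult.assoc)
    have 2: "\<bar>F0 x * Dg x $ p\<bar> \<le> \<gamma> x * \<bar>Dg x $ p\<bar> * s"
     using mult_right_mono[OF F0b, of "\<bar>Dg x $ p\<bar>"] by (simp add: abs_mult mult.commute mult.left_commute)
    show ?thesis using 1 2 unfolding distrib_right by linarith
   qed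
   have bb: "\<bar>b l x\<bar> \<le> \<beta> l x * s" for l
   proof -
    have nn: "0 \<le> ((\<Oplus>m. lam $ m * \<bar>D2g x $ p $ m\<bar>) + \<gamma> x * \<bar>Dg x $ p\<bar>) * s" for p using SS[of p] by linarith
    have ifb: "\<bar>if P then (\<Oplus>m. lam $ m * (Dv m x * D2g x $ p $ m)) + F0 x * Dg x $ p else 0\<bar> \<le> ((\<Oplus>m. lam $ m * \<bar>D2g x $ p $ m\<bar>) + \<gamma> x * \<bar>Dg x $ p\<bar>) * s" for P p
     using SS[of p] nn[of p] by auto
    have "\<bar>Dv j x * D2g x $ i $ l - Dv i x * D2g x $ j $ l\<bar> \<le> (\<bar>D2g x $ i $ l\<bar> + \<bar>D2g x $ j $ l\<bar>) * s"
     using DD[of j i l] DD[of i j l] unfolding distrib_right by linarith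
    from mult_left_mono[OF this, of "lam $ l"] have "\<bar>lam $ l * (Dv j x * D2g x $ i $ l - Dv i x * D2g x $ j $ l)\<bar> \<le> lam $ l * (\<bar>D2g x $ i $ l\<bar> + \<bar>D2g x $ j $ l\<bar>) * s"
     using lam[of l] by (simp add: abs_mult mult.assoc)
    then show ?thesis using ifb[of "l = j" i] ifb[of "l = i" j] unfolding b_def \<beta>_def distrib_right[of _ _ s] by linarith
   qed
   have sqm: "(c * a)\<^sup>2 \<le> c\<^sup>2 * (B\<^sup>2 * s\<^sup>2)" if "\<bar>a\<bar> \<le> B * s" for a B c
   proof -
    have "a\<^sup>2 \<le> (B * s)\<^sup>2" using power_mono[OF that, of 2] by simp
    then show ?thesis by (simp add: power_mult_distrib mult_left_mono)
   qed
   have "Q x \<le> (\<Oplus>l. 5 * lam $ l * ((Dtheta R x $ l)\<^sup>2 * ((\<bar>Dg x $ i\<bar> + \<bar>Dg x $ j\<bar>)\<^sup>2 * s\<^sup>2)) + 2 * ((?th x)\<^sup>2 * ((\<beta> l x)\<^sup>2 * s\<^sup>2)) / lam $ l)"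
    unfolding Q_def
   proof (intro sum_mono add_mono)
    fix l
    show "5 * lam $ l * (Dtheta R x $ l * t x)\<^sup>2 \<le> 5 * lam $ l * ((Dtheta R x $ l)\<^sup>2 * ((\<bar>Dg x $ i\<bar> + \<bar>Dg x $ j\<bar>)\<^sup>2 * s\<^sup>2))"
     using lam[of l] by (intro mult_left_mono sqm[OF tb]) auto
    show "2 * (b l x * ?th x)\<^sup>2 / lam $ l \<le> 2 * ((?th x)\<^sup>2 * ((\<beta> l x)\<^sup>2 * s\<^sup>2)) / lam $ l"
     using lam[of l] sqm[OF bb[of l], of "?th x"] by (intro divide_right_mono) (auto simp: mult.commute)
   qed
   also have "\<dots> = kp x * s\<^sup>2" unfolding kp_def by (simp add: sum_distrib_right distrib_right mult.assoc)
   also have "\<dots> \<le> C * gw lam x * s\<^sup>2" by (intro mult_right_mono kpC) simp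
   finally show ?thesis by (simp add: s(2) mult.assoc)
  qed
  have iN: "integrable (gauss lam) (Nrm v Dv f)"
   unfolding Nrm_def by (intro Bochner_Integration.integrable_add Bochner_Integration.integrable_sum L2_integrable_square vL f)
  have mN: "Nrm v Dv f \<in> borel_measurable borel" using borel_measurable_integrable[OF iN] by (simp add: measurable_gauss)
  have iG: "integrable lborel (\<lambda>x. gw lam x * Nrm v Dv f x)" "(LBINT x. gw lam x * Nrm v Dv f x) = (LINT x|gauss lam. Nrm v Dv f x)"
   using gauss_integral[OF lam mN] iN by auto
  have L1: "L2 lborel (\<lambda>x. ?th x * Dt l x)" for l by (rule L2_cc_mult[OF tL(2) test_fn_cc(1)[OF thU]])
  have L2': "L2 lborel (\<lambda>x. Dtheta R x $ l * t x)" for l by (rule L2_cc_mult[OF tL(1) test_fn_cc(2)[OF thU]])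
  have L3: "L2 lborel (\<lambda>x. b l x * ?th x)" for l using L2_cc_mult[OF bL test_fn_cc(1)[OF thU]] by (simp add: mult.commute)
  have Qi: "integrable lborel Q" unfolding Q_def
   by (intro Bochner_Integration.integrable_sum Bochner_Integration.integrable_add integrable_mult_right integrable_divide
      L2_integrable_square[OF L2'] L2_integrable_square[OF L3])
  have Qint: "(LBINT x. Q x) \<le> C * (LINT x|gauss lam. Nrm v Dv f x)"
   using integral_mono[OF Qi _ Qb] iG by simp
  have Dtb: "lam $ l / 2 * (LBINT x. (?th x * Dt l x)\<^sup>2) \<le> C * (LINT x|gauss lam. Nrm v Dv f x)" for l
  proof -
   have "(LBINT x. lam $ l * (?th x * Dt l x)\<^sup>2 / 2) \<le> (LBINT x. Q x - NN x)"
   proof (rule integral_mono)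
    fix x
    have "lam $ l * (?th x * Dt l x)\<^sup>2 / 2 \<le> (\<Oplus>l. lam $ l * (?th x * Dt l x)\<^sup>2 / 2)"
     by (rule member_le_sum[of l UNIV "\<lambda>l. lam $ l * (?th x * Dt l x)\<^sup>2 / 2"]) (use lam less_imp_le in \<open>auto intro!: divide_nonneg_pos mult_nonneg_nonneg\<close>)
    then show "lam $ l * (?th x * Dt l x)\<^sup>2 / 2 \<le> Q x - NN x" using ptw[of x] by linarith
   qed (use L2_integrable_square[OF L1] Qi Ni in auto)
   also have "\<dots> = (LBINT x. Q x)" using Qi Ni by simp
   finally show ?thesis using Qint by simp
  qed
  have tb: "5 * lam $ l * (LBINT x. (Dtheta R x $ l * t x)\<^sup>2) \<le> C * (LINT x|gauss lam. Nrm v Dv f x)" for l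
  proof -
   have "(LBINT x. 5 * lam $ l * (Dtheta R x $ l * t x)\<^sup>2) \<le> (LBINT x. Q x)"
   proof (rule integral_mono)
    fix x
    have nn: "0 \<le> 2 * (b l x * ?th x)\<^sup>2 / lam $ l" "0 \<le> 5 * lam $ l * (Dtheta R x $ l * t x)\<^sup>2" for l
     using lam[of l] by (auto intro!: divide_nonneg_pos mult_nonneg_nonneg)
    have "5 * lam $ l * (Dtheta R x $ l * t x)\<^sup>2 \<le> 5 * lam $ l * (Dtheta R x $ l * t x)\<^sup>2 + 2 * (b l x * ?th x)\<^sup>2 / lam $ l" using nn by simp
    also have "\<dots> \<le> Q x" unfolding Q_def
     by (rule member_le_sum[of l UNIV "\<lambda>l. 5 * lam $ l * (Dtheta R x $ l * t x)\<^sup>2 + 2 * (b l x * ?th x)\<^sup>2 / lam $ l"]) (use nn in \<open>auto intro!: add_nonneg_nonneg\<close>)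
    finally show "5 * lam $ l * (Dtheta R x $ l * t x)\<^sup>2 \<le> Q x" .
   qed (use L2_integrable_square[OF L2'] Qi in auto)
   then show ?thesis using Qint by simp
  qed
  define d where "d l x = ?th x * Dt l x + t x * Dtheta R x $ l" for l x
  have Wd: "Wc U (\<lambda>x. ?th x * t x) d" unfolding d_def by (rule Wc_mult[OF W1t thU])
  have "(LBINT x. (d l x)\<^sup>2) \<le> C' * (LINT x|gauss lam. Nrm v Dv f x)" for l
  proof -
   define I where "I = (LINT x|gauss lam. Nrm v Dv f x)"
   have I: "I \<ge> 0" unfolding I_def using Nrm_bounds(4) by (intro integral_nonneg_AE AE_I2) auto
   have "(LBINT x. (d l x)\<^sup>2) \<le> (LBINT x. 2 * (?th x * Dt l x)\<^sup>2 + 2 * (Dtheta R x $ l * t x)\<^sup>2)"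
   proof (rule integral_mono)
    show "integrable lborel (\<lambda>x. (d l x)\<^sup>2)" using Wd by (auto simp: Wc_def L2_def)
    show "integrable lborel (\<lambda>x. 2 * (?th x * Dt l x)\<^sup>2 + 2 * (Dtheta R x $ l * t x)\<^sup>2)"
     using L2_integrable_square[OF L1] L2_integrable_square[OF L2'] by simp
    have "(a + c)\<^sup>2 \<le> 2 * a\<^sup>2 + 2 * c\<^sup>2" for a c :: real using sum_squares_bound[of a c] by (simp add: power2_eq_square algebra_simps)
    from this[of "?th _ * Dt l _" "Dtheta R _ $ l * t _"] show "(d l x)\<^sup>2 \<le> 2 * (?th x * Dt l x)\<^sup>2 + 2 * (Dtheta R x $ l * t x)\<^sup>2" for x
     unfolding d_def by (simp add: mult.commute[of "t x"])
   qed
   also have "\<dots> = 2 * (LBINT x. (?th x * Dt l x)\<^sup>2) + 2 * (LBINT x. (Dtheta R x $ l * t x)\<^sup>2)"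
    using L2_integrable_square[OF L1] L2_integrable_square[OF L2'] by simp
   also have "\<dots> \<le> 5 / lam $ l * C * I"
   proof -
    have "(LBINT x. (?th x * Dt l x)\<^sup>2) \<le> 2 * (C * I) / lam $ l" using Dtb[of l] lam[of l] by (simp add: I_def field_simps)
    moreover have "(LBINT x. (Dtheta R x $ l * t x)\<^sup>2) \<le> (C * I) / (5 * lam $ l)" using tb[of l] lam[of l] by (simp add: I_def field_simps)
    moreover have "2 * (2 * (C * I) / lam $ l) + 2 * ((C * I) / (5 * lam $ l)) \<le> 5 / lam $ l * C * I"
    proof -
     have "0 \<le> C * I / lam $ l" using C(1) I lam[of l] by simp
     moreover have "2 * (2 * (C * I) / lam $ l) + 2 * ((C * I) / (5 * lam $ l)) = (22/5) * (C * I / lam $ l)" using lam[of l] by (simp add: field_simps)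
     moreover have "5 / lam $ l * C * I = 5 * (C * I / lam $ l)" by simp
     ultimately show ?thesis by linarith
    qed
    ultimately show ?thesis by linarith
   qed
   also have "\<dots> \<le> C' * I" using C'l[of l] I by (intro mult_right_mono)
   finally show ?thesis by (simp add: I_def)
  qed
  then show "\<exists>d. \<forall>l. L2 lborel (d l) \<and> weak_pderiv UNIV (\<lambda>x. theta R x * tang i j Dv x) l (d l) \<and>
    (LBINT x. (d l x)\<^sup>2) \<le> C' * (LINT x|gauss lam. Nrm v Dv f x)"
   using Wd unfolding Wc_def t_def by blast
 qed
qed

text \<open>Energy convergence of the penalised solutions keeps the integrals of \<open>Nrm\<close>
  bounded, so the uniform tangential bound passes to the limit by \<open>weak_pderiv_limit\<close>.
  Since the test functions range over the whole space, the resulting regularity holds up to the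
  boundary.\<close>

lemma tangential_regularity:
 assumes R: "R > 0" and lmb: "lmb > 0" and f: "L2 (gauss lam) f" and U: "HW lam U DU" "AE x in lborel. g x > 0 \<longrightarrow> U x = 0"
  and eqU: "\<And>\<psi> D\<psi>. HW lam \<psi> D\<psi> ==> AE x in lborel. g x > 0 \<longrightarrow> \<psi> x = 0 ==> Efm lmb U DU \<psi> D\<psi> = (LINT x|gauss lam. f x * \<psi> x)"
 obtains d where "\<And>l. L2 lborel (d l)" "\<And>l. weak_pderiv UNIV (\<lambda>x. theta R x * tang i j DU x) l (d l)"
proof -
 obtain un Dun where H: "\<And>n::nat. HW lam (un n) (Dun n)"
  and eq: "\<And>n \<psi> D\<psi>. HW lam \<psi> D\<psi> ==> Efm lmb (un n) (Dun n) \<psi> D\<psi> + real n * (LINT x|gauss lam. (pen x * un n x) * \<psi> x) = (LINT x|gauss lam. f x * \<psi> x)"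
  and l1: "(\<lambda>n. \<integral>x. (un n x - U x)\<^sup>2 \<partial>gauss lam) \<longlonglongrightarrow> 0"
  and l2: "\<And>l. (\<lambda>n. \<integral>x. (Dun n l x - DU l x)\<^sup>2 \<partial>gauss lam) \<longlonglongrightarrow> 0"
  by (rule penalised_approximation[OF lmb f U]) (assumption | rule eqU | rule that)+
 obtain C where C: "C \<ge> 0" "\<forall>n v Dv f. HW lam v Dv \<longrightarrow> L2 (gauss lam) f \<longrightarrow>
   (\<forall>\<psi> D\<psi>. HW lam \<psi> D\<psi> \<longrightarrow> Efm lmb v Dv \<psi> D\<psi> + real n * (LINT x|gauss lam. (pen x * v x) * \<psi> x) = (LINT x|gauss lam. f x * \<psi> x)) \<longrightarrow>
   (\<exists>d. \<forall>l. L2 lborel (d l) \<and> weak_pderiv UNIV (\<lambda>x. theta R x * tang i j Dv x) l (d l) \<and>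
    (LBINT x. (d l x)\<^sup>2) \<le> C * (LINT x|gauss lam. Nrm v Dv f x))"
  by (rule tangential_bound[OF R less_imp_le[OF lmb], of i j]) (rule that)
 have "\<forall>n. \<exists>d. \<forall>l. L2 lborel (d l) \<and> weak_pderiv UNIV (\<lambda>x. theta R x * tang i j (Dun n) x) l (d l) \<and>
    (LBINT x. (d l x)\<^sup>2) \<le> C * (LINT x|gauss lam. Nrm (un n) (Dun n) f x)"
  using C(2)[rule_format, OF H f eq] by blast
 from choice[OF this] obtain dn where dn: "\<And>n l. L2 lborel (dn n l)" "\<And>n l. weak_pderiv UNIV (\<lambda>x. theta R x * tang i j (Dun n) x) l (dn n l)"
  "\<And>n l. (LBINT x. (dn n l x)\<^sup>2) \<le> C * (LINT x|gauss lam. Nrm (un n) (Dun n) f x)" by blast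
 have uL: "L2 (gauss lam) (un n)" "L2 (gauss lam) (Dun n l)" "L2 (gauss lam) U" "L2 (gauss lam) (DU l)" for n l
  using H U(1) by (auto simp: HW_def)
 have Ne: "(LINT x|gauss lam. Nrm (un n) (Dun n) f x) = (LINT x|gauss lam. (un n x)\<^sup>2) + (\<Oplus>k. \<integral>x. (Dun n k x)\<^sup>2 \<partial>gauss lam) + (LINT x|gauss lam. (f x)\<^sup>2)" for n
  unfolding Nrm_def using L2_integrable_square[OF uL(1)] L2_integrable_square[OF uL(2)] L2_integrable_square[OF f] by simp
 have "(\<lambda>n. \<integral>x. Nrm (un n) (Dun n) f x \<partial>gauss lam) \<longlonglongrightarrow> (LINT x|gauss lam. (U x)\<^sup>2) + (\<Oplus>k. \<integral>x. (DU k x)\<^sup>2 \<partial>gauss lam) + (LINT x|gauss lam. (f x)\<^sup>2)"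
  unfolding Ne by (intro tendsto_intros L2_tendsto_square[OF uL(1) uL(3) l1] L2_tendsto_square[OF uL(2) uL(4) l2])
 then have "Bseq (\<lambda>n. \<integral>x. Nrm (un n) (Dun n) f x \<partial>gauss lam)" by (rule convergent_imp_Bseq[OF convergentI])
 then obtain B where B: "\<And>n. \<bar>\<integral>x. Nrm (un n) (Dun n) f x \<partial>gauss lam\<bar> \<le> B" unfolding Bseq_def by auto
 have bd: "(LBINT x. (dn n l x)\<^sup>2) \<le> C * B" for n l
  using dn(3)[of n l] mult_left_mono[of "\<integral>x. Nrm (un n) (Dun n) f x \<partial>gauss lam" B C] B[of n] C(1) by linarith
 let ?th = "theta R :: real^'n => real"
 note th = theta_test[OF R]
 have TL: "L2loc UNIV (\<lambda>x. ?th x * tang i j DU x)"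
  unfolding tang_def
  by (intro L2loc_mult[OF L2loc_diff[OF L2loc_mult[OF L2_gauss_L2loc[OF lam uL(4)] Dg_continuous] L2loc_mult[OF L2_gauss_L2loc[OF lam uL(4)] Dg_continuous]] C1_continuous[OF test_fn_C1[OF th]]])
 have "\<exists>d. L2 lborel d \<and> weak_pderiv UNIV (\<lambda>x. ?th x * tang i j DU x) l d" for l
 proof (rule weak_pderiv_limit[OF TL dn(2)[where l=l] dn(1) bd])
  fix \<phi> :: "real^'n => real" and D\<phi> assume t: "test_fn UNIV \<phi> D\<phi>"
  have c: "cc UNIV (\<lambda>x. (?th x * Dg x $ p) * D\<phi> x $ l)" for p
   by (intro cc_mult[OF _ test_fn_cc(2)[OF t]] continuous_intros C1_continuous[OF test_fn_C1[OF th]] Dg_continuous)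
  have e: "(LBINT x. ?th x * tang i j Dv x * D\<phi> x $ l) = (LBINT x. Dv j x * ((?th x * Dg x $ i) * D\<phi> x $ l)) - (LBINT x. Dv i x * ((?th x * Dg x $ j) * D\<phi> x $ l))"
   if "\<And>k. L2 (gauss lam) (Dv k)" for Dv
  proof -
   have i: "integrable lborel (\<lambda>x. Dv k x * ((?th x * Dg x $ p) * D\<phi> x $ l))" for k p
    using cc_integrable_mult[OF L2_gauss_L2loc[OF lam that] c, of p k] by (simp add: mult.commute)
   have "?th x * tang i j Dv x * D\<phi> x $ l = Dv j x * ((?th x * Dg x $ i) * D\<phi> x $ l) - Dv i x * ((?th x * Dg x $ j) * D\<phi> x $ l)" for x
    by (simp add: tang_def algebra_simps)
   then show ?thesis using i by simp
  qed
  show "(\<lambda>n. \<integral>x. ?th x * tang i j (Dun n) x * D\<phi> x $ l \<partial>lborel) \<longlonglongrightarrow> (LBINT x. ?th x * tang i j DU x * D\<phi> x $ l)"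
   unfolding e[OF uL(2)] e[OF uL(4)]
   by (intro tendsto_diff gauss_tendsto_cc[OF lam uL(2) uL(4) l2 c])
 qed blast
 then have "\<forall>l. \<exists>d. L2 lborel d \<and> weak_pderiv UNIV (\<lambda>x. ?th x * tang i j DU x) l d" by blast
 from choice[OF this] show thesis using that by blast
qed

end

lemma monotone_bounded_integrable:
 fixes f :: "nat => 'a => real"
 assumes f: "\<And>n. integrable M (f n)" and mono: "\<And>x m n. m \<le> n ==> f m x \<le> f n x" and lim: "\<And>x. (\<lambda>n. f n x) \<longlonglongrightarrow> u x"
  and b: "\<And>n. (LINT x|M. f n x) \<le> K"
 shows "integrable M u" "(LINT x|M. u x) \<le> K"
proof -
 have inc: "incseq (\<lambda>n. \<integral>x. f n x \<partial>M)" unfolding incseq_def using mono f by (auto intro!: integral_mono)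
 obtain L where L: "(\<lambda>n. \<integral>x. f n x \<partial>M) \<longlonglongrightarrow> L" using incseq_convergent[OF inc, of K] b by blast
 have m: "u \<in> borel_measurable M"
  by (rule borel_measurable_LIMSEQ_real[OF lim borel_measurable_integrable[OF f]])
 have AEm: "AE x in M. mono (\<lambda>n. f n x)" using mono by (auto simp: mono_def)
 have AEl: "AE x in M. (\<lambda>n. f n x) \<longlonglongrightarrow> u x" using lim by simp
 show "integrable M u" by (rule integrable_monotone_convergence[OF f AEm AEl L m])
 have "(LINT x|M. u x) = L" by (rule integral_monotone_convergence[OF f AEm AEl L m])
 then show "(LINT x|M. u x) \<le> K" using LIMSEQ_le_const2[OF L] b by blast
qed

section \<open>Hardy inequality\<close>

text \<open>The function \<open>1 / (sqrt (s\<^sup>2 + e\<^sup>2) - s)\<close> satisfies \<open>\<beta>\<^sup>2 \<le> \<beta>'\<close> and \<open>\<beta>' \<ge> 1 / (2 (s\<^sup>2 + e\<^sup>2))\<close> for negative arguments; integrating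
 \<open>div (\<beta>(g) Dg P\<^sup>2)\<close> therefore gives Hardy's inequality with a regularised weight.\<close>
definition hb :: "real => real => real" where "hb e s = 1 / (sqrt (s\<^sup>2 + e\<^sup>2) - s)"
definition hb' :: "real => real => real" where "hb' e s = 1 / (sqrt (s\<^sup>2 + e\<^sup>2) * (sqrt (s\<^sup>2 + e\<^sup>2) - s))"

lemma hb_facts:
 assumes e: "e > 0"
 shows "(hb e has_real_derivative hb' e s) (at s)" "continuous_on UNIV (hb' e)" "hb e s > 0" "hb' e s > 0"
  "s \<le> 0 ==> (hb e s)\<^sup>2 \<le> hb' e s" "s \<le> 0 ==> 1 / (2 * (s\<^sup>2 + e\<^sup>2)) \<le> hb' e s" "\<eta> > 0 ==> s \<le> - \<eta> ==> hb e s \<le> 1 / \<eta>"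
proof -
 have pos: "s\<^sup>2 + e\<^sup>2 > 0" for s using e by (simp add: add_nonneg_pos)
 have r: "sqrt (s\<^sup>2 + e\<^sup>2) > 0" "sqrt (s\<^sup>2 + e\<^sup>2) > \<bar>s\<bar>" "(sqrt (s\<^sup>2 + e\<^sup>2))\<^sup>2 = s\<^sup>2 + e\<^sup>2" for s
 proof -
  show "sqrt (s\<^sup>2 + e\<^sup>2) > 0" using pos by simp
  have "sqrt (s\<^sup>2) < sqrt (s\<^sup>2 + e\<^sup>2)" using e by (intro real_sqrt_less_mono) simp
  then show "sqrt (s\<^sup>2 + e\<^sup>2) > \<bar>s\<bar>" by simp
  show "(sqrt (s\<^sup>2 + e\<^sup>2))\<^sup>2 = s\<^sup>2 + e\<^sup>2" using pos[of s] by (simp add: less_imp_le)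
 qed
 have d: "sqrt (s\<^sup>2 + e\<^sup>2) - s > 0" for s using r(2)[of s] by linarith
 have der: "((\<lambda>s. sqrt (s\<^sup>2 + e\<^sup>2) - s) has_real_derivative s / sqrt (s\<^sup>2 + e\<^sup>2) - 1) (at s)" for s
  using pos[of s] by (auto intro!: derivative_eq_intros simp: field_simps)
 show "(hb e has_real_derivative hb' e s) (at s)"
 proof -
  have "((\<lambda>s. 1 / (sqrt (s\<^sup>2 + e\<^sup>2) - s)) has_real_derivative (0 * (sqrt (s\<^sup>2 + e\<^sup>2) - s) - 1 * (s / sqrt (s\<^sup>2 + e\<^sup>2) - 1)) / ((sqrt (s\<^sup>2 + e\<^sup>2) - s) * (sqrt (s\<^sup>2 + e\<^sup>2) - s))) (at s)"
   by (rule DERIV_divide[OF DERIV_const der]) (use d[of s] in simp)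
  moreover have "(0 * (t - s) - 1 * (s / t - 1)) / ((t - s) * (t - s)) = 1 / (t * (t - s))" if "t > 0" "t - s > 0" for t
  proof -
   have "s / t - 1 = - ((t - s) / t)" using that by (simp add: field_simps)
   then have "(0 * (t - s) - 1 * (s / t - 1)) / ((t - s) * (t - s)) = (t - s) / (t * ((t - s) * (t - s)))" by simp
   also have "\<dots> = 1 / (t * (t - s))" proof -
    have "r / (t * (r * r)) = 1 / (t * r)" for r by (cases "r = 0") simp_all
    then show ?thesis .
   qed
   finally show ?thesis .
  qed
  ultimately show ?thesis using r(1)[of s] d[of s] by (simp add: hb_def[abs_def] hb'_def)
 qed
 show "continuous_on UNIV (hb' e)" unfolding hb'_def[abs_def] using r(1) d by (intro continuous_intros) (auto simp: less_le)
 show p: "hb e s > 0" "hb' e s > 0" using r(1)[of s] d[of s] by (auto simp: hb_def hb'_def)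
 show "(hb e s)\<^sup>2 \<le> hb' e s" if "s \<le> 0"
 proof -
  have "1 / (sqrt (s\<^sup>2 + e\<^sup>2) - s) \<le> 1 / sqrt (s\<^sup>2 + e\<^sup>2)" using that r(1)[of s] d[of s] by (intro divide_left_mono mult_pos_pos) auto
  from mult_right_mono[OF this, of "hb e s"] show ?thesis using p by (simp add: power2_eq_square hb_def hb'_def)
 qed
 show "1 / (2 * (s\<^sup>2 + e\<^sup>2)) \<le> hb' e s" if "s \<le> 0"
 proof -
  have "sqrt (s\<^sup>2 + e\<^sup>2) * (sqrt (s\<^sup>2 + e\<^sup>2) - s) \<le> sqrt (s\<^sup>2 + e\<^sup>2) * (2 * sqrt (s\<^sup>2 + e\<^sup>2))"
   using r(1,2)[of s] by (intro mult_left_mono) auto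
  also have "\<dots> = 2 * (sqrt (s\<^sup>2 + e\<^sup>2))\<^sup>2" by (simp only: power2_eq_square mult.left_commute)
  also have "\<dots> = 2 * (s\<^sup>2 + e\<^sup>2)" unfolding r(3) ..
  finally show ?thesis unfolding hb'_def using r(1)[of s] d[of s] by (intro divide_left_mono) (auto intro!: mult_pos_pos pos)
 qed
 show "hb e s \<le> 1 / \<eta>" if "\<eta> > 0" "s \<le> - \<eta>"
  unfolding hb_def using that r(2)[of s] by (intro divide_left_mono) (auto intro!: mult_pos_pos d)
qed

context regular_domain
begin

definition gq :: "real^'n => real" where "gq x = (\<Oplus>i. (Dg x $ i)\<^sup>2)"

lemma gq_continuous: "continuous_on UNIV gq"
 unfolding gq_def by (intro continuous_intros Dg_continuous)

lemma gq_nonneg: "gq x \<ge> 0" unfolding gq_def by (intro sum_nonneg) auto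

text \<open>The continuous function \<open>\<bar>g\<bar> + gq\<close> is positive, because the
  gradient does not vanish on the zero set; half of its minimum over the compact ball works.\<close>

lemma near_boundary:
 obtains c where "c > 0" "\<And>x. x \<in> cball 0 \<rho> ==> \<bar>g x\<bar> \<le> c ==> gq x \<ge> c"
proof (cases "cball (0::real^'n) \<rho> = {}")
 case True then show thesis using that[of 1] by auto
next
 case False
 have "continuous_on (cball 0 \<rho>) (\<lambda>x. \<bar>g x\<bar> + gq x)"
  by (intro continuous_intros continuous_on_subset[OF g_continuous] continuous_on_subset[OF gq_continuous]) auto
 then obtain x0 where x0: "x0 \<in> cball 0 \<rho>" "\<And>x. x \<in> cball 0 \<rho> ==> \<bar>g x0\<bar> + gq x0 \<le> \<bar>g x\<bar> + gq x"
  using continuous_attains_inf[OF compact_cball False] by blast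
 have "\<bar>g x0\<bar> + gq x0 > 0"
 proof (cases "g x0 = 0")
  case True
  then have "Dg x0 \<noteq> 0" by (rule Dg_nz)
  then have "gq x0 \<noteq> 0" unfolding gq_def by (subst sum_nonneg_eq_0_iff) (auto simp: vec_eq_iff)
  then show ?thesis using gq_nonneg[of x0] by linarith
 next
  case False then show ?thesis using gq_nonneg[of x0] by linarith
 qed
 then show thesis using x0(2) by (intro that[of "(\<bar>g x0\<bar> + gq x0) / 2"]) fastforce+
qed

text \<open>Because \<open>P\<close> is a Sobolev function on the whole space that vanishes where
  \<open>g > 0\<close>, the field carrying the regularised weight can be integrated over the whole
  space and no boundary term appears.\<close>

lemma hardy:
 assumes W: "W1 UNIV P d" and L: "L2 lborel P" "\<And>l. L2 lborel (d l)" and rho: "\<rho> > 0" and z: "\<And>x. norm x > \<rho> ==> P x = 0"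
  and P0: "AE x in lborel. g x > 0 \<longrightarrow> P x = 0"
 shows "integrable lborel (\<lambda>x. indicator Om x * (gq x * (P x / g x)\<^sup>2))"
proof -
 define lap where "lap x = (\<Oplus>i. D2g x $ i $ i)" for x
 have "bounded (lap ` cball 0 \<rho>)" unfolding lap_def
  by (intro compact_imp_bounded compact_continuous_image continuous_intros continuous_on_subset[OF D2g_continuous]) auto
 then obtain m0 where m0: "\<forall>x\<in>cball 0 \<rho>. \<bar>lap x\<bar> \<le> m0" by (auto simp: bounded_iff)
 define m where "m = \<bar>m0\<bar>"
 have m: "m \<ge> 0" "\<And>x. norm x \<le> \<rho> ==> \<bar>lap x\<bar> \<le> m" using m0 by (force simp: m_def)+
 obtain c where c: "c > 0" "\<And>x. x \<in> cball 0 \<rho> ==> \<bar>g x\<bar> \<le> c ==> gq x \<ge> c" by (rule near_boundary) (rule that)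
 \<comment> \<open>Pays for the term with the Laplacian of \<open>g\<close>:
   \<open>m\<^sup>2 / c\<close> comes from Young's inequality near the boundary, where
   \<open>gq \<ge> c\<close>, and \<open>m / c\<close> from the bound \<open>1 / c\<close> on the
   weight away from it.\<close>
 define K where "K = m\<^sup>2 / c + m / c"
 have K: "K \<ge> 0" unfolding K_def using m c by simp
 let ?th = "theta \<rho> :: real^'n => real"
 have est: "(LBINT x. gq x * (P x)\<^sup>2 * hb' e (g x)) \<le> 4 * (LBINT x. 2 * (\<Oplus>i. (d i x)\<^sup>2) + K * (P x)\<^sup>2)"
  and esti: "integrable lborel (\<lambda>x. gq x * (P x)\<^sup>2 * hb' e (g x))" if e: "e > 0" for e
 proof -
  note h = hb_facts[OF e]
  have Cb: "C1 (\<lambda>x. hb e (g x) * Dg x $ i) (\<lambda>x. hb e (g x) *\<^sub>R D2g x $ i + Dg x $ i *\<^sub>R (hb' e (g x) *\<^sub>R Dg x))" for i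
   by (rule C1_mult[OF C1_compose[OF gC1 h(1,2)] DgC1])
  define E where "E i x = (hb e (g x) * Dg x $ i * ?th x) * (P x * d i x + P x * d i x) + P x * P x *
    ((hb e (g x) * Dg x $ i) *\<^sub>R Dtheta \<rho> x + ?th x *\<^sub>R (hb e (g x) *\<^sub>R D2g x $ i + Dg x $ i *\<^sub>R (hb' e (g x) *\<^sub>R Dg x))) $ i" for i x
  have "null_integral (E i)" for i
   using W1_product[OF open_UNIV W W test_fn_mult[OF Cb theta_test[OF rho]], of i i] unfolding E_def by simp
  then have "has_bochner_integral lborel (\<lambda>x. \<Oplus>i. E i x) (\<Sum>i\<in>(UNIV::'n set). 0)" by (intro has_bochner_integral_sum) auto
  then have Ei: "integrable lborel (\<lambda>x. \<Oplus>i. E i x)" "(LBINT x. (\<Oplus>i. E i x)) = 0" by (auto simp: has_bochner_integral_iff)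
  have Es: "(\<Oplus>i. E i x) = 2 * P x * hb e (g x) * (\<Oplus>i. Dg x $ i * d i x) + (P x)\<^sup>2 * (hb e (g x) * lap x + hb' e (g x) * gq x)" for x
  proof (cases "norm x \<le> \<rho>")
   case True
   have "Dtheta \<rho> x = 0"
   proof -
    have "(norm x)\<^sup>2 \<le> \<rho>\<^sup>2" using True by (intro power_mono) auto
    then have "(x \<bullet> x) / \<rho>\<^sup>2 \<le> 1" using rho by (simp add: power2_norm_eq_inner divide_le_eq)
    then show ?thesis by (simp add: Dtheta_def step_simps(4))
   qed
   moreover have "?th x = 1" by (rule theta_bounds(3)[OF rho True])
   ultimately show ?thesis unfolding E_def lap_def gq_def
    by (simp add: sum.distrib sum_distrib_left power2_eq_square algebra_simps)
  next
   case False
   then have "P x = 0" using z by simp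
   then show ?thesis by (simp add: E_def)
  qed
  have ptw: "AE x in lborel. gq x * (P x)\<^sup>2 * hb' e (g x) \<le> 4 * ((\<Oplus>i. E i x) + (2 * (\<Oplus>i. (d i x)\<^sup>2) + K * (P x)\<^sup>2))"
   using P0
  proof eventually_elim
   case (elim x)
   show ?case
   proof (cases "P x = 0")
    case True
    have "0 \<le> (\<Oplus>i. (d i x)\<^sup>2)" by (intro sum_nonneg) auto
    then show ?thesis unfolding Es using True by simp
   next
    case False
    then have gx: "g x \<le> 0" and nx: "norm x \<le> \<rho>" using elim z[of x] by (meson not_less)+
    define B where "B = hb e (g x)"
    define B' where "B' = hb' e (g x)"
    have B: "B > 0" "B' > 0" "B\<^sup>2 \<le> B'" using h(3,4,5)[of "g x"] gx by (auto simp: B_def B'_def)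
    have y1: "- (2 * P x * B * (\<Oplus>i. Dg x $ i * d i x)) \<le> (P x)\<^sup>2 * B' * gq x / 2 + 2 * (\<Oplus>i. (d i x)\<^sup>2)"
    proof -
     have "- (2 * P x * B * (\<Oplus>i. Dg x $ i * d i x)) = (\<Oplus>i. - (2 * (P x * B * Dg x $ i) * d i x))"
      by (simp add: sum_distrib_left sum_negf mult.assoc)
     also have "\<dots> \<le> (\<Oplus>i. (P x * B * Dg x $ i)\<^sup>2 / 2 + 2 * (d i x)\<^sup>2)"
     proof (rule sum_mono)
      fix i have "0 \<le> (P x * B * Dg x $ i + 2 * d i x)\<^sup>2 / 2" by simp
      then show "- (2 * (P x * B * Dg x $ i) * d i x) \<le> (P x * B * Dg x $ i)\<^sup>2 / 2 + 2 * (d i x)\<^sup>2"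
       by (simp add: power2_eq_square algebra_simps)
     qed
     also have "\<dots> = (P x)\<^sup>2 * B\<^sup>2 * gq x / 2 + 2 * (\<Oplus>i. (d i x)\<^sup>2)"
      unfolding gq_def by (simp add: sum.distrib sum_distrib_left sum_divide_distrib power_mult_distrib)
     also have "(P x)\<^sup>2 * B\<^sup>2 * gq x / 2 \<le> (P x)\<^sup>2 * B' * gq x / 2"
      using B(3) gq_nonneg[of x] by (intro divide_right_mono mult_right_mono mult_left_mono) auto
     finally show ?thesis by simp
    qed
    have y2: "- (B * lap x) \<le> B' * gq x / 4 + K"
    proof -
     have "- (B * lap x) \<le> B * m" using m(2)[OF nx] B(1) by (metis abs_le_D2 mult_left_mono mult_minus_right less_imp_le)
     also have "\<dots> \<le> B' * gq x / 4 + K"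
     proof (cases "\<bar>g x\<bar> \<le> c")
      case True
      have q: "gq x \<ge> c" using c(2)[of x] nx True by simp
      have "0 \<le> (B * c / 2 - m)\<^sup>2 / c" using c by simp
      then have "B * m \<le> B\<^sup>2 * c / 4 + m\<^sup>2 / c" using c by (simp add: power2_eq_square field_simps)
      also have "B\<^sup>2 * c \<le> B' * gq x" using B q c by (intro mult_mono) auto
      finally show ?thesis unfolding K_def using m c by (simp add: field_simps)
     next
      case False
      then have "B \<le> 1 / c" unfolding B_def using h(7)[OF c(1)] gx by simp
      then have "B * m \<le> 1 / c * m" by (intro mult_right_mono m)
      moreover have "0 \<le> B' * gq x / 4" "0 \<le> m\<^sup>2 / c" using B(2) gq_nonneg[of x] c by auto
      ultimately show ?thesis unfolding K_def by simp
     qed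
     finally show ?thesis .
    qed
    have y2': "- ((P x)\<^sup>2 * (B * lap x)) \<le> (P x)\<^sup>2 * (B' * gq x) / 4 + K * (P x)\<^sup>2"
     using mult_left_mono[OF y2, of "(P x)\<^sup>2"] by (simp add: algebra_simps)
    show ?thesis unfolding Es B_def[symmetric] B'_def[symmetric] using y1 y2' by (simp add: algebra_simps)
   qed
  qed
  have di: "integrable lborel (\<lambda>x. 2 * (\<Oplus>i. (d i x)\<^sup>2) + K * (P x)\<^sup>2)"
   using L2_integrable_square[OF L(1)] L2_integrable_square[OF L(2)] by simp
  show i1: "integrable lborel (\<lambda>x. gq x * (P x)\<^sup>2 * hb' e (g x))"
  proof -
   have "continuous_on UNIV (\<lambda>x. hb' e (g x) * gq x)"
    by (intro continuous_intros gq_continuous continuous_on_compose2[OF h(2) g_continuous]) auto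
   then have "cc UNIV (\<lambda>x. (hb' e (g x) * gq x) * ?th x)" by (rule cc_mult[OF _ test_fn_cc(1)[OF theta_test[OF rho]]])
   from L2loc_integrable_mult[OF L2_L2loc[OF L(1)] L2_L2loc[OF L(1)] this]
   have "integrable lborel (\<lambda>x. (hb' e (g x) * gq x) * ?th x * (P x * P x))" .
   moreover have "(hb' e (g x) * gq x) * ?th x * (P x * P x) = gq x * (P x)\<^sup>2 * hb' e (g x)" for x
    using z[of x] theta_bounds(3)[OF rho, of x] by (cases "norm x \<le> \<rho>") (auto simp: power2_eq_square)
   ultimately show ?thesis by simp
  qed
  have "(LBINT x. gq x * (P x)\<^sup>2 * hb' e (g x)) \<le> (LBINT x. 4 * ((\<Oplus>i. E i x) + (2 * (\<Oplus>i. (d i x)\<^sup>2) + K * (P x)\<^sup>2)))"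
   by (rule integral_mono_AE[OF i1 integrable_mult_right[OF Bochner_Integration.integrable_add[OF Ei(1) di]] ptw])
  also have "\<dots> = 4 * (LBINT x. 2 * (\<Oplus>i. (d i x)\<^sup>2) + K * (P x)\<^sup>2)"
   using Ei di by (subst integral_mult_right_zero) (simp add: Bochner_Integration.integral_add[OF Ei(1) di])
  finally show "(LBINT x. gq x * (P x)\<^sup>2 * hb' e (g x)) \<le> 4 * (LBINT x. 2 * (\<Oplus>i. (d i x)\<^sup>2) + K * (P x)\<^sup>2)" .
 qed
 define I where "I = (LBINT x. 2 * (\<Oplus>i. (d i x)\<^sup>2) + K * (P x)\<^sup>2)"
 define ep where "ep n = 1 / real (Suc n)" for n
 have ep: "ep n > 0" for n by (simp add: ep_def)
 \<comment> \<open>The weight regularised by \<open>ep n\<close>; it increases as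
   \<open>ep n\<close> decreases, so a uniform bound on its integrals gives the claim by monotone
   convergence.\<close>
 define F where "F n x = indicator Om x * (gq x * (P x)\<^sup>2 / ((g x)\<^sup>2 + (ep n)\<^sup>2))" for n x
 have [measurable]: "P \<in> borel_measurable borel" "gq \<in> borel_measurable borel"
  using L(1) by (auto simp: L2_def borel_measurable_continuous_onI[OF gq_continuous])
 have Fb: "0 \<le> F n x" "F n x \<le> 2 * (gq x * (P x)\<^sup>2 * hb' (ep n) (g x))" for n x
 proof -
  have p: "(g x)\<^sup>2 + (ep n)\<^sup>2 > 0" using ep[of n] by (simp add: add_nonneg_pos)
  have q: "0 \<le> gq x * (P x)\<^sup>2" using gq_nonneg[of x] by simp
  show "0 \<le> F n x" unfolding F_def using p q by simp
  show "F n x \<le> 2 * (gq x * (P x)\<^sup>2 * hb' (ep n) (g x))"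
  proof (cases "g x < 0")
   case True
   have "gq x * (P x)\<^sup>2 * (1 / (2 * ((g x)\<^sup>2 + (ep n)\<^sup>2))) \<le> gq x * (P x)\<^sup>2 * hb' (ep n) (g x)"
    using hb_facts(6)[OF ep, of "g x"] True q by (intro mult_left_mono) auto
   moreover have "a * (1 / (2 * D)) = a / D / 2" for a D :: real by simp
   moreover have "y \<le> 2 * z" if "x = y / 2" "x \<le> z" for x y z :: real using that by linarith
   ultimately have "gq x * (P x)\<^sup>2 / ((g x)\<^sup>2 + (ep n)\<^sup>2) \<le> 2 * (gq x * (P x)\<^sup>2 * hb' (ep n) (g x))" by blast
   then show ?thesis using True by (simp add: F_def)
  next
   case False then show ?thesis using q hb_facts(4)[OF ep, of n "g x"] by (simp add: F_def)
  qed
 qed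
 have Fi: "integrable lborel (F n)" for n
 proof (rule Bochner_Integration.integrable_bound)
  show "integrable lborel (\<lambda>x. 2 * (gq x * (P x)\<^sup>2 * hb' (ep n) (g x)))" using esti[OF ep] by simp
  have "Om \<in> sets borel" by measurable
  then show "F n \<in> borel_measurable lborel" unfolding F_def by measurable
  show "AE x in lborel. norm (F n x) \<le> norm (2 * (gq x * (P x)\<^sup>2 * hb' (ep n) (g x)))"
   using Fb by (intro AE_I2) (simp add: abs_of_nonneg[OF Fb(1)] order_trans[OF Fb(2) abs_ge_self])
 qed
 have FI: "(LBINT x. F n x) \<le> 8 * I" for n
  using integral_mono[OF Fi[of n] _ Fb(2)] esti[OF ep, of n] est[OF ep, of n] unfolding I_def by simp
 show ?thesis
 proof (rule monotone_bounded_integrable(1)[OF Fi _ _ FI])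
  show "F a x \<le> F b x" if "a \<le> b" for a b x
  proof -
   have "ep b \<le> ep a" unfolding ep_def using that by (intro divide_left_mono) auto
   then have "(ep b)\<^sup>2 \<le> (ep a)\<^sup>2" using ep[of b] by (intro power_mono) auto
   then show ?thesis unfolding F_def using gq_nonneg[of x] ep[of a] ep[of b]
    by (intro mult_left_mono divide_left_mono) (auto intro!: mult_pos_pos add_nonneg_pos)
  qed
  show "(\<lambda>n. F n x) \<longlonglongrightarrow> indicator Om x * (gq x * (P x / g x)\<^sup>2)" for x
  proof (cases "x \<in> Om")
   case True
   then have g0: "(g x)\<^sup>2 + 0\<^sup>2 \<noteq> 0" by simp
   have "ep \<longlonglongrightarrow> 0" unfolding ep_def by (rule LIMSEQ_Suc[OF lim_const_over_n])
   then have "(\<lambda>n. indicator Om x * (gq x * (P x)\<^sup>2 / ((g x)\<^sup>2 + (ep n)\<^sup>2))) \<longlonglongrightarrow> indicator Om x * (gq x * (P x)\<^sup>2 / ((g x)\<^sup>2 + 0\<^sup>2))"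
    by (intro tendsto_intros g0)
   then show ?thesis unfolding F_def by (simp add: power_divide)
  qed (simp add: F_def)
 qed
qed

end

section \<open>The solution inside the domain\<close>

lemma compact_subset_increasing:
 fixes U :: "nat => 'a::topological_space set"
 assumes "compact K" "K \<subseteq> (\<Union>n. U n)" "\<And>n. open (U n)" "\<And>m n. m \<le> n ==> U m \<subseteq> U n"
 obtains m where "K \<subseteq> U m"
proof -
 obtain C where C: "finite C" "K \<subseteq> (\<Union>n\<in>C. U n)" using compactE_image[OF assms(1), of UNIV U] assms(2,3) by auto
 have "U n \<subseteq> U (Max (insert 0 C))" if "n \<in> C" for n using that C(1) by (intro assms(4)) auto
 then show thesis using C(2) by (intro that[of "Max (insert 0 C)"]) blast
qed

text \<open>The local derivatives agree almost everywhere on overlaps. Choosing at each point the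
  one with the least admissible index gives a measurable function and keeps the symmetry
  exact.\<close>

lemma W1_glue:
 fixes U :: "nat => (real^'n) set" and w :: "nat => 'n => 'n => real^'n => real"
 assumes U: "\<And>n. open (U n)" "\<And>m n. m \<le> n ==> U m \<subseteq> U n" "Om = (\<Union>n. U n)"
  and w: "\<And>n h k. L2 lborel (w n h k)" "\<And>n k. W1 (U n) (a k) (\<lambda>h. w n h k)" "\<And>n h k x. w n h k x = w n k h x"
  and a: "\<And>k. L2loc Om (a k)"
 obtains d where "\<And>k. W1 Om (a k) (\<lambda>h. d h k)" "\<And>h k x. d h k x = d k h x"
proof -
 define N where "N x = (LEAST n. x \<in> U n)" for x
 define d where "d h k x = w (N x) h k x" for h k x
 have [measurable]: "U n \<in> sets borel" for n using U(1) by auto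
 have Nm: "N \<in> measurable borel (count_space UNIV)" unfolding N_def by measurable
 have dm: "d h k \<in> borel_measurable borel" for h k
  unfolding d_def by (rule measurable_compose_countable[OF _ Nm]) (use w(1) in \<open>auto simp: L2_def\<close>)
 have dw: "AE x in lborel. x \<in> U m \<longrightarrow> d h k x = w m h k x" for h k m
 proof -
  have "AE x in lborel. x \<in> U n \<longrightarrow> n \<le> m \<longrightarrow> w n h k x = w m h k x" for n
  proof (cases "n \<le> m")
   case True
   have "AE x in lborel. x \<in> U n \<longrightarrow> w n h k x = w m h k x"
    by (rule weak_pderiv_unique[OF U(1)])
     (use w(2)[of n k] W1_mono[OF w(2)[of m k] U(2)[OF True]] in \<open>auto simp: W1_def\<close>)
   then show ?thesis by eventually_elim auto
  qed auto
  then have "AE x in lborel. \<forall>n. x \<in> U n \<longrightarrow> n \<le> m \<longrightarrow> w n h k x = w m h k x" by (simp add: AE_all_countable)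
  then show ?thesis
  proof eventually_elim
   case (elim x)
   show ?case
   proof
    assume x: "x \<in> U m"
    then have "x \<in> U (N x)" "N x \<le> m" unfolding N_def by (auto intro: LeastI Least_le)
    then show "d h k x = w m h k x" using elim by (simp add: d_def)
   qed
  qed
 qed
 have dL: "L2loc Om (d h k)" for h k
  unfolding L2loc_def
 proof (intro conjI allI impI dm)
  fix K assume K: "compact K" "K \<subseteq> Om"
  obtain m where m: "K \<subseteq> U m" using compact_subset_increasing[OF K(1) K(2)[unfolded U(3)] U(1,2)] by metis
  have [measurable]: "K \<in> sets borel" "w m h k \<in> borel_measurable borel" "d h k \<in> borel_measurable borel"
   using K(1) w(1) dm by (auto simp: L2_def borel_compact)
  have "AE x in lborel. indicator K x * (w m h k x)\<^sup>2 = indicator K x * (d h k x)\<^sup>2"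
   using dw[of m h k] by eventually_elim (use m in \<open>auto simp: indicator_def\<close>)
  moreover have "integrable lborel (\<lambda>x. indicator K x * (w m h k x)\<^sup>2)" using L2_L2loc[OF w(1), of UNIV] K(1) by (auto simp: L2loc_def)
  ultimately show "integrable lborel (\<lambda>x. indicator K x * (d h k x)\<^sup>2)"
   by (subst integrable_cong_AE[symmetric]) auto
 qed
 have "weak_pderiv Om (a k) h (d h k)" for h k
 proof (rule weak_pderiv_L2locI[OF a dL])
  fix \<phi> D\<phi> assume t: "test_fn Om \<phi> D\<phi>"
  have K: "compact (closure {x. \<phi> x \<noteq> 0})" "closure {x. \<phi> x \<noteq> 0} \<subseteq> Om" using t by (auto simp: test_fn_def)
  obtain m where m: "closure {x. \<phi> x \<noteq> 0} \<subseteq> U m" using compact_subset_increasing[OF K(1) K(2)[unfolded U(3)] U(1,2)] by metis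
  then have t': "test_fn (U m) \<phi> D\<phi>" using t by (auto simp: test_fn_def)
  have wm: "weak_pderiv (U m) (a k) h (w m h k)" using w(2)[of m k] by (auto simp: W1_def)
  have "AE x in lborel. w m h k x * \<phi> x = d h k x * \<phi> x" using dw[of m h k]
  proof eventually_elim
   case (elim x)
   show ?case
   proof (cases "\<phi> x = 0")
    case False
    then have "x \<in> closure {x. \<phi> x \<noteq> 0}" using closure_subset[of "{x. \<phi> x \<noteq> 0}"] by blast
    then show ?thesis using elim m by auto
   qed simp
  qed
  then have "(LBINT x. w m h k x * \<phi> x) = (LBINT x. d h k x * \<phi> x)"
   using w(1)[of m h k] dm[of h k] cc_measurable[OF test_fn_cc(1)[OF t]] by (intro integral_cong_AE) (auto simp: L2_def)
  then show "(LBINT x. a k x * D\<phi> x $ h) = - (LBINT x. d h k x * \<phi> x)" using weak_pderivD(3)[OF wm t'] by simp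
 qed
 then have "W1 Om (a k) (\<lambda>h. d h k)" for k using a dL by (auto simp: W1_def)
 then show thesis by (rule that) (simp add: d_def w(3))
qed

section \<open>Cutoffs in the level of g and second derivatives inside the domain\<close>

context regular_domain
begin

text \<open>\<open>chi e\<close> vanishes for g at least -e and equals 1 for g at most -2e, and its
  gradient is \<open>- sh e\<close> times \<open>Dg\<close>. Thus \<open>sh e\<close> is a
  nonnegative weight on the shell between these levels, standing in for the surface measure;
  \<open>sh'\<close> is its derivative as a function of \<open>g\<close>.\<close>

definition chi :: "real => real^'n => real" where "chi e x = step (- g x / e - 1)"
definition sh :: "real => real^'n => real" where "sh e x = step' (- g x / e - 1) / e"
definition sh' :: "real => real^'n => real" where "sh' e x = - step'' (- g x / e - 1) / e\<^sup>2"

lemma chi_C2: "\<exists>D2. C2 (chi e) (\<lambda>x. (- sh e x) *\<^sub>R Dg x) D2"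
 and sh_C1: "C1 (sh e) (\<lambda>x. sh' e x *\<^sub>R Dg x)"
proof -
 have d: "((\<lambda>t. - t / e - 1) has_real_derivative - (1 / e)) (at t)" for t
  by (auto intro!: derivative_eq_intros simp: divide_inverse)
 have h1: "((\<lambda>t. step (- t / e - 1)) has_real_derivative - (step' (- t / e - 1) / e)) (at t)" for t
  using DERIV_chain2[OF DERIV_step(1) d, of t] by simp
 have h2: "((\<lambda>t. step' (- t / e - 1) / e) has_real_derivative - step'' (- t / e - 1) / e\<^sup>2) (at t)" for t
  using DERIV_cdivide[OF DERIV_chain2[OF DERIV_step(2) d, of t], of e] by (simp add: power2_eq_square)
 have c: "continuous_on UNIV (\<lambda>t. - step'' (- t / e - 1) / e\<^sup>2)"
  unfolding divide_inverse by (intro continuous_intros continuous_on_compose2[OF continuous_step(3)]) auto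
 have h3: "((\<lambda>t. - (step' (- t / e - 1) / e)) has_real_derivative - (- step'' (- t / e - 1) / e\<^sup>2)) (at t)" for t
  by (rule DERIV_minus[OF h2])
 have c': "continuous_on UNIV (\<lambda>t. - (- step'' (- t / e - 1) / e\<^sup>2))" by (rule continuous_on_minus[OF c])
 show "\<exists>D2. C2 (chi e) (\<lambda>x. (- sh e x) *\<^sub>R Dg x) D2"
  using C2_compose[OF gC2 h1 h3 c'] unfolding chi_def sh_def by blast
 show "C1 (sh e) (\<lambda>x. sh' e x *\<^sub>R Dg x)"
  using C1_compose[OF gC1 h2 c] unfolding sh_def sh'_def .
qed

text \<open>The last bound holds since the weight is at most \<open>2 / e\<close> and
  \<open>\<bar>g\<bar>\<close> is at most \<open>2 e\<close> on the shell. It trades the singular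
  weight for a division by \<open>g\<close>, which Hardy's inequality controls.\<close>

lemma chi_sh_facts:
 assumes e: "e > 0"
 shows "0 \<le> chi e x" "chi e x \<le> 1" "g x \<ge> - e ==> chi e x = 0" "g x \<le> - (2 * e) ==> chi e x = 1"
  "0 \<le> sh e x" "sh e x \<le> 2 / e" "g x \<ge> - e ==> sh e x = 0" "g x \<le> - (2 * e) ==> sh e x = 0" "sh e x * \<bar>g x\<bar> \<le> 4"
proof -
 have a: "- g x / e - 1 \<le> 0" if "g x \<ge> - e" using e that by (simp add: field_simps)
 have b: "- g x / e - 1 \<ge> 1" if "g x \<le> - (2 * e)" using e that by (simp add: field_simps)
 show "0 \<le> chi e x" "chi e x \<le> 1" "g x \<ge> - e ==> chi e x = 0" "g x \<le> - (2 * e) ==> chi e x = 1"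
  using a b by (auto simp: chi_def step_simps)
 show n: "0 \<le> sh e x" "sh e x \<le> 2 / e" and z: "g x \<ge> - e ==> sh e x = 0" "g x \<le> - (2 * e) ==> sh e x = 0"
  using a b e by (auto simp: sh_def step_simps divide_right_mono)
 show "sh e x * \<bar>g x\<bar> \<le> 4"
 proof (cases "g x \<ge> - e \<or> g x \<le> - (2 * e)")
  case False
  then have "sh e x * \<bar>g x\<bar> \<le> 2 / e * (2 * e)" using n e by (intro mult_mono) auto
  then show ?thesis using e by simp
 qed (use z in auto)
qed

lemma support_in_Om:
 assumes e: "e > 0" and z: "test_fn UNIV z Dz"
 obtains K where "compact K" "K \<subseteq> Om" "\<And>x. x \<notin> K ==> g x \<ge> - e \<or> z x = 0"
proof -
 obtain K where K: "compact K" "K \<subseteq> UNIV" "\<And>x. x \<notin> K ==> z x = 0" using test_fn_zero_outside[OF z] by metis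
 have "closed {x. g x \<le> - e}" by (rule closed_Collect_le[OF g_continuous continuous_on_const])
 then have "compact (K \<inter> {x. g x \<le> - e})" by (rule compact_Int_closed[OF K(1)])
 then show thesis by (rule that) (use e K(3) in force)+
qed

lemma chi_test:
 assumes e: "e > 0" and z: "test_fn UNIV z Dz"
 shows "test_fn Om (\<lambda>x. chi e x * z x) (\<lambda>x. chi e x *\<^sub>R Dz x + z x *\<^sub>R ((- sh e x) *\<^sub>R Dg x))"
  "test_fn Om (\<lambda>x. sh e x * z x) (\<lambda>x. sh e x *\<^sub>R Dz x + z x *\<^sub>R (sh' e x *\<^sub>R Dg x))"
proof -
 obtain K where K: "compact K" "K \<subseteq> Om" "\<And>x. x \<notin> K ==> g x \<ge> - e \<or> z x = 0" by (rule support_in_Om[OF e z]) (rule that)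
 have c: "C1 (chi e) (\<lambda>x. (- sh e x) *\<^sub>R Dg x)" using chi_C2 by (auto simp: C2_def)
 show "test_fn Om (\<lambda>x. chi e x * z x) (\<lambda>x. chi e x *\<^sub>R Dz x + z x *\<^sub>R ((- sh e x) *\<^sub>R Dg x))"
  by (rule test_fnI[OF C1_mult[OF c test_fn_C1[OF z]] K(1,2)]) (use K(3) chi_sh_facts(3)[OF e] in auto)
 show "test_fn Om (\<lambda>x. sh e x * z x) (\<lambda>x. sh e x *\<^sub>R Dz x + z x *\<^sub>R (sh' e x *\<^sub>R Dg x))"
  by (rule test_fnI[OF C1_mult[OF sh_C1 test_fn_C1[OF z]] K(1,2)]) (use K(3) chi_sh_facts(7)[OF e] in auto)
qed

end

text \<open>The boundary condition is encoded by null extension: \<open>U\<close> has square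
  integrable weak derivatives on the whole space. Test functions need vanish only where
  \<open>g > 0\<close>; this amounts to vanishing outside the domain because the zero set of
  \<open>g\<close> is null.\<close>

locale dirichlet_solution = regular_domain lam g Dg D2g for lam :: "real^'n" and g Dg D2g +
 fixes lmb :: real and f U :: "real^'n => real" and DU :: "'n => real^'n => real"
 assumes lmb: "lmb > 0" and f: "L2 (gauss lam) f" and U: "HW lam U DU"
  and U0: "\<And>x. x \<notin> Om ==> U x = 0" and DU0: "\<And>l x. x \<notin> Om ==> DU l x = 0" and f0: "\<And>x. x \<notin> Om ==> f x = 0"
  and eqU: "\<And>\<psi> D\<psi>. HW lam \<psi> D\<psi> ==> AE x in lborel. g x > 0 \<longrightarrow> \<psi> x = 0 ==> Efm lmb U DU \<psi> D\<psi> = (LINT x|gauss lam. f x * \<psi> x)"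
begin

lemma fL: "L2loc A f" and UL: "L2loc A U" and DUL: "L2loc A (DU l)"
 using f U L2_gauss_L2loc[OF lam] by (auto simp: HW_def)

text \<open>By the equation this is twice the Ornstein-Uhlenbeck operator applied to
  \<open>U\<close>, written without second derivatives and hence square integrable at once.\<close>

definition divF :: "real^'n => real" where "divF x = 2 * (lmb * U x - f x)"

lemma divFL: "L2loc A divF"
 unfolding divF_def[abs_def] using L2loc_mult[OF L2loc_diff[OF L2loc_mult[OF UL continuous_on_const[of UNIV lmb]] fL] continuous_on_const[of UNIV 2]] by simp

lemma eqOm:
 assumes "test_fn Om z Dz"
 shows "null_integral (\<lambda>x. (\<Oplus>l. lam $ l * (DU l x * Dz x $ l)) + (divF x + (\<Oplus>l. x $ l * DU l x)) * z x)"
proof -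
 have "Efm lmb U DU z (\<lambda>l x. Dz x $ l) + (LINT x|gauss lam. (0 * U x) * z x) = (LINT x|gauss lam. f x * z x)" if t: "test_fn Om z Dz" for z Dz
 proof -
  obtain K where K: "K \<subseteq> Om" "\<And>x. x \<notin> K ==> z x = 0" using test_fn_zero_outside[OF t] by metis
  have "z x = 0" if "g x > 0" for x using K that by force
  then show ?thesis using eqU[OF HW_test_fn[OF lam t]] by simp
 qed
 from lebesgue_form[OF U f _ _ _ this assms, of 0] show ?thesis by (simp add: divF_def algebra_simps)
qed

text \<open>Exhaust the domain by bounded sets at positive distance in level from the boundary. On
  each one a product of the two cutoffs equals 1 and interior regularity applies; the pieces are
  glued. The strong form of the equation then follows from the weak one by the fundamental
  lemma.\<close>

lemma second_derivatives:
 obtains D2U where "\<And>k. W1 Om (DU k) (\<lambda>h. D2U h k)" "\<And>h k x. D2U h k x = D2U k h x"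
  "AE x in lborel. x \<in> Om \<longrightarrow> (\<Oplus>k. lam $ k * D2U k k x) = divF x + (\<Oplus>l. x $ l * DU l x)"
proof -
 define F where "F x = divF x + (\<Oplus>l. x $ l * DU l x)" for x
 have FL: "L2loc Om F" unfolding F_def by (intro L2loc_add divFL L2loc_sum L2loc_mult DUL continuous_intros)
 define e where "e n = 1 / real (Suc n)" for n
 define V where "V n = {x. g x < - (2 * e n)} \<inter> ball 0 (real (Suc n))" for n
 have e: "e n > 0" for n by (simp add: e_def)
 have Vo: "open (V n)" for n unfolding V_def by (intro open_Int open_Collect_less g_continuous continuous_intros open_ball)
 have Vm: "V m \<subseteq> V n" if "m \<le> n" for m n
 proof -
  have "e n \<le> e m" unfolding e_def using that by (intro divide_left_mono) auto
  then show ?thesis using that by (auto simp: V_def)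
 qed
 have VOm: "V n \<subseteq> Om" for n
 proof -
  have "g x < 0" if "g x < - (2 * e n)" for x using that e[of n] by linarith
  then show ?thesis by (auto simp: V_def)
 qed
 have Vu: "Om = (\<Union>n. V n)"
 proof
  show "Om \<subseteq> (\<Union>n. V n)"
  proof
   fix x assume "x \<in> Om"
   then have gx: "g x < 0" by simp
   obtain n1 where n1: "e n1 < - g x / 2" using reals_Archimedean[of "- g x / 2"] gx by (auto simp: e_def inverse_eq_divide)
   obtain n2 where n2: "norm x < real n2" using reals_Archimedean2 by blast
   let ?n = "max n1 n2"
   have "e ?n \<le> e n1" unfolding e_def by (intro divide_left_mono) auto
   then have "x \<in> V ?n" unfolding V_def using n1 n2 by auto
   then show "x \<in> (\<Union>n. V n)" by blast
  qed
 qed (use VOm in blast)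
 have "\<forall>n. \<exists>w. (\<forall>h k. L2 lborel (w h k)) \<and> (\<forall>k. W1 (V n) (DU k) (\<lambda>h. w h k)) \<and> (\<forall>h k x. w h k x = w k h x)"
 proof
  fix n
  obtain D2 where D2: "C2 (chi (e n)) (\<lambda>x. (- sh (e n) x) *\<^sub>R Dg x) D2" using chi_C2 by blast
  have R: "real (Suc n) > 0" by simp
  obtain D2t where D2t: "C2 (theta (real (Suc n)) :: real^'n => real) (Dtheta (real (Suc n))) D2t" using theta_C2 by blast
  obtain K where K: "compact K" "K \<subseteq> Om" "\<And>x. x \<notin> K ==> g x \<ge> - e n \<or> theta (real (Suc n)) x = 0"
   by (rule support_in_Om[OF e theta_test[OF R]]) (rule that)
  have z: "chi (e n) x * theta (real (Suc n)) x = 0" if "x \<notin> K" for x using K(3)[OF that] chi_sh_facts(3)[OF e] by auto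
  have o: "chi (e n) x * theta (real (Suc n)) x = 1" if "x \<in> V n" for x
   using that chi_sh_facts(4)[OF e, of x n] theta_bounds(3)[OF R, of x] by (auto simp: V_def)
  have eq: "null_integral (\<lambda>x. (\<Oplus>l. lam $ l * (DU l x * Dz x $ l)) + F x * z x)" if "test_fn Om z Dz" for z Dz
   using eqOm[OF that] unfolding F_def .
  obtain w where "\<And>h k. L2 lborel (w h k)" "\<And>k. W1 (V n) (DU k) (\<lambda>h. w h k)" "\<And>h k x. w h k x = w k h x"
   by (rule interior_regularity[OF lam open_Om HW_W1[OF lam U] FL eq C2_test2[OF C2_mult[OF D2 D2t] K(1,2) z] Vo VOm o]) (assumption | rule that)+
  then show "\<exists>w. (\<forall>h k. L2 lborel (w h k)) \<and> (\<forall>k. W1 (V n) (DU k) (\<lambda>h. w h k)) \<and> (\<forall>h k x. w h k x = w k h x)" by blast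
 qed
 from choice[OF this] obtain w where w': "\<forall>n. (\<forall>h k. L2 lborel (w n h k)) \<and> (\<forall>k. W1 (V n) (DU k) (\<lambda>h. w n h k)) \<and> (\<forall>h k x. w n h k x = w n k h x)" ..
 have w: "L2 lborel (w n h k)" "W1 (V n) (DU k) (\<lambda>h. w n h k)" "w n h k x = w n k h x" for n h k x using w' by simp_all
 obtain D2U where D: "\<And>k. W1 Om (DU k) (\<lambda>h. D2U h k)" "\<And>h k x. D2U h k x = D2U k h x"
  by (rule W1_glue[OF Vo Vm Vu w DUL]) (assumption | rule that)+
 have DL: "L2loc Om (D2U h k)" and Dw: "weak_pderiv Om (DU k) h (D2U h k)" for h k using D(1)[of k] by (auto simp: W1_def)
 have "AE x in lborel. x \<in> Om \<longrightarrow> (\<Oplus>k. lam $ k * D2U k k x) = F x"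
 proof (rule fundamental_lemma_L2loc[OF open_Om _ FL])
  show "L2loc Om (\<lambda>x. \<Oplus>k. lam $ k * D2U k k x)" by (intro L2loc_sum L2loc_mult DL continuous_intros)
  fix \<phi> D\<phi> assume t: "test_fn Om \<phi> D\<phi>"
  have a: "has_bochner_integral lborel (\<lambda>x. \<Oplus>k. lam $ k * (DU k x * D\<phi> x $ k + D2U k k x * \<phi> x)) (\<Sum>k\<in>(UNIV::'n set). lam $ k * 0)"
   by (intro has_bochner_integral_sum has_bochner_integral_mult_right weak_pderivD_null[OF Dw t])
  have b: "null_integral (\<lambda>x. (\<Oplus>k. lam $ k * D2U k k x) * \<phi> x - F x * \<phi> x)"
   using has_bochner_integral_diff[OF a eqOm[OF t]] unfolding F_def
   by (simp add: algebra_simps sum.distrib sum_distrib_left)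
  have "integrable lborel (\<lambda>x. F x * \<phi> x)" using cc_integrable_mult[OF FL test_fn_cc(1)[OF t]] by (simp add: mult.commute)
  from has_bochner_integral_add[OF b has_bochner_integral_integrable[OF this]]
  show "(LBINT x. (\<Oplus>k. lam $ k * D2U k k x) * \<phi> x) = (LBINT x. F x * \<phi> x)"
   by (simp add: has_bochner_integral_iff)
 qed
 then show thesis unfolding F_def using D by (intro that)
qed

end

section \<open>The boundary term\<close>

text \<open>Pointwise algebra, applied with \<open>L\<close> the eigenvalues, \<open>G = Dg\<close>,
  \<open>P = DU\<close>, \<open>H = D\<^sup>2g\<close>, \<open>W = D\<^sup>2U\<close> and
  \<open>X = x\<close>. The left side is what the product rule for
  \<open>s t\<^sub>j\<^sub>i\<close> leaves of second derivatives; the right side is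
  \<open>N\<close> times the Bochner flux \<open>b\<close> plus \<open>s\<^sup>2 h\<close>, and
  every remaining term carries a factor \<open>t\<close> or \<open>tau\<close>.\<close>

lemma normal_tangential_algebra:
 fixes L G P X :: "'n::finite => real" and H W :: "'n => 'n => real"
 assumes H: "\<And>i j. H i j = H j i" and W: "\<And>i j. W i j = W j i"
  and t: "\<And>i j. t i j = G i * P j - G j * P i"
  and Dt: "\<And>l i j. Dt l i j = (G i * W l j + P j * H i l) - (G j * W l i + P i * H j l)"
  and s: "s = (\<Oplus>k. L k * (G k * P k))" and Ds: "\<And>l. Ds l = (\<Oplus>k. L k * (G k * W l k + P k * H k l))"
  and tau: "\<And>i. tau i = (\<Oplus>k. L k * G k * t k i)"
  and N: "N = (\<Oplus>k. L k * (G k)\<^sup>2)" and N0: "N \<noteq> 0"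
  and b: "b = s * ((\<Oplus>k. L k * W k k) - (\<Oplus>k. X k * P k)) - (\<Oplus>i. \<Oplus>j. L i * L j * (W i j * P j * G i))"
  and h: "h = - ((\<Oplus>k. L k * H k k) - (\<Oplus>k. X k * G k)) / N + (\<Oplus>i. \<Oplus>j. L i * L j * (H i j * G j * G i)) / N\<^sup>2"
 shows "(\<Oplus>i. \<Oplus>j. L i * L j * G j * (s * Dt i j i + t j i * Ds i)) = N * b + N * s\<^sup>2 * h
   + s * (\<Oplus>i. X i * tau i) + s / N * (\<Oplus>i. \<Oplus>j. L i * L j * (H i j * G j * tau i))
   + (\<Oplus>i. \<Oplus>j. \<Oplus>k. L i * L j * L k * G i * t k j * (Dt i k j - H k i * P j + H j i * P k))
   + (\<Oplus>i. \<Oplus>k. L i * L k * (tau i * H k i * P k))"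
proof -
 define \<alpha> where "\<alpha> = (\<Oplus>i. \<Oplus>j. L i * L j * (H i j * G j * P i))"
 define \<nu> where "\<nu> = (\<Oplus>i. \<Oplus>j. L i * L j * (W i j * G j * G i))"
 define \<beta> where "\<beta> = (\<Oplus>k. L k * H k k)"
 define \<Gamma> where "\<Gamma> = (\<Oplus>i. \<Oplus>j. L i * L j * (H i j * G j * G i))"
 define \<mu> where "\<mu> = (\<Oplus>i. \<Oplus>j. L i * L j * (W i j * G i * tau j))"
 define \<rho> where "\<rho> = (\<Oplus>i. \<Oplus>k. L i * L k * (tau i * H k i * P k))"
 define T where "T = (\<Oplus>k. L k * W k k)"
 define xG where "xG = (\<Oplus>k. X k * G k)"
 define xt where "xt = (\<Oplus>k. X k * tau k)"
 define xP where "xP = (\<Oplus>k. X k * P k)"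
 define Ht where "Ht = (\<Oplus>i. \<Oplus>j. L i * L j * (H i j * G j * tau i))"
 define wP where "wP = (\<Oplus>i. \<Oplus>j. L i * L j * (W i j * P j * G i))"
 \<comment> \<open>The splitting of the gradient into its component along \<open>G\<close> and a
   tangential remainder, in the weighted inner product and scaled by \<open>N\<close>.\<close>
 have NP: "N * P i = s * G i + tau i" for i
  unfolding N s tau t by (simp add: sum_distrib_left sum_distrib_right sum.distrib[symmetric] power2_eq_square algebra_simps)
 have a: "(\<Oplus>i. \<Oplus>j. L i * L j * G j * Dt i j i) = \<alpha> + T * N - \<beta> * s - \<nu>"
  unfolding \<alpha>_def T_def N \<beta>_def s \<nu>_def Dt sum_product sum.distrib[symmetric] sum_subtractf[symmetric]
  by (intro sum.cong refl) (simp add: H[of _ _] power2_eq_square algebra_simps)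
 have b2: "(\<Oplus>i. \<Oplus>j. L i * L j * G j * (t j i * Ds i)) = \<rho> + \<mu>"
 proof -
  have "(\<Oplus>i. \<Oplus>j. L i * L j * G j * (t j i * Ds i)) = (\<Oplus>i. L i * tau i * Ds i)"
   unfolding tau by (simp add: sum_distrib_left sum_distrib_right algebra_simps)
  also have "\<dots> = \<rho> + (\<Oplus>i. \<Oplus>k. L i * L k * (W i k * G k * tau i))"
   unfolding Ds \<rho>_def by (simp add: sum_distrib_left sum.distrib algebra_simps)
  also have "(\<Oplus>i. \<Oplus>k. L i * L k * (W i k * G k * tau i)) = \<mu>"
   unfolding \<mu>_def by (subst sum.swap) (intro sum.cong refl, simp add: W[of _ _] mult.commute)
  finally show ?thesis .
 qed
 have c: "N * wP = s * \<nu> + \<mu>"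
 proof -
  have "N * wP = (\<Oplus>i. \<Oplus>j. L i * L j * (W i j * (N * P j) * G i))"
   unfolding wP_def by (simp add: sum_distrib_left algebra_simps)
  then show ?thesis unfolding NP \<nu>_def \<mu>_def by (simp add: sum_distrib_left sum.distrib algebra_simps)
 qed
 have d: "N * xP = s * xG + xt"
 proof -
  have "N * xP = (\<Oplus>k. X k * (N * P k))" unfolding xP_def by (simp add: sum_distrib_left algebra_simps)
  then show ?thesis unfolding NP xG_def xt_def by (simp add: sum_distrib_left sum.distrib algebra_simps)
 qed
 have e: "N * \<alpha> = s * \<Gamma> + Ht"
 proof -
  have "N * \<alpha> = (\<Oplus>i. \<Oplus>j. L i * L j * (H i j * G j * (N * P i)))"
   unfolding \<alpha>_def by (simp add: sum_distrib_left algebra_simps)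
  then show ?thesis unfolding NP \<Gamma>_def Ht_def by (simp add: sum_distrib_left sum.distrib algebra_simps)
 qed
 \<comment> \<open>Exchanging \<open>j\<close> and \<open>k\<close> and using the antisymmetry of
   \<open>t\<close> gives a second expression for \<open>\<mu>\<close>. In the sum of the two,
   \<open>W\<close> appears only through \<open>Dt\<close>, which is square integrable up to the
   boundary, whereas \<open>W\<close> itself is not known to be.\<close>
 have f: "(\<Oplus>i. \<Oplus>j. \<Oplus>k. L i * L j * L k * G i * t k j * (Dt i k j - H k i * P j + H j i * P k)) = 2 * \<mu>"
 proof -
  have m1: "\<mu> = (\<Oplus>i. \<Oplus>j. \<Oplus>k. L i * L j * L k * G i * t k j * (G k * W i j))"
   unfolding \<mu>_def tau by (simp add: sum_distrib_left algebra_simps)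
  have "\<mu> = (\<Oplus>i. \<Oplus>k. \<Oplus>j. L i * L j * L k * G i * t k j * (G k * W i j))"
   unfolding m1 by (intro sum.cong refl sum.swap)
  also have "\<dots> = (\<Oplus>i. \<Oplus>j. \<Oplus>k. L i * L j * L k * G i * t k j * (- (G j * W i k)))"
   unfolding t by (intro sum.cong refl) (simp add: algebra_simps)
  finally have "2 * \<mu> = (\<Oplus>i. \<Oplus>j. \<Oplus>k. L i * L j * L k * G i * t k j * (G k * W i j)) + (\<Oplus>i. \<Oplus>j. \<Oplus>k. L i * L j * L k * G i * t k j * (- (G j * W i k)))"
   using m1 by linarith
  then show ?thesis unfolding sum.distrib[symmetric] by (simp add: Dt H algebra_simps)
 qed
 have l: "(\<Oplus>i. \<Oplus>j. L i * L j * G j * (s * Dt i j i + t j i * Ds i)) = s * (\<alpha> + T * N - \<beta> * s - \<nu>) + (\<rho> + \<mu>)"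
  unfolding a[symmetric] b2[symmetric] by (simp add: sum_distrib_left sum.distrib algebra_simps)
 have sa: "s / N * Ht = s * \<alpha> - s\<^sup>2 * (\<Gamma> / N)"
 proof -
  have "Ht = N * \<alpha> - s * \<Gamma>" using e by simp
  then show ?thesis using N0 by (simp add: right_diff_distrib power2_eq_square)
 qed
 have hh: "N * s\<^sup>2 * h = s\<^sup>2 * (- \<beta> + xG + \<Gamma> / N)"
  unfolding h \<beta>_def[symmetric] xG_def[symmetric] \<Gamma>_def[symmetric] using N0 by (simp add: power2_eq_square distrib_left right_diff_distrib add_divide_distrib diff_divide_distrib)
 have bb: "N * b = s * (N * T) - s * (s * xG + xt) - (s * \<nu> + \<mu>)"
  unfolding c[symmetric] d[symmetric] b T_def[symmetric] xP_def[symmetric] wP_def[symmetric] by (simp add: algebra_simps)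
 show ?thesis unfolding l f bb hh xt_def[symmetric] \<rho>_def[symmetric] Ht_def[symmetric] sa
  by (simp add: algebra_simps power2_eq_square)
qed

text \<open>The weight must be divided by the squared conormal length \<open>Nq\<close>, which is
  bounded below only near the boundary. Below \<open>c\<close> the denominator is modified by a
  quadratic term that keeps it positive: completing the square leaves 3/4 of the square of
  \<open>c\<close>.\<close>

lemma C1_reciprocal_extension:
 fixes c :: real assumes c: "c > 0"
 obtains r r' where "\<And>t. (r has_real_derivative r' t) (at t)" "continuous_on UNIV r'" "\<And>t. t \<ge> c ==> r t = 1 / t"
proof -
 define \<sigma> where "\<sigma> t = t + (max 0 (c - t))\<^sup>2 / c" for t
 define \<sigma>' where "\<sigma>' t = 1 - 2 * max 0 (c - t) / c" for t
 have d: "(\<sigma> has_real_derivative \<sigma>' t) (at t)" for t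
 proof -
  have "((\<lambda>t. (max 0 (c - t))\<^sup>2) has_real_derivative (2 * max 0 (c - t)) * (- 1)) (at t)"
   by (rule DERIV_chain2[where f = "\<lambda>t. (max 0 t)\<^sup>2" and g = "\<lambda>t. c - t"])
    (use DERIV_max0_power[of 2 "c - t"] in \<open>auto intro!: derivative_eq_intros\<close>)
  from DERIV_add[OF DERIV_ident DERIV_cdivide[OF this]] show ?thesis unfolding \<sigma>_def \<sigma>'_def by simp
 qed
 have p: "\<sigma> t > 0" for t
 proof (cases "t \<ge> c")
  case False
  have "c * t + (c - t)\<^sup>2 = (t - c / 2)\<^sup>2 + 3 / 4 * c\<^sup>2" by (simp add: power2_eq_square field_simps)
  also have "\<dots> > 0" using c by (intro add_nonneg_pos) auto
  finally have "c * t + (c - t)\<^sup>2 > 0" .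
  moreover have "\<sigma> t = (c * t + (c - t)\<^sup>2) / c" using False c by (simp add: \<sigma>_def field_simps)
  ultimately show ?thesis using c by simp
 qed (use c in \<open>simp add: \<sigma>_def\<close>)
 show thesis
 proof (rule that)
  show "((\<lambda>t. 1 / \<sigma> t) has_real_derivative - (\<sigma>' t) / (\<sigma> t)\<^sup>2) (at t)" for t
   using DERIV_divide[OF DERIV_const[of 1] d[of t]] p[of t] by (simp add: power2_eq_square)
  have "continuous_on UNIV \<sigma>" using d by (meson DERIV_isCont continuous_at_imp_continuous_on)
  then show "continuous_on UNIV (\<lambda>t. - (\<sigma>' t) / (\<sigma> t)\<^sup>2)" unfolding \<sigma>'_def using p c
   by (intro continuous_intros) (auto simp: less_le)
  show "1 / \<sigma> t = 1 / t" if "t \<ge> c" for t using that by (simp add: \<sigma>_def)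
 qed
qed

section \<open>The Bochner identity for the solution\<close>

locale regular_solution = dirichlet_solution lam g Dg D2g lmb f U DU
 for lam :: "real^'n" and g Dg D2g lmb f U DU +
 fixes D2U :: "'n => 'n => real^'n => real"
 assumes D2W: "\<And>k. W1 Om (DU k) (\<lambda>h. D2U h k)" and D2s: "\<And>h k x. D2U h k x = D2U k h x"
  and eq2: "AE x in lborel. x \<in> Om \<longrightarrow> (\<Oplus>k. lam $ k * D2U k k x) = divF x + (\<Oplus>l. x $ l * DU l x)"
begin

definition tg :: "'n => 'n => real^'n => real" where "tg i j = tang i j DU"
definition Dtg :: "'n => 'n => 'n => real^'n => real" where
 "Dtg l i j x = (Dg x $ i * D2U l j x + DU j x * D2g x $ i $ l) - (Dg x $ j * D2U l i x + DU i x * D2g x $ j $ l)"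
text \<open>The conormal derivative, called s in the overview. Below, \<open>Nq\<close>,
  \<open>hess\<close> and \<open>grd\<close> are the squared norms of
  \<open>Q\<^sup>1\<^sup>/\<^sup>2 Dg\<close>, \<open>Q\<^sup>1\<^sup>/\<^sup>2 D\<^sup>2U
  Q\<^sup>1\<^sup>/\<^sup>2\<close> and \<open>Q\<^sup>1\<^sup>/\<^sup>2 DU\<close>.\<close>

definition nd :: "real^'n => real" where "nd x = (\<Oplus>k. lam $ k * (Dg x $ k * DU k x))"
definition Dnd :: "'n => real^'n => real" where "Dnd l x = (\<Oplus>k. lam $ k * (Dg x $ k * D2U l k x + DU k x * D2g x $ k $ l))"
definition Nq :: "real^'n => real" where "Nq x = (\<Oplus>k. lam $ k * (Dg x $ k)\<^sup>2)"
definition hess :: "real^'n => real" where "hess x = (\<Oplus>i. \<Oplus>j. lam $ i * lam $ j * (D2U i j x)\<^sup>2)"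
definition grd :: "real^'n => real" where "grd x = (\<Oplus>i. lam $ i * (DU i x)\<^sup>2)"
text \<open>The Bochner flux in direction \<open>Dg\<close>: the factor that remains when the
  derivative falls on the cutoff in the level of \<open>g\<close>.\<close>

definition bt :: "real^'n => real" where
 "bt x = nd x * divF x - (\<Oplus>i. \<Oplus>j. lam $ i * lam $ j * (D2U i j x * DU j x * Dg x $ i))"

lemma D2L: "L2loc Om (D2U h k)" using D2W by (auto simp: W1_def)

lemma tgW: "W1 Om (tg i j) (\<lambda>l. Dtg l i j)"
proof -
 have "W1 Om (\<lambda>x. Dg x $ i * DU j x + (- 1) * (Dg x $ j * DU i x))
   (\<lambda>l x. (Dg x $ i * D2U l j x + DU j x * D2g x $ i $ l) + ((- 1) * (Dg x $ j * D2U l i x + DU i x * D2g x $ j $ l) + (Dg x $ j * DU i x) * (0::real^'n) $ l))"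
  by (intro W1_add W1_mult[OF D2W DgC1] W1_mult[OF W1_mult[OF D2W DgC1] C1_const])
 then show ?thesis unfolding tg_def tang_def[abs_def] Dtg_def[abs_def] by (simp add: algebra_simps)
qed

lemma ndW: "W1 Om nd Dnd"
proof -
 have "W1 Om (\<lambda>x. \<Oplus>k. lam $ k * (Dg x $ k * DU k x)) (\<lambda>l x. \<Oplus>k. lam $ k * (Dg x $ k * D2U l k x + DU k x * D2g x $ k $ l) + (Dg x $ k * DU k x) * (0::real^'n) $ l)"
  by (intro W1_sum W1_mult[OF W1_mult[OF D2W DgC1] C1_const])
 then show ?thesis unfolding nd_def[abs_def] Dnd_def[abs_def] by simp
qed

text \<open>Exchanging derivatives against \<open>\<psi> D\<^sub>jU\<close>, with
  \<open>\<psi>\<close> the weighted test function, compares the squared trace with the sum of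
  squares. Subtracting the product rule for the drift \<open>S = \<langle>x, DU\<rangle>\<close>
  replaces the trace by \<open>divF\<close>; the terms from differentiating the Gaussian weight
  cancel the rest of the drift, and differentiating the coefficient \<open>x\<close> leaves
  \<open>grd\<close>.\<close>

lemma bochner_identity:
 assumes t: "test_fn Om \<phi> D\<phi>"
 shows "null_integral (\<lambda>x. gw lam x * (\<phi> x * ((divF x)\<^sup>2 - hess x - grd x) + divF x * (\<Oplus>k. lam $ k * (DU k x * D\<phi> x $ k))
   - (\<Oplus>i. \<Oplus>j. lam $ i * lam $ j * (D2U i j x * DU j x * D\<phi> x $ i))))"
proof -
 define \<psi> where "\<psi> x = gw lam x * \<phi> x" for x
 define D\<psi> where "D\<psi> x = gw lam x *\<^sub>R D\<phi> x + \<phi> x *\<^sub>R (\<chi> k. - (x $ k / lam $ k) * gw lam x)" for x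
 have t': "test_fn Om \<psi> D\<psi>" unfolding \<psi>_def D\<psi>_def by (rule test_fn_mult[OF C1_gw[OF lam] t])
 define E1 where "E1 i j x = D2U i i x * (\<psi> x * D2U j j x + DU j x * D\<psi> x $ j) - D2U j i x * (\<psi> x * D2U i j x + DU j x * D\<psi> x $ i)" for i j x
 have i1: "null_integral (E1 i j)" for i j
  unfolding E1_def by (rule W1_swap_derivatives[OF open_Om D2W Wc_mult[OF D2W t']])
 define S where "S x = (\<Oplus>l. x $ l * DU l x)" for x
 define DS where "DS k x = (\<Oplus>l. x $ l * D2U k l x) + DU k x" for k x
 have SW: "W1 Om S DS"
 proof -
  have "W1 Om (\<lambda>x. \<Oplus>l. x $ l * DU l x) (\<lambda>k x. \<Oplus>l. x $ l * D2U k l x + DU l x * axis l 1 $ k)"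
   by (intro W1_sum W1_mult[OF D2W C1_coord])
  moreover have "(\<Oplus>l. x $ l * D2U k l x + DU l x * axis l 1 $ k) = DS k x" for k x
   unfolding DS_def by (simp add: sum.distrib axis_def if_distrib[of "\<lambda>c. _ * c"] cong: if_cong)
  ultimately show ?thesis unfolding S_def[abs_def] by simp
 qed
 define E2 where "E2 j x = \<psi> x * (S x * D2U j j x + DU j x * DS j x) + S x * DU j x * D\<psi> x $ j" for j x
 have i2: "null_integral (E2 j)" for j
  unfolding E2_def by (rule W1_product[OF open_Om SW D2W t'])
 have "has_bochner_integral lborel (\<lambda>x. (\<Oplus>i. \<Oplus>j. lam $ i * lam $ j * E1 i j x) - (\<Oplus>j. lam $ j * E2 j x))
   ((\<Sum>i\<in>(UNIV::'n set). \<Sum>j\<in>(UNIV::'n set). lam $ i * lam $ j * 0) - (\<Sum>j\<in>(UNIV::'n set). lam $ j * 0))"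
  by (intro has_bochner_integral_diff has_bochner_integral_sum has_bochner_integral_mult_right i1 i2)
 then have I: "null_integral (\<lambda>x. (\<Oplus>i. \<Oplus>j. lam $ i * lam $ j * E1 i j x) - (\<Oplus>j. lam $ j * E2 j x))" by simp
 obtain K where K: "K \<subseteq> Om" "\<And>x. x \<notin> K ==> \<phi> x = 0" "\<And>x. x \<notin> K ==> D\<phi> x = 0" using test_fn_zero_outside[OF t] by metis
 let ?R = "\<lambda>x. gw lam x * (\<phi> x * ((divF x)\<^sup>2 - hess x - grd x) + divF x * (\<Oplus>k. lam $ k * (DU k x * D\<phi> x $ k))
   - (\<Oplus>i. \<Oplus>j. lam $ i * lam $ j * (D2U i j x * DU j x * D\<phi> x $ i)))"
 have ae: "AE x in lborel. (\<Oplus>i. \<Oplus>j. lam $ i * lam $ j * E1 i j x) - (\<Oplus>j. lam $ j * E2 j x) = ?R x"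
  using eq2
 proof eventually_elim
  case (elim x)
  show ?case
  proof (cases "x \<in> Om")
   case False
   then have "\<phi> x = 0" "D\<phi> x = 0" using K by blast+
   then show ?thesis by (simp add: E1_def E2_def \<psi>_def D\<psi>_def)
  next
   case True
   define T where "T = (\<Oplus>k. lam $ k * D2U k k x)"
   define F\<phi> where "F\<phi> = (\<Oplus>k. lam $ k * (DU k x * D\<phi> x $ k))"
   define w where "w = gw lam x"
   define Q where "Q = (\<Oplus>i. \<Oplus>j. lam $ i * lam $ j * (D2U i j x * DU j x * D\<phi> x $ i))"
   define Y where "Y = (\<Oplus>i. \<Oplus>j. lam $ j * (D2U i j x * DU j x * x $ i))"
   have T: "T = divF x + S x" unfolding T_def S_def using elim True by simp
   have D\<psi>: "lam $ k * (c * D\<psi> x $ k) = w * (lam $ k * (c * D\<phi> x $ k)) - w * \<phi> x * (c * x $ k)" for k c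
    unfolding D\<psi>_def w_def using lam[of k] by (simp add: algebra_simps less_imp_neq[THEN not_sym])
   have FD: "(\<Oplus>k. lam $ k * (DU k x * D\<psi> x $ k)) = w * F\<phi> - w * \<phi> x * S x"
    unfolding D\<psi> F\<phi>_def S_def by (simp add: sum_subtractf sum_distrib_left algebra_simps)
   have "(\<Oplus>i. \<Oplus>j. lam $ i * lam $ j * E1 i j x) = w * \<phi> x * (T * T - hess x) + T * (\<Oplus>k. lam $ k * (DU k x * D\<psi> x $ k))
     - (\<Oplus>i. \<Oplus>j. lam $ j * (lam $ i * ((D2U i j x * DU j x) * D\<psi> x $ i)))"
    unfolding E1_def T_def hess_def sum_product \<psi>_def w_def
    by (simp add: sum_subtractf sum.distrib sum_distrib_left sum_distrib_right power2_eq_square algebra_simps D2s[of _ _ x])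
   moreover have "(\<Oplus>i. \<Oplus>j. lam $ j * (lam $ i * ((D2U i j x * DU j x) * D\<psi> x $ i))) = w * Q - w * \<phi> x * Y"
    unfolding D\<psi> Q_def Y_def by (simp add: sum_subtractf sum_distrib_left algebra_simps)
   moreover have "(\<Oplus>j. lam $ j * E2 j x) = w * \<phi> x * (S x * T + Y + grd x) + S x * (\<Oplus>k. lam $ k * (DU k x * D\<psi> x $ k))"
   proof -
    have "Y = (\<Oplus>j. \<Oplus>i. lam $ j * (D2U i j x * DU j x * x $ i))" unfolding Y_def by (rule sum.swap)
    then show ?thesis unfolding E2_def T_def grd_def DS_def \<psi>_def w_def
     by (simp add: sum.distrib sum_distrib_left power2_eq_square algebra_simps D2s[of _ _ x])
   qed
   ultimately show ?thesis unfolding FD w_def[symmetric] F\<phi>_def[symmetric] Q_def[symmetric] T by (simp add: power2_eq_square algebra_simps)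
  qed
 qed
 have [measurable]: "D2U h k \<in> borel_measurable borel" "DU k \<in> borel_measurable borel" "divF \<in> borel_measurable borel" "gw lam \<in> borel_measurable borel"
   "\<phi> \<in> borel_measurable borel" "(\<lambda>x. D\<phi> x $ k) \<in> borel_measurable borel" for h k
  using D2L DUL divFL cc_measurable[OF test_fn_cc(1)[OF t]] cc_measurable[OF test_fn_cc(2)[OF t]] borel_measurable_continuous_onI[OF C1_continuous[OF C1_gw[OF lam]]] by (auto simp: L2loc_def)
 have "?R \<in> borel_measurable borel" unfolding hess_def grd_def by measurable
 then show ?thesis using I ae by (subst has_bochner_integral_cong_AE[symmetric]) (auto simp: has_bochner_integral_iff)
qed

end

section \<open>The shell terms: tangential errors vanish and h appears\<close>

context regular_solution
begin

text \<open>Square integrability up to the boundary on bounded parts of the domain, in contrast to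
  \<open>L2loc Om\<close>, which sees only compact subsets.\<close>

definition bd :: "real => (real^'n => real) => bool" where
 "bd \<rho> y \<longleftrightarrow> L2 lborel (\<lambda>x. indicator (Om \<inter> cball 0 \<rho>) x * y x)"

lemma bd_L2loc: assumes y: "L2loc UNIV y" and z: "\<And>x. x \<notin> Om ==> y x = 0" shows "bd \<rho> y"
 unfolding bd_def
proof (rule L2_cong[OF L2loc_L2[OF y compact_cball subset_UNIV]])
 show "indicator (cball 0 \<rho>) x * y x = indicator (Om \<inter> cball 0 \<rho>) x * y x" for x
  using z[of x] by (auto simp: indicator_def)
qed

lemma tgL: "L2loc A (tg i j)" and ndL: "L2loc A nd" and tg0: "x \<notin> Om ==> tg i j x = 0" and nd0: "x \<notin> Om ==> nd x = 0"
 unfolding tg_def tang_def[abs_def] nd_def[abs_def]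
 by (intro L2loc_diff L2loc_mult DUL Dg_continuous L2loc_sum continuous_intros)+ (simp_all add: DU0)

lemma tg_extension:
 assumes rho: "\<rho> > 0"
 obtains d where "\<And>l. L2 lborel (d l)" "\<And>l. weak_pderiv UNIV (\<lambda>x. theta \<rho> x * tg i j x) l (d l)"
proof -
 have z: "AE x in lborel. g x > 0 \<longrightarrow> U x = 0" using U0 by auto
 show thesis by (rule tangential_regularity[OF rho lmb f U z eqU, of i j]) (assumption | rule that[unfolded tg_def])+
qed

text \<open>The derivative of the cut-off tangential derivative exists on the whole space. By
  uniqueness of weak derivatives it agrees with the interior formula where the cutoff is 1, so the
  formula inherits the integrability up to the boundary.\<close>

lemma bd_Dtg: assumes rho: "\<rho> > 0" shows "bd \<rho> (Dtg l i j)"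
proof -
 have r2: "2 * \<rho> > 0" using rho by simp
 obtain d where d: "\<And>l. L2 lborel (d l)" "\<And>l. weak_pderiv UNIV (\<lambda>x. theta (2 * \<rho>) x * tg i j x) l (d l)"
  by (rule tg_extension[OF r2]) (rule that)
 let ?B = "Om \<inter> ball 0 (2 * \<rho>)"
 have B: "open ?B" by (intro open_Int open_Om open_ball)
 have w1: "weak_pderiv ?B (tg i j) l (d l)"
  by (rule weak_pderiv_cong_on[OF d(2)]) (simp add: theta_bounds(3)[OF r2])
 have "W1 ?B (tg i j) (\<lambda>l. Dtg l i j)" by (rule W1_mono[OF tgW]) auto
 then have w2: "weak_pderiv ?B (tg i j) l (Dtg l i j)" "L2loc ?B (Dtg l i j)" by (auto simp: W1_def)
 have ae: "AE x in lborel. x \<in> ?B \<longrightarrow> d l x = Dtg l i j x"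
  by (rule weak_pderiv_unique[OF B w1 w2(1) L2_L2loc[OF d(1)] w2(2)])
 have [measurable]: "Om \<inter> cball 0 \<rho> \<in> sets borel" using open_Om by auto
 have L: "L2 lborel (\<lambda>x. indicator (Om \<inter> cball 0 \<rho>) x * d l x)"
  by (rule L2_bounded_mult[OF d(1), of _ 1]) (auto simp: indicator_def)
 have [measurable]: "Dtg l i j \<in> borel_measurable borel" "d l \<in> borel_measurable borel" using w2(2) d(1)[of l] by (auto simp: L2loc_def L2_def)
 have "AE x in lborel. (indicator (Om \<inter> cball 0 \<rho>) x * d l x)\<^sup>2 = (indicator (Om \<inter> cball 0 \<rho>) x * Dtg l i j x)\<^sup>2"
  using ae by eventually_elim (use rho in \<open>auto simp: indicator_def\<close>)
 then show ?thesis using L unfolding bd_def L2_def by (subst integrable_cong_AE[symmetric]) auto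
qed

text \<open>Dominated convergence: the shell weight times \<open>\<bar>g\<bar>\<close> is bounded,
  \<open>tg / g\<close> is square integrable by Hardy's inequality, \<open>y\<close> is so by
  assumption, and each point is in the shell for only finitely many \<open>n\<close>.\<close>

lemma shell_vanish:
 assumes rho: "\<rho> > 0" and c: "cc UNIV c" "\<And>x. norm x > \<rho> ==> c x = 0" and y: "bd \<rho> y"
  and c0: "c0 > 0" "\<And>x. x \<in> cball 0 \<rho> ==> \<bar>g x\<bar> \<le> c0 ==> gq x \<ge> c0"
  and e: "\<And>n. 0 < e n" "\<And>n. 2 * e n \<le> c0" "e \<longlonglongrightarrow> 0"
 shows "integrable lborel (\<lambda>x. sh (e n) x * (c x * (tg i j x * y x)))"
  "(\<lambda>n. \<integral>x. sh (e n) x * (c x * (tg i j x * y x)) \<partial>lborel) \<longlonglongrightarrow> 0"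
proof -
 define P where "P = (\<lambda>x. theta \<rho> x * tg i j x)"
 obtain d where d0: "\<And>l. L2 lborel (d l)" "\<And>l. weak_pderiv UNIV (\<lambda>x. theta \<rho> x * tg i j x) l (d l)"
  by (rule tg_extension[OF rho, of i j]) (rule that)
 note d = d0[folded P_def]
 have PL: "L2 lborel P" unfolding P_def by (rule L2_cc_mult[OF tgL test_fn_cc(1)[OF theta_test[OF rho]]])
 have PW: "W1 UNIV P d" using L2_L2loc[OF PL] L2_L2loc[OF d(1)] d(2) by (auto simp: W1_def)
 have H: "integrable lborel (\<lambda>x. indicator Om x * (gq x * (P x / g x)\<^sup>2))"
 proof (rule hardy[OF PW PL d(1), of "2 * \<rho>"])
  show "P x = 0" if "norm x > 2 * \<rho>" for x using theta_bounds(4)[OF rho, of x] that by (simp add: P_def)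
  show "AE x in lborel. g x > 0 \<longrightarrow> P x = 0" using tg0 by (auto simp: P_def)
 qed (use rho in simp)
 obtain M where M: "M > 0" "\<And>x. \<bar>c x\<bar> \<le> M" using cc_bounded[OF c(1)] by metis
 define Y where "Y x = indicator (Om \<inter> cball 0 \<rho>) x * y x" for x
 have YL: "L2 lborel Y" using y unfolding bd_def Y_def .
 \<comment> \<open>From \<open>4 M \<bar>a b\<bar> \<le> 2 M (a\<^sup>2 + b\<^sup>2)\<close> with
   \<open>a = P / g\<close>; near the boundary \<open>gq / c0\<close> is at least 1, which inserts
   the Hardy integrand.\<close>
 define w where "w x = 2 * M * (indicator Om x * (gq x * (P x / g x)\<^sup>2) / c0 + (Y x)\<^sup>2)" for x
 have wi: "integrable lborel w" unfolding w_def using H L2_integrable_square[OF YL] by simp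
 have w0: "0 \<le> w x" for x unfolding w_def using M(1) c0(1) gq_nonneg[of x] by (intro mult_nonneg_nonneg add_nonneg_nonneg divide_nonneg_pos) auto
 have eqY: "sh (e n) x * (c x * (tg i j x * y x)) = sh (e n) x * (c x * (tg i j x * Y x))" for n x
  using c(2)[of x] tg0[of x i j] by (cases "norm x \<le> \<rho>"; cases "x \<in> Om") (auto simp: Y_def)
 have b: "norm (sh (e n) x * (c x * (tg i j x * Y x))) \<le> w x" for n x
 proof (cases "sh (e n) x = 0 \<or> c x = 0")
  case True then show ?thesis using w0[of x] by auto
 next
  case False
  then have nx: "norm x \<le> \<rho>" and gx: "- (2 * e n) < g x" "g x < - e n"
   using c(2)[of x] chi_sh_facts(7,8)[OF e(1)[of n], of x] by (meson not_le)+
  have g0: "g x < 0" "\<bar>g x\<bar> \<le> c0" using gx e(1,2)[of n] by linarith+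
  have Px: "P x = tg i j x" using theta_bounds(3)[OF rho nx] by (simp add: P_def)
  have "norm (sh (e n) x * (c x * (tg i j x * Y x))) = (sh (e n) x * \<bar>g x\<bar>) * (\<bar>c x\<bar> * (\<bar>P x / g x\<bar> * \<bar>Y x\<bar>))"
   using g0(1) chi_sh_facts(5)[OF e(1)[of n], of x] by (simp add: abs_mult Px)
  also have "\<dots> \<le> 4 * (M * (\<bar>P x / g x\<bar> * \<bar>Y x\<bar>))"
   using chi_sh_facts(5,9)[OF e(1)[of n], of x] M by (intro mult_mono mult_nonneg_nonneg) auto
  also have "\<dots> \<le> 2 * M * ((P x / g x)\<^sup>2 + (Y x)\<^sup>2)"
  proof -
   have "2 * (\<bar>P x / g x\<bar> * \<bar>Y x\<bar>) \<le> (P x / g x)\<^sup>2 + (Y x)\<^sup>2"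
    using sum_squares_bound[of "\<bar>P x / g x\<bar>" "\<bar>Y x\<bar>"] by (simp only: power2_abs mult.assoc)
   from mult_left_mono[OF this, of "2 * M"] show ?thesis using M(1) by (simp add: algebra_simps)
  qed
  also have "(P x / g x)\<^sup>2 \<le> indicator Om x * (gq x * (P x / g x)\<^sup>2) / c0"
  proof -
   have "c0 * (P x / g x)\<^sup>2 \<le> gq x * (P x / g x)\<^sup>2" using c0(2)[of x] nx g0(2) by (intro mult_right_mono) auto
   then show ?thesis using g0(1) c0(1) by (simp add: pos_le_divide_eq mult.commute)
  qed
  finally show ?thesis unfolding w_def using M(1) by simp
 qed
 have [measurable]: "sh (e n) \<in> borel_measurable borel" "c \<in> borel_measurable borel" "tg i j \<in> borel_measurable borel" "Y \<in> borel_measurable borel" for n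
  using borel_measurable_continuous_onI[OF C1_continuous[OF sh_C1]] cc_measurable[OF c(1)] tgL[of UNIV i j] YL by (auto simp: L2loc_def L2_def)
 show "integrable lborel (\<lambda>x. sh (e n) x * (c x * (tg i j x * y x)))" unfolding eqY
  by (rule Bochner_Integration.integrable_bound[OF wi]) (use b w0 in \<open>auto intro!: AE_I2 simp: abs_of_nonneg\<close>)
 have "(\<lambda>n. \<integral>x. sh (e n) x * (c x * (tg i j x * Y x)) \<partial>lborel) \<longlonglongrightarrow> (\<integral>x. 0 \<partial>(lborel :: (real^'n) measure))"
 proof (rule integral_dominated_convergence[OF _ _ wi])
  show "AE x in lborel. (\<lambda>n. sh (e n) x * (c x * (tg i j x * Y x))) \<longlonglongrightarrow> 0"
  proof (rule AE_I2)
   fix x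
   have "\<forall>\<^sub>F n in sequentially. sh (e n) x = 0"
   proof (cases "g x < 0")
    case True
    then have "\<forall>\<^sub>F n in sequentially. e n < - g x / 2" by (intro order_tendstoD(2)[OF e(3)]) simp
    then show ?thesis by eventually_elim (intro chi_sh_facts(8) e(1), simp)
   next
    case False
    then have "sh (e n) x = 0" for n using e(1)[of n] by (intro chi_sh_facts(7)) auto
    then show ?thesis by simp
   qed
   then have "\<forall>\<^sub>F n in sequentially. sh (e n) x * (c x * (tg i j x * Y x)) = 0" by eventually_elim simp
   then show "(\<lambda>n. sh (e n) x * (c x * (tg i j x * Y x))) \<longlonglongrightarrow> 0" by (rule tendsto_eventually)
  qed
 qed (use b in auto)
 then show "(\<lambda>n. \<integral>x. sh (e n) x * (c x * (tg i j x * y x)) \<partial>lborel) \<longlonglongrightarrow> 0" unfolding eqY by simp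
qed

text \<open>The cutoff is squared so that its derivative still contains a factor
  \<open>theta\<close>; this is what allows Young's inequality to absorb the cutoff error into the
  Hessian term.\<close>

definition qt :: "real => real^'n => real" where "qt R x = (theta R x)\<^sup>2 * gw lam x"

lemma qt_test: assumes "R > 0" shows "\<exists>Dq. test_fn UNIV (qt R) Dq"
proof -
 have "C1 (theta R :: real^'n => real) (Dtheta R)" using test_fn_C1[OF theta_test[OF assms]] .
 from test_fn_mult[OF C1_mult[OF C1_gw[OF lam] this] theta_test[OF assms]]
 show ?thesis unfolding qt_def[abs_def] by (auto simp: power2_eq_square mult_ac)
qed

lemma qt_facts: "R > 0 ==> 0 \<le> qt R x" "R > 0 ==> norm x \<ge> 2 * R ==> qt R x = 0"
 using gw_pos[OF lam, of x] theta_bounds(4)[of R x] by (auto simp: qt_def)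

lemma hfun_Nq: "hfun lam Dg D2g x = - ((\<Oplus>k. lam $ k * D2g x $ k $ k) - (\<Oplus>k. x $ k * Dg x $ k)) / Nq x
  + (\<Oplus>i. \<Oplus>j. lam $ i * lam $ j * (D2g x $ i $ j * Dg x $ j * Dg x $ i)) / (Nq x)\<^sup>2"
proof -
 have n: "(qnorm lam (Dg x))\<^sup>2 = Nq x" unfolding qnorm_def Nq_def using lam by (intro real_sqrt_pow2 sum_nonneg) (auto simp: less_imp_le)
 have n4: "(qnorm lam (Dg x))^4 = (Nq x)\<^sup>2" unfolding n[symmetric] by simp
 have "(D2g x *v qmul lam (Dg x)) \<bullet> qmul lam (Dg x) = (\<Oplus>i. \<Oplus>j. lam $ i * lam $ j * (D2g x $ i $ j * Dg x $ j * Dg x $ i))"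
  unfolding qmul_def inner_vec_def matrix_vector_mult_def by (simp add: sum_distrib_left algebra_simps)
 then show ?thesis unfolding hfun_def n n4 OU_op_def by (simp add: algebra_simps)
qed

lemma integrable_bt_nd:
 assumes c: "cc Om \<phi>" shows "integrable lborel (\<lambda>x. \<phi> x * bt x)" "integrable lborel (\<lambda>x. \<phi> x * (nd x)\<^sup>2)"
proof -
 have "integrable lborel (\<lambda>x. \<phi> x * (nd x * divF x) - (\<Oplus>i. \<Oplus>j. \<phi> x * (D2U i j x * ((lam $ i * lam $ j * Dg x $ i) * DU j x))))"
  by (intro Bochner_Integration.integrable_diff Bochner_Integration.integrable_sum L2loc_integrable_mult[OF _ _ c] D2L L2loc_mult DUL ndL divFL continuous_intros Dg_continuous)
 moreover have "\<phi> x * bt x = \<phi> x * (nd x * divF x) - (\<Oplus>i. \<Oplus>j. \<phi> x * (D2U i j x * ((lam $ i * lam $ j * Dg x $ i) * DU j x)))" for x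
  unfolding bt_def by (simp add: right_diff_distrib sum_distrib_left mult_ac)
 ultimately show "integrable lborel (\<lambda>x. \<phi> x * bt x)" by simp
 show "integrable lborel (\<lambda>x. \<phi> x * (nd x)\<^sup>2)" unfolding power2_eq_square by (rule L2loc_integrable_mult[OF ndL ndL c])
qed

text \<open>Apply the product rule to \<open>nd\<close> times \<open>tg j i\<close>, tested with the
  shell weight times \<open>lam $ i * lam $ j * Dg x $ j\<close>. Antisymmetry removes the terms in
  which that weight or \<open>Dg\<close> is differentiated; \<open>normal_tangential_algebra\<close>
  turns the others into \<open>bt\<close> plus the square of \<open>nd\<close> times h, up to errors
  that vanish by \<open>shell_vanish\<close>.\<close>

lemma boundary_term:
 assumes R: "R > 0" and eta: "\<eta> > 0" and e0: "e0 > 0" and hC: "\<And>x. g x = 0 ==> hfun lam Dg D2g x \<le> C"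
 obtains e err where "\<And>n. 0 < e n" "\<And>n. e n \<le> e0" "e \<longlonglongrightarrow> 0" "err \<longlonglongrightarrow> 0"
  "\<And>n. - (LBINT x. sh (e n) x * qt R x * bt x) \<le> (C + \<eta>) * (LBINT x. sh (e n) x * qt R x * (nd x)\<^sup>2) + err n"
proof -
 define lmin where "lmin = Min (range (($) lam))"
 have lmin: "lmin > 0" "\<And>k. lmin \<le> lam $ k" unfolding lmin_def using lam by auto
 have NC: "\<exists>D. C1 Nq D"
 proof -
  have "C1 (\<lambda>x. \<Oplus>k. lam $ k * (Dg x $ k * Dg x $ k)) (\<lambda>x. \<Oplus>k. lam $ k *\<^sub>R (Dg x $ k *\<^sub>R D2g x $ k + Dg x $ k *\<^sub>R D2g x $ k))"
   by (intro C1_sum C1_cmult C1_mult DgC1)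
  then show ?thesis unfolding Nq_def[abs_def] power2_eq_square by blast
 qed
 then obtain DN where DN: "C1 Nq DN" by blast
 have Nge: "Nq x \<ge> lmin * gq x" for x unfolding Nq_def gq_def sum_distrib_left by (intro sum_mono mult_right_mono lmin(2)) auto
 obtain c0 where c0: "c0 > 0" "\<And>x. x \<in> cball 0 (2 * R) ==> \<bar>g x\<bar> \<le> c0 ==> gq x \<ge> c0" by (rule near_boundary) (rule that)
 have c1: "lmin * c0 > 0" using lmin c0 by simp
 obtain r r' where r: "\<And>t. (r has_real_derivative r' t) (at t)" "continuous_on UNIV r'" "\<And>t. t \<ge> lmin * c0 ==> r t = 1 / t"
  by (rule C1_reciprocal_extension[OF c1]) (assumption | rule that)+
 have N1: "Nq x > 0" "r (Nq x) = 1 / Nq x" if "norm x \<le> 2 * R" "\<bar>g x\<bar> \<le> c0" for x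
 proof -
  have "lmin * c0 \<le> lmin * gq x" using c0(2)[of x] that lmin(1) by (intro mult_left_mono) auto
  then have "lmin * c0 \<le> Nq x" using Nge[of x] by linarith
  then show "Nq x > 0" "r (Nq x) = 1 / Nq x" using c1 r(3) by auto
 qed
 have rc: "continuous_on UNIV (\<lambda>x. r (Nq x))" by (rule C1_continuous[OF C1_compose[OF DN r(1,2)]])
 \<comment> \<open>The reciprocal of \<open>Nq\<close> cancels the factor \<open>N\<close> of the
   algebraic identity, so that \<open>m\<close> times \<open>Nq\<close> is \<open>qt\<close> on the
   shell.\<close>
 define a where "a x = gw lam x * (r (Nq x) * theta R x)" for x
 have thC: "C1 (theta R :: real^'n => real) (Dtheta R)" using test_fn_C1[OF theta_test[OF R]] .
 obtain Da where Da: "C1 a Da" using C1_mult[OF C1_gw[OF lam] C1_mult[OF C1_compose[OF DN r(1,2)] thC]] unfolding a_def by blast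
 define m where "m x = a x * theta R x" for x
 define Dm where "Dm x = a x *\<^sub>R Dtheta R x + theta R x *\<^sub>R Da x" for x
 have mt: "test_fn UNIV m Dm" unfolding m_def Dm_def by (rule test_fn_mult[OF Da theta_test[OF R]])
 have m0: "m x = 0" "Dm x = 0" if "norm x > 2 * R" for x
  using theta_bounds(4,6)[OF R, of x] that by (auto simp: m_def Dm_def)
 define ht where "ht x = - ((\<Oplus>k. lam $ k * D2g x $ k $ k) - (\<Oplus>k. x $ k * Dg x $ k)) * r (Nq x)
  + (\<Oplus>i. \<Oplus>j. lam $ i * lam $ j * (D2g x $ i $ j * Dg x $ j * Dg x $ i)) * (r (Nq x))\<^sup>2" for x
 have ht: "ht x = hfun lam Dg D2g x" if "norm x \<le> 2 * R" "\<bar>g x\<bar> \<le> c0" for x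
  unfolding ht_def hfun_Nq N1(2)[OF that] by (simp add: power_divide)
 have htc: "continuous_on UNIV ht" unfolding ht_def by (intro continuous_intros rc Dg_continuous D2g_continuous)
 \<comment> \<open>The bound on h is available only on the zero set. By compactness it persists in a
   thin neighbourhood at the price of \<open>\<eta>\<close>.\<close>
 obtain e1 where e1: "e1 > 0" "\<And>x. norm x \<le> 2 * R ==> \<bar>g x\<bar> < e1 ==> ht x < C + \<eta>"
 proof -
  define K where "K = cball 0 (2 * R) \<inter> {x. C + \<eta> \<le> ht x}"
  have K: "compact K" unfolding K_def by (rule compact_Int_closed[OF compact_cball closed_Collect_le[OF continuous_on_const htc]])
  show thesis
  proof (cases "K = {}")
   case True
   then have "ht x < C + \<eta>" if "norm x \<le> 2 * R" for x using that by (force simp: K_def)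
   then show thesis using that[of 1] by simp
  next
   case False
   have "continuous_on K (\<lambda>x. \<bar>g x\<bar>)" by (intro continuous_intros continuous_on_subset[OF g_continuous]) auto
   then obtain x0 where x0: "x0 \<in> K" "\<And>x. x \<in> K ==> \<bar>g x0\<bar> \<le> \<bar>g x\<bar>" using continuous_attains_inf[OF K False] by metis
   have "g x0 \<noteq> 0"
   proof
    assume "g x0 = 0"
    then have "ht x0 \<le> C" using ht[of x0] hC[of x0] x0(1) c0(1) by (auto simp: K_def)
    then show False using x0(1) eta by (auto simp: K_def)
   qed
   then show thesis
   proof (intro that[of "\<bar>g x0\<bar>"])
    fix x assume "norm x \<le> 2 * R" "\<bar>g x\<bar> < \<bar>g x0\<bar>"
    then show "ht x < C + \<eta>" using x0(2)[of x] by (force simp: K_def)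
   qed simp
  qed
 qed
 define em where "em = min e0 (min (c0 / 2) (e1 / 2))"
 have em: "em > 0" "em \<le> e0" "2 * em \<le> c0" "2 * em \<le> e1" unfolding em_def using e0 c0(1) e1(1) by auto
 define e where "e n = em / real (Suc n)" for n
 have e: "0 < e n" "e n \<le> em" for n using em(1) by (auto simp: e_def divide_le_eq)
 have elim0: "e \<longlonglongrightarrow> 0" unfolding e_def by (rule LIMSEQ_Suc[OF lim_const_over_n])
 have ec: "2 * e n \<le> c0" for n using e(2)[of n] em(3) by linarith
 \<comment> \<open>The class of error densities whose shell integrals tend to zero; it is closed
   under finite sums.\<close>
 define van where "van F \<longleftrightarrow> (\<forall>n. integrable lborel (\<lambda>x. sh (e n) x * F x)) \<and> (\<lambda>n. \<integral>x. sh (e n) x * F x \<partial>lborel) \<longlonglongrightarrow> 0" for F :: "real^'n => real"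
 have van_sum: "van (\<lambda>x. \<Sum>i\<in>(UNIV::'n set). F i x)" if "\<And>i. van (F i)" for F
  using that unfolding van_def sum_distrib_left by (auto intro!: tendsto_null_sum simp: Bochner_Integration.integral_sum)
 have van_add: "van (\<lambda>x. F x + G x)" if "van F" "van G" for F G
  using that tendsto_add[of "\<lambda>n. \<integral>x. sh (e n) x * F x \<partial>lborel" 0 sequentially "\<lambda>n. \<integral>x. sh (e n) x * G x \<partial>lborel" 0]
  unfolding van_def distrib_left by (simp add: Bochner_Integration.integral_add)
 have R2: "2 * R > 0" using R by simp
 have vanb: "van (\<lambda>x. \<beta> x * m x * (tg i j x * y x))" "van (\<lambda>x. \<beta> x * Dm x $ k * (tg i j x * y x))" if b: "continuous_on UNIV \<beta>" and y: "bd (2 * R) y" for \<beta> y i j k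
  unfolding van_def
  by (intro conjI allI shell_vanish[OF R2 cc_mult[OF b test_fn_cc(1)[OF mt]] _ y c0 e(1) ec elim0]; simp add: m0)
   (intro conjI allI shell_vanish[OF R2 cc_mult[OF b test_fn_cc(2)[OF mt]] _ y c0 e(1) ec elim0]; simp add: m0)
 have bnd: "bd (2 * R) nd" and bDU: "bd (2 * R) (DU k)" for k
  by (rule bd_L2loc[OF ndL nd0], assumption) (rule bd_L2loc[OF DUL DU0], assumption)
 have bDt: "bd (2 * R) (Dtg l i j)" for l i j by (rule bd_Dtg[OF R2])
 define er1 where "er1 x = (\<Oplus>i. \<Oplus>k. (x $ i * lam $ k * Dg x $ k) * m x * (tg k i x * nd x))" for x
 define er2 where "er2 x = (\<Oplus>i. \<Oplus>j. \<Oplus>k. (r (Nq x) * lam $ i * lam $ j * D2g x $ i $ j * Dg x $ j * lam $ k * Dg x $ k) * m x * (tg k i x * nd x))" for x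
 define er3 where "er3 x = (\<Oplus>i. \<Oplus>j. \<Oplus>k. (lam $ i * lam $ j * lam $ k * Dg x $ i) * m x * (tg k j x * Dtg i k j x)
   + ((- (lam $ i * lam $ j * lam $ k * Dg x $ i * D2g x $ k $ i)) * m x * (tg k j x * DU j x)
   + (lam $ i * lam $ j * lam $ k * Dg x $ i * D2g x $ j $ i) * m x * (tg k j x * DU k x)))" for x
 define er4 where "er4 x = (\<Oplus>i. \<Oplus>k. \<Oplus>l. (lam $ i * lam $ k * D2g x $ k $ i * lam $ l * Dg x $ l) * m x * (tg l i x * DU k x))" for x
 define er5 where "er5 x = (\<Oplus>i. \<Oplus>j. (lam $ i * lam $ j * Dg x $ j) * Dm x $ i * (tg j i x * nd x))" for x
 define ER where "ER x = er1 x + (er2 x + (er3 x + (er4 x + er5 x)))" for x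
 note cont = continuous_intros Dg_continuous D2g_continuous rc
 have v1: "van er1" unfolding er1_def by (rule van_sum, rule van_sum, rule vanb(1)[OF _ bnd], intro cont)
 have v2: "van er2" unfolding er2_def by (rule van_sum, rule van_sum, rule van_sum, rule vanb(1)[OF _ bnd], intro cont)
 have v3: "van er3" unfolding er3_def
  by (rule van_sum, rule van_sum, rule van_sum, rule van_add, rule vanb(1)[OF _ bDt], (intro cont)[1], rule van_add, rule vanb(1)[OF _ bDU], (intro cont)[1], rule vanb(1)[OF _ bDU], intro cont)
 have v4: "van er4" unfolding er4_def by (rule van_sum, rule van_sum, rule van_sum, rule vanb(1)[OF _ bDU], intro cont)
 have v5: "van er5" unfolding er5_def by (rule van_sum, rule van_sum, rule vanb(2)[OF _ bnd], intro cont)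
 have vER: "van ER" unfolding ER_def by (rule van_add[OF v1 van_add[OF v2 van_add[OF v3 van_add[OF v4 v5]]]])
 define EE where "EE n x = (\<Oplus>i. \<Oplus>j. sh (e n) x * (lam $ i * lam $ j * Dg x $ j * m x) * (nd x * Dtg i j i x + tg j i x * Dnd i x)
   + nd x * tg j i x * (sh (e n) x *\<^sub>R ((lam $ i * lam $ j * Dg x $ j) *\<^sub>R Dm x + m x *\<^sub>R ((lam $ i * lam $ j) *\<^sub>R D2g x $ j))
    + (lam $ i * lam $ j * Dg x $ j * m x) *\<^sub>R (sh' (e n) x *\<^sub>R Dg x)) $ i)" for n x
 have EEi: "null_integral (EE n)" for n
 proof -
  have "has_bochner_integral lborel (EE n) (\<Sum>i\<in>(UNIV::'n set). \<Sum>j\<in>(UNIV::'n set). 0)" unfolding EE_def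
   by (intro has_bochner_integral_sum W1_product[OF open_Om ndW tgW chi_test(2)[OF e(1) test_fn_mult[OF C1_cmult[OF DgC1] mt]]])
  then show ?thesis by simp
 qed
 \<comment> \<open>Symmetric coefficients are annihilated by the antisymmetric \<open>tg\<close>. In
   particular this disposes of the terms with \<open>sh'\<close>, which is of order
   \<open>1 / e\<^sup>2\<close>, too singular for Hardy's inequality.\<close>
 have anti: "(\<Oplus>i. \<Oplus>j. S i j * tg j i x) = 0" if "\<And>i j. S i j = S j i" for S x
 proof -
  have "(\<Oplus>i. \<Oplus>j. S i j * tg j i x) = (\<Oplus>j. \<Oplus>i. S i j * tg j i x)" by (rule sum.swap)
  also have "\<dots> = (\<Oplus>j. \<Oplus>i. - (S j i * tg i j x))"
   by (intro sum.cong refl) (simp add: tg_def tang_def that[of _ _] algebra_simps)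
  also have "\<dots> = - (\<Oplus>i. \<Oplus>j. S i j * tg j i x)" by (simp add: sum_negf)
  finally show ?thesis by simp
 qed
 define TT where "TT x = (\<Oplus>i. \<Oplus>j. lam $ i * lam $ j * Dg x $ j * (nd x * Dtg i j i x + tg j i x * Dnd i x))" for x
 have EE: "EE n x = sh (e n) x * (m x * TT x + er5 x)" for n x
 proof -
  have "EE n x = sh (e n) x * (m x * TT x + er5 x) + sh (e n) x * m x * nd x * (\<Oplus>i. \<Oplus>j. (lam $ i * lam $ j * D2g x $ i $ j) * tg j i x)
    + sh' (e n) x * m x * nd x * (\<Oplus>i. \<Oplus>j. (lam $ i * lam $ j * Dg x $ i * Dg x $ j) * tg j i x)"
   unfolding EE_def TT_def er5_def sum_distrib_left distrib_left sum.distrib[symmetric]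
   by (intro sum.cong refl) (simp add: D2g_sym[of x _ _] algebra_simps)
  moreover have "(\<Oplus>i. \<Oplus>j. (lam $ i * lam $ j * D2g x $ i $ j) * tg j i x) = 0"
   by (rule anti) (subst D2g_sym, simp add: mult.commute)
  moreover have "(\<Oplus>i. \<Oplus>j. (lam $ i * lam $ j * Dg x $ i * Dg x $ j) * tg j i x) = 0"
   by (rule anti) (simp add: mult_ac)
  ultimately show ?thesis by simp
 qed
 have key: "AE x in lborel. sh (e n) x * qt R x * bt x = EE n x - sh (e n) x * qt R x * (nd x)\<^sup>2 * ht x - sh (e n) x * ER x" for n
  using eq2
 proof eventually_elim
  case (elim x)
  show ?case
  proof (cases "sh (e n) x = 0")
   case True then show ?thesis by (simp add: EE)
  next
   case False
   then have gx: "- (2 * e n) < g x" "g x < - e n" using chi_sh_facts(7,8)[OF e(1)[of n], of x] by (meson not_le)+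
   then have g0: "g x < 0" "\<bar>g x\<bar> \<le> c0" using e(1)[of n] ec[of n] by linarith+
   have "m x * TT x = qt R x * bt x + qt R x * (nd x)\<^sup>2 * ht x + er1 x + er2 x + er3 x + er4 x"
   proof (cases "norm x \<le> 2 * R")
    case False
    then have "m x = 0" "qt R x = 0" using m0 qt_facts(2)[OF R, of x] by auto
    then show ?thesis by (simp add: er1_def er2_def er3_def er4_def)
   next
    case True
    note N = N1[OF True g0(2)]
    have q: "qt R x = m x * Nq x" using N by (simp add: qt_def m_def a_def power2_eq_square)
    define tau where "tau i = (\<Oplus>k. lam $ k * Dg x $ k * tg k i x)" for i
    have "TT x = Nq x * bt x + Nq x * (nd x)\<^sup>2 * hfun lam Dg D2g x
      + nd x * (\<Oplus>i. x $ i * tau i) + nd x / Nq x * (\<Oplus>i. \<Oplus>j. lam $ i * lam $ j * (D2g x $ i $ j * Dg x $ j * tau i))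
      + (\<Oplus>i. \<Oplus>j. \<Oplus>k. lam $ i * lam $ j * lam $ k * Dg x $ i * tg k j x * (Dtg i k j x - D2g x $ k $ i * DU j x + D2g x $ j $ i * DU k x))
      + (\<Oplus>i. \<Oplus>k. lam $ i * lam $ k * (tau i * D2g x $ k $ i * DU k x))"
     unfolding TT_def
     by (rule normal_tangential_algebra[where L = "\<lambda>k. lam $ k" and G = "\<lambda>k. Dg x $ k" and P = "\<lambda>k. DU k x" and X = "\<lambda>k. x $ k"
       and H = "\<lambda>i j. D2g x $ i $ j" and W = "\<lambda>i j. D2U i j x" and t = "\<lambda>i j. tg i j x" and Dt = "\<lambda>l i j. Dtg l i j x" and Ds = "\<lambda>l. Dnd l x"])
      (use elim g0(1) N(1) in \<open>auto simp: D2s tg_def tang_def Dtg_def nd_def Dnd_def tau_def Nq_def bt_def hfun_Nq intro: D2g_sym\<close>)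
    moreover have "m x * (nd x * (\<Oplus>i. x $ i * tau i)) = er1 x"
     unfolding er1_def tau_def by (simp add: sum_distrib_left mult_ac)
    moreover have "m x * (nd x / Nq x * (\<Oplus>i. \<Oplus>j. lam $ i * lam $ j * (D2g x $ i $ j * Dg x $ j * tau i))) = er2 x"
     unfolding er2_def tau_def N(2) by (simp add: sum_distrib_left mult_ac divide_inverse)
    moreover have "m x * (\<Oplus>i. \<Oplus>j. \<Oplus>k. lam $ i * lam $ j * lam $ k * Dg x $ i * tg k j x * (Dtg i k j x - D2g x $ k $ i * DU j x + D2g x $ j $ i * DU k x)) = er3 x"
     unfolding er3_def sum_distrib_left by (intro sum.cong refl) (simp add: algebra_simps)
    moreover have "m x * (\<Oplus>i. \<Oplus>k. lam $ i * lam $ k * (tau i * D2g x $ k $ i * DU k x)) = er4 x"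
     unfolding er4_def tau_def by (simp add: sum_distrib_left sum_distrib_right mult_ac)
    ultimately show ?thesis unfolding q ht[OF True g0(2)] by (simp only: distrib_left mult.assoc)
   qed
   then show ?thesis unfolding EE ER_def by (simp add: algebra_simps)
  qed
 qed
 obtain Dq where Dq: "test_fn UNIV (qt R) Dq" using qt_test[OF R] by blast
 have ccq: "cc Om (\<lambda>x. sh (e n) x * qt R x)" for n by (rule test_fn_cc(1)[OF chi_test(2)[OF e(1) Dq]])
 define err where "err n = (LBINT x. sh (e n) x * ER x)" for n
 have main: "- (LBINT x. sh (e n) x * qt R x * bt x) \<le> (C + \<eta>) * (LBINT x. sh (e n) x * qt R x * (nd x)\<^sup>2) + err n" for n
 proof -
  note i = integrable_bt_nd[OF ccq[of n]]
  have iE: "integrable lborel (EE n)" "(LBINT x. EE n x) = 0" using EEi[of n] by (auto simp: has_bochner_integral_iff)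
  have iR: "integrable lborel (\<lambda>x. sh (e n) x * ER x)" using vER by (simp add: van_def)
  have "(LBINT x. - (sh (e n) x * qt R x * bt x)) \<le> (LBINT x. ((C + \<eta>) * (sh (e n) x * qt R x * (nd x)\<^sup>2) - EE n x) + sh (e n) x * ER x)"
  proof (rule integral_mono_AE)
   show "AE x in lborel. - (sh (e n) x * qt R x * bt x) \<le> ((C + \<eta>) * (sh (e n) x * qt R x * (nd x)\<^sup>2) - EE n x) + sh (e n) x * ER x"
    using key[of n]
   proof eventually_elim
    case (elim x)
    have "sh (e n) x * qt R x * (nd x)\<^sup>2 * ht x \<le> sh (e n) x * qt R x * (nd x)\<^sup>2 * (C + \<eta>)"
    proof (cases "sh (e n) x = 0 \<or> norm x > 2 * R")
     case True then show ?thesis using qt_facts(2)[OF R, of x] by auto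
    next
     case False
     then have gx: "- (2 * e n) < g x" "g x < - e n" using chi_sh_facts(7,8)[OF e(1)[of n], of x] by (meson not_le)+
     then have "\<bar>g x\<bar> < e1" using e[of n] em(4) by linarith
     then have "ht x \<le> C + \<eta>" using e1(2)[of x] False by simp
     then show ?thesis using chi_sh_facts(5)[OF e(1)[of n], of x] qt_facts(1)[OF R, of x] by (intro mult_left_mono) auto
    qed
    then show ?case unfolding elim by (simp add: mult.commute)
   qed
  qed (use i iE iR in \<open>auto\<close>)
  also have "\<dots> = (C + \<eta>) * (LBINT x. sh (e n) x * qt R x * (nd x)\<^sup>2) - 0 + err n"
   unfolding err_def iE(2)[symmetric] using i iE(1) iR by simp
  finally show ?thesis by simp
 qed
 show thesis
 proof (rule that[OF e(1) _ elim0 _ main])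
  show "e n \<le> e0" for n using e(2)[of n] em(2) by linarith
  show "err \<longlonglongrightarrow> 0" using vER unfolding van_def err_def by simp
 qed
qed

end

section \<open>The global estimate\<close>

lemma weighted_Cauchy_Schwarz:
 fixes L u v :: "'n::finite => real" assumes L: "\<And>i. L i > 0"
 shows "\<bar>\<Oplus>i. L i * (u i * v i)\<bar> \<le> sqrt (\<Oplus>i. L i * (u i)\<^sup>2) * sqrt (\<Oplus>i. L i * (v i)\<^sup>2)"
proof -
 have s: "(sqrt (L i) * y)\<^sup>2 = L i * y\<^sup>2" for i y using L[of i] by (simp add: power_mult_distrib less_imp_le)
 have e: "sqrt (L i) * u i * (sqrt (L i) * v i) = L i * (u i * v i)" for i
 proof -
  have "sqrt (L i) * u i * (sqrt (L i) * v i) = (sqrt (L i) * sqrt (L i)) * (u i * v i)" by (simp only: mult_ac)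
  then show ?thesis using L[of i] by simp
 qed
 have "(\<Oplus>i. L i * (u i * v i))\<^sup>2 \<le> (\<Oplus>i. L i * (u i)\<^sup>2) * (\<Oplus>i. L i * (v i)\<^sup>2)"
  using Cauchy_Schwarz_ineq_sum[of "\<lambda>i. sqrt (L i) * u i" "\<lambda>i. sqrt (L i) * v i" UNIV] unfolding s e .
 then have "sqrt ((\<Oplus>i. L i * (u i * v i))\<^sup>2) \<le> sqrt ((\<Oplus>i. L i * (u i)\<^sup>2) * (\<Oplus>i. L i * (v i)\<^sup>2))" by (rule real_sqrt_le_mono)
 then show ?thesis by (simp add: real_sqrt_mult)
qed

text \<open>The previous inequality on pairs of indices with product weights; the norm of a tensor
  product factorises.\<close>

lemma weighted_Cauchy_Schwarz_double:
 fixes L u v :: "'n::finite => real" and W :: "'n => 'n => real" assumes L: "\<And>i. L i > 0"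
 shows "\<bar>\<Oplus>i. \<Oplus>j. L i * L j * (W i j * u i * v j)\<bar>
  \<le> sqrt (\<Oplus>i. \<Oplus>j. L i * L j * (W i j)\<^sup>2) * (sqrt (\<Oplus>i. L i * (u i)\<^sup>2) * sqrt (\<Oplus>i. L i * (v i)\<^sup>2))"
proof -
 have "(\<Oplus>p. (\<lambda>(i, j). L i * L j) p * ((\<lambda>(i, j). W i j) p * (\<lambda>(i, j). u i * v j) p)) = (\<Oplus>i. \<Oplus>j. L i * L j * (W i j * u i * v j))"
  unfolding UNIV_Times_UNIV[symmetric] sum.cartesian_product by (intro sum.cong) (auto simp: mult.assoc)
 moreover have "(\<Oplus>p. (\<lambda>(i, j). L i * L j) p * ((\<lambda>(i, j). W i j) p)\<^sup>2) = (\<Oplus>i. \<Oplus>j. L i * L j * (W i j)\<^sup>2)"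
  unfolding UNIV_Times_UNIV[symmetric] sum.cartesian_product by (intro sum.cong) auto
 moreover have "(\<Oplus>p. (\<lambda>(i, j). L i * L j) p * ((\<lambda>(i, j). u i * v j) p)\<^sup>2) = (\<Oplus>i. L i * (u i)\<^sup>2) * (\<Oplus>i. L i * (v i)\<^sup>2)"
  unfolding UNIV_Times_UNIV[symmetric] sum_product sum.cartesian_product by (intro sum.cong) (auto simp: power_mult_distrib)
 ultimately show ?thesis
  using weighted_Cauchy_Schwarz[of "\<lambda>(i, j). L i * L j" "\<lambda>(i, j). W i j" "\<lambda>(i, j). u i * v j"] L by (simp add: split_beta real_sqrt_mult)
qed

text \<open>Scalar bookkeeping with \<open>D = divF\<close>, \<open>c\<^sup>2 = hess\<close>,
  \<open>p\<^sup>2 = grd\<close> and the two cutoffs. The 1/4 in front of \<open>c\<^sup>2\<close>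
  comes from the Rellich term \<open>C' A c p\<close>; the 5/4 in front of \<open>D\<^sup>2\<close>
  is the 1 of the Bochner identity plus 1/4 from the Rellich term with \<open>D\<close>; everything
  with \<open>kp\<close> is error from the cutoff at infinity.\<close>

lemma young_combination:
 fixes D p c th ch w :: real
 assumes ch: "0 \<le> ch" "ch \<le> 1" and w: "0 \<le> w" and th: "0 \<le> th" "th \<le> 1" and n: "0 \<le> c" "0 \<le> p" "0 \<le> A" "0 \<le> B" "0 \<le> C'" "0 \<le> kp"
  and F: "\<bar>F\<bar> \<le> p * kp" and Z: "\<bar>Z\<bar> \<le> c * (kp * p)" and st: "\<bar>st\<bar> \<le> A * p" and FD: "FD \<le> c * (p * A) + B * (p * p)"
 shows "ch * (th\<^sup>2 * w) * (D\<^sup>2 - p\<^sup>2) + 2 * ch * th * w * (D * F - Z) + C' * (ch * (th\<^sup>2 * w) * (st * D + FD) + 2 * ch * th * w * st * F)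
  \<le> (1 / 4 + kp) * (ch * (th\<^sup>2 * w) * c\<^sup>2) + w * ((5 / 4 + kp) * D\<^sup>2 + (2 * C'\<^sup>2 * A\<^sup>2 + C' * B + 2 * kp * (1 + C' * A)) * p\<^sup>2)"
proof -
 have t2: "th\<^sup>2 \<le> 1" using th by (simp add: power_le_one)
 have am: "2 * (a * b) \<le> a\<^sup>2 + b\<^sup>2" for a b :: real using sum_squares_bound[of a b] by (simp add: mult.assoc)
 have le1: "th\<^sup>2 * y \<le> y" if "0 \<le> y" for y using t2 that mult_right_mono[of "th\<^sup>2" 1 y] by simp
 have a0: "th\<^sup>2 * (D\<^sup>2 - p\<^sup>2) \<le> D\<^sup>2" using le1[of "D\<^sup>2"] by (simp add: algebra_simps) (meson add_increasing2 zero_le_mult_iff zero_le_power2)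
 have a1: "2 * (th * (D * F)) \<le> kp * D\<^sup>2 + kp * p\<^sup>2"
 proof -
  have "th * (D * F) \<le> \<bar>th * D\<bar> * \<bar>F\<bar>" by (metis abs_ge_self abs_mult mult.assoc)
  also have "\<dots> \<le> \<bar>th * D\<bar> * (p * kp)" by (intro mult_left_mono F) simp
  finally have "2 * (th * (D * F)) \<le> kp * (2 * (\<bar>th * D\<bar> * p))" by (simp add: algebra_simps)
  also have "\<dots> \<le> kp * (\<bar>th * D\<bar>\<^sup>2 + p\<^sup>2)" by (intro mult_left_mono am n)
  also have "\<dots> \<le> kp * (D\<^sup>2 + p\<^sup>2)" using le1[of "D\<^sup>2"] by (intro mult_left_mono n) (simp add: power_mult_distrib)
  finally show ?thesis by (simp add: algebra_simps)
 qed
 have a2: "- (2 * (th * Z)) \<le> kp * (th\<^sup>2 * c\<^sup>2) + kp * p\<^sup>2"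
 proof -
  have "th * (- Z) \<le> th * (c * (kp * p))" using Z by (intro mult_left_mono th) auto
  then have "- (2 * (th * Z)) \<le> kp * (2 * ((th * c) * p))" by (simp add: algebra_simps)
  also have "\<dots> \<le> kp * ((th * c)\<^sup>2 + p\<^sup>2)" by (intro mult_left_mono am n)
  finally show ?thesis by (simp add: power_mult_distrib algebra_simps)
 qed
 have a3: "C' * (th\<^sup>2 * (st * D)) \<le> D\<^sup>2 / 4 + C'\<^sup>2 * A\<^sup>2 * p\<^sup>2"
 proof -
  have "st * D \<le> \<bar>st\<bar> * \<bar>D\<bar>" by (metis abs_ge_self abs_mult)
  also have "\<dots> \<le> (A * p) * \<bar>D\<bar>" by (intro mult_right_mono st) simp
  finally have "th\<^sup>2 * (st * D) \<le> th\<^sup>2 * ((A * p) * \<bar>D\<bar>)" by (intro mult_left_mono) auto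
  also have "\<dots> \<le> (A * p) * \<bar>D\<bar>" using n by (intro le1) simp
  finally have "C' * (th\<^sup>2 * (st * D)) \<le> C' * ((A * p) * \<bar>D\<bar>)" by (intro mult_left_mono n)
  also have "\<dots> = 2 * ((\<bar>D\<bar> / 2) * (C' * A * p))" by simp
  also have "\<dots> \<le> (\<bar>D\<bar> / 2)\<^sup>2 + (C' * A * p)\<^sup>2" by (rule am)
  finally show ?thesis by (simp add: power_mult_distrib power_divide)
 qed
 have a4: "C' * (th\<^sup>2 * FD) \<le> th\<^sup>2 * c\<^sup>2 / 4 + C'\<^sup>2 * A\<^sup>2 * p\<^sup>2 + C' * B * p\<^sup>2"
 proof -
  have "C' * (th\<^sup>2 * FD) \<le> C' * (th\<^sup>2 * (c * (p * A) + B * (p * p)))" by (intro mult_left_mono FD n) simp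
  also have "\<dots> = th\<^sup>2 * (2 * ((c / 2) * (C' * A * p))) + th\<^sup>2 * (C' * B * p\<^sup>2)" by (simp add: power2_eq_square algebra_simps)
  also have "\<dots> \<le> th\<^sup>2 * ((c / 2)\<^sup>2 + (C' * A * p)\<^sup>2) + C' * B * p\<^sup>2" using n by (intro add_mono mult_left_mono am le1) auto
  also have "\<dots> \<le> th\<^sup>2 * (c / 2)\<^sup>2 + (C' * A * p)\<^sup>2 + C' * B * p\<^sup>2" using le1[of "(C' * A * p)\<^sup>2"] by (simp add: distrib_left)
  finally show ?thesis by (simp add: power_mult_distrib power_divide)
 qed
 have a5: "C' * (2 * (th * (st * F))) \<le> 2 * kp * (C' * A) * p\<^sup>2"
 proof -
  have "st * F \<le> \<bar>st\<bar> * \<bar>F\<bar>" by (metis abs_ge_self abs_mult)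
  also have "\<dots> \<le> (A * p) * (p * kp)" using n by (intro mult_mono st F) auto
  finally have "th * (st * F) \<le> th * ((A * p) * (p * kp))" by (intro mult_left_mono th)
  also have "\<dots> \<le> (A * p) * (p * kp)" using n th mult_right_mono[of th 1 "(A * p) * (p * kp)"] by simp
  finally have "2 * (th * (st * F)) \<le> 2 * ((A * p) * (p * kp))" by linarith
  from mult_left_mono[OF this n(5)] have "C' * (2 * (th * (st * F))) \<le> C' * (2 * ((A * p) * (p * kp)))" .
  then show ?thesis by (simp add: power2_eq_square algebra_simps)
 qed
 define Y where "Y = (5 / 4 + kp) * D\<^sup>2 + (2 * C'\<^sup>2 * A\<^sup>2 + C' * B + 2 * kp * (1 + C' * A)) * p\<^sup>2"
 have Y0: "0 \<le> Y" unfolding Y_def using n by (intro add_nonneg_nonneg mult_nonneg_nonneg) auto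
 have "th\<^sup>2 * (D\<^sup>2 - p\<^sup>2) + 2 * (th * (D * F)) - 2 * (th * Z) + C' * (th\<^sup>2 * (st * D)) + C' * (th\<^sup>2 * FD) + C' * (2 * (th * (st * F)))
   \<le> (1 / 4 + kp) * (th\<^sup>2 * c\<^sup>2) + Y"
  unfolding Y_def using a0 a1 a2 a3 a4 a5 by (simp add: algebra_simps)
 from mult_left_mono[OF this, of "ch * w"]
 have "ch * w * (th\<^sup>2 * (D\<^sup>2 - p\<^sup>2) + 2 * (th * (D * F)) - 2 * (th * Z) + C' * (th\<^sup>2 * (st * D)) + C' * (th\<^sup>2 * FD) + C' * (2 * (th * (st * F))))
   \<le> ch * w * ((1 / 4 + kp) * (th\<^sup>2 * c\<^sup>2)) + ch * (w * Y)" using ch w by (simp add: algebra_simps)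
 also have "ch * (w * Y) \<le> w * Y" using ch w Y0 mult_right_mono[of ch 1 "w * Y"] by simp
 finally show ?thesis unfolding Y_def by (simp add: algebra_simps)
qed

section \<open>Energy, Rellich and Bochner identities combined\<close>

context regular_solution
begin

text \<open>Test the equation with \<open>U\<close> itself. Expanding the square of
  \<open>divF\<close> and inserting the energy identity leaves four times the square of
  \<open>f\<close> minus nonnegative terms. For the gradient,
  \<open>f U \<le> lmb U\<^sup>2 + f\<^sup>2 / (4 lmb)\<close> cancels the zeroth-order term
  exactly.\<close>

lemma energy_bounds:
 shows "integrable (gauss lam) grd" "integrable (gauss lam) (\<lambda>x. (divF x)\<^sup>2)"
  "(LINT x|gauss lam. grd x) \<le> (LINT x|gauss lam. (f x)\<^sup>2) / (2 * lmb)" "(LINT x|gauss lam. (divF x)\<^sup>2) \<le> 4 * (LINT x|gauss lam. (f x)\<^sup>2)"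
proof -
 let ?M = "gauss lam"
 have UL2: "L2 ?M U" and DL2: "L2 ?M (DU l)" for l using U by (auto simp: HW_def)
 note i = L2_integrable_square[OF UL2] L2_integrable_square[OF DL2] L2_integrable_square[OF f] L2_integrable_mult[OF f UL2]
 have "Efm lmb U DU U DU = (LINT x|?M. f x * U x)" by (rule eqU[OF U]) (use U0 in auto)
 moreover have g: "(LINT x|?M. grd x) = (\<Oplus>l. lam $ l * (LINT x|?M. (DU l x)\<^sup>2))"
  unfolding grd_def using i by simp
 ultimately have E: "lmb * (LINT x|?M. (U x)\<^sup>2) + (LINT x|?M. grd x) / 2 = (LINT x|?M. f x * U x)"
  unfolding Efm_def by (simp add: power2_eq_square sum_divide_distrib)
 have G0: "0 \<le> (LINT x|?M. grd x)" unfolding grd_def using lam by (intro integral_nonneg_AE AE_I2 sum_nonneg) (simp add: less_imp_le)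
 have U0': "0 \<le> (LINT x|?M. (U x)\<^sup>2)" by simp
 show "integrable ?M grd" unfolding grd_def using i by simp
 have dF: "(divF x)\<^sup>2 = 4 * lmb\<^sup>2 * (U x)\<^sup>2 - 8 * lmb * (f x * U x) + 4 * (f x)\<^sup>2" for x
  unfolding divF_def by (simp add: power2_eq_square algebra_simps)
 show "integrable ?M (\<lambda>x. (divF x)\<^sup>2)" unfolding dF using i by simp
 have "(LINT x|?M. (divF x)\<^sup>2) = 4 * lmb\<^sup>2 * (LINT x|?M. (U x)\<^sup>2) - 8 * lmb * (LINT x|?M. f x * U x) + 4 * (LINT x|?M. (f x)\<^sup>2)"
  unfolding dF using i by simp
 also have "\<dots> = 4 * (LINT x|?M. (f x)\<^sup>2) - (4 * lmb\<^sup>2 * (LINT x|?M. (U x)\<^sup>2) + 4 * lmb * (LINT x|?M. grd x))"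
  unfolding E[symmetric] by (simp add: power2_eq_square algebra_simps)
 also have "\<dots> \<le> 4 * (LINT x|?M. (f x)\<^sup>2)"
 proof -
  have "0 \<le> 4 * lmb\<^sup>2 * (LINT x|?M. (U x)\<^sup>2)" "0 \<le> 4 * lmb * (LINT x|?M. grd x)" using lmb G0 U0' by (auto intro!: mult_nonneg_nonneg)
  then show ?thesis by linarith
 qed
 finally show "(LINT x|?M. (divF x)\<^sup>2) \<le> 4 * (LINT x|?M. (f x)\<^sup>2)" .
 have "(LINT x|?M. f x * U x) \<le> (LINT x|?M. lmb * (U x)\<^sup>2 + (f x)\<^sup>2 / (4 * lmb))"
 proof (rule integral_mono)
  show "f x * U x \<le> lmb * (U x)\<^sup>2 + (f x)\<^sup>2 / (4 * lmb)" for x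
  proof -
   have "0 \<le> (2 * lmb * U x - f x)\<^sup>2 / (4 * lmb)" using lmb by simp
   then show ?thesis using lmb by (simp add: power2_eq_square field_simps)
  qed
 qed (use i in auto)
 also have "\<dots> = lmb * (LINT x|?M. (U x)\<^sup>2) + (LINT x|?M. (f x)\<^sup>2) / (4 * lmb)" using i by simp
 finally have "(LINT x|?M. grd x) / 2 \<le> (LINT x|?M. (f x)\<^sup>2) / (4 * lmb)" using E by linarith
 then show "(LINT x|?M. grd x) \<le> (LINT x|?M. (f x)\<^sup>2) / (2 * lmb)" by simp
qed

definition Ft :: "real => real^'n => real" where "Ft R x = (\<Oplus>k. lam $ k * (DU k x * Dtheta R x $ k))"

text \<open>The product rule for \<open>st\<close> times \<open>DU\<close>, weighted by the interior
  cutoff and the Gaussian density. The derivative of the cutoff produces the shell integral of the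
  squared conormal derivative, because \<open>Dgt\<close> equals \<open>Dg\<close> on the shell; in
  the volume terms only \<open>Dgt\<close> and \<open>D2gt\<close> occur, which are controlled by A
  and B.\<close>

lemma rellich:
 assumes R: "R > 0" and e: "e > 0" and gt: "\<And>k. C1 (\<lambda>x. Dgt x $ k) (\<lambda>x. D2gt x $ k)"
  and near: "\<And>x. norm x \<le> 2 * R ==> \<bar>g x\<bar> \<le> 2 * e ==> Dgt x = Dg x"
  and st: "st = (\<lambda>x. \<Oplus>k. lam $ k * (Dgt x $ k * DU k x))"
  and FD: "FD = (\<lambda>x. \<Oplus>j. lam $ j * (DU j x * (\<Oplus>k. lam $ k * (Dgt x $ k * D2U j k x + DU k x * D2gt x $ k $ j))))"
 shows "null_integral (\<lambda>x. chi e x * qt R x * (st x * divF x + FD x) + 2 * chi e x * theta R x * gw lam x * st x * Ft R x - sh e x * qt R x * (nd x)\<^sup>2)"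
proof -
 define Dq where "Dq x = (gw lam x * theta R x) *\<^sub>R Dtheta R x + theta R x *\<^sub>R (gw lam x *\<^sub>R Dtheta R x + theta R x *\<^sub>R (\<chi> k. - (x $ k / lam $ k) * gw lam x))" for x
 have qtest: "test_fn UNIV (qt R) Dq"
  using test_fn_mult[OF C1_mult[OF C1_gw[OF lam] test_fn_C1[OF theta_test[OF R]]] theta_test[OF R]]
  unfolding qt_def[abs_def] Dq_def[abs_def] by (simp add: power2_eq_square mult_ac)
 note t = chi_test(1)[OF e qtest]
 define Dst where "Dst j x = (\<Oplus>k. lam $ k * (Dgt x $ k * D2U j k x + DU k x * D2gt x $ k $ j))" for j x
 have stW: "W1 Om st Dst"
 proof -
  have "W1 Om (\<lambda>x. \<Oplus>k. lam $ k * (Dgt x $ k * DU k x)) (\<lambda>l x. \<Oplus>k. lam $ k * (Dgt x $ k * D2U l k x + DU k x * D2gt x $ k $ l) + (Dgt x $ k * DU k x) * (0::real^'n) $ l)"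
   by (intro W1_sum W1_mult[OF W1_mult[OF D2W gt] C1_const])
  then show ?thesis unfolding st Dst_def[abs_def] by simp
 qed
 define E where "E k x = chi e x * qt R x * (st x * D2U k k x + DU k x * Dst k x) + st x * DU k x * (chi e x *\<^sub>R Dq x + qt R x *\<^sub>R ((- sh e x) *\<^sub>R Dg x)) $ k" for k x
 have "has_bochner_integral lborel (\<lambda>x. \<Oplus>k. lam $ k * E k x) (\<Sum>k\<in>(UNIV::'n set). lam $ k * 0)"
  unfolding E_def by (intro has_bochner_integral_sum has_bochner_integral_mult_right W1_product[OF open_Om stW D2W t])
 then have I: "null_integral (\<lambda>x. \<Oplus>k. lam $ k * E k x)" by simp
 let ?R = "\<lambda>x. chi e x * qt R x * (st x * divF x + FD x) + 2 * chi e x * theta R x * gw lam x * st x * Ft R x - sh e x * qt R x * (nd x)\<^sup>2"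
 have ae: "AE x in lborel. (\<Oplus>k. lam $ k * E k x) = ?R x" using eq2
 proof eventually_elim
  case (elim x)
  define T where "T = (\<Oplus>k. lam $ k * D2U k k x)"
  define S where "S = (\<Oplus>k. x $ k * DU k x)"
  have lq: "lam $ k * Dq x $ k = 2 * theta R x * gw lam x * (lam $ k * Dtheta R x $ k) - qt R x * x $ k" for k
   unfolding Dq_def qt_def using lam[of k] by (simp add: power2_eq_square algebra_simps less_imp_neq[THEN not_sym])
  have Ek: "lam $ k * E k x = chi e x * qt R x * (st x * (lam $ k * D2U k k x) + lam $ k * (DU k x * Dst k x))
    + st x * DU k x * (chi e x * (lam $ k * Dq x $ k)) - qt R x * sh e x * st x * (lam $ k * (Dg x $ k * DU k x))" for k
   unfolding E_def by (simp add: algebra_simps)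
  have p1: "(\<Oplus>k. lam $ k * E k x) = chi e x * qt R x * (st x * T + FD x) + (2 * chi e x * theta R x * gw lam x * st x * Ft R x - chi e x * qt R x * (st x * S)) - qt R x * sh e x * st x * nd x"
   unfolding Ek lq T_def S_def FD Ft_def nd_def Dst_def
   by (simp add: sum.distrib sum_subtractf sum_distrib_left algebra_simps)
  have p2: "chi e x * T = chi e x * (divF x + S)"
  proof (cases "x \<in> Om")
   case True then show ?thesis unfolding T_def S_def using elim by simp
  next
   case False then show ?thesis using chi_sh_facts(3)[OF e, of x] e by auto
  qed
  \<comment> \<open>On the support of the shell weight the two vector fields agree, so
    \<open>st\<close> is the conormal derivative \<open>nd\<close> there.\<close>
  have p3: "sh e x * qt R x * st x = sh e x * qt R x * nd x"
  proof (cases "sh e x = 0 \<or> norm x > 2 * R")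
   case True then show ?thesis using qt_facts(2)[OF R, of x] by auto
  next
   case False
   then have "- (2 * e) < g x" "g x < - e" using chi_sh_facts(7,8)[OF e, of x] by (meson not_le)+
   then have "Dgt x = Dg x" using near[of x] False e by auto
   then show ?thesis by (simp add: st nd_def)
  qed
  have p4: "chi e x * qt R x * (st x * T + FD x) = (chi e x * T) * (qt R x * st x) + chi e x * qt R x * FD x"
   and p5: "qt R x * sh e x * st x * nd x = (sh e x * qt R x * st x) * nd x" by (simp_all add: algebra_simps)
  show ?case unfolding p1 p4 p5 p2 p3 by (simp add: algebra_simps power2_eq_square)
 qed
 have [measurable]: "D2U h k \<in> borel_measurable borel" "DU k \<in> borel_measurable borel" "divF \<in> borel_measurable borel" "gw lam \<in> borel_measurable borel"
   "nd \<in> borel_measurable borel" for h k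
  using D2L DUL divFL ndL borel_measurable_continuous_onI[OF C1_continuous[OF C1_gw[OF lam]]] by (auto simp: L2loc_def)
 have [measurable]: "(\<lambda>x. Dgt x $ k) \<in> borel_measurable borel" "(\<lambda>x. D2gt x $ k $ l) \<in> borel_measurable borel" "chi e \<in> borel_measurable borel" "sh e \<in> borel_measurable borel"
   "qt R \<in> borel_measurable borel" "(theta R :: real^'n => real) \<in> borel_measurable borel" "(\<lambda>x::real^'n. Dtheta R x $ k) \<in> borel_measurable borel" for k l
  using borel_measurable_continuous_onI[OF C1_continuous[OF gt]] borel_measurable_continuous_onI[OF C1_continuous_D[OF gt]] chi_C2[of e]
   borel_measurable_continuous_onI[OF C1_continuous[OF sh_C1]] cc_measurable[OF test_fn_cc(1)[OF qtest]]
   cc_measurable[OF test_fn_cc(1)[OF theta_test[OF R]]] cc_measurable[OF test_fn_cc(2)[OF theta_test[OF R]]]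
  by (auto simp: C2_def dest!: C1_continuous intro: borel_measurable_continuous_onI)
 have "?R \<in> borel_measurable borel" unfolding FD st Ft_def by measurable
 then show ?thesis using I ae by (subst has_bochner_integral_cong_AE[symmetric]) (auto simp: has_bochner_integral_iff)
qed

lemma bochner_chi:
 assumes R: "R > 0" and e: "e > 0"
 shows "null_integral (\<lambda>x. chi e x * qt R x * ((divF x)\<^sup>2 - hess x - grd x) + 2 * chi e x * theta R x * gw lam x * (divF x * Ft R x
   - (\<Oplus>i. \<Oplus>j. lam $ i * lam $ j * (D2U i j x * Dtheta R x $ i * DU j x))) - sh e x * qt R x * bt x)"
proof -
 note t = chi_test(1)[OF e test_fn_mult[OF test_fn_C1[OF theta_test[OF R]] theta_test[OF R]]]
 define Dp where "Dp x = chi e x *\<^sub>R (theta R x *\<^sub>R Dtheta R x + theta R x *\<^sub>R Dtheta R x) + (theta R x * theta R x) *\<^sub>R ((- sh e x) *\<^sub>R Dg x)" for x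
 have v: "Dp x $ k = 2 * chi e x * theta R x * Dtheta R x $ k - sh e x * (theta R x)\<^sup>2 * Dg x $ k" for x k
  unfolding Dp_def by (simp add: power2_eq_square)
 have s1: "(\<Oplus>k. lam $ k * (DU k x * Dp x $ k)) = 2 * chi e x * theta R x * Ft R x - sh e x * (theta R x)\<^sup>2 * nd x" for x
  unfolding v Ft_def nd_def by (simp add: sum_subtractf sum_distrib_left algebra_simps)
 have s2: "(\<Oplus>i. \<Oplus>j. lam $ i * lam $ j * (D2U i j x * DU j x * Dp x $ i))
   = 2 * chi e x * theta R x * (\<Oplus>i. \<Oplus>j. lam $ i * lam $ j * (D2U i j x * Dtheta R x $ i * DU j x))
   - sh e x * (theta R x)\<^sup>2 * (\<Oplus>i. \<Oplus>j. lam $ i * lam $ j * (D2U i j x * DU j x * Dg x $ i))" for x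
  unfolding v by (simp add: sum_subtractf sum_distrib_left algebra_simps)
 have "gw lam x * (chi e x * (theta R x * theta R x) * ((divF x)\<^sup>2 - hess x - grd x) + divF x * (\<Oplus>k. lam $ k * (DU k x * Dp x $ k))
   - (\<Oplus>i. \<Oplus>j. lam $ i * lam $ j * (D2U i j x * DU j x * Dp x $ i)))
   = chi e x * qt R x * ((divF x)\<^sup>2 - hess x - grd x) + 2 * chi e x * theta R x * gw lam x * (divF x * Ft R x
   - (\<Oplus>i. \<Oplus>j. lam $ i * lam $ j * (D2U i j x * Dtheta R x $ i * DU j x))) - sh e x * qt R x * bt x" for x
  unfolding s1 s2 bt_def qt_def by (simp add: power2_eq_square algebra_simps)
 then show ?thesis using bochner_identity[OF t] unfolding Dp_def[symmetric] by simp
qed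

lemma hess_integrable: assumes c: "cc Om \<phi>" shows "integrable lborel (\<lambda>x. \<phi> x * hess x)"
proof -
 have "integrable lborel (\<lambda>x. \<Oplus>i. \<Oplus>j. lam $ i * lam $ j * (\<phi> x * (D2U i j x * D2U i j x)))"
  using L2loc_integrable_mult[OF D2L D2L c] by auto
 then show ?thesis unfolding hess_def by (simp add: sum_distrib_left power2_eq_square mult_ac)
qed

lemma hess_nonneg: "0 \<le> hess x" and grd_nonneg: "0 \<le> grd x"
 unfolding hess_def grd_def using lam by (auto intro!: sum_nonneg mult_nonneg_nonneg simp: less_imp_le)

text \<open>The Bochner identity expresses the volume integral of \<open>V1\<close> as Hessian term
  plus flux \<open>S1\<close>, and the Rellich identity that of \<open>V2\<close> as the shell
  integral \<open>S2\<close>. Since the flux is bounded below by \<open>- C'\<close> times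
  \<open>S2\<close> up to \<open>err\<close>, adding \<open>C'\<close> times the second to the first
  leaves volume integrals only, which \<open>young_combination\<close> estimates pointwise.\<close>

lemma cutoff_estimate:
 assumes R: "R > 0" and eta: "\<eta> > 0" and kap: "kp \<ge> 0" "\<And>x. (\<Oplus>k. lam $ k * (Dtheta R x $ k)\<^sup>2) \<le> kp\<^sup>2"
  and gt: "\<And>k. C1 (\<lambda>x. Dgt x $ k) (\<lambda>x. D2gt x $ k)" and V: "open V" "{x. g x = 0} \<subseteq> V" "\<And>x. x \<in> V ==> Dgt x = Dg x"
  and A: "A \<ge> 0" "\<And>x. x \<in> Om ==> (\<Oplus>k. lam $ k * (Dgt x $ k)\<^sup>2) \<le> A\<^sup>2"
  and B: "B \<ge> 0" "\<And>x. x \<in> Om ==> (\<Oplus>h. \<Oplus>k. lam $ h * lam $ k * (D2gt x $ h $ k)\<^sup>2) \<le> B\<^sup>2"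
  and C: "C \<ge> 0" "\<And>x. g x = 0 ==> hfun lam Dg D2g x \<le> C" and C': "C' = C + \<eta>"
 obtains e err where "\<And>n. 0 < e n" "e \<longlonglongrightarrow> 0" "err \<longlonglongrightarrow> 0"
  "\<And>n. (3 / 4 - kp) * (LBINT x. chi (e n) x * qt R x * hess x) \<le> (5 / 4 + kp) * (LINT x|gauss lam. (divF x)\<^sup>2)
    + (2 * C'\<^sup>2 * A\<^sup>2 + C' * B + 2 * kp * (1 + C' * A)) * (LINT x|gauss lam. grd x) + err n"
proof -
 \<comment> \<open>A level below which the part of the shell in the bounded ball lies inside the
   neighbourhood \<open>V\<close>, where \<open>Dgt\<close> and \<open>Dg\<close> coincide; again by
   compactness.\<close>
 obtain e0 where e0: "e0 > 0" "\<And>x. norm x \<le> 2 * R ==> \<bar>g x\<bar> \<le> 2 * e0 ==> x \<in> V"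
 proof -
  have K: "compact (cball 0 (2 * R) - V)" by (rule compact_diff[OF compact_cball V(1)])
  show thesis
  proof (cases "cball 0 (2 * R) - V = {}")
   case True
   then have "x \<in> V" if "norm x \<le> 2 * R" for x using that by force
   then show thesis using that[of 1] by simp
  next
   case False
   have "continuous_on (cball 0 (2 * R) - V) (\<lambda>x. \<bar>g x\<bar>)" by (intro continuous_intros continuous_on_subset[OF g_continuous]) auto
   then obtain x0 where x0: "x0 \<in> cball 0 (2 * R) - V" "\<And>x. x \<in> cball 0 (2 * R) - V ==> \<bar>g x0\<bar> \<le> \<bar>g x\<bar>" using continuous_attains_inf[OF K False] by metis
   have p: "\<bar>g x0\<bar> > 0" using x0(1) V(2) by auto
   show thesis
   proof (rule that[of "\<bar>g x0\<bar> / 4"])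
    fix x assume "norm x \<le> 2 * R" "\<bar>g x\<bar> \<le> 2 * (\<bar>g x0\<bar> / 4)"
    then show "x \<in> V" using x0(2)[of x] p by force
   qed (use p in simp)
  qed
 qed
 obtain e err where e: "\<And>n. 0 < e n" "\<And>n. e n \<le> e0" "e \<longlonglongrightarrow> 0" "err \<longlonglongrightarrow> 0"
  and bte: "\<And>n. - (LBINT x. sh (e n) x * qt R x * bt x) \<le> (C + \<eta>) * (LBINT x. sh (e n) x * qt R x * (nd x)\<^sup>2) + err n"
  by (rule boundary_term[OF R eta e0(1) C(2)]) (assumption | rule that)+
 have C0: "C' \<ge> 0" using C(1) eta C' by simp
 obtain Dq where Dq: "test_fn UNIV (qt R) Dq" using qt_test[OF R] by blast
 define K where "K = 2 * C'\<^sup>2 * A\<^sup>2 + C' * B + 2 * kp * (1 + C' * A)"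
 have K0: "K \<ge> 0" unfolding K_def using C0 A(1) B(1) kap(1) by simp
 show thesis
 proof (rule that[OF e(1,3,4)])
  fix n
  define H where "H x = chi (e n) x * qt R x * hess x" for x
  define S1 where "S1 x = sh (e n) x * qt R x * bt x" for x
  define S2 where "S2 x = sh (e n) x * qt R x * (nd x)\<^sup>2" for x
  define st where "st = (\<lambda>x. \<Oplus>k. lam $ k * (Dgt x $ k * DU k x))"
  define FD where "FD = (\<lambda>x. \<Oplus>j. lam $ j * (DU j x * (\<Oplus>k. lam $ k * (Dgt x $ k * D2U j k x + DU k x * D2gt x $ k $ j))))"
  define Z where "Z x = (\<Oplus>i. \<Oplus>j. lam $ i * lam $ j * (D2U i j x * Dtheta R x $ i * DU j x))" for x
  define V1 where "V1 x = chi (e n) x * qt R x * ((divF x)\<^sup>2 - grd x) + 2 * chi (e n) x * theta R x * gw lam x * (divF x * Ft R x - Z x)" for x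
  define V2 where "V2 x = chi (e n) x * qt R x * (st x * divF x + FD x) + 2 * chi (e n) x * theta R x * gw lam x * st x * Ft R x" for x
  have iH: "integrable lborel H" unfolding H_def by (rule hess_integrable[OF test_fn_cc(1)[OF chi_test(1)[OF e(1) Dq]]])
  have iS: "integrable lborel S1" "integrable lborel S2" unfolding S1_def S2_def
   by (rule integrable_bt_nd[OF test_fn_cc(1)[OF chi_test(2)[OF e(1) Dq]]])+
  have "null_integral (\<lambda>x. V1 x - H x - S1 x)"
   using bochner_chi[OF R e(1)[of n]] unfolding V1_def H_def S1_def Z_def by (simp add: algebra_simps)
  from has_bochner_integral_add[OF has_bochner_integral_add[OF this has_bochner_integral_integrable[OF iH]] has_bochner_integral_integrable[OF iS(1)]]
  have v1: "integrable lborel V1" "(LBINT x. V1 x) = (LBINT x. H x) + (LBINT x. S1 x)" by (auto simp: has_bochner_integral_iff)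
  have "null_integral (\<lambda>x. V2 x - S2 x)"
   unfolding V2_def S2_def
  proof (rule rellich[OF R e(1) gt _ st_def FD_def])
   show "Dgt x = Dg x" if "norm x \<le> 2 * R" "\<bar>g x\<bar> \<le> 2 * e n" for x using V(3) e0(2)[of x] that e(2)[of n] by simp
  qed
  from has_bochner_integral_add[OF this has_bochner_integral_integrable[OF iS(2)]]
  have v2: "integrable lborel V2" "(LBINT x. V2 x) = (LBINT x. S2 x)" by (auto simp: has_bochner_integral_iff)
  have ptw: "V1 x + C' * V2 x \<le> (1 / 4 + kp) * H x + gw lam x * ((5 / 4 + kp) * (divF x)\<^sup>2 + K * grd x)" for x
  proof (cases "x \<in> Om")
   case False
   then have "chi (e n) x = 0" using chi_sh_facts(3)[OF e(1), of n x] e(1)[of n] by simp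
   then show ?thesis unfolding V1_def V2_def H_def using gw_pos[OF lam, of x] kap(1) K0 grd_nonneg[of x] by simp
  next
   case True
   define p where "p = sqrt (grd x)"
   define c where "c = sqrt (hess x)"
   have pc: "0 \<le> p" "0 \<le> c" "p\<^sup>2 = grd x" "c\<^sup>2 = hess x" using grd_nonneg[of x] hess_nonneg[of x] by (auto simp: p_def c_def)
   have sA: "sqrt (\<Oplus>k. lam $ k * (Dgt x $ k)\<^sup>2) \<le> A" using A(1) A(2)[OF True] by (rule real_le_lsqrt)
   have sk: "sqrt (\<Oplus>k. lam $ k * (Dtheta R x $ k)\<^sup>2) \<le> kp" using kap by (intro real_le_lsqrt)
   have sB: "sqrt (\<Oplus>h. \<Oplus>k. lam $ h * lam $ k * (D2gt x $ h $ k)\<^sup>2) \<le> B" using B(1) B(2)[OF True] by (rule real_le_lsqrt)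
   have f1: "\<bar>Ft R x\<bar> \<le> p * kp"
    unfolding Ft_def p_def grd_def by (rule order_trans[OF weighted_Cauchy_Schwarz[OF lam] mult_left_mono[OF sk real_sqrt_ge_zero]]) (use grd_nonneg[of x] in \<open>simp add: grd_def\<close>)
   have f2: "\<bar>Z x\<bar> \<le> c * (kp * p)"
    unfolding Z_def p_def grd_def c_def hess_def
    by (rule order_trans[OF weighted_Cauchy_Schwarz_double[OF lam] mult_left_mono[OF mult_right_mono[OF sk]]])
     (use grd_nonneg[of x] hess_nonneg[of x] in \<open>auto simp: grd_def hess_def\<close>)
   have f3: "\<bar>st x\<bar> \<le> A * p"
    unfolding st_def p_def grd_def by (rule order_trans[OF weighted_Cauchy_Schwarz[OF lam] mult_right_mono[OF sA]]) (use grd_nonneg[of x] in \<open>simp add: grd_def\<close>)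
   have f4: "FD x \<le> c * (p * A) + B * (p * p)"
   proof -
    have "FD x = (\<Oplus>j. \<Oplus>k. lam $ j * lam $ k * (D2U j k x * DU j x * Dgt x $ k)) + (\<Oplus>k. \<Oplus>j. lam $ k * lam $ j * (D2gt x $ k $ j * DU k x * DU j x))"
    proof -
     have "(\<Oplus>k. \<Oplus>j. lam $ k * lam $ j * (D2gt x $ k $ j * DU k x * DU j x)) = (\<Oplus>j. \<Oplus>k. lam $ k * lam $ j * (D2gt x $ k $ j * DU k x * DU j x))"
      by (rule sum.swap)
     then show ?thesis unfolding FD_def by (simp add: sum_distrib_left sum.distrib algebra_simps)
    qed
    also have "\<dots> \<le> c * (p * A) + B * (p * p)"
    proof (rule add_mono)
     show "(\<Oplus>j. \<Oplus>k. lam $ j * lam $ k * (D2U j k x * DU j x * Dgt x $ k)) \<le> c * (p * A)"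
      unfolding p_def grd_def c_def hess_def
      by (rule order_trans[OF abs_ge_self order_trans[OF weighted_Cauchy_Schwarz_double[OF lam] mult_left_mono[OF mult_left_mono[OF sA]]]])
       (use grd_nonneg[of x] hess_nonneg[of x] in \<open>auto simp: grd_def hess_def\<close>)
     show "(\<Oplus>k. \<Oplus>j. lam $ k * lam $ j * (D2gt x $ k $ j * DU k x * DU j x)) \<le> B * (p * p)"
      unfolding p_def grd_def
      by (rule order_trans[OF abs_ge_self order_trans[OF weighted_Cauchy_Schwarz_double[OF lam] mult_right_mono[OF sB]]])
       (use grd_nonneg[of x] in \<open>auto simp: grd_def\<close>)
    qed
    finally show ?thesis .
   qed
   show ?thesis unfolding V1_def V2_def H_def K_def pc(3,4)[symmetric] qt_def
    by (rule young_combination) (use chi_sh_facts(1,2)[OF e(1)[of n], of x] gw_pos[OF lam, of x] theta_bounds(1,2)[OF R, of x] pc A(1) B(1) C0 kap(1) f1 f2 f3 f4 in \<open>auto\<close>)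
  qed
  have gm: "grd \<in> borel_measurable borel" "(\<lambda>x. (divF x)\<^sup>2) \<in> borel_measurable borel"
   using energy_bounds(1,2)[THEN borel_measurable_integrable] by (simp_all add: measurable_gauss)
  note ig = energy_bounds(1,2)[unfolded gauss_integral(2)[OF lam gm(1)] gauss_integral(2)[OF lam gm(2)]]
  have "(LBINT x. V1 x + C' * V2 x) \<le> (LBINT x. (1 / 4 + kp) * H x + ((5 / 4 + kp) * (gw lam x * (divF x)\<^sup>2) + K * (gw lam x * grd x)))"
  proof (rule integral_mono)
   show "V1 x + C' * V2 x \<le> (1 / 4 + kp) * H x + ((5 / 4 + kp) * (gw lam x * (divF x)\<^sup>2) + K * (gw lam x * grd x))" for x
    using ptw[of x] by (simp add: algebra_simps)
  qed (use v1(1) v2(1) iH ig in auto)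
  also have "\<dots> = (1 / 4 + kp) * (LBINT x. H x) + ((5 / 4 + kp) * (LINT x|gauss lam. (divF x)\<^sup>2) + K * (LINT x|gauss lam. grd x))"
   unfolding gauss_integral(1)[OF lam gm(1)] gauss_integral(1)[OF lam gm(2)] using iH ig by simp
  finally have "(LBINT x. V1 x) + C' * (LBINT x. V2 x) \<le> (1 / 4 + kp) * (LBINT x. H x) + ((5 / 4 + kp) * (LINT x|gauss lam. (divF x)\<^sup>2) + K * (LINT x|gauss lam. grd x))"
   using v1(1) v2(1) by simp
  moreover have "- (LBINT x. S1 x) \<le> C' * (LBINT x. S2 x) + err n" using bte[of n] unfolding S1_def S2_def C' .
  ultimately have "(3 / 4 - kp) * (LBINT x. H x) \<le> (5 / 4 + kp) * (LINT x|gauss lam. (divF x)\<^sup>2) + K * (LINT x|gauss lam. grd x) + err n"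
   unfolding v1(2) v2(2) by (simp add: algebra_simps)
  then show "(3 / 4 - kp) * (LBINT x. chi (e n) x * qt R x * hess x) \<le> (5 / 4 + kp) * (LINT x|gauss lam. (divF x)\<^sup>2)
    + (2 * C'\<^sup>2 * A\<^sup>2 + C' * B + 2 * kp * (1 + C' * A)) * (LINT x|gauss lam. grd x) + err n" unfolding H_def K_def .
 qed
qed

text \<open>The Hessian factor 3/4 - kp is at least 7/10 because \<open>kp \<le> 1 / 20\<close>.
  Seven tenths of 8 is 28/5, while the left side has constant part at most 5 + 1/5 from
  \<open>kp\<close> and 1/5 from the error terms; the products with A and B have room to spare as
  well.\<close>

lemma constants_estimate:
 fixes A B C :: real
 assumes n: "A \<ge> 0" "B \<ge> 0" "C \<ge> 0" "l > 0"
 obtains \<eta> kp where "\<eta> > 0" "kp > 0" "kp \<le> 1 / 20"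
  "(5 / 4 + kp) * 4 + (2 * (C + \<eta>)\<^sup>2 * A\<^sup>2 + (C + \<eta>) * B + 2 * kp * (1 + (C + \<eta>) * A)) / (2 * l) \<le> 7 / 10 * (8 + 4 * C * (C * A\<^sup>2 / l + B / l))"
proof -
 \<comment> \<open>Each parameter is chosen so that its contribution to the numerator is at most
   \<open>l / 5\<close>; together they give 1/5 after division by \<open>2 l\<close>.\<close>
 define \<eta> where "\<eta> = min 1 (l / (5 * (4 * A\<^sup>2 + B + 1)))"
 define kp where "kp = min (1 / 20) (l / (10 * (1 + (C + 1) * A)))"
 have d: "4 * A\<^sup>2 + B + 1 > 0" "1 + (C + 1) * A > 0" using n zero_le_power2[of A] mult_nonneg_nonneg[of "C + 1" A] by linarith+
 have e: "\<eta> > 0" "\<eta> \<le> 1" and k: "kp > 0" unfolding \<eta>_def kp_def using n(4) d by auto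
 have k20: "kp \<le> 1 / 20" unfolding kp_def by (rule min.cobounded1)
 have "\<eta> * (4 * A\<^sup>2 + B + 1) \<le> l / (5 * (4 * A\<^sup>2 + B + 1)) * (4 * A\<^sup>2 + B + 1)" using d by (intro mult_right_mono) (auto simp: \<eta>_def)
 also have "\<dots> = l / 5"
 proof -
  have "l / (5 * y) * y = l / 5" if "y > 0" for y using that by simp
  then show ?thesis using d(1) by blast
 qed
 finally have e1: "\<eta> * (4 * A\<^sup>2) + \<eta> * B \<le> l / 5" using e by (simp add: algebra_simps)
 have "kp * (1 + (C + \<eta>) * A) \<le> kp * (1 + (C + 1) * A)" using e k n by (intro mult_left_mono add_left_mono mult_right_mono) auto
 also have "\<dots> \<le> l / (10 * (1 + (C + 1) * A)) * (1 + (C + 1) * A)" using d by (intro mult_right_mono) (auto simp: kp_def)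
 also have "\<dots> = l / 10"
 proof -
  have "l / (10 * y) * y = l / 10" if "y > 0" for y using that by simp
  then show ?thesis using d(2) by blast
 qed
 finally have k1: "2 * kp * (1 + (C + \<eta>) * A) \<le> l / 5" by simp
 have "(C + \<eta>)\<^sup>2 \<le> 2 * C\<^sup>2 + 2 * \<eta>"
 proof -
  have "0 \<le> (C - \<eta>)\<^sup>2" by simp
  moreover have "\<eta> * \<eta> \<le> \<eta> * 1" using e by (intro mult_left_mono) auto
  ultimately show ?thesis by (simp add: power2_eq_square algebra_simps)
 qed
 from mult_left_mono[OF this, of "2 * A\<^sup>2"] have "2 * (C + \<eta>)\<^sup>2 * A\<^sup>2 \<le> 4 * (C\<^sup>2 * A\<^sup>2) + \<eta> * (4 * A\<^sup>2)" by (simp add: algebra_simps)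
 then have "2 * (C + \<eta>)\<^sup>2 * A\<^sup>2 + (C + \<eta>) * B + 2 * kp * (1 + (C + \<eta>) * A) \<le> 4 * (C\<^sup>2 * A\<^sup>2) + C * B + 2 * l / 5"
  using e1 k1 by (simp add: distrib_right)
 then have "(2 * (C + \<eta>)\<^sup>2 * A\<^sup>2 + (C + \<eta>) * B + 2 * kp * (1 + (C + \<eta>) * A)) / (2 * l) \<le> (4 * (C\<^sup>2 * A\<^sup>2) + C * B + 2 * l / 5) / (2 * l)"
  using n(4) by (intro divide_right_mono) auto
 also have "\<dots> = 2 * (C\<^sup>2 * A\<^sup>2 / l) + C * B / l / 2 + 1 / 5" using n(4) by (simp add: field_simps)
 finally have "(2 * (C + \<eta>)\<^sup>2 * A\<^sup>2 + (C + \<eta>) * B + 2 * kp * (1 + (C + \<eta>) * A)) / (2 * l) \<le> 2 * (C\<^sup>2 * A\<^sup>2 / l) + C * B / l / 2 + 1 / 5" .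
 moreover have "7 / 10 * (8 + 4 * C * (C * A\<^sup>2 / l + B / l)) = 28 / 5 + 14 / 5 * (C\<^sup>2 * A\<^sup>2 / l) + 14 / 5 * (C * B / l)"
  by (simp add: power2_eq_square algebra_simps)
 moreover have "0 \<le> C\<^sup>2 * A\<^sup>2 / l" "0 \<le> C * B / l" using n by auto
 moreover have "(5 / 4 + kp) * 4 + x \<le> r" if "x \<le> 2 * y + z / 2 + 1 / 5" "r = 28 / 5 + 14 / 5 * y + 14 / 5 * z" "0 \<le> y" "0 \<le> z" for x y z r
 proof -
  have "(5 / 4 + kp) * 4 = 5 + 4 * kp" by simp
  then show ?thesis using that k20 by linarith
 qed
 ultimately show thesis by (intro that[OF e(1) k k20]) blast
qed

text \<open>First the shell tends to the boundary with all other parameters fixed, which removes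
  \<open>err\<close>; then the truncation of the domain is removed by monotone convergence. The
  parameters \<open>\<eta>\<close> and \<open>kp\<close> stay fixed throughout, thanks to the room
  left by the constants.\<close>

lemma hessian_bound:
 assumes gt: "\<And>k. C1 (\<lambda>x. Dgt x $ k) (\<lambda>x. D2gt x $ k)" and V: "open V" "{x. g x = 0} \<subseteq> V" "\<And>x. x \<in> V ==> Dgt x = Dg x"
  and A: "A \<ge> 0" "\<And>x. x \<in> Om ==> (\<Oplus>k. lam $ k * (Dgt x $ k)\<^sup>2) \<le> A\<^sup>2"
  and B: "B \<ge> 0" "\<And>x. x \<in> Om ==> (\<Oplus>h. \<Oplus>k. lam $ h * lam $ k * (D2gt x $ h $ k)\<^sup>2) \<le> B\<^sup>2"
  and C: "C \<ge> 0" "\<And>x. g x = 0 ==> hfun lam Dg D2g x \<le> C"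
 shows "integrable (gauss lam) (\<lambda>x. indicator Om x * hess x)"
  "(LINT x|gauss lam. indicator Om x * hess x) \<le> (8 + 4 * C * (C * A\<^sup>2 / lmb + B / lmb)) * (LINT x|gauss lam. (f x)\<^sup>2)"
proof -
 define F where "F = (LINT x|gauss lam. (f x)\<^sup>2)"
 define M where "M = (8 + 4 * C * (C * A\<^sup>2 / lmb + B / lmb)) * F"
 have F0: "F \<ge> 0" unfolding F_def by simp
 define lmax where "lmax = Max (range (($) lam))"
 have lmax: "lam $ k \<le> lmax" for k unfolding lmax_def by auto
 have lm0: "lmax > 0" using lam[of undefined] lmax[of undefined] by linarith
 obtain \<eta> kp where eta: "\<eta> > 0" and k: "kp > 0" "kp \<le> 1 / 20"
  and kc: "(5 / 4 + kp) * 4 + (2 * (C + \<eta>)\<^sup>2 * A\<^sup>2 + (C + \<eta>) * B + 2 * kp * (1 + (C + \<eta>) * A)) / (2 * lmb) \<le> 7 / 10 * (8 + 4 * C * (C * A\<^sup>2 / lmb + B / lmb))"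
  by (rule constants_estimate[OF A(1) B(1) C(1) lmb]) (rule that)
 define K where "K = 2 * (C + \<eta>)\<^sup>2 * A\<^sup>2 + (C + \<eta>) * B + 2 * kp * (1 + (C + \<eta>) * A)"
 have K0: "K \<ge> 0" unfolding K_def using C(1) eta A(1) B(1) k(1) by simp
 have [measurable]: "D2U h k \<in> borel_measurable borel" "gw lam \<in> borel_measurable borel" for h k
  using D2L borel_measurable_continuous_onI[OF C1_continuous[OF C1_gw[OF lam]]] by (auto simp: L2loc_def)
 have hm[measurable]: "hess \<in> borel_measurable borel" unfolding hess_def by measurable
 define J where "J n x = (if g x \<le> - (1 / real (Suc n)) \<and> norm x \<le> real (Suc n) then gw lam x * hess x else 0)" for n x
 have Jm: "J n \<in> borel_measurable borel" for n unfolding J_def by measurable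
 have gh: "0 \<le> gw lam x * hess x" for x using gw_pos[OF lam, of x] hess_nonneg[of x] by simp
 have J: "integrable lborel (J n) \<and> (LBINT x. J n x) \<le> M" for n
 proof -
  \<comment> \<open>Large enough for the cutoff to equal 1 on the truncated set, and for the
    weighted gradient of the cutoff, at most \<open>8 sqrt lmax / R\<close>, not to exceed
    \<open>kp\<close>.\<close>
  define R where "R = max (real (Suc n)) (8 * sqrt lmax / kp)"
  have R: "R > 0" "real (Suc n) \<le> R" "8 * sqrt lmax / kp \<le> R" by (auto simp: R_def)
  have kR: "(\<Oplus>i. lam $ i * (Dtheta R x $ i)\<^sup>2) \<le> kp\<^sup>2" for x :: "real^'n"
  proof -
   have "(\<Oplus>i. lam $ i * (Dtheta R x $ i)\<^sup>2) \<le> (\<Oplus>i. lmax * (Dtheta R x $ i)\<^sup>2)" by (intro sum_mono mult_right_mono lmax) auto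
   also have "\<dots> = lmax * (norm (Dtheta R x))\<^sup>2"
    unfolding power2_norm_eq_inner inner_vec_def by (simp add: sum_distrib_left power2_eq_square)
   also have "\<dots> \<le> lmax * (8 / R)\<^sup>2" using lm0 theta_bounds(5)[OF R(1), of x] by (intro mult_left_mono power_mono) auto
   also have "\<dots> = (8 * sqrt lmax / R)\<^sup>2" using lm0 by (simp add: power_mult_distrib power_divide)
   also have "\<dots> \<le> kp\<^sup>2"
   proof (rule power_mono)
    show "8 * sqrt lmax / R \<le> kp" using R k(1) by (simp add: pos_divide_le_eq mult.commute)
   qed (use R lm0 in simp)
   finally show ?thesis .
  qed
  obtain e err where e: "\<And>m. 0 < e m" "e \<longlonglongrightarrow> 0" "err \<longlonglongrightarrow> 0"
   and est: "\<And>m. (3 / 4 - kp) * (LBINT x. chi (e m) x * qt R x * hess x) \<le> (5 / 4 + kp) * (LINT x|gauss lam. (divF x)\<^sup>2)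
    + (2 * (C + \<eta>)\<^sup>2 * A\<^sup>2 + (C + \<eta>) * B + 2 * kp * (1 + (C + \<eta>) * A)) * (LINT x|gauss lam. grd x) + err m"
   by (rule cutoff_estimate[OF R(1) eta less_imp_le[OF k(1)] kR gt V A B C refl]) (assumption | rule that)+
  obtain Dq where Dq: "test_fn UNIV (qt R) Dq" using qt_test[OF R(1)] by blast
  have Hi: "integrable lborel (\<lambda>x. chi (e m) x * qt R x * hess x)" for m
   by (rule hess_integrable[OF test_fn_cc(1)[OF chi_test(1)[OF e(1) Dq]]])
  have Hn: "0 \<le> chi (e m) x * qt R x * hess x" for m x
   using chi_sh_facts(1)[OF e(1)[of m], of x] qt_facts(1)[OF R(1), of x] hess_nonneg[of x] by simp
  have JH: "J n x \<le> chi (e m) x * qt R x * hess x" if m: "e m < 1 / real (Suc n) / 2" for m x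
  proof (cases "g x \<le> - (1 / real (Suc n)) \<and> norm x \<le> real (Suc n)")
   case True
   then have gn: "g x \<le> - (1 / real (Suc n))" "norm x \<le> real (Suc n)" by blast+
   have "2 * a < b" if "a < b / 2" for a b :: real using that by linarith
   from this[OF m] have "2 * e m < 1 / real (Suc n)" .
   then have "g x \<le> - (2 * e m)" "norm x \<le> R" using gn R(2) by linarith+
   then have "chi (e m) x = 1" "theta R x = 1" using chi_sh_facts(4)[OF e(1)[of m], of x] theta_bounds(3)[OF R(1), of x] by auto
   then show ?thesis using True by (simp add: J_def qt_def)
  next
   case False then show ?thesis using Hn by (simp only: J_def if_False)
  qed
  have ev: "\<forall>\<^sub>F m in sequentially. e m < 1 / real (Suc n) / 2" by (intro order_tendstoD(2)[OF e(2)]) simp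
  then obtain m0 where m0: "e m0 < 1 / real (Suc n) / 2" by (auto simp: eventually_sequentially)
  have Ji: "integrable lborel (J n)"
  proof (rule Bochner_Integration.integrable_bound[OF Hi[of m0]])
   have "0 \<le> J n x" for x using gh[of x] by (simp add: J_def)
   then show "AE x in lborel. norm (J n x) \<le> norm (chi (e m0) x * qt R x * hess x)" using JH[OF m0] by (auto intro!: AE_I2 simp: abs_of_nonneg[OF Hn])
  qed (use Jm in simp)
  have Hb: "(LBINT x. chi (e m) x * qt R x * hess x) \<le> M + 10 / 7 * err m" for m
  proof -
   let ?H = "\<integral>x. chi (e m) x * qt R x * hess x \<partial>lborel"
   have "7 / 10 * ?H \<le> (3 / 4 - kp) * ?H" using k(2) Hn by (intro mult_right_mono integral_nonneg_AE AE_I2) auto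
   also have "\<dots> \<le> (5 / 4 + kp) * (4 * F) + K * (F / (2 * lmb)) + err m"
    by (rule order_trans[OF est[of m, folded K_def] add_mono[OF add_mono[OF mult_left_mono[OF energy_bounds(4)[folded F_def]] mult_left_mono[OF energy_bounds(3)[folded F_def] K0]] order_refl]])
     (use k(1) in simp)
   also have "\<dots> = ((5 / 4 + kp) * 4 + K / (2 * lmb)) * F + err m" by (simp add: algebra_simps)
   also have "\<dots> \<le> (7 / 10 * (8 + 4 * C * (C * A\<^sup>2 / lmb + B / lmb))) * F + err m" using mult_right_mono[OF kc[folded K_def] F0] by simp
   also have "\<dots> = 7 / 10 * M + err m" unfolding M_def by (simp only: mult.assoc)
   finally have "7 / 10 * ?H \<le> 7 / 10 * M + err m" .
   moreover have "a \<le> b + 10 / 7 * c" if "7 / 10 * a \<le> 7 / 10 * b + c" for a b c :: real using that by linarith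
   ultimately show ?thesis by blast
  qed
  have "(\<lambda>m. M + 10 / 7 * err m) \<longlonglongrightarrow> M + 10 / 7 * 0" by (intro tendsto_intros e(3))
  moreover have "\<forall>\<^sub>F m in sequentially. (LBINT x. J n x) \<le> M + 10 / 7 * err m"
   using ev by eventually_elim (rule order_trans[OF integral_mono[OF Ji Hi JH] Hb])
  ultimately have "(LBINT x. J n x) \<le> M + 10 / 7 * 0" by (rule tendsto_lowerbound) simp
  then show ?thesis using Ji by simp
 qed
 have mono: "J m x \<le> J n x" if "m \<le> n" for m n x
 proof -
  have "1 / real (Suc n) \<le> 1 / real (Suc m)" using that by (intro divide_left_mono) auto
  then show ?thesis unfolding J_def using gh[of x] that by auto
 qed
 have lim: "(\<lambda>n. J n x) \<longlonglongrightarrow> gw lam x * (indicator Om x * hess x)" for x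
 proof (rule tendsto_eventually, cases "g x < 0")
  case True
  have l1: "(\<lambda>n. 1 / real (Suc n)) \<longlonglongrightarrow> 0" by (rule LIMSEQ_Suc[OF lim_const_over_n])
  have "\<forall>\<^sub>F n in sequentially. 1 / real (Suc n) < - g x" by (rule order_tendstoD(2)[OF l1]) (use True in simp)
  moreover have "\<forall>\<^sub>F n in sequentially. norm x \<le> real (Suc n)" using eventually_ge_at_top[of "nat \<lceil>norm x\<rceil>"] by eventually_elim linarith
  ultimately show "\<forall>\<^sub>F n in sequentially. J n x = gw lam x * (indicator Om x * hess x)"
   by eventually_elim (use True in \<open>auto simp: J_def\<close>)
 next
  case False
  have "J n x = gw lam x * (indicator Om x * hess x)" for n
  proof -
   have "1 / real (Suc n) > 0" by simp
   then have "\<not> g x \<le> - (1 / real (Suc n))" using False by linarith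
   then show ?thesis using False by (simp add: J_def)
  qed
  then show "\<forall>\<^sub>F n in sequentially. J n x = gw lam x * (indicator Om x * hess x)" by simp
 qed
 have im: "(\<lambda>x. indicator Om x * hess x) \<in> borel_measurable borel" by measurable
 have "integrable lborel (\<lambda>x. gw lam x * (indicator Om x * hess x))" "(LBINT x. gw lam x * (indicator Om x * hess x)) \<le> M"
  by (rule monotone_bounded_integrable[OF conjunct1[OF J] mono lim conjunct2[OF J]], assumption)+
 then show "integrable (gauss lam) (\<lambda>x. indicator Om x * hess x)" "(LINT x|gauss lam. indicator Om x * hess x) \<le> (8 + 4 * C * (C * A\<^sup>2 / lmb + B / lmb)) * (LINT x|gauss lam. (f x)\<^sup>2)"
  unfolding gauss_integral[OF lam im] M_def F_def by - assumption+
qed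

end

section \<open>Sobolev spaces with Dirichlet condition\<close>

lemma L2on_UNIV: "L2on M UNIV u \<longleftrightarrow> L2 M u"
 unfolding L2on_def L2_def set_borel_measurable_def set_integrable_def by simp

lemma L2on_null_extension: "L2on M A u \<longleftrightarrow> L2 M (\<lambda>x. if x \<in> A then u x else 0)"
proof -
 have "(\<lambda>x. indicator A x *\<^sub>R u x) = (\<lambda>x. if x \<in> A then u x else 0)" "(\<lambda>x. indicator A x *\<^sub>R (u x)\<^sup>2) = (\<lambda>x. (if x \<in> A then u x else 0)\<^sup>2)"
  by (auto simp: indicator_def)
 then show ?thesis unfolding L2on_def L2_def set_borel_measurable_def set_integrable_def by simp
qed

context regular_domain
begin

text \<open>On a nonempty compact subset \<open>g\<close> has a negative maximum; half its absolute
  value is a level at which the interior cutoff is already 1 on the subset.\<close>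

lemma cutoff_one_on_compact:
 assumes K: "compact K" "K \<subseteq> Om"
 obtains \<phi> D\<phi> where "test_fn Om \<phi> D\<phi>" "\<And>x. x \<in> K ==> \<phi> x = 1"
proof (cases "K = {}")
 case True
 have "test_fn Om (\<lambda>x. 0) (\<lambda>x. 0)" by (rule test_fnI[OF C1_const, of "{}"]) auto
 then show thesis using that True by blast
next
 case False
 obtain x0 where x0: "x0 \<in> K" "\<And>x. x \<in> K ==> g x \<le> g x0"
  using continuous_attains_sup[OF K(1) False continuous_on_subset[OF g_continuous]] by blast
 define e where "e = - g x0 / 2"
 have e: "e > 0" using x0(1) K(2) by (auto simp: e_def)
 obtain R0 where R0: "\<forall>x\<in>K. norm x \<le> R0" using compact_imp_bounded[OF K(1)] by (auto simp: bounded_iff)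
 define R where "R = max R0 1"
 have R: "R > 0" by (simp add: R_def)
 show thesis
 proof (rule that[OF chi_test(1)[OF e theta_test[OF R]]])
  fix x assume x: "x \<in> K"
  have "g x \<le> - (2 * e)" "norm x \<le> R" using x0(2)[OF x] R0 x by (auto simp: e_def R_def)
  then show "chi e x * theta R x = 1" using chi_sh_facts(4)[OF e] theta_bounds(3)[OF R] by simp
 qed
qed

lemma exhaustion_Om:
 obtains \<phi> D\<phi> where "\<And>n::nat. test_fn Om (\<phi> n) (D\<phi> n)" "\<And>x. (\<lambda>n. \<phi> n x) \<longlonglongrightarrow> indicator Om x"
proof -
 define \<phi> where "\<phi> n x = chi (1 / real (Suc n)) x * theta (real (Suc n)) x" for n x
 have "\<exists>D. test_fn Om (\<phi> n) D" for n unfolding \<phi>_def using chi_test(1)[OF _ theta_test, of "1 / real (Suc n)" "real (Suc n)"] by auto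
 then obtain D where D: "\<And>n. test_fn Om (\<phi> n) (D n)" by metis
 show thesis
 proof (rule that[OF D])
  fix x
  show "(\<lambda>n. \<phi> n x) \<longlonglongrightarrow> indicator Om x"
  proof (rule tendsto_eventually, cases "x \<in> Om")
   case True
   have l1: "(\<lambda>n. 1 / real (Suc n)) \<longlonglongrightarrow> 0" by (rule LIMSEQ_Suc[OF lim_const_over_n])
   have "\<forall>\<^sub>F n in sequentially. 1 / real (Suc n) < - g x / 2" by (rule order_tendstoD(2)[OF l1]) (use True in simp)
   moreover have "\<forall>\<^sub>F n in sequentially. norm x \<le> real (Suc n)" using eventually_ge_at_top[of "nat \<lceil>norm x\<rceil>"] by eventually_elim linarith
   ultimately show "\<forall>\<^sub>F n in sequentially. \<phi> n x = indicator Om x"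
   proof eventually_elim
    case (elim n)
    have "2 * a \<le> - b" if "a < - b / 2" for a b :: real using that by linarith
    from this[OF elim(1)] have "g x \<le> - (2 * (1 / real (Suc n)))" by linarith
    then show ?case unfolding \<phi>_def using elim(2) True chi_sh_facts(4)[of "1 / real (Suc n)" x] theta_bounds(3)[of "real (Suc n)" x] by simp
   qed
  next
   case False
   have "\<phi> n x = 0" for n
   proof -
    have p: "1 / real (Suc n) > 0" by simp
    moreover have "0 \<le> g x" using False by simp
    ultimately have "g x \<ge> - (1 / real (Suc n))" by linarith
    then show ?thesis unfolding \<phi>_def using chi_sh_facts(3)[OF p] by simp
   qed
   then show "\<forall>\<^sub>F n in sequentially. \<phi> n x = indicator Om x" using False by simp
  qed
 qed
qed

text \<open>The definition of a weak derivative does not require measurability; it follows from integrability against cutoffs exhausting the domain.\<close>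
lemma weak_pderiv_AE_eq:
 assumes v: "weak_pderiv Om u k v" and w: "weak_pderiv Om u k w" "L2loc Om w"
 shows "(\<lambda>x. indicator Om x * v x) \<in> borel_measurable borel" "AE x in lborel. x \<in> Om \<longrightarrow> v x = w x"
proof -
 obtain \<phi> D\<phi> where p: "\<And>n::nat. test_fn Om (\<phi> n) (D\<phi> n)" "\<And>x. (\<lambda>n. \<phi> n x) \<longlonglongrightarrow> indicator Om x" by (rule exhaustion_Om) (rule that)
 have m: "(\<lambda>x. v x * \<phi> n x) \<in> borel_measurable borel" for n
  using borel_measurable_integrable[OF weak_pderivD(2)[OF v p(1)[of n]]] by simp
 have lim: "(\<lambda>n. v x * \<phi> n x) \<longlonglongrightarrow> v x * indicator Om x" for x by (intro tendsto_intros p(2))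
 have "(\<lambda>x. v x * indicator Om x) \<in> borel_measurable borel"
  by (rule borel_measurable_LIMSEQ_real[OF lim m])
 then show vm: "(\<lambda>x. indicator Om x * v x) \<in> borel_measurable borel" by (simp add: mult.commute)
 have Omm [measurable]: "Om \<in> sets borel" using open_Om by auto
 define h where "h x = indicator Om x * v x - indicator Om x * w x" for x
 have hm: "h \<in> borel_measurable borel" unfolding h_def using vm L2loc_measurable[OF w(2)] by measurable
 have hz: "h x * \<psi> x = v x * \<psi> x - w x * \<psi> x" if t: "test_fn Om \<psi> D\<psi>" for \<psi> D\<psi> x
 proof -
  obtain K where "K \<subseteq> Om" "\<And>x. x \<notin> K ==> \<psi> x = 0" using test_fn_zero_outside[OF t] by metis
  then show ?thesis by (cases "x \<in> Om") (auto simp: h_def left_diff_distrib)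
 qed
 have "AE x in lborel. x \<in> Om \<longrightarrow> h x = 0"
 proof (rule fundamental_lemma[OF open_Om hm])
  fix K assume K: "compact K" "K \<subseteq> Om"
  obtain \<psi> D\<psi> where t: "test_fn Om \<psi> D\<psi>" "\<And>x. x \<in> K ==> \<psi> x = 1" by (rule cutoff_one_on_compact[OF K]) (rule that)
  have "integrable lborel (\<lambda>x. indicator K x *\<^sub>R (v x * \<psi> x - w x * \<psi> x))"
   using weak_pderivD(2)[OF v t(1)] weak_pderivD(2)[OF w(1) t(1)] K(1) by (intro integrable_mult_indicator) (auto simp: borel_compact)
  moreover have "indicator K x *\<^sub>R (v x * \<psi> x - w x * \<psi> x) = indicator K x * h x" for x
   using hz[OF t(1), of x] t(2)[of x] by (cases "x \<in> K") auto
  ultimately show "integrable lborel (\<lambda>x. indicator K x * h x)" by (simp only:)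
 next
  fix \<psi> D\<psi> assume t: "test_fn Om \<psi> D\<psi>"
  show "(LBINT x. h x * \<psi> x) = 0" unfolding hz[OF t]
   using weak_pderivD[OF v t] weak_pderivD[OF w(1) t] by simp
 qed
 then show "AE x in lborel. x \<in> Om \<longrightarrow> v x = w x" by eventually_elim (auto simp: h_def)
qed

text \<open>Translates the definition into the locale. The gradient of the null extension may be set
  to zero outside the domain, and inside it agrees almost everywhere with the gradient chosen in
  \<open>weak_solution\<close>, so the weak equation holds with the new representative.\<close>

lemma weak_solution_dirichlet:
 assumes lmb: "lmb > 0" and f: "L2on (gauss lam) Om f" and u: "weak_solution lam Om lmb f u"
 obtains DU where "dirichlet_solution lam g Dg D2g lmb (\<lambda>x. if x \<in> Om then f x else 0) (\<lambda>x. if x \<in> Om then u x else 0) DU"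
  "\<And>k. weak_pderiv Om u k (DU k)"
proof -
 define U where "U x = (if x \<in> Om then u x else 0)" for x
 define F where "F x = (if x \<in> Om then f x else 0)" for x
 have Omm [measurable]: "Om \<in> sets borel" using open_Om by auto
 obtain Du where Du: "\<And>k. weak_pderiv Om u k (Du k)" and eq: "\<And>\<psi> D\<psi>. W12_0 lam Om \<psi> ==> (\<And>k. weak_pderiv Om \<psi> k (D\<psi> k)) ==>
   lmb * (\<integral>x\<in>Om. u x * \<psi> x \<partial>gauss lam) + (1/2) * (\<integral>x\<in>Om. (\<Oplus>k. lam$k * Du k x * D\<psi> k x) \<partial>gauss lam) = (\<integral>x\<in>Om. f x * \<psi> x \<partial>gauss lam)"
  using u unfolding weak_solution_def by blast
 have "W12 lam UNIV U" using u unfolding weak_solution_def W12_0_def U_def by simp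
 then obtain D' where D': "L2 (gauss lam) U" "\<And>k. weak_pderiv UNIV U k (D' k)" "\<And>k. L2 (gauss lam) (D' k)"
  unfolding W12_def L2on_UNIV by blast
 define DU where "DU k x = (if x \<in> Om then D' k x else 0)" for k x
 have DUL: "L2 (gauss lam) (DU k)" for k
 proof -
  have "L2 (gauss lam) (\<lambda>x. indicator Om x * D' k x)" by (rule L2_bounded_mult[OF D'(3), of _ 1]) (auto simp: indicator_def measurable_gauss)
  moreover have "(\<lambda>x. indicator Om x * D' k x) = DU k" by (auto simp: DU_def)
  ultimately show ?thesis by simp
 qed
 \<comment> \<open>On the open set where \<open>g > 0\<close> the extension is zero and hence so is
   its weak derivative; the remaining zero set of \<open>g\<close> is null.\<close>
 have off: "AE x in lborel. x \<notin> Om \<longrightarrow> D' k x = 0" for k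
 proof -
  have op: "open {x. g x > 0}" by (rule open_Collect_less[OF continuous_on_const g_continuous])
  have "weak_pderiv UNIV (\<lambda>x. 0) k (\<lambda>x. 0)" using weak_pderiv_C1[OF C1_const[of 0]] by simp
  then have z: "weak_pderiv {x. g x > 0} U k (\<lambda>x. 0)" by (rule weak_pderiv_cong_on) (auto simp: U_def)
  have "AE x in lborel. x \<in> {x. g x > 0} \<longrightarrow> D' k x = 0"
   by (rule weak_pderiv_unique[OF op weak_pderiv_mono[OF D'(2)] z L2_gauss_L2loc[OF lam D'(3)] L2loc_continuous]) auto
  then show ?thesis using AE_g_nonzero by eventually_elim auto
 qed
 have DUw: "weak_pderiv UNIV U k (DU k)" for k
 proof (rule weak_pderiv_cong_AE[OF D'(2)])
  show "L2loc UNIV U" "L2loc UNIV U" "L2loc UNIV (D' k)" "L2loc UNIV (DU k)" using D' DUL L2_gauss_L2loc[OF lam] by blast+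
  show "AE x in lborel. x \<in> UNIV \<longrightarrow> D' k x = DU k x" using off[of k] by eventually_elim (auto simp: DU_def)
 qed simp
 have DUu: "weak_pderiv Om u k (DU k)" for k by (rule weak_pderiv_cong_on[OF DUw]) (simp add: U_def)
 have H: "HW lam U DU" using D'(1) DUL DUw by (auto simp: HW_def)
 have Fl: "L2 (gauss lam) F" using f unfolding L2on_null_extension F_def .
 have "dirichlet_solution lam g Dg D2g lmb F U DU"
 proof (unfold_locales, rule lmb, rule Fl, rule H)
  show "U x = 0" "F x = 0" "DU l x = 0" if "\<not> x \<in> Om" for x l using that by (auto simp: U_def DU_def F_def)
  fix \<psi> D\<psi> assume ps: "HW lam \<psi> D\<psi>" and z: "AE x in lborel. g x > 0 \<longrightarrow> \<psi> x = 0"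
  have pm: "\<psi> \<in> borel_measurable borel" "D\<psi> k \<in> borel_measurable borel" and pL: "L2 (gauss lam) \<psi>" "L2 (gauss lam) (D\<psi> k)" for k
   using ps by (auto simp: HW_def L2_gauss_iff[OF lam])
  \<comment> \<open>The test function vanishes almost everywhere outside the domain, so its null
    extension is the same function almost everywhere and has the same weak derivatives; this puts it
    into \<open>W12_0\<close>.\<close>
  define P where "P x = (if x \<in> Om then \<psi> x else 0)" for x
  have PA: "AE x in lborel. P x = \<psi> x" using z AE_g_nonzero by eventually_elim (auto simp: P_def)
  have Pe: "P = (\<lambda>x. indicator Om x * \<psi> x)" by (auto simp: P_def)
  have PL: "L2 (gauss lam) P" unfolding Pe by (rule L2_bounded_mult[OF pL(1), of _ 1]) (auto simp: indicator_def measurable_gauss)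
  have "weak_pderiv UNIV P k (D\<psi> k)" for k
  proof (rule weak_pderiv_cong_AE)
   show "weak_pderiv UNIV \<psi> k (D\<psi> k)" using ps by (auto simp: HW_def)
   show "L2loc UNIV \<psi>" "L2loc UNIV P" "L2loc UNIV (D\<psi> k)" "L2loc UNIV (D\<psi> k)" using pL PL L2_gauss_L2loc[OF lam] by blast+
   show "AE x in lborel. x \<in> UNIV \<longrightarrow> \<psi> x = P x" using PA by eventually_elim simp
  qed simp
  then have "W12_0 lam Om \<psi>" unfolding W12_0_def W12_def P_def[abs_def, symmetric] L2on_UNIV using PL pL(2) by blast
  moreover have "weak_pderiv Om \<psi> k (D\<psi> k)" for k by (rule weak_pderiv_mono[OF _ subset_UNIV]) (use ps in \<open>simp add: HW_def\<close>)
  ultimately have E: "lmb * (\<integral>x\<in>Om. u x * \<psi> x \<partial>gauss lam) + (1/2) * (\<integral>x\<in>Om. (\<Oplus>k. lam$k * Du k x * D\<psi> k x) \<partial>gauss lam) = (\<integral>x\<in>Om. f x * \<psi> x \<partial>gauss lam)"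
   by (rule eq)
  have e1: "(\<integral>x\<in>Om. u x * \<psi> x \<partial>gauss lam) = (LINT x|gauss lam. U x * \<psi> x)" "(\<integral>x\<in>Om. f x * \<psi> x \<partial>gauss lam) = (LINT x|gauss lam. F x * \<psi> x)"
   unfolding set_lebesgue_integral_def by (auto intro!: Bochner_Integration.integral_cong simp: U_def F_def)
  note ww = weak_pderiv_AE_eq[OF Du DUu L2_gauss_L2loc[OF lam DUL]]
  have "(\<integral>x\<in>Om. (\<Oplus>k. lam$k * Du k x * D\<psi> k x) \<partial>gauss lam) = (LINT x|gauss lam. (\<Oplus>k. lam$k * (DU k x * D\<psi> k x)))"
   unfolding set_lebesgue_integral_def
  proof (rule integral_cong_AE)
   have "(\<lambda>x. \<Oplus>k. lam$k * (indicator Om x * Du k x) * D\<psi> k x) \<in> borel_measurable borel"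
    using ww(1) pm(2) by measurable
   then show "(\<lambda>x. indicator Om x *\<^sub>R (\<Oplus>k. lam$k * Du k x * D\<psi> k x)) \<in> borel_measurable (gauss lam)"
    unfolding measurable_gauss by (simp add: sum_distrib_left mult_ac)
   show "(\<lambda>x. \<Oplus>k. lam$k * (DU k x * D\<psi> k x)) \<in> borel_measurable (gauss lam)"
    using L2_measurable[OF DUL] L2_measurable[OF pL(2)] by measurable
   have "AE x in lborel. \<forall>k\<in>(UNIV::'n set). x \<in> Om \<longrightarrow> Du k x = DU k x" by (intro AE_finite_allI ww(2)) simp
   then have "AE x in lborel. indicator Om x *\<^sub>R (\<Oplus>k. lam$k * Du k x * D\<psi> k x) = (\<Oplus>k. lam$k * (DU k x * D\<psi> k x))"
   proof eventually_elim
    case (elim x)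
    then show ?case by (cases "x \<in> Om") (auto simp: DU_def mult.assoc)
   qed
   then show "AE x in gauss lam. indicator Om x *\<^sub>R (\<Oplus>k. lam$k * Du k x * D\<psi> k x) = (\<Oplus>k. lam$k * (DU k x * D\<psi> k x))"
    unfolding AE_gauss[OF lam] .
  qed
  also have "\<dots> = (\<Oplus>k. lam$k * (LINT x|gauss lam. DU k x * D\<psi> k x))" using L2_integrable_mult[OF DUL pL(2)] by simp
  finally show "Efm lmb U DU \<psi> D\<psi> = (LINT x|gauss lam. F x * \<psi> x)"
   using E unfolding e1 Efm_def by (simp add: sum_distrib_left)
 qed
 then show thesis unfolding U_def[abs_def] F_def[abs_def] using DUu by (rule that)
qed

text \<open>Returns to the original function on the domain. Each second derivative is square
  integrable because its square is at most \<open>hess\<close> divided by a product of two positive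
  eigenvalues.\<close>

lemma hessian_estimate:
 assumes lmb: "lmb > 0" and f: "L2on (gauss lam) Om f" and u: "weak_solution lam Om lmb f u"
  and gt: "\<And>k. C1 (\<lambda>x. Dgt x $ k) (\<lambda>x. D2gt x $ k)" and V: "open V" "{x. g x = 0} \<subseteq> V" "\<And>x. x \<in> V ==> Dgt x = Dg x"
  and A: "A \<ge> 0" "\<And>x. x \<in> Om ==> (\<Oplus>k. lam $ k * (Dgt x $ k)\<^sup>2) \<le> A\<^sup>2"
  and B: "B \<ge> 0" "\<And>x. x \<in> Om ==> (\<Oplus>h. \<Oplus>k. lam $ h * lam $ k * (D2gt x $ h $ k)\<^sup>2) \<le> B\<^sup>2"
  and C: "C \<ge> 0" "\<And>x. g x = 0 ==> hfun lam Dg D2g x \<le> C"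
 obtains DU D2U where "W22_derivs lam Om u DU D2U"
  "(\<integral>x\<in>Om. (\<Oplus>h. \<Oplus>k. lam$h * lam$k * (D2U h k x)^2) \<partial>gauss lam)
    \<le> (8 + 4 * C * (C * A\<^sup>2 / lmb + B / lmb)) * (\<integral>x\<in>Om. (f x)^2 \<partial>gauss lam)"
proof -
 define F where "F x = (if x \<in> Om then f x else 0)" for x
 define U where "U x = (if x \<in> Om then u x else 0)" for x
 obtain DU where DU: "dirichlet_solution lam g Dg D2g lmb (\<lambda>x. if x \<in> Om then f x else 0) (\<lambda>x. if x \<in> Om then u x else 0) DU" "\<And>k. weak_pderiv Om u k (DU k)"
  by (rule weak_solution_dirichlet[OF lmb f u]) (rule that)
 interpret S: dirichlet_solution lam g Dg D2g lmb "\<lambda>x. if x \<in> Om then f x else 0" "\<lambda>x. if x \<in> Om then u x else 0" DU by (rule DU(1))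
 obtain D2U where D2: "\<And>k. W1 Om (DU k) (\<lambda>h. D2U h k)" "\<And>h k x. D2U h k x = D2U k h x"
  "AE x in lborel. x \<in> Om \<longrightarrow> (\<Oplus>k. lam $ k * D2U k k x) = S.divF x + (\<Oplus>l. x $ l * DU l x)"
  by (rule S.second_derivatives) (rule that)
 interpret T: regular_solution lam g Dg D2g lmb "\<lambda>x. if x \<in> Om then f x else 0" "\<lambda>x. if x \<in> Om then u x else 0" DU D2U
  by unfold_locales (rule D2)+
 note h = T.hessian_bound[OF gt V A B C]
 have Omm [measurable]: "Om \<in> sets borel" using open_Om by auto
 have D2m: "D2U h k \<in> borel_measurable borel" for h k using T.D2L by (auto simp: L2loc_def)
 have "L2on (gauss lam) Om (D2U h k)" for h k
  unfolding L2on_def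
 proof
  show "set_borel_measurable (gauss lam) Om (D2U h k)" unfolding set_borel_measurable_def measurable_gauss using D2m by measurable
  have p: "lam $ h * lam $ k > 0" using lam by simp
  show "set_integrable (gauss lam) Om (\<lambda>x. (D2U h k x)\<^sup>2)" unfolding set_integrable_def
  proof (rule Bochner_Integration.integrable_bound[OF integrable_mult_right[OF h(1), of "1 / (lam $ h * lam $ k)"]])
   show "(\<lambda>x. indicator Om x *\<^sub>R (D2U h k x)\<^sup>2) \<in> borel_measurable (gauss lam)" unfolding measurable_gauss using D2m by measurable
   have "(D2U h k x)\<^sup>2 \<le> 1 / (lam $ h * lam $ k) * T.hess x" for x
   proof -
    have "lam $ h * lam $ k * (D2U h k x)\<^sup>2 \<le> (\<Oplus>j. lam $ h * lam $ j * (D2U h j x)\<^sup>2)"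
     by (rule member_le_sum[of k UNIV "\<lambda>j. lam $ h * lam $ j * (D2U h j x)\<^sup>2"]) (use lam in \<open>auto simp: less_imp_le\<close>)
    also have "\<dots> \<le> T.hess x" unfolding T.hess_def
     by (rule member_le_sum[of h UNIV "\<lambda>i. \<Oplus>j. lam $ i * lam $ j * (D2U i j x)\<^sup>2"]) (use lam in \<open>auto simp: less_imp_le intro!: sum_nonneg\<close>)
    finally show ?thesis using p by (simp add: pos_le_divide_eq mult.commute)
   qed
   then show "AE x in gauss lam. norm (indicator Om x *\<^sub>R (D2U h k x)\<^sup>2) \<le> norm (1 / (lam $ h * lam $ k) * (indicator Om x * T.hess x))"
    using T.hess_nonneg p by (intro AE_I2) (auto simp: indicator_def abs_mult abs_of_pos[OF lam])
  qed
 qed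
 moreover have "L2on (gauss lam) Om u" using S.U unfolding HW_def L2on_null_extension by blast
 moreover have "L2on (gauss lam) Om (DU k)" for k
 proof -
  have "(\<lambda>x. if x \<in> Om then DU k x else 0) = DU k" using S.DU0 by auto
  then show ?thesis unfolding L2on_null_extension using S.U by (auto simp: HW_def)
 qed
 ultimately have W: "W22_derivs lam Om u DU D2U" unfolding W22_derivs_def using DU(2) D2(1) by (auto simp: W1_def)
 have "(\<integral>x\<in>Om. (f x)\<^sup>2 \<partial>gauss lam) = (LINT x|gauss lam. (if x \<in> Om then f x else 0)\<^sup>2)"
  unfolding set_lebesgue_integral_def by (auto intro!: Bochner_Integration.integral_cong)
 then show thesis using h(2) unfolding T.hess_def set_lebesgue_integral_def by (intro that[OF W]) (simp add: set_lebesgue_integral_def)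
qed

end

theorem mainTheorem5:
  fixes lam :: "real^'n"
    and g gt :: "real^'n \<Rightarrow> real"
    and Dg Dgt :: "real^'n \<Rightarrow> real^'n"
    and D2g D2gt :: "real^'n \<Rightarrow> real^'n^'n"
    and \<alpha> \<delta> lmb :: real
    and Om :: "(real^'n) set"
    and f u :: "real^'n \<Rightarrow> real"
  assumes lam_pos: "\<forall>k. lam$k > 0"
    and alpha: "0 < \<alpha>" "\<alpha> < 1"
    and g_reg: "C2alpha_loc \<alpha> g Dg D2g"
    and O_def: "Om = {x. g x < 0}"
    and Dg_nz: "\<forall>x. g x = 0 \<longrightarrow> Dg x \<noteq> 0"
    and delta: "\<delta> > 0"
    and a_fin: "bdd_above ((\<lambda>x. qnorm lam (Dg x)) ` {x. \<bar>g x\<bar> \<le> \<delta>})"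
    and b_fin: "bdd_above ((\<lambda>x. hsnorm lam (D2g x)) ` {x. \<bar>g x\<bar> \<le> \<delta>})"
    and gt_reg: "C2alpha_loc \<alpha> gt Dgt D2gt"
    and O_gt: "Om = {x. gt x < 0}"
    and gt_near: "\<exists>U. open U \<and> {x. g x = 0} \<subseteq> U \<and> (\<forall>x\<in>U. gt x = g x)"
    and A_fin: "bdd_above ((\<lambda>x. qnorm lam (Dgt x)) ` Om)"
    and B_fin: "bdd_above ((\<lambda>x. hsnorm lam (D2gt x)) ` Om)"
    and A_le: "supnn Om (\<lambda>x. qnorm lam (Dgt x))
                 \<le> supnn {x. \<bar>g x\<bar> \<le> \<delta>} (\<lambda>x. qnorm lam (Dg x))"
    and B_le: "supnn Om (\<lambda>x. hsnorm lam (D2gt x))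
                 \<le> supnn {x. \<bar>g x\<bar> \<le> \<delta>} (\<lambda>x. hsnorm lam (D2g x))
                   + 3 * (supnn {x. \<bar>g x\<bar> \<le> \<delta>} (\<lambda>x. qnorm lam (Dg x)))^2 / \<delta>"
    and C_fin: "bdd_above (hfun lam Dg D2g ` {x. g x = 0})"
    and lmb_pos: "lmb > 0"
    and f_L2: "L2on (gauss lam) Om f"
    and u_sol: "weak_solution lam Om lmb f u"
  shows "W22 lam Om u \<and>
    (\<exists>Du D2u. W22_derivs lam Om u Du D2u \<and>
      (let A = supnn Om (\<lambda>x. qnorm lam (Dgt x));
           B = supnn Om (\<lambda>x. hsnorm lam (D2gt x));
           C = (if {x. g x = 0} = {} then 0 else Sup (hfun lam Dg D2g ` {x. g x = 0}))
       in (\<integral>x\<in>Om. (\<Sum>h\<in>UNIV. \<Sum>k\<in>UNIV. lam$h * lam$k * (D2u h k x)^2) \<partial>gauss lam)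
          \<le> (8 + 4 * max C 0 * (2 + 2 * sqrt 2 / sqrt lmb * A + (1 / lmb) * \<bar>C\<bar> * A^2 + B / lmb))
            * (\<integral>x\<in>Om. (f x)^2 \<partial>gauss lam)))"
proof -
 define A where "A = supnn Om (\<lambda>x. qnorm lam (Dgt x))"
 define B where "B = supnn Om (\<lambda>x. hsnorm lam (D2gt x))"
 \<comment> \<open>If the zero set is empty there is no boundary contribution; the value 0 reduces
   the bound to 8 times the data norm.\<close>
 define C where "C = (if {x. g x = 0} = {} then 0 else Sup (hfun lam Dg D2g ` {x. g x = 0}))"
 have lam: "lam $ k > 0" for k using lam_pos by simp
 have rd: "regular_domain lam g Dg D2g"
  by unfold_locales (use lam C2alpha_loc_C2[OF alpha(1) g_reg] Dg_nz in auto)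
 have gtC: "C1 (\<lambda>x. Dgt x $ k) (\<lambda>x. D2gt x $ k)" for k using C2alpha_loc_C2[OF alpha(1) gt_reg] by (auto simp: C2_def)
 obtain V where V: "open V" "{x. g x = 0} \<subseteq> V" "\<forall>x\<in>V. gt x = g x" using gt_near by blast
 have DV: "Dgt x = Dg x" if x: "x \<in> V" for x
 proof -
  have a: "(gt has_derivative (\<lambda>v. Dgt x \<bullet> v)) (at x)" and d: "(g has_derivative (\<lambda>v. Dg x \<bullet> v)) (at x)"
   using gt_reg g_reg by (auto simp: C2alpha_loc_def)
  have "(g has_derivative (\<lambda>v. Dgt x \<bullet> v)) (at x)" by (rule has_derivative_transform_within_open[OF a V(1) x]) (use V(3) in auto)
  from has_derivative_unique[OF this d] have "Dgt x \<bullet> v = Dg x \<bullet> v" for v by meson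
  then show ?thesis by (metis vector_eq_rdot)
 qed
 have supnn: "0 \<le> supnn S F" "x \<in> S ==> F x \<le> supnn S F" if "bdd_above (F ` S)" for S and F :: "real^'n => real" and x
  using that unfolding supnn_def by (auto intro!: cSup_upper)
 have A: "A \<ge> 0" "(\<Oplus>k. lam $ k * (Dgt x $ k)\<^sup>2) \<le> A\<^sup>2" if "x \<in> Om" for x
  using supnn(1)[OF A_fin] sqrt_le_D[OF supnn(2)[OF A_fin that, unfolded qnorm_def]] unfolding A_def qnorm_def by auto
 have B: "B \<ge> 0" "(\<Oplus>h. \<Oplus>k. lam $ h * lam $ k * (D2gt x $ h $ k)\<^sup>2) \<le> B\<^sup>2" if "x \<in> Om" for x
  using supnn(1)[OF B_fin] sqrt_le_D[OF supnn(2)[OF B_fin that, unfolded hsnorm_def]] unfolding B_def hsnorm_def by auto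
 have A0: "A \<ge> 0" and B0: "B \<ge> 0" unfolding A_def B_def by (rule supnn(1)[OF A_fin], rule supnn(1)[OF B_fin])
 \<comment> \<open>The Rellich identity is multiplied by this constant before estimating, which
   requires a nonnegative bound for h.\<close>
 have C: "hfun lam Dg D2g x \<le> max C 0" if "g x = 0" for x
 proof -
  have "hfun lam Dg D2g x \<le> Sup (hfun lam Dg D2g ` {x. g x = 0})" using that by (intro cSup_upper C_fin) auto
  moreover have "C = Sup (hfun lam Dg D2g ` {x. g x = 0})" unfolding C_def using that by auto
  ultimately show ?thesis by (simp only: max.coboundedI1)
 qed
 define I where "I = (\<integral>x\<in>Om. (f x)^2 \<partial>gauss lam)"
 obtain DU D2U where W: "W22_derivs lam Om u DU D2U"
  "(\<integral>x\<in>Om. (\<Oplus>h. \<Oplus>k. lam$h * lam$k * (D2U h k x)^2) \<partial>gauss lam)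
    \<le> (8 + 4 * max C 0 * (max C 0 * A\<^sup>2 / lmb + B / lmb)) * I"
  unfolding I_def
  by (rule regular_domain.hessian_estimate[OF rd lmb_pos f_L2[unfolded O_def] u_sol[unfolded O_def] gtC V(1,2) DV A0 A(2)[unfolded O_def] B0 B(2)[unfolded O_def] _ C, folded O_def])
   (assumption | rule that | simp)+
 \<comment> \<open>The estimate obtained is sharper than the claim: the extra summands with 2 and
   with the square root of \<open>lmb\<close> are nonnegative, and
   \<open>max C 0 \<le> \<bar>C\<bar>\<close>.\<close>
 have le: "(8 + 4 * max C 0 * (max C 0 * A\<^sup>2 / lmb + B / lmb)) * I \<le> (8 + 4 * max C 0 * (2 + 2 * sqrt 2 / sqrt lmb * A + (1 / lmb) * \<bar>C\<bar> * A^2 + B / lmb)) * I"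
 proof (rule mult_right_mono)
  have "max C 0 * A\<^sup>2 / lmb \<le> (1 / lmb) * \<bar>C\<bar> * A^2" using lmb_pos by (simp add: divide_right_mono mult_right_mono)
  moreover have "0 \<le> 2 * sqrt 2 / sqrt lmb * A" using A0 lmb_pos by simp
  ultimately have "max C 0 * A\<^sup>2 / lmb + B / lmb \<le> 2 + 2 * sqrt 2 / sqrt lmb * A + (1 / lmb) * \<bar>C\<bar> * A^2 + B / lmb" by linarith
  then show "8 + 4 * max C 0 * (max C 0 * A\<^sup>2 / lmb + B / lmb) \<le> 8 + 4 * max C 0 * (2 + 2 * sqrt 2 / sqrt lmb * A + (1 / lmb) * \<bar>C\<bar> * A^2 + B / lmb)"
   by (intro add_left_mono mult_left_mono) auto
  show "0 \<le> I" unfolding I_def set_lebesgue_integral_def by (intro integral_nonneg_AE AE_I2) auto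
 qed
 have "W22_derivs lam Om u DU D2U \<and> (\<integral>x\<in>Om. (\<Oplus>h. \<Oplus>k. lam$h * lam$k * (D2U h k x)^2) \<partial>gauss lam)
   \<le> (8 + 4 * max C 0 * (2 + 2 * sqrt 2 / sqrt lmb * A + (1 / lmb) * \<bar>C\<bar> * A^2 + B / lmb)) * I"
  by (rule conjI[OF W(1) order_trans[OF W(2) le]])
 then show ?thesis unfolding W22_def Let_def A_def B_def C_def I_def by blast
qed

end
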